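(* Let $u_0:\mathbb{R}\to\mathbb{R}$ be absolutely continuous with $u_0'=w_0$ a.e. and $w_0\in L^2(\mathbb{R})$. Let $\tilde u$ be the (unique) dissipative solution of the Hunter–Saxton equation with initial datum $u_0$, and let $u$ be any weak solution with the same initial datum $u_0$. Then (1) $E^{\tilde u}(t)\le E^{u}(t)$ for every $t\ge 0$; (2) if $E^{u}(t)=E^{\tilde u}(t)$ for every $t\ge 0$, then $u=\tilde u$.
   Context: The Hunter–Saxton equation is $\partial_t u(x,t)+\partial_x\big[\tfrac12 u^2(x,t)\big]=\tfrac12\int_{-\infty}^x w^2(y,t)\,dy$, $w=\partial_x u$, for $x\in\mathbb{R}$, $t\ge 0$, with $u(x,0)=u_0(x)$, $w(x,0)=w_0(x)=u_0'(x)$. A weak solution is a continuous function $u$ on $\mathbb{R}\times[0,\infty)$ such that for each $t\ge0$, $u(\cdot,t)$ is absolutely continuous on $\mathbb{R}$ with $\partial_x u=w\in L^\infty([0,\infty);L^2(\mathbb{R}))$, the map $t\mapsto u(\cdot,t)\in L^2_{loc}(\mathbb{R})$ is absolutely continuous, the equation holds in the sense of distributions on $\mathbb{R}\times[0,\infty)$, $u(x,0)=u_0(x)$, and $w_0\in L^2(\mathbb{R})$. A weak solution is dissipative if $\partial_x u$ is bounded from above on every compact subset of the open upper half-plane $\{t>0\}$ and $w(\cdot,t)\to w_0$ in $L^2(\mathbb{R})$ as $t\downarrow 0$. (Dissipative solutions exist and are unique.) For a weak solution $u$, its energy is $E^u(t):=\frac12\int_{\mathbb{R}}w^2(y,t)\,dy$.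 *)

theory Defs
  imports "HOL-Analysis.Analysis"
begin

definition ac_on :: "real set \<Rightarrow> ('a \<Rightarrow> 'a \<Rightarrow> real) \<Rightarrow> (real \<Rightarrow> 'a) \<Rightarrow> bool" where
  "ac_on I d f \<longleftrightarrow>
     (\<forall>e>0. \<exists>\<delta>>0. \<forall>(n::nat) (a::nat \<Rightarrow> real) (b::nat \<Rightarrow> real).
        ((\<forall>k<n. a k \<le> b k \<and> a k \<in> I \<and> b k \<in> I) \<and>
         (\<forall>j<n. \<forall>k<n. j \<noteq> k \<longrightarrow> b j \<le> a k \<or> b k \<le> a j) \<and>
         (\<Sum>k<n. b k - a k) < \<delta>)
        \<longrightarrow> (\<Sum>k<n. d (f (a k)) (f (b k))) < e)"

definition abs_cont_real :: "(real \<Rightarrow> real) \<Rightarrow> bool" where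
  "abs_cont_real f \<longleftrightarrow> (\<forall>a b. ac_on {a..b} dist f)"

definition L2_dist_on :: "real \<Rightarrow> real \<Rightarrow> (real \<Rightarrow> real) \<Rightarrow> (real \<Rightarrow> real) \<Rightarrow> real" where
  "L2_dist_on a b v v' = sqrt (LINT x:{a..b}|lborel. (v x - v' x)^2)"

definition square_integrable :: "(real \<Rightarrow> real) \<Rightarrow> bool" where
  "square_integrable f \<longleftrightarrow> f \<in> borel_measurable lborel \<and> integrable lborel (\<lambda>x. (f x)^2)"

definition pdx :: "(real \<Rightarrow> real \<Rightarrow> real) \<Rightarrow> real \<Rightarrow> real \<Rightarrow> real" where
  "pdx g x t = deriv (\<lambda>y. g y t) x"
definition pdt :: "(real \<Rightarrow> real \<Rightarrow> real) \<Rightarrow> real \<Rightarrow> real \<Rightarrow> real" where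
  "pdt g x t = deriv (\<lambda>s. g x s) t"

text \<open>C^infinity on R^2: all partial derivatives of all orders exist and are continuous.\<close>
definition smooth2 :: "(real \<Rightarrow> real \<Rightarrow> real) \<Rightarrow> bool" where
  "smooth2 \<phi> \<longleftrightarrow> (\<exists>S. \<phi> \<in> S \<and>
     (\<forall>g\<in>S. continuous_on UNIV (\<lambda>p. g (fst p) (snd p)) \<and>
        (\<forall>x t. (\<lambda>y. g y t) differentiable (at x) \<and> (\<lambda>s. g x s) differentiable (at t)) \<and>
        pdx g \<in> S \<and> pdt g \<in> S))"

text \<open>Test functions on R x [0,oo): restrictions of smooth compactly supported
  functions on R^2.\<close>
definition test_fun :: "(real \<Rightarrow> real \<Rightarrow> real) \<Rightarrow> bool" where
  "test_fun \<phi> \<longleftrightarrow> smooth2 \<phi> \<and> bounded {(x, t). \<phi> x t \<noteq> 0}"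

definition HP :: "(real \<times> real) set" where "HP = {p. 0 \<le> snd p}"
definition HPo :: "(real \<times> real) set" where "HPo = {p. 0 < snd p}"

definition hs_source :: "(real \<Rightarrow> real \<Rightarrow> real) \<Rightarrow> real \<Rightarrow> real \<Rightarrow> real" where
  "hs_source w x t = (1/2) * (LINT y:{..x}|lborel. (w y t)^2)"

definition hs_weak_solution ::
  "(real \<Rightarrow> real) \<Rightarrow> (real \<Rightarrow> real) \<Rightarrow> (real \<Rightarrow> real \<Rightarrow> real) \<Rightarrow> (real \<Rightarrow> real \<Rightarrow> real) \<Rightarrow> bool" where
  "hs_weak_solution u0 w0 u w \<longleftrightarrow>
     \<comment> \<open>u continuous on R x [0,oo)\<close>
     continuous_on HP (\<lambda>p. u (fst p) (snd p)) \<and>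
     \<comment> \<open>each u(.,t) absolutely continuous with derivative w(.,t) a.e.\<close>
     (\<forall>t\<ge>0. abs_cont_real (\<lambda>x. u x t) \<and>
        (AE x in lborel. ((\<lambda>y. u y t) has_real_derivative w x t) (at x))) \<and>
     \<comment> \<open>w in L^oo([0,oo); L^2(R)) (w jointly measurable)\<close>
     (\<lambda>p. w (fst p) (snd p)) \<in> borel_measurable (lborel \<Otimes>\<^sub>M lborel) \<and>
     (\<exists>M. \<forall>t\<ge>0. square_integrable (\<lambda>x. w x t) \<and> (LINT x|lborel. (w x t)^2) \<le> M) \<and>
     \<comment> \<open>t \<mapsto> u(.,t) absolutely continuous into L^2_loc(R)\<close>
     (\<forall>a b T. ac_on {0..T} (L2_dist_on a b) (\<lambda>t x. u x t)) \<and>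
     \<comment> \<open>the equation in the sense of distributions on R x [0,oo), with initial datum\<close>
     (\<forall>\<phi>. test_fun \<phi> \<longrightarrow>
        set_integrable (lborel \<Otimes>\<^sub>M lborel) HP
          (\<lambda>p. u (fst p) (snd p) * pdt \<phi> (fst p) (snd p)
               + (1/2) * (u (fst p) (snd p))^2 * pdx \<phi> (fst p) (snd p)
               + hs_source w (fst p) (snd p) * \<phi> (fst p) (snd p)) \<and>
        (LINT p:HP|(lborel \<Otimes>\<^sub>M lborel).
             u (fst p) (snd p) * pdt \<phi> (fst p) (snd p)
           + (1/2) * (u (fst p) (snd p))^2 * pdx \<phi> (fst p) (snd p)
           + hs_source w (fst p) (snd p) * \<phi> (fst p) (snd p))
        + (LINT x|lborel. u0 x * \<phi> x 0) = 0) \<and>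
     \<comment> \<open>initial datum\<close>
     (\<forall>x. u x 0 = u0 x) \<and>
     square_integrable w0"

definition hs_dissipative ::
  "(real \<Rightarrow> real) \<Rightarrow> (real \<Rightarrow> real) \<Rightarrow> (real \<Rightarrow> real \<Rightarrow> real) \<Rightarrow> (real \<Rightarrow> real \<Rightarrow> real) \<Rightarrow> bool" where
  "hs_dissipative u0 w0 u w \<longleftrightarrow>
     hs_weak_solution u0 w0 u w \<and>
     (\<forall>K. compact K \<and> K \<subseteq> HPo \<longrightarrow>
        (\<exists>C. AE p in lborel \<Otimes>\<^sub>M lborel. p \<in> K \<longrightarrow> w (fst p) (snd p) \<le> C)) \<and>
     ((\<lambda>t. LINT x|lborel. (w x t - w0 x)^2) \<longlongrightarrow> 0) (at_right 0)"

definition hs_energy :: "(real \<Rightarrow> real \<Rightarrow> real) \<Rightarrow> real \<Rightarrow> real" where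
  "hs_energy w t = (1/2) * (LINT y|lborel. (w y t)^2)"

end

theory Submission
  imports Defs "HOL-Complex_Analysis.Great_Picard" "HOL-Computational_Algebra.Polynomial"
begin

text \<open>
  Along a characteristic \<open>x' = u(x, t)\<close> a smooth solution satisfies \<open>w' = - w\<^sup>2 / 2\<close>, so
  \<open>w / (1 - s w / 2)\<close> is constant and \<open>(1 - s w / 2)\<^sup>2\<close> is the density of a transported measure,
  where \<open>s\<close> is the time shifted by a constant. For a weak solution this is recovered by
  renormalization: Steklov averages in \<open>x\<close> satisfy the transport equation up to a commutator that
  vanishes because \<open>w\<close> is square integrable, and integrating up to characteristics, which exist by
  Peano's theorem, shows that for every weak solution and every \<open>T > 0\<close> the energy carried by
  \<open>{w < 2 / T}\<close> at time \<open>T\<close> is the energy carried by \<open>{w > - 2 / T}\<close> at time \<open>0\<close>, on the whole line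
  as well as to the left of a characteristic. A dissipative solution satisfies \<open>w < 2 / T\<close> almost
  everywhere: the upper bound on \<open>w\<close> makes the integral of \<open>(((1 + c t / 2) w - c)\<^sup>+)\<^sup>2\<close> a conserved
  quantity, and strong convergence at \<open>t = 0\<close> makes it small for large \<open>c\<close>. Hence its energy is the
  least possible one. If another weak solution has the same energy, then \<open>w < 2 / T\<close> holds for it
  too. The source term along a characteristic is then determined by the initial data, so the two
  solutions have the same characteristics and agree along them.
\<close>

text \<open>Since \<open>w\<close> is merely square integrable in x, \<open>u\<close> is only
  Hoelder continuous of order 1/2 in x. Characteristics therefore need not be unique and offer no
  change of variables; identities are stated between two chosen characteristics and proved by
  testing with cutoffs that move along with them. At a characteristic X the error in a window of
  width 1/c has size |w| * c * |u - u(X)|, which Cauchy-Schwarz bounds by the energy inside the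
  window; it vanishes as c grows because the measure with density w^2 has no atoms. The other
  obstacle is blow-up. Riccati values below -2/T reach minus infinity before time T, and values from
  2/T upwards at time T do not come from finite initial values. Transported functions must vanish
  near both thresholds, and the interval of initial values above -2/T is carried onto the interval
  of values below 2/T. What distinguishes one weak solution from another in energy is exactly the
  nonnegative part carried by values from 2/T upwards.\<close>

section \<open>Absolute continuity and the fundamental theorem of calculus\<close>

text \<open>\<open>ac_on\<close> speaks of numbered families of intervals, the gauge integral of
  tagged divisions; this translates the former for use with the latter.\<close>

lemma ac_on_tagged_partial_division:
  fixes f :: "real \<Rightarrow> real"
  assumes "ac_on {a..b} dist f" "e > 0"
  obtains \<delta> where "\<delta> > 0"
    "\<And>p. p tagged_partial_division_of {a..b} \<Longrightarrow> (\<Sum>(x,K)\<in>p. measure lborel K) < \<delta> \<Longrightarrow>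
         (\<Sum>(x,K)\<in>p. \<bar>f (Sup K) - f (Inf K)\<bar>) < e"
proof -
  obtain \<delta> where "\<delta> > 0" and D: "\<forall>(n::nat) l r. (\<forall>k<n. l k \<le> r k \<and> l k \<in> {a..b} \<and> r k \<in> {a..b}) \<and>
      (\<forall>j<n. \<forall>k<n. j \<noteq> k \<longrightarrow> r j \<le> l k \<or> r k \<le> l j) \<and> (\<Sum>k<n. r k - l k) < \<delta> \<longrightarrow>
      (\<Sum>k<n. dist (f (l k)) (f (r k))) < e"
    using assms(1)[unfolded ac_on_def, rule_format, OF assms(2)] by (elim exE conjE) (rule that)
  note \<delta> = D[rule_format, OF conjI, OF _ conjI]
  show thesis
  proof (rule that[OF \<open>\<delta> > 0\<close>])
    fix p :: "(real \<times> real set) set"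
    assume p: "p tagged_partial_division_of {a..b}" and small: "(\<Sum>(x,K)\<in>p. measure lborel K) < \<delta>"
    \<comment> \<open>One-point pieces are dropped: disjoint interiors say nothing about where such
      a piece lies, so the ordering that \<open>ac_on\<close> asks for could fail. They contribute
      neither length nor increment.\<close>
    define q where "q = {(x,K)\<in>p. Inf K < Sup K}"
    have fp: "finite p" using p by (auto simp: tagged_partial_division_of_def)
    have form: "\<exists>l r. K = {l..r} \<and> l \<le> r \<and> a \<le> l \<and> r \<le> b" if xK: "(x,K) \<in> p" for x K
    proof -
      obtain l r where K: "K = cbox l r" and sub: "K \<subseteq> {a..b}" and x: "x \<in> K"
        using p xK unfolding tagged_partial_division_of_def by meson
      then have "l \<le> r" by auto
      then show ?thesis using K sub by auto
    qed
    have q: "q \<subseteq> p" "finite q" using fp by (auto simp: q_def intro: finite_subset)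
    obtain h where h: "bij_betw h {0..<card q} q" using ex_bij_betw_nat_finite[OF q(2)] by blast
    define l r where "l k = Inf (snd (h k))" and "r k = Sup (snd (h k))" for k
    have hq: "h k \<in> q" if "k < card q" for k using h that by (auto simp: bij_betw_def)
    have lr: "l k < r k \<and> snd (h k) = {l k..r k} \<and> a \<le> l k \<and> r k \<le> b" if "k < card q" for k
    proof -
      obtain x K where xK: "h k = (x,K)" by fastforce
      then have "(x,K) \<in> p" "Inf K < Sup K" using hq[OF that] by (auto simp: q_def)
      then show ?thesis using form[of x K] xK unfolding l_def r_def by auto
    qed
    have disj: "r j \<le> l k \<or> r k \<le> l j" if "j < card q" "k < card q" "j \<noteq> k" for j k
    proof -
      have "h j \<noteq> h k" using h that by (auto simp: bij_betw_def inj_on_def)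
      moreover have "h j \<in> p" "h k \<in> p" using hq that q by auto
      ultimately have "interior (snd (h j)) \<inter> interior (snd (h k)) = {}"
        using p unfolding tagged_partial_division_of_def by (metis prod.collapse)
      then have "{l j<..<r j} \<inter> {l k<..<r k} = {}" using lr that by simp
      then have "{max (l j) (l k)<..<min (r j) (r k)} = {}" by auto
      then have "min (r j) (r k) \<le> max (l j) (l k)"
        using dense by (metis greaterThanLessThan_empty_iff)
      then show ?thesis using lr that by (smt (verit))
    qed
    have "(\<Sum>k<card q. r k - l k) = (\<Sum>(x,K)\<in>q. measure lborel K)"
    proof -
      have "(\<Sum>k<card q. r k - l k) = (\<Sum>k\<in>{0..<card q}. (\<lambda>(x,K). measure lborel K) (h k))"
        using lr by (intro sum.cong) (auto simp: case_prod_beta less_imp_le)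
      also have "\<dots> = (\<Sum>(x,K)\<in>q. measure lborel K)" by (rule sum.reindex_bij_betw[OF h])
      finally show ?thesis .
    qed
    also have "\<dots> \<le> (\<Sum>(x,K)\<in>p. measure lborel K)"
      using q fp by (intro sum_mono2) auto
    finally have small': "(\<Sum>k<card q. r k - l k) < \<delta>" using small by simp
    have lr': "l k \<le> r k \<and> l k \<in> {a..b} \<and> r k \<in> {a..b}" if "k < card q" for k
      using lr[OF that] by auto
    have "(\<Sum>k<card q. dist (f (l k)) (f (r k))) < e"
      by (rule \<delta>) (use lr' disj small' in blast, use disj in blast, rule small')
    also have "(\<Sum>k<card q. dist (f (l k)) (f (r k))) = (\<Sum>k\<in>{0..<card q}. (\<lambda>(x,K). \<bar>f (Sup K) - f (Inf K)\<bar>) (h k))"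
      by (intro sum.cong) (auto simp: case_prod_beta l_def r_def dist_real_def)
    also have "\<dots> = (\<Sum>(x,K)\<in>q. \<bar>f (Sup K) - f (Inf K)\<bar>)" by (rule sum.reindex_bij_betw[OF h])
    also have "\<dots> = (\<Sum>(x,K)\<in>p. \<bar>f (Sup K) - f (Inf K)\<bar>)"
    proof (intro sum.mono_neutral_left ballI)
      fix z assume z: "z \<in> p - q"
      obtain x K where xK: "z = (x,K)" by fastforce
      then have "Sup K = Inf K" using form[of x K] z by (auto simp: q_def)
      then show "(case z of (x, K) \<Rightarrow> \<bar>f (Sup K) - f (Inf K)\<bar>) = 0" using xK by simp
    qed (use q fp in auto)
    finally show "(\<Sum>(x,K)\<in>p. \<bar>f (Sup K) - f (Inf K)\<bar>) < e" .
  qed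
qed

text \<open>On the exceptional set the integrand is set to zero, and a gauge forcing the tags there
  into an open set of small measure makes the increments of \<^term>\<open>f\<close> small by absolute
  continuity.\<close>

lemma ac_on_has_integral:
  fixes f g :: "real \<Rightarrow> real"
  assumes "a \<le> b" and ac: "ac_on {a..b} dist f" and N: "negligible N"
    and der: "\<And>x. x \<in> {a..b} - N \<Longrightarrow> (f has_real_derivative g x) (at x)"
  shows "(g has_integral (f b - f a)) {a..b}"
proof -
  define g' where "g' x = (if x \<in> N then 0 else g x)" for x
  have "(g' has_integral (f b - f a)) {a..b}"
    unfolding has_integral_real
  proof safe
    fix e :: real assume "e > 0"
    \<comment> \<open>The 1 keeps the denominator positive when a = b. Half of e is spent on the
      tags outside \<open>N\<close>, the other half on the tags in \<open>N\<close>.\<close>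
    define e2 where "e2 = e / (2 * (b - a + 1))"
    have e2: "e2 > 0" "e2 * (b - a) < e/2" using \<open>e > 0\<close> \<open>a \<le> b\<close> by (auto simp: e2_def field_simps)
    obtain \<delta> where "\<delta> > 0" and \<delta>: "\<And>p. p tagged_partial_division_of {a..b} \<Longrightarrow> (\<Sum>(x,K)\<in>p. measure lborel K) < \<delta> \<Longrightarrow>
         (\<Sum>(x,K)\<in>p. \<bar>f (Sup K) - f (Inf K)\<bar>) < e/2"
      using ac_on_tagged_partial_division[OF ac, of "e/2"] \<open>e > 0\<close> by auto
    obtain U where U: "open U" "N \<subseteq> U" "U - N \<in> lmeasurable" "emeasure lebesgue (U - N) < ennreal \<delta>"
      using sets_lebesgue_outer_open[OF negligible_imp_sets[OF N] \<open>\<delta> > 0\<close>] by metis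
    have Um: "U \<in> lmeasurable" "measure lebesgue U < \<delta>"
    proof -
      have eq: "U = (U - N) \<union> N" using U by auto
      have "N \<in> lmeasurable" using N by (simp add: negligible_imp_measurable)
      then show "U \<in> lmeasurable" using U eq by (metis fmeasurable.Un)
      have "measure lebesgue U = measure lebesgue (U - N)"
        using N by (simp add: measure_Diff_null_set negligible_iff_null_sets U)
      also have "\<dots> < \<delta>" using U \<open>\<delta> > 0\<close> by (simp add: emeasure_eq_measure2 ennreal_less_iff)
      finally show "measure lebesgue U < \<delta>" .
    qed
    have "\<exists>d>0. (x \<in> N \<longrightarrow> ball x d \<subseteq> U) \<and>
       (x \<in> {a..b} - N \<longrightarrow> (\<forall>y. \<bar>y - x\<bar> < d \<longrightarrow> \<bar>f y - f x - g x * (y - x)\<bar> \<le> e2 * \<bar>y - x\<bar>))" for x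
    proof (cases "x \<in> N")
      case True
      then show ?thesis using U by (metis DiffD2 open_contains_ball subsetD)
    next
      case False
      show ?thesis
      proof (cases "x \<in> {a..b}")
        case True
        then have "(f has_derivative (\<lambda>h. g x * h)) (at x)"
          using der False by (simp add: has_field_derivative_def)
        then show ?thesis using False e2 unfolding has_derivative_at_alt real_norm_def by blast
      qed (auto simp: False intro: exI[of _ 1])
    qed
    then obtain d where d: "\<And>x. d x > 0" "\<And>x. x \<in> N \<Longrightarrow> ball x (d x) \<subseteq> U"
      "\<And>x y. x \<in> {a..b} - N \<Longrightarrow> \<bar>y - x\<bar> < d x \<Longrightarrow> \<bar>f y - f x - g x * (y - x)\<bar> \<le> e2 * \<bar>y - x\<bar>"
      by metis
    show "\<exists>\<gamma>. gauge \<gamma> \<and> (\<forall>\<D>. \<D> tagged_division_of {a..b} \<and> \<gamma> fine \<D> \<longrightarrow>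
        norm ((\<Sum>(x,k)\<in>\<D>. measure lborel k *\<^sub>R g' x) - (f b - f a)) < e)"
    proof (intro exI conjI allI impI)
      show "gauge (\<lambda>x. ball x (d x))" using d by (simp add: gauge_def)
      fix p assume "p tagged_division_of {a..b} \<and> (\<lambda>x. ball x (d x)) fine p"
      then have p: "p tagged_division_of {a..b}" and fine: "(\<lambda>x. ball x (d x)) fine p" by auto
      have fp: "finite p" using p by (auto simp: tagged_division_of_def tagged_partial_division_of_def)
      define p1 where "p1 = {(x,K)\<in>p. x \<in> N}"
      define p2 where "p2 = {(x,K)\<in>p. x \<notin> N}"
      have split: "p = p1 \<union> p2" "p1 \<inter> p2 = {}" "finite p1" "finite p2"
        using fp by (auto simp: p1_def p2_def intro: finite_subset[OF _ fp])
      have form: "\<exists>l r. K = {l..r} \<and> l \<le> r \<and> l \<le> x \<and> x \<le> r \<and> x \<in> {a..b}" if xK: "(x,K) \<in> p" for x K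
      proof -
        obtain l r where K: "K = cbox l r" using tagged_division_ofD(4)[OF p xK] by blast
        moreover have "x \<in> K" "K \<subseteq> {a..b}" using tagged_division_ofD(2,3)[OF p xK] by auto
        ultimately show ?thesis by auto
      qed
      let ?D = "\<lambda>(x,K). measure lborel K *\<^sub>R g' x - (f (Sup K) - f (Inf K))"
      have p1: "p1 tagged_partial_division_of {a..b}"
        using p by (rule tagged_division_of_def[THEN iffD1, THEN conjunct1, THEN tagged_partial_division_subset])
          (auto simp: p1_def)
      have "(\<Sum>(x,K)\<in>p1. measure lborel K) < \<delta>"
      proof -
        have "p1 tagged_division_of \<Union>(snd ` p1)"
          by (rule tagged_partial_division_of_Union_self[OF p1])
        then have div: "snd ` p1 division_of \<Union>(snd ` p1)" by (rule division_of_tagged_division)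
        have "(\<Sum>(x,K)\<in>p1. measure lborel K) = (\<Sum>K\<in>snd ` p1. measure lborel K)"
          by (rule sum.over_tagged_division_lemma[OF \<open>p1 tagged_division_of \<Union>(snd ` p1)\<close>, of "measure lborel"])
            (simp add: content_eq_0_interior)
        also have "\<dots> = (\<Sum>K\<in>snd ` p1. measure lebesgue K)"
          by (intro sum.cong refl) (metis div division_ofD(4) lborelD borel_closed closed_cbox measure_completion sets_lborel)
        also have "\<dots> = measure lebesgue (\<Union>(snd ` p1))"
          using content_division[OF div] by simp
        also have "\<dots> \<le> measure lebesgue U"
        proof (rule measure_mono_fmeasurable)
          show "\<Union>(snd ` p1) \<subseteq> U"
            using fine d(2) unfolding fine_def p1_def by fastforce
          show "\<Union>(snd ` p1) \<in> sets lebesgue"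
            using div by (metis fmeasurableD lmeasurable_division)
        qed (use Um in auto)
        finally show ?thesis using Um by simp
      qed
      then have "(\<Sum>(x,K)\<in>p1. \<bar>f (Sup K) - f (Inf K)\<bar>) < e/2" by (rule \<delta>[OF p1])
      moreover have "\<bar>\<Sum>z\<in>p1. ?D z\<bar> \<le> (\<Sum>(x,K)\<in>p1. \<bar>f (Sup K) - f (Inf K)\<bar>)"
        by (rule order_trans[OF sum_abs], rule sum_mono) (auto simp: p1_def g'_def)
      ultimately have b1: "\<bar>\<Sum>z\<in>p1. ?D z\<bar> < e/2" by linarith
      have "\<bar>\<Sum>z\<in>p2. ?D z\<bar> \<le> (\<Sum>(x,K)\<in>p2. e2 * measure lborel K)"
      proof (rule order_trans[OF sum_abs], rule sum_mono)
        fix z assume z: "z \<in> p2"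
        obtain x K where xK: "z = (x,K)" by fastforce
        then have zp: "(x,K) \<in> p" "x \<notin> N" using z by (auto simp: p2_def)
        then obtain l r where K: "K = {l..r}" "l \<le> r" "l \<le> x" "x \<le> r" "x \<in> {a..b}" using form by blast
        have "K \<subseteq> ball x (d x)" using fine zp unfolding fine_def by auto
        moreover have "l \<in> K" "r \<in> K" using K by auto
        ultimately have "l \<in> ball x (d x)" "r \<in> ball x (d x)" by blast+
        then have "\<bar>l - x\<bar> < d x" "\<bar>r - x\<bar> < d x" by (auto simp: dist_real_def)
        then have "\<bar>f l - f x - g x * (l - x)\<bar> \<le> e2 * \<bar>l - x\<bar>" "\<bar>f r - f x - g x * (r - x)\<bar> \<le> e2 * \<bar>r - x\<bar>"
          using d(3)[of x l] d(3)[of x r] K(5) zp by auto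
        moreover have "(f r - f l) - (r - l) * g x = (f r - f x - g x * (r - x)) - (f l - f x - g x * (l - x))"
          by (simp add: algebra_simps)
        moreover have "e2 * \<bar>l - x\<bar> + e2 * \<bar>r - x\<bar> = e2 * (r - l)" using K by (simp add: algebra_simps)
        ultimately show "\<bar>?D z\<bar> \<le> (case z of (x, K) \<Rightarrow> e2 * measure lborel K)"
          using K zp by (simp add: xK g'_def)
      qed
      also have "\<dots> \<le> (\<Sum>(x,K)\<in>p. e2 * measure lborel K)"
        using split fp e2 by (intro sum_mono2) (auto simp: p2_def)
      also have "\<dots> = e2 * (b - a)"
        using additive_content_tagged_division[of p a b] p \<open>a \<le> b\<close>
        by (simp add: case_prod_beta box_real flip: sum_distrib_left)
      finally have b2: "\<bar>\<Sum>z\<in>p2. ?D z\<bar> < e/2" using e2 by linarith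
      have "(\<Sum>(x,k)\<in>p. measure lborel k *\<^sub>R g' x) - (f b - f a) = (\<Sum>z\<in>p. ?D z)"
        by (subst additive_tagged_division_1[OF \<open>a \<le> b\<close> p, symmetric])
          (simp add: sum_subtractf case_prod_beta)
      also have "\<dots> = (\<Sum>z\<in>p1. ?D z) + (\<Sum>z\<in>p2. ?D z)"
        unfolding split(1) by (rule sum.union_disjoint[OF split(3,4,2)])
      finally have eq: "(\<Sum>(x,k)\<in>p. measure lborel k *\<^sub>R g' x) - (f b - f a) = (\<Sum>z\<in>p1. ?D z) + (\<Sum>z\<in>p2. ?D z)" .
      show "norm ((\<Sum>(x,k)\<in>p. measure lborel k *\<^sub>R g' x) - (f b - f a)) < e"
        unfolding eq real_norm_def
        using abs_triangle_ineq[of "\<Sum>z\<in>p1. ?D z" "\<Sum>z\<in>p2. ?D z"] b1 b2 by argo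
    qed
  qed
  then show ?thesis
    by (rule has_integral_spike[OF N, rotated]) (simp add: g'_def)
qed

lemma set_integrable_square_integrable:
  assumes "square_integrable g"
  shows "set_integrable lborel {a..b} g"
proof -
  have g: "g \<in> borel_measurable borel" "integrable lborel (\<lambda>x. (g x)\<^sup>2)"
    using assms by (auto simp: square_integrable_def)
  have "integrable lborel (\<lambda>x. indicator {a..b} x + (g x)\<^sup>2 :: real)"
    using g by (intro Bochner_Integration.integrable_add integrable_real_indicator) (auto simp: emeasure_lborel_Icc_eq)
  then show ?thesis unfolding set_integrable_def
  proof (rule Bochner_Integration.integrable_bound)
    have "\<bar>y\<bar> \<le> 1 + y\<^sup>2" for y :: real
      using zero_le_power2[of "\<bar>y\<bar> - 1/2"] by (simp add: power2_eq_square algebra_simps)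
    then show "AE x in lborel. norm (indicator {a..b} x *\<^sub>R g x) \<le> norm (indicator {a..b} x + (g x)\<^sup>2 :: real)"
      by (intro AE_I2) (auto simp: indicator_def)
  qed (use g in measurable)
qed

lemma abs_cont_real_FTC:
  assumes ac: "abs_cont_real f" and der: "AE x in lborel. (f has_real_derivative g x) (at x)"
    and g: "square_integrable g" and "a \<le> b"
  shows "f b - f a = (LINT x:{a..b}|lborel. g x)"
proof -
  have "AE x in lebesgue. (f has_real_derivative g x) (at x)" using der by (rule AE_completion)
  then obtain N where N: "N \<in> null_sets lebesgue" "{x. \<not> (f has_real_derivative g x) (at x)} \<subseteq> N"
    unfolding eventually_ae_filter by auto
  have "(g has_integral (f b - f a)) {a..b}"
    using ac N \<open>a \<le> b\<close> by (intro ac_on_has_integral[of _ _ _ N])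
      (auto simp: abs_cont_real_def negligible_iff_null_sets)
  then show ?thesis
    using set_borel_integral_eq_integral(2)[OF set_integrable_square_integrable[OF g]]
    by (simp add: integral_unique)
qed

section \<open>A smooth step function\<close>

text \<open>Smoothness in one variable is counted by iterating \<open>deriv\<close>, so that closure
  under sums, products and affine substitutions is an induction on the order.\<close>

fun n_smooth :: "nat \<Rightarrow> (real \<Rightarrow> real) \<Rightarrow> bool" where
  "n_smooth 0 f \<longleftrightarrow> True"
| "n_smooth (Suc n) f \<longleftrightarrow> (\<forall>x. f differentiable at x) \<and> n_smooth n (deriv f)"

definition smooth1 :: "(real \<Rightarrow> real) \<Rightarrow> bool" where
  "smooth1 f \<longleftrightarrow> (\<forall>n. n_smooth n f)"

lemma n_smooth_SucI:
  assumes "\<And>x. (f has_real_derivative f' x) (at x)" "n_smooth n f'"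
  shows "n_smooth (Suc n) f"
proof -
  have "deriv f = f'" using assms(1) by (intro ext DERIV_imp_deriv)
  then show ?thesis using assms by (auto simp: real_differentiable_def)
qed

lemma smooth1_deriv: "smooth1 f \<Longrightarrow> smooth1 (deriv f)"
  unfolding smooth1_def using n_smooth.simps(2) by blast

lemma smooth1_differentiable: "smooth1 f \<Longrightarrow> f differentiable at x"
  unfolding smooth1_def using n_smooth.simps(2) by blast

lemma smooth1_DERIV: "smooth1 f \<Longrightarrow> (f has_real_derivative deriv f x) (at x)"
  using smooth1_differentiable[of f x] DERIV_deriv_iff_real_differentiable by blast

lemma smooth1_continuous: "smooth1 f \<Longrightarrow> continuous_on A f"
  by (meson DERIV_continuous_on smooth1_DERIV has_field_derivative_at_within)

lemma smooth1_I:
  assumes "\<And>x. (f has_real_derivative f' x) (at x)" "smooth1 f'"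
  shows "smooth1 f"
  unfolding smooth1_def
proof
  show "n_smooth n f" for n
    using n_smooth_SucI[OF assms(1)] assms(2) by (cases n) (auto simp: smooth1_def)
qed

lemma n_smooth_Suc_imp: "n_smooth (Suc n) f \<Longrightarrow> n_smooth n f"
  by (induction n arbitrary: f) auto

lemma n_smooth_DERIV: "n_smooth (Suc n) f \<Longrightarrow> (f has_real_derivative deriv f x) (at x)"
  by (simp add: DERIV_deriv_iff_real_differentiable)

lemma n_smooth_add: "n_smooth n f \<Longrightarrow> n_smooth n g \<Longrightarrow> n_smooth n (\<lambda>x. f x + g x)"
proof (induction n arbitrary: f g)
  case (Suc n)
  show ?case
    using Suc.prems by (intro n_smooth_SucI[OF DERIV_add] Suc.IH) (auto intro: n_smooth_DERIV)
qed simp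

lemma n_smooth_mult: "n_smooth n f \<Longrightarrow> n_smooth n g \<Longrightarrow> n_smooth n (\<lambda>x. f x * g x)"
proof (induction n arbitrary: f g)
  case (Suc n)
  show ?case
    using Suc.prems
    by (intro n_smooth_SucI[OF DERIV_mult] n_smooth_add Suc.IH)
      (auto intro: n_smooth_DERIV n_smooth_Suc_imp)
qed simp

lemma n_smooth_const: "n_smooth n (\<lambda>x. c)"
  by (induction n arbitrary: c) auto

lemma n_smooth_affine: "n_smooth n f \<Longrightarrow> n_smooth n (\<lambda>x. f (c * x + d))"
proof (induction n arbitrary: f)
  case (Suc n)
  have "((\<lambda>x. f (c * x + d)) has_real_derivative deriv f (c * x + d) * c) (at x)" for x
    by (rule DERIV_chain2[OF n_smooth_DERIV[OF Suc.prems], of "\<lambda>x. c * x + d" c x UNIV])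
      (auto intro!: derivative_eq_intros)
  then show ?case
    by (rule n_smooth_SucI) (use Suc in \<open>auto intro!: n_smooth_mult n_smooth_const\<close>)
qed simp

lemma smooth1_add: "smooth1 f \<Longrightarrow> smooth1 g \<Longrightarrow> smooth1 (\<lambda>x. f x + g x)"
  by (simp add: smooth1_def n_smooth_add)
lemma smooth1_mult: "smooth1 f \<Longrightarrow> smooth1 g \<Longrightarrow> smooth1 (\<lambda>x. f x * g x)"
  by (simp add: smooth1_def n_smooth_mult)
lemma smooth1_const: "smooth1 (\<lambda>x. c)"
  by (simp add: smooth1_def n_smooth_const)
lemma smooth1_affine: "smooth1 f \<Longrightarrow> smooth1 (\<lambda>x. f (c * x + d))"
  by (simp add: smooth1_def n_smooth_affine)
lemma smooth1_diff: "smooth1 f \<Longrightarrow> smooth1 g \<Longrightarrow> smooth1 (\<lambda>x. f x - g x)"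
  using smooth1_add[of f "\<lambda>x. (-1) * g x"] smooth1_mult[OF smooth1_const, of g "-1"] by simp

text \<open>The functions p(1/x) exp(-1/x), extended by zero, form a class closed under
  differentiation: in terms of y = 1/x the derivative replaces p by y^2 (p - p'). Smoothness thus
  reduces to differentiability at 0, checked once for all p.\<close>

definition flat :: "real poly \<Rightarrow> real \<Rightarrow> real" where
  "flat p x = (if x > 0 then poly p (1/x) * exp (- (1/x)) else 0)"

lemma poly_div_exp_tendsto_0: "((\<lambda>y. poly p y / exp y) \<longlongrightarrow> (0::real)) at_top"
proof -
  have "((\<lambda>y. \<Sum>i\<le>degree p. coeff p i * (y ^ i / exp y)) \<longlongrightarrow> (\<Sum>i\<le>degree p. coeff p i * (0::real))) at_top"
    by (intro tendsto_intros tendsto_power_div_exp_0)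
  then show ?thesis by (simp add: poly_altdef sum_divide_distrib)
qed

lemma flat_DERIV: "(flat p has_real_derivative flat ([:0,0,1:] * (p - pderiv p)) x) (at x)"
proof -
  consider "x > 0" | "x < 0" | "x = 0" by linarith
  then show ?thesis
  proof cases
    case 1
    have "((\<lambda>x. poly p (1/x) * exp (- (1/x))) has_real_derivative flat ([:0,0,1:] * (p - pderiv p)) x) (at x)"
      using 1 by (auto intro!: derivative_eq_intros simp: flat_def field_simps power2_eq_square)
    then show ?thesis
      by (rule has_field_derivative_transform_within_open[of _ _ _ "{0<..}"]) (use 1 in \<open>auto simp: flat_def\<close>)
  next
    case 2
    have "((\<lambda>x. 0) has_real_derivative flat ([:0,0,1:] * (p - pderiv p)) x) (at x)"
      using 2 by (auto simp: flat_def)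
    then show ?thesis
      by (rule has_field_derivative_transform_within_open[of _ _ _ "{..<0}"]) (use 2 in \<open>auto simp: flat_def\<close>)
  next
    case 3
    have "((\<lambda>h. poly ([:0,1:] * p) (inverse h) / exp (inverse h)) \<longlongrightarrow> 0) (at_right (0::real))"
      using filterlim_compose[OF poly_div_exp_tendsto_0 filterlim_inverse_at_top_right] .
    then have "((\<lambda>h. flat p h / h) \<longlongrightarrow> 0) (at_right 0)"
      by (rule Lim_transform_eventually)
        (auto simp: eventually_at_right_less flat_def exp_minus field_simps intro!: eventually_at_rightI[of 0 1])
    moreover have "((\<lambda>h. flat p h / h) \<longlongrightarrow> 0) (at_left 0)"
      by (rule Lim_transform_eventually[OF tendsto_const])
        (auto simp: flat_def intro!: eventually_at_leftI[of "-1" 0])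
    ultimately have "((\<lambda>h. flat p h / h) \<longlongrightarrow> 0) (at 0)" by (simp add: filterlim_split_at)
    then show ?thesis using 3 by (simp add: DERIV_def flat_def)
  qed
qed

lemma smooth1_flat: "smooth1 (flat p)"
  unfolding smooth1_def
proof
  show "n_smooth n (flat p)" for n
    by (induction n arbitrary: p) (auto intro: n_smooth_SucI[OF flat_DERIV] simp del: n_smooth.simps(2))
qed

lemma primitive_DERIV:
  fixes f :: "real \<Rightarrow> real"
  assumes "continuous_on UNIV f"
  shows "((\<lambda>x. LBINT y=ereal 0..ereal x. f y) has_real_derivative f x) (at x)"
proof -
  define N where "N = \<bar>x\<bar> + 1"
  have N: "- N \<le> 0" "0 \<le> N" "- N < x" "x < N" unfolding N_def by auto
  have "((\<lambda>u. LBINT y=ereal 0..ereal u. f y) has_vector_derivative f x) (at x within {-N..N})"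
    by (rule interval_integral_FTC2) (use N assms continuous_on_subset in auto)
  then have "((\<lambda>u. LBINT y=ereal 0..ereal u. f y) has_vector_derivative f x) (at x within {-N<..<N})"
    by (rule has_vector_derivative_within_subset) auto
  moreover have "at x within {-N<..<N} = at x" using N by (intro at_within_open) auto
  ultimately show ?thesis by (simp only: has_real_derivative_iff_has_vector_derivative)
qed

definition bump0 :: "real \<Rightarrow> real" where
  "bump0 x = flat 1 x * flat 1 (1 - x)"

text \<open>The support lies in [0, 1] and not around 0. Rescaled averages at a point then use
  values to its right only, which lets a time cutoff act at the initial time, and differences of
  rescaled \<open>step\<close> functions tend to indicators of left-open intervals.\<close>

definition bump :: "real \<Rightarrow> real" where
  "bump x = bump0 x / (LBINT y=ereal 0..ereal 1. bump0 y)"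

definition step :: "real \<Rightarrow> real" where
  "step x = (LBINT y=ereal 0..ereal x. bump y)"

lemma smooth1_bump0: "smooth1 bump0"
  using smooth1_mult[OF smooth1_flat[of 1] smooth1_affine[OF smooth1_flat[of 1], of "-1" 1]]
  by (simp add: bump0_def[abs_def])

lemma smooth1_bump: "smooth1 bump"
  using smooth1_mult[OF smooth1_bump0 smooth1_const] by (simp add: bump_def[abs_def] divide_inverse)

lemma bump0_nonneg: "bump0 x \<ge> 0" by (auto simp: bump0_def flat_def)
lemma bump0_pos: "0 < x \<Longrightarrow> x < 1 \<Longrightarrow> bump0 x > 0" by (auto simp: bump0_def flat_def)

lemma bump0_integral_pos: "(LBINT y=ereal 0..ereal 1. bump0 y) > 0"
proof -
  let ?P = "\<lambda>x. LBINT y=ereal 0..ereal x. bump0 y"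
  have D: "(?P has_real_derivative bump0 x) (at x)" for x
    by (rule primitive_DERIV[OF smooth1_continuous[OF smooth1_bump0]])
  have "?P 0 < ?P 1"
    by (rule DERIV_pos_imp_increasing_open)
      (use D bump0_pos in \<open>auto intro!: continuous_at_imp_continuous_on DERIV_isCont\<close>)
  then show ?thesis by simp
qed

lemma bump_nonneg: "bump x \<ge> 0"
  using bump0_nonneg[of x] bump0_integral_pos by (simp add: bump_def)

lemma bump_eq_0: "x \<le> 0 \<or> 1 \<le> x \<Longrightarrow> bump x = 0"
  by (auto simp: bump_def bump0_def flat_def)

lemma bump_continuous: "continuous_on A bump" by (rule smooth1_continuous[OF smooth1_bump])

lemma step_DERIV: "(step has_real_derivative bump x) (at x)"
  unfolding step_def[abs_def] by (rule primitive_DERIV[OF bump_continuous])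

lemma smooth1_step: "smooth1 step"
  by (rule smooth1_I[OF step_DERIV smooth1_bump])

lemma step_continuous: "continuous_on A step" by (rule smooth1_continuous[OF smooth1_step])

lemma step_measurable [measurable]: "step \<in> borel_measurable borel"
  by (rule borel_measurable_continuous_onI[OF step_continuous])

lemma step_mono: "x \<le> y \<Longrightarrow> step x \<le> step y"
  by (rule DERIV_nonneg_imp_nondecreasing[of x y step]) (use step_DERIV bump_nonneg in auto)

lemma step_eq_0: assumes "x \<le> 0" shows "step x = 0"
proof -
  have "step 0 = 0" by (simp add: step_def)
  moreover have "step x = step 0"
  proof (cases "x < 0")
    case True
    show ?thesis
      by (rule DERIV_isconst_end[OF True, of step, symmetric])
        (use step_DERIV bump_eq_0 in \<open>auto intro!: step_continuous, metis less_imp_le\<close>)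
  qed (use assms in auto)
  ultimately show ?thesis by simp
qed

lemma step_eq_1: assumes "1 \<le> x" shows "step x = 1"
proof -
  have "step 1 = (LBINT y=ereal 0..ereal 1. bump0 y * (1 / (LBINT y=ereal 0..ereal 1. bump0 y)))"
    by (simp add: step_def bump_def[abs_def])
  also have "\<dots> = 1" using bump0_integral_pos by (simp only: interval_lebesgue_integral_mult_left) simp
  finally have "step 1 = 1" .
  moreover have "step x = step 1"
  proof (cases "1 < x")
    case True
    show ?thesis
      by (rule DERIV_isconst_end[OF True])
        (use step_DERIV bump_eq_0 in \<open>auto intro!: step_continuous, metis less_imp_le\<close>)
  qed (use assms in auto)
  ultimately show ?thesis by simp
qed

lemma step_bounds: "0 \<le> step x" "step x \<le> 1"
  using step_mono[of 0 x] step_mono[of x 1] step_eq_0[of x] step_eq_1[of x] step_eq_0[of 0] step_eq_1[of 1]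
  by (cases "x \<le> 0"; cases "1 \<le> x"; force)+

lemma bump_bounded: obtains B where "B > 0" "\<And>x. bump x \<le> B"
proof -
  have "bounded (bump ` {0..1})"
    by (intro compact_imp_bounded compact_continuous_image bump_continuous) auto
  then obtain B where "B > 0" and B: "\<And>x. x \<in> {0..1} \<Longrightarrow> \<bar>bump x\<bar> \<le> B"
    unfolding bounded_pos by auto
  have "bump x \<le> B" for x
    using B[of x] bump_eq_0[of x] \<open>B > 0\<close> by (cases "x \<in> {0..1}") auto
  then show thesis using \<open>B > 0\<close> that by blast
qed

lemma step_scaled_tendsto:
  "(\<lambda>n. step (real (Suc n) * (x - a))) \<longlonglongrightarrow> (if x > a then 1 else 0)"
proof (cases "x > a")
  case True
  have "\<forall>\<^sub>F n in sequentially. 1 \<le> real (Suc n) * (x - a)"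
  proof -
    obtain N :: nat where N: "1 / (x - a) < real N" using reals_Archimedean2 by blast
    show ?thesis
    proof (rule eventually_sequentiallyI[of N])
      fix n assume "N \<le> n"
      then have "1 / (x - a) \<le> real (Suc n)" using N by linarith
      then show "1 \<le> real (Suc n) * (x - a)" using True by (simp add: field_simps)
    qed
  qed
  then show ?thesis using True
    by (intro tendsto_eventually) (auto elim!: eventually_mono simp: step_eq_1)
next
  case False
  then have "step (real (Suc n) * (x - a)) = 0" for n
    by (intro step_eq_0 mult_nonneg_nonpos) auto
  then show ?thesis using False by simp
qed

lemma bump_has_integral_1: "has_bochner_integral lborel bump 1"
proof -
  have "has_bochner_integral lborel (\<lambda>x. bump x * indicator {0..1} x) (step 1 - step 0)"
    by (rule has_bochner_integral_FTC_Icc_real)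
      (use step_DERIV bump_continuous[of UNIV] in \<open>auto simp: continuous_on_eq_continuous_at\<close>)
  moreover have "bump x * indicator {0..1} x = bump x" for x
    using bump_eq_0[of x] by (cases "x \<in> {0..1}") auto
  ultimately show ?thesis by (simp add: step_eq_0 step_eq_1)
qed

lemma bump_scaled_integral:
  assumes "c > 0"
  shows "(LINT t|lborel. g t * (c * bump (c * (t - a)))) = (LINT z|lborel. g (a + z / c) * bump z)"
proof -
  have "(LINT t|lborel. g t * (c * bump (c * (t - a))))
      = \<bar>1/c\<bar> *\<^sub>R (LINT x|lborel. g (a + 1/c * x) * (c * bump (c * (a + 1/c * x - a))))"
    by (rule lborel_integral_real_affine) (use assms in simp)
  also have "\<dots> = 1/c * (LINT x|lborel. c * (g (a + x/c) * bump x))"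
    using assms by (simp add: mult.left_commute)
  also have "\<dots> = (LINT x|lborel. g (a + x/c) * bump x)"
    using assms by (simp only: integral_mult_right_zero) simp
  finally show ?thesis .
qed

lemma bump_average_tendsto:
  fixes g :: "real \<Rightarrow> real"
  assumes cont: "continuous_on {a..a+1} g"
  shows "(\<lambda>n. LINT t|lborel. g t * (real (Suc n) * bump (real (Suc n) * (t - a)))) \<longlonglongrightarrow> g a"
    and "\<And>B n. (\<And>t. t \<in> {a..a+1} \<Longrightarrow> \<bar>g t\<bar> \<le> B) \<Longrightarrow>
      \<bar>LINT t|lborel. g t * (real (Suc n) * bump (real (Suc n) * (t - a)))\<bar> \<le> B"
proof -
  \<comment> \<open>Continuity is known on [a, a + 1] only. Clamping the argument gives a globally
    continuous function that agrees with \<open>g\<close> wherever the rescaled bump is not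
    zero.\<close>
  define G where "G t = g (max a (min (a+1) t))" for t
  have Gc: "continuous_on UNIV G" unfolding G_def
    by (rule continuous_on_compose2[OF cont]) (auto intro!: continuous_intros)
  then have Gm [measurable]: "G \<in> borel_measurable borel" by (rule borel_measurable_continuous_onI)
  have G_eq: "g (a + z / real (Suc n)) * bump z = G (a + z / real (Suc n)) * bump z" for z n
  proof (cases "0 \<le> z \<and> z \<le> 1")
    case True
    then have "0 \<le> z / real (Suc n)" "z / real (Suc n) \<le> 1" by (auto simp: divide_le_eq)
    then show ?thesis by (simp add: G_def)
  qed (use bump_eq_0 in auto)
  have eq: "(LINT t|lborel. g t * (real (Suc n) * bump (real (Suc n) * (t - a))))
      = (LINT z|lborel. G (a + z / real (Suc n)) * bump z)" for n
    unfolding G_eq[symmetric] by (rule bump_scaled_integral) simp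
  have bi: "integrable lborel bump" "(LINT z|lborel. bump z) = 1"
    using bump_has_integral_1 by (auto simp: has_bochner_integral_iff)
  have bd: "\<bar>LINT t|lborel. g t * (real (Suc n) * bump (real (Suc n) * (t - a)))\<bar> \<le> B"
    if B: "\<And>t. t \<in> {a..a+1} \<Longrightarrow> \<bar>g t\<bar> \<le> B" for B n
  proof -
    have GB: "\<bar>G t\<bar> \<le> B" for t unfolding G_def by (rule B) auto
    then have le: "\<bar>G (a + z / real (Suc n)) * bump z\<bar> \<le> B * bump z" for z
      by (simp add: abs_mult bump_nonneg mult_right_mono)
    have "\<bar>LINT z|lborel. G (a + z / real (Suc n)) * bump z\<bar> \<le> (LINT z|lborel. \<bar>G (a + z / real (Suc n)) * bump z\<bar>)"
      by (rule integral_abs_bound)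
    also have "\<dots> \<le> (LINT z|lborel. B * bump z)"
    proof (rule integral_mono)
      show "integrable lborel (\<lambda>z. \<bar>G (a + z / real (Suc n)) * bump z\<bar>)"
        by (rule Bochner_Integration.integrable_bound[of _ "\<lambda>z. B * bump z"])
          (use le bi in \<open>auto intro: order_trans[OF _ abs_ge_self]\<close>)
    qed (use le bi in auto)
    finally show ?thesis using bi by (simp add: eq del: of_nat_Suc)
  qed
  show "\<bar>LINT t|lborel. g t * (real (Suc n) * bump (real (Suc n) * (t - a)))\<bar> \<le> B"
    if "\<And>t. t \<in> {a..a+1} \<Longrightarrow> \<bar>g t\<bar> \<le> B" for B n using bd that .
  have "bounded (g ` {a..a+1})"
    using cont by (intro compact_imp_bounded compact_continuous_image) auto
  then obtain B where B: "\<forall>y\<in>g ` {a..a+1}. norm y \<le> B" unfolding bounded_iff by blast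
  have GB: "\<bar>G t\<bar> \<le> B" for t
    using B[rule_format, of "G t"] unfolding G_def by fastforce
  have "(\<lambda>n. LINT z|lborel. G (a + z / real (Suc n)) * bump z) \<longlonglongrightarrow> (LINT z|lborel. G a * bump z)"
  proof (rule integral_dominated_convergence[where w = "\<lambda>z. B * bump z"])
    have "(\<lambda>n. G (a + z / real (Suc n))) \<longlonglongrightarrow> G a" for z
    proof (rule continuous_on_tendsto_compose[OF Gc])
      have "(\<lambda>n. z * (1 / real (Suc n))) \<longlonglongrightarrow> z * 0"
        by (intro tendsto_intros LIMSEQ_Suc lim_1_over_n)
      then show "(\<lambda>n. a + z / real (Suc n)) \<longlonglongrightarrow> a" using tendsto_add[OF tendsto_const] by fastforce
    qed auto
    then show "AE z in lborel. (\<lambda>n. G (a + z / real (Suc n)) * bump z) \<longlonglongrightarrow> G a * bump z"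
      by (intro AE_I2 tendsto_intros)
    show "AE z in lborel. norm (G (a + z / real (Suc n)) * bump z) \<le> B * bump z" for n
      using GB by (intro AE_I2) (simp add: abs_mult bump_nonneg mult_right_mono)
  qed (use bi in auto)
  then show "(\<lambda>n. LINT t|lborel. g t * (real (Suc n) * bump (real (Suc n) * (t - a)))) \<longlonglongrightarrow> g a"
    using bi by (simp add: eq G_def del: of_nat_Suc)
qed

section \<open>Product test functions\<close>

lemma test_fun_product:
  assumes A: "smooth1 A" and B: "smooth1 B"
    and "\<And>x. A x \<noteq> 0 \<Longrightarrow> \<bar>x\<bar> \<le> R" "\<And>t. B t \<noteq> 0 \<Longrightarrow> \<bar>t\<bar> \<le> R"
  shows "test_fun (\<lambda>x t. A x * B t)"
  unfolding test_fun_def smooth2_def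
proof (intro conjI exI)
  \<comment> \<open>Products p(x) q(t) of smooth functions are closed under both partial
    derivatives, so they form a family of the kind that \<open>smooth2\<close> asks for.\<close>
  let ?S = "{\<lambda>x t. p x * q t |p q. smooth1 p \<and> smooth1 q}"
  show "(\<lambda>x t. A x * B t) \<in> ?S" using A B by auto
  show "\<forall>g\<in>?S. continuous_on UNIV (\<lambda>p. g (fst p) (snd p)) \<and>
        (\<forall>x t. (\<lambda>y. g y t) differentiable at x \<and> g x differentiable at t) \<and>
        pdx g \<in> ?S \<and> pdt g \<in> ?S"
  proof
    fix g assume "g \<in> ?S"
    then obtain p q where g: "g = (\<lambda>x t. p x * q t)" and p: "smooth1 p" and q: "smooth1 q" by auto
    have "continuous_on UNIV (\<lambda>z. g (fst z) (snd z))"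
      unfolding g by (intro continuous_intros continuous_on_compose2[OF smooth1_continuous[OF p]]
          continuous_on_compose2[OF smooth1_continuous[OF q]]) auto
    moreover have "(\<lambda>y. g y t) differentiable at x \<and> g x differentiable at t" for x t
      unfolding g using smooth1_differentiable[OF p] smooth1_differentiable[OF q] by auto
    moreover have "pdx g = (\<lambda>x t. deriv p x * q t)"
      unfolding pdx_def g
      by (intro ext DERIV_imp_deriv) (auto intro!: derivative_eq_intros smooth1_DERIV[OF p])
    moreover have "pdt g = (\<lambda>x t. p x * deriv q t)"
      unfolding pdt_def g
      by (intro ext DERIV_imp_deriv) (auto intro!: derivative_eq_intros smooth1_DERIV[OF q])
    ultimately show "continuous_on UNIV (\<lambda>p. g (fst p) (snd p)) \<and>
        (\<forall>x t. (\<lambda>y. g y t) differentiable at x \<and> g x differentiable at t) \<and>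
        pdx g \<in> ?S \<and> pdt g \<in> ?S"
      using p q smooth1_deriv[OF p] smooth1_deriv[OF q] by blast
  qed
  have "{(x, t). A x * B t \<noteq> 0} \<subseteq> {-R..R} \<times> {-R..R}" using assms by (auto simp: abs_le_iff; force)
  then show "bounded {(x, t). A x * B t \<noteq> 0}"
    by (rule bounded_subset[rotated]) (simp add: bounded_Times)
qed

lemma pd_product:
  assumes "smooth1 A" "smooth1 B"
  shows "pdx (\<lambda>x t. A x * B t) x t = deriv A x * B t" "pdt (\<lambda>x t. A x * B t) x t = A x * deriv B t"
  using assms unfolding pdx_def pdt_def
  by (auto intro!: DERIV_imp_deriv derivative_eq_intros smooth1_DERIV)

section \<open>Energy and source term\<close>

lemma integrable_continuous_support:
  fixes g :: "real \<Rightarrow> real"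
  assumes "continuous_on UNIV g" "\<And>x. x \<notin> {a..b} \<Longrightarrow> g x = 0"
  shows "integrable lborel g"
proof -
  have "integrable lborel (\<lambda>x. indicator {a..b} x *\<^sub>R g x)"
    by (rule borel_integrable_compact) (auto intro: continuous_on_subset[OF assms(1)])
  moreover have "(\<lambda>x. indicator {a..b} x *\<^sub>R g x) = g"
  proof
    show "indicator {a..b} x *\<^sub>R g x = g x" for x
      using assms(2)[of x] by (cases "x \<in> {a..b}") auto
  qed
  ultimately show ?thesis by (simp only:)
qed

lemma integrable_bounded_support:
  fixes g :: "real \<Rightarrow> real"
  assumes "g \<in> borel_measurable borel" "\<And>x. x \<in> {a..b} \<Longrightarrow> \<bar>g x\<bar> \<le> C" "\<And>x. x \<notin> {a..b} \<Longrightarrow> g x = 0"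
  shows "integrable lborel g"
proof (rule Bochner_Integration.integrable_bound[of _ "\<lambda>x. C * indicator {a..b} x"])
  show "integrable lborel (\<lambda>x. C * indicator {a..b} x :: real)"
    by (intro integrable_mult_right integrable_real_indicator) (auto simp: emeasure_lborel_Icc_eq)
  have "norm (g x) \<le> norm (C * indicator {a..b} x)" for x
    using assms(2)[of x] assms(3)[of x] by (cases "x \<in> {a..b}") auto
  then show "AE x in lborel. norm (g x) \<le> norm (C * indicator {a..b} x :: real)" by simp
qed (use assms in auto)

lemma continuous_on_pair_slice:
  assumes "continuous_on UNIV (\<lambda>p. f (fst p) (snd p))" "continuous_on S g" "continuous_on S h"
  shows "continuous_on S (\<lambda>z. f (g z) (h z))"
  using continuous_on_compose2[OF assms(1), of S "\<lambda>z. (g z, h z)"] assms(2,3)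
  by (auto intro!: continuous_intros)

lemma continuous_bounded_box:
  fixes f :: "real \<Rightarrow> real \<Rightarrow> real"
  assumes "continuous_on UNIV (\<lambda>p. f (fst p) (snd p))"
  obtains B where "B \<ge> 0" "\<And>x t. x \<in> {a..b} \<Longrightarrow> t \<in> {c..d} \<Longrightarrow> \<bar>f x t\<bar> \<le> B"
proof -
  have "bounded ((\<lambda>p. f (fst p) (snd p)) ` ({a..b} \<times> {c..d}))"
    using assms by (intro compact_imp_bounded compact_continuous_image compact_Times)
      (auto intro: continuous_on_subset)
  then obtain B where B: "\<And>p. p \<in> {a..b} \<times> {c..d} \<Longrightarrow> \<bar>f (fst p) (snd p)\<bar> \<le> B"
    unfolding bounded_iff by fastforce
  have "\<bar>f x t\<bar> \<le> \<bar>B\<bar>" if "x \<in> {a..b}" "t \<in> {c..d}" for x t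
    using B[of "(x, t)"] that by fastforce
  then show thesis using that[of "\<bar>B\<bar>"] by auto
qed

lemma continuous_on_integral_param:
  fixes f :: "real \<Rightarrow> real \<Rightarrow> real"
  assumes f: "continuous_on UNIV (\<lambda>p. f (fst p) (snd p))" and "\<And>x t. x \<notin> {a..b} \<Longrightarrow> f x t = 0"
  shows "continuous_on UNIV (\<lambda>t. LINT x|lborel. f x t)"
proof -
  have eq: "(LINT x|lborel. f x t) = integral (cbox a b) (\<lambda>x. f x t)" for t
  proof -
    have "(LINT x|lborel. f x t) = (LINT x:{a..b}|lborel. f x t)"
      unfolding set_lebesgue_integral_def
      by (rule Bochner_Integration.integral_cong) (use assms(2) in \<open>auto simp: indicator_def\<close>)
    also have "\<dots> = integral (cbox a b) (\<lambda>x. f x t)"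
      unfolding cbox_interval
      by (rule set_borel_integral_eq_integral(2), unfold set_integrable_def, rule borel_integrable_compact)
        (auto intro!: continuous_on_pair_slice[OF f] continuous_intros)
    finally show ?thesis .
  qed
  have "continuous_on (UNIV \<times> cbox a b) (\<lambda>(t, x). f x t)"
    unfolding case_prod_beta
    by (rule continuous_on_pair_slice[OF f]) (auto intro!: continuous_intros)
  then show ?thesis unfolding eq by (rule integral_continuous_on_param)
qed

text \<open>All properties are required for every real time: a weak solution will be extended to
  negative times by its initial values, so that continuity and measurability hold on the whole plane
  and no side condition on t has to be carried along.\<close>

locale hs_base =
  fixes u w :: "real \<Rightarrow> real \<Rightarrow> real" and M :: real
  assumes u_cont: "continuous_on UNIV (\<lambda>p. u (fst p) (snd p))"
    and w_meas [measurable]: "case_prod w \<in> borel_measurable (borel \<Otimes>\<^sub>M borel)"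
    and w_sq: "\<And>t. integrable lborel (\<lambda>x. (w x t)\<^sup>2)"
    and w_M: "\<And>t. (LINT x|lborel. (w x t)\<^sup>2) \<le> M"
    and u_FTC: "\<And>t a b. a \<le> b \<Longrightarrow> u b t - u a t = (LINT x:{a..b}|lborel. w x t)"
    and u_deriv: "\<And>t. AE x in lborel. ((\<lambda>y. u y t) has_real_derivative w x t) (at x)"
begin

abbreviation F where "F \<equiv> hs_source w"

lemma u_meas [measurable]: "case_prod u \<in> borel_measurable (borel \<Otimes>\<^sub>M borel)"
  using borel_measurable_continuous_onI[OF u_cont] by (simp add: borel_prod case_prod_beta')

lemma w_meas1 [measurable]: "(\<lambda>x. w x t) \<in> borel_measurable borel"
  by measurable

lemma u_continuous: "continuous_on S g \<Longrightarrow> continuous_on S h \<Longrightarrow> continuous_on S (\<lambda>z. u (g z) (h z))"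
  by (rule continuous_on_pair_slice[OF u_cont])

lemma w_square_integrable: "square_integrable (\<lambda>x. w x t)"
  using w_sq by (simp add: square_integrable_def)

lemma w_sq_set: "A \<in> sets borel \<Longrightarrow> set_integrable lborel A (\<lambda>x. (w x t)\<^sup>2)"
  unfolding set_integrable_def using w_sq[of t]
  by (metis integrable_mult_indicator sets_lborel)

lemma w_set: "set_integrable lborel {a..b} (\<lambda>x. w x t)"
  by (rule set_integrable_square_integrable[OF w_square_integrable])

lemma M_nonneg: "0 \<le> M"
proof -
  have "0 \<le> (LINT x|lborel. (w x 0)\<^sup>2)" by simp
  then show ?thesis using w_M[of 0] by linarith
qed

lemma F_alt: "F x t = 1/2 * (LINT y|lborel. (if y \<le> x then (w y t)\<^sup>2 else 0))"
  unfolding hs_source_def set_lebesgue_integral_def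
  by (intro arg_cong2[where f = "(*)"] refl Bochner_Integration.integral_cong) (auto simp: indicator_def)

lemma F_meas [measurable]: "case_prod F \<in> borel_measurable (borel \<Otimes>\<^sub>M borel)"
  unfolding F_alt[abs_def] by measurable

lemma w_sq_set_le: "A \<in> sets borel \<Longrightarrow> (LINT x:A|lborel. (w x t)\<^sup>2) \<le> (LINT x|lborel. (w x t)\<^sup>2)"
  unfolding set_lebesgue_integral_def
  by (intro integral_mono w_sq_set[unfolded set_integrable_def] w_sq) (auto simp: indicator_def)

lemma w_sq_set_nonneg: "0 \<le> (LINT x:A|lborel. (w x t)\<^sup>2)"
  unfolding set_lebesgue_integral_def by simp

lemma F_nonneg: "0 \<le> F x t"
  unfolding hs_source_def using w_sq_set_nonneg by simp

lemma F_le: "F x t \<le> M / 2"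
  unfolding hs_source_def using w_sq_set_le[of "{..x}" t] w_M[of t] by simp

lemma F_abs_le: "\<bar>F x t\<bar> \<le> M / 2"
  using F_nonneg[of x t] F_le[of x t] by simp

lemma F_diff: assumes "a \<le> b" shows "F b t - F a t = 1/2 * (LINT x:{a<..b}|lborel. (w x t)\<^sup>2)"
proof -
  have "{..b} = {..a} \<union> {a<..b}" using assms by auto
  then have "(LINT x:{..b}|lborel. (w x t)\<^sup>2) = (LINT x:{..a}|lborel. (w x t)\<^sup>2) + (LINT x:{a<..b}|lborel. (w x t)\<^sup>2)"
    by (simp only:) (rule set_integral_Un, auto intro: w_sq_set)
  then show ?thesis unfolding hs_source_def by linarith
qed

lemma F_diff': assumes "a \<le> b" shows "F b t - F a t = 1/2 * (LINT x:{a..b}|lborel. (w x t)\<^sup>2)"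
proof -
  have "AE x in lborel. x \<noteq> a" by (rule AE_lborel_singleton)
  then have "(LINT x:{a<..b}|lborel. (w x t)\<^sup>2) = (LINT x:{a..b}|lborel. (w x t)\<^sup>2)"
    unfolding set_lebesgue_integral_def
    by (intro integral_cong_AE) (auto simp: indicator_def elim!: eventually_mono)
  then show ?thesis using F_diff[OF assms] by simp
qed

lemma F_mono: "a \<le> b \<Longrightarrow> F a t \<le> F b t"
  using F_diff[of a b t] w_sq_set_nonneg[of "{a<..b}" t] by simp

text \<open>The measure with density w^2 has no atoms: the integrands converge except possibly at
  the one point y = x. This continuity is what later makes the energy in a shrinking window
  vanish.\<close>

lemma F_continuous: "continuous_on UNIV (\<lambda>x. F x t)"
  unfolding continuous_on_sequentially
proof (safe, unfold comp_def)
  fix x and X :: "nat \<Rightarrow> real" assume X: "X \<longlonglongrightarrow> x"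
  show "(\<lambda>n. F (X n) t) \<longlonglongrightarrow> F x t"
    unfolding F_alt
  proof (intro tendsto_intros integral_dominated_convergence[where w = "\<lambda>y. (w y t)\<^sup>2"])
    have "AE y in lborel. y \<noteq> x" by (rule AE_lborel_singleton)
    then show "AE y in lborel. (\<lambda>n. if y \<le> X n then (w y t)\<^sup>2 else 0) \<longlonglongrightarrow> (if y \<le> x then (w y t)\<^sup>2 else 0)"
    proof (rule eventually_mono)
      fix y assume "y \<noteq> x"
      then have "\<forall>\<^sub>F n in sequentially. (y \<le> X n) = (y \<le> x)"
      proof (cases "y < x")
        case True
        show ?thesis by (rule eventually_mono[OF order_tendstoD(1)[OF X True]]) (use True in auto)
      next
        case False
        then have "x < y" using \<open>y \<noteq> x\<close> by simp
        show ?thesis by (rule eventually_mono[OF order_tendstoD(2)[OF X \<open>x < y\<close>]]) (use \<open>x < y\<close> in auto)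
      qed
      then show "(\<lambda>n. if y \<le> X n then (w y t)\<^sup>2 else 0) \<longlonglongrightarrow> (if y \<le> x then (w y t)\<^sup>2 else 0)"
        by (intro tendsto_eventually) (erule eventually_mono, simp)
    qed
  qed (use w_sq in auto)
qed

text \<open>The quantity is the integral of (w - m)^2 over [a, b]. The mean slope as m gives
  Cauchy-Schwarz; m is left free because a kernel average needs one and the same m for intervals of
  all lengths.\<close>

lemma quadratic_nonneg:
  assumes "a \<le> b"
  shows "0 \<le> 2 * (F b t - F a t) - 2 * m * (u b t - u a t) + m\<^sup>2 * (b - a)"
proof -
  have i: "set_integrable lborel {a..b} (\<lambda>x. (w x t)\<^sup>2)" "set_integrable lborel {a..b} (\<lambda>x. 2 * m * w x t)"
    "set_integrable lborel {a..b} (\<lambda>x. m\<^sup>2)"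
    using w_sq_set[of "{a..b}" t] w_set[of a b t]
    by (auto intro!: set_integrable_mult_right) (simp add: set_integrable_def emeasure_lborel_Icc_eq)
  have "0 \<le> (LINT x:{a..b}|lborel. (w x t - m)\<^sup>2)"
    unfolding set_lebesgue_integral_def by simp
  also have "\<dots> = (LINT x:{a..b}|lborel. (w x t)\<^sup>2 - 2 * m * w x t + m\<^sup>2)"
    by (simp add: power2_eq_square algebra_simps)
  also have "\<dots> = (LINT x:{a..b}|lborel. (w x t)\<^sup>2) - (LINT x:{a..b}|lborel. 2 * m * w x t)
      + (LINT x:{a..b}|lborel. m\<^sup>2)"
    using i by (simp add: set_integral_add set_integral_diff)
  also have "\<dots> = 2 * (F b t - F a t) - 2 * m * (u b t - u a t) + m\<^sup>2 * (b - a)"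
    using assms by (simp add: F_diff'[OF assms] u_FTC[OF assms]) (simp add: set_lebesgue_integral_def)
  finally show ?thesis .
qed

lemma u_diff_sq:
  assumes "a \<le> b" shows "(u b t - u a t)\<^sup>2 \<le> (b - a) * (2 * (F b t - F a t))"
proof (cases "a = b")
  case False
  define m where "m = (u b t - u a t) / (b - a)"
  have "0 \<le> (2 * (F b t - F a t) - 2 * m * (u b t - u a t) + m\<^sup>2 * (b - a)) * (b - a)"
    using quadratic_nonneg[OF assms, of t m] assms by simp
  also have "\<dots> = (b - a) * (2 * (F b t - F a t)) - 2 * (u b t - u a t) * (m * (b - a)) + (m * (b - a))\<^sup>2"
    by (simp add: algebra_simps power2_eq_square)
  also have "m * (b - a) = u b t - u a t" using False by (simp add: m_def)
  also have "(b - a) * (2 * (F b t - F a t)) - 2 * (u b t - u a t) * (u b t - u a t) + (u b t - u a t)\<^sup>2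
      = (b - a) * (2 * (F b t - F a t)) - (u b t - u a t)\<^sup>2"
    by (simp add: power2_eq_square)
  finally show ?thesis by simp
qed simp

end

section \<open>The evolution of interval means\<close>

definition weak_eq :: "(real \<Rightarrow> real \<Rightarrow> real) \<Rightarrow> (real \<Rightarrow> real \<Rightarrow> real) \<Rightarrow> bool" where
  "weak_eq u w \<longleftrightarrow> (\<forall>\<phi>. test_fun \<phi> \<longrightarrow>
        set_integrable (lborel \<Otimes>\<^sub>M lborel) HP
          (\<lambda>p. u (fst p) (snd p) * pdt \<phi> (fst p) (snd p)
               + (1/2) * (u (fst p) (snd p))^2 * pdx \<phi> (fst p) (snd p)
               + hs_source w (fst p) (snd p) * \<phi> (fst p) (snd p)) \<and>
        (LINT p:HP|(lborel \<Otimes>\<^sub>M lborel).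
             u (fst p) (snd p) * pdt \<phi> (fst p) (snd p)
           + (1/2) * (u (fst p) (snd p))^2 * pdx \<phi> (fst p) (snd p)
           + hs_source w (fst p) (snd p) * \<phi> (fst p) (snd p))
        + (LINT x|lborel. u x 0 * \<phi> x 0) = 0)"

context hs_base
begin

text \<open>Test functions A(x) B(t) are used with \<open>B n\<close> falling from 1 to 0 right
  after \<tau>: its time derivative produces an average of q just after \<tau>, and
  \<open>B n\<close> tends to the indicator of [0, \<tau>] on nonnegative times.\<close>

lemma weak_eq_smooth:
  assumes W: "weak_eq u w" and A: "smooth1 A" and supp: "\<And>x. x \<notin> {-R..R} \<Longrightarrow> A x = 0"
    and supp': "\<And>x. x \<notin> {-R..R} \<Longrightarrow> deriv A x = 0" and "0 \<le> \<tau>"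
  shows "(LINT x|lborel. u x \<tau> * A x) - (LINT x|lborel. u x 0 * A x)
    = (LINT s:{0..\<tau>}|lborel. LINT x|lborel. 1/2 * (u x s)\<^sup>2 * deriv A x + F x s * A x)"
proof -
  define q where "q t = (LINT x|lborel. u x t * A x)" for t
  define Q where "Q t = (LINT x|lborel. 1/2 * (u x t)\<^sup>2 * deriv A x + F x t * A x)" for t
  \<comment> \<open>The factor \<open>step (1 * t + 2)\<close> is 1 for t >= -1 and 0 for t <= -2:
    it only bounds the support from below and is invisible on the half plane.\<close>
  define B where "B n t = step (1 * t + 2) * (1 - step (real (Suc n) * t + (- real (Suc n) * \<tau>)))" for n t
  have A_cont: "continuous_on S A" "continuous_on S (deriv A)" for S
    using A by (auto intro: smooth1_continuous smooth1_deriv)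
  have [measurable]: "A \<in> borel_measurable borel" "deriv A \<in> borel_measurable borel"
    using A_cont by (auto intro: borel_measurable_continuous_onI)
  have A_cont2: "continuous_on S f \<Longrightarrow> continuous_on S (\<lambda>x. A (f x))"
      "continuous_on S f \<Longrightarrow> continuous_on S (\<lambda>x. deriv A (f x))" for S and f :: "'z::topological_space \<Rightarrow> real"
    using continuous_on_compose2[OF A_cont(1)[of UNIV], of S f]
      continuous_on_compose2[OF A_cont(2)[of UNIV], of S f] by auto
  have iu: "integrable lborel (\<lambda>x. u x t * A x)" for t
    by (rule integrable_continuous_support[of _ "-R" R])
      (use supp in \<open>auto intro!: continuous_intros u_continuous A_cont\<close>)
  have iu2: "integrable lborel (\<lambda>x. 1/2 * (u x t)\<^sup>2 * deriv A x)" for t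
    by (rule integrable_continuous_support[of _ "-R" R])
      (use supp' in \<open>auto intro!: continuous_intros u_continuous A_cont\<close>)
  obtain CA where CA: "\<And>x. x \<in> {-R..R} \<Longrightarrow> \<bar>A x\<bar> \<le> CA"
  proof (rule continuous_bounded_box[of "\<lambda>x t. A x" "-R" R 0 0])
    show "continuous_on UNIV (\<lambda>p::real \<times> real. A (fst p))" by (intro A_cont2 continuous_intros)
  qed auto
  have iF: "integrable lborel (\<lambda>x. F x t * A x)" for t
  proof (rule integrable_bounded_support[of _ "-R" R "M/2 * CA"])
    show "\<bar>F x t * A x\<bar> \<le> M/2 * CA" if "x \<in> {-R..R}" for x
      unfolding abs_mult using F_abs_le CA[OF that] M_nonneg by (intro mult_mono) auto
  qed (use supp in auto)
  have iQ: "integrable lborel (\<lambda>x. 1/2 * (u x t)\<^sup>2 * deriv A x + F x t * A x)" for t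
    by (intro Bochner_Integration.integrable_add iu2 iF)
  have q_cont: "continuous_on UNIV q"
    unfolding q_def
    by (rule continuous_on_integral_param[of _ "-R" R])
      (use supp in \<open>auto intro!: continuous_intros u_continuous A_cont2\<close>)
  have [measurable]: "q \<in> borel_measurable borel" by (rule borel_measurable_continuous_onI[OF q_cont])
  have [measurable]: "Q \<in> borel_measurable borel" unfolding Q_def by measurable
  obtain C where C: "C \<ge> 0" "\<And>t. t \<in> {0..\<tau>+1} \<Longrightarrow> \<bar>Q t\<bar> \<le> C"
  proof -
    obtain C1 where C1: "C1 \<ge> 0" "\<And>x t. x \<in> {-R..R} \<Longrightarrow> t \<in> {0..\<tau>+1} \<Longrightarrow> \<bar>1/2 * (u x t)\<^sup>2 * deriv A x\<bar> \<le> C1"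
      by (rule continuous_bounded_box[of "\<lambda>x t. 1/2 * (u x t)\<^sup>2 * deriv A x" "-R" R 0 "\<tau>+1"])
        (auto intro!: continuous_intros u_continuous A_cont2)
    define D where "D = C1 + M/2 * \<bar>CA\<bar>"
    have "\<bar>Q t\<bar> \<le> D * measure lborel {-R..R}" if "t \<in> {0..\<tau>+1}" for t
    proof -
      have bd: "\<bar>1/2 * (u x t)\<^sup>2 * deriv A x + F x t * A x\<bar> \<le> D * indicator {-R..R} x" for x
      proof (cases "x \<in> {-R..R}")
        case True
        have "\<bar>F x t * A x\<bar> \<le> M/2 * \<bar>CA\<bar>"
          unfolding abs_mult using F_abs_le CA[OF True] M_nonneg by (intro mult_mono) auto
        then show ?thesis using C1(2)[OF True that] True by (simp add: D_def)
      qed (use supp supp' in auto)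
      have "\<bar>Q t\<bar> \<le> (LINT x|lborel. \<bar>1/2 * (u x t)\<^sup>2 * deriv A x + F x t * A x\<bar>)"
        unfolding Q_def by (rule integral_abs_bound)
      also have "\<dots> \<le> (LINT x|lborel. D * indicator {-R..R} x)"
        by (intro integral_mono integrable_abs iQ bd integrable_mult_right integrable_real_indicator)
          (auto simp: emeasure_lborel_Icc_eq)
      finally show ?thesis by simp
    qed
    moreover have "0 \<le> D * measure lborel {-R..R}" using C1 M_nonneg by (simp add: D_def)
    ultimately show thesis using that by blast
  qed
  have B_eq: "B n t = 1 - step (real (Suc n) * (t - \<tau>))" if "t \<ge> 0" for n t
    using that by (simp add: B_def step_eq_1 algebra_simps)
  have B_smooth: "smooth1 (B n)" for n
    unfolding B_def[abs_def] by (intro smooth1_mult smooth1_diff smooth1_const smooth1_affine smooth1_step)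
  have B_deriv: "deriv (B n) t = - (real (Suc n) * bump (real (Suc n) * (t - \<tau>)))" if "t \<ge> 0" for n t
  proof -
    define c where "c = real (Suc n)"
    have "bump (t + 2) = 0" "step (t + 2) = 1" using that by (auto intro!: bump_eq_0 step_eq_1)
    moreover have "((\<lambda>t. step (1 * t + 2) * (1 - step (c * t + (- c * \<tau>)))) has_real_derivative
        step (t + 2) * (- (bump (c * t + (- c * \<tau>)) * c)) + bump (t + 2) * (1 - step (c * t + (- c * \<tau>)))) (at t)"
      by (auto intro!: derivative_eq_intros DERIV_chain2[OF step_DERIV])
    ultimately show ?thesis
      unfolding B_def[abs_def] c_def[symmetric]
      by (intro DERIV_imp_deriv) (simp add: algebra_simps)
  qed
  have B_supp: "B n t \<noteq> 0 \<Longrightarrow> \<bar>t\<bar> \<le> 2 + \<tau>" for n t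
  proof (rule ccontr)
    assume nz: "B n t \<noteq> 0" and "\<not> \<bar>t\<bar> \<le> 2 + \<tau>"
    then consider "t \<le> -2" | "t \<ge> \<tau> + 1" using \<open>0 \<le> \<tau>\<close> by linarith
    then show False
    proof cases
      case 1
      then have "step (1 * t + 2) = 0" by (intro step_eq_0) simp
      then show False using nz by (simp add: B_def)
    next
      case 2
      then have "1 * 1 \<le> real (Suc n) * (t - \<tau>)" by (intro mult_mono) auto
      then show False using nz B_eq[of t n] 2 \<open>0 \<le> \<tau>\<close> by (simp add: step_eq_1 del: of_nat_Suc)
    qed
  qed
  have key: "(LINT t|lborel. q t * (real (Suc n) * bump (real (Suc n) * (t - \<tau>))))
      = (LINT t|lborel. indicator {0..} t * (Q t * B n t)) + q 0" for n
  proof -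
    define \<phi> where "\<phi> x t = A x * B n t" for x t
    have "test_fun \<phi>" unfolding \<phi>_def[abs_def]
    proof (rule test_fun_product[of _ _ "max R (2 + \<tau>)"])
      show "A x \<noteq> 0 \<Longrightarrow> \<bar>x\<bar> \<le> max R (2 + \<tau>)" for x
        using supp[of x] by (cases "x \<in> {-R..R}") auto
      show "B n t \<noteq> 0 \<Longrightarrow> \<bar>t\<bar> \<le> max R (2 + \<tau>)" for t using B_supp[of n t] by auto
    qed (use A B_smooth in auto)
    have pd: "pdt \<phi> x t = A x * deriv (B n) t" "pdx \<phi> x t = deriv A x * B n t" for x t
      unfolding \<phi>_def[abs_def] using pd_product[OF A B_smooth] by auto
    define g where "g x t = indicator HP (x, t) *\<^sub>R (u x t * (A x * deriv (B n) t)
               + (1/2) * (u x t)^2 * (deriv A x * B n t) + F x t * (A x * B n t))" for x t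
    have B0: "B n 0 = 1" using B_eq[of 0 n] \<open>0 \<le> \<tau>\<close> by (simp add: step_eq_0 mult_nonneg_nonpos)
    have gi: "integrable (lborel \<Otimes>\<^sub>M lborel) (case_prod g)"
      and g0: "integral\<^sup>L (lborel \<Otimes>\<^sub>M lborel) (case_prod g) + q 0 = 0"
      using W[unfolded weak_eq_def, rule_format, OF \<open>test_fun \<phi>\<close>]
      unfolding pd set_integrable_def set_lebesgue_integral_def g_def case_prod_beta q_def
      by (simp_all add: \<phi>_def B0)
    have "integral\<^sup>L (lborel \<Otimes>\<^sub>M lborel) (case_prod g) = (LINT t|lborel. LINT x|lborel. g x t)"
      using lborel_pair.integral_snd[OF gi] by simp
    also have "(\<lambda>t. LINT x|lborel. g x t) = (\<lambda>t. indicator {0..} t * (q t * deriv (B n) t + Q t * B n t))"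
    proof
      fix t
      have "g x t = indicator {0..} t * (deriv (B n) t * (u x t * A x) + B n t * (1/2 * (u x t)\<^sup>2 * deriv A x + F x t * A x))" for x
        unfolding g_def by (auto simp: HP_def indicator_def algebra_simps)
      then have "(LINT x|lborel. g x t) = indicator {0..} t *
         (LINT x|lborel. deriv (B n) t * (u x t * A x) + B n t * (1/2 * (u x t)\<^sup>2 * deriv A x + F x t * A x))"
        by (simp only: integral_mult_right_zero)
      also have "(LINT x|lborel. deriv (B n) t * (u x t * A x) + B n t * (1/2 * (u x t)\<^sup>2 * deriv A x + F x t * A x))
         = deriv (B n) t * q t + B n t * Q t"
        using iu[of t] iQ[of t] unfolding q_def Q_def
        by (subst Bochner_Integration.integral_add) (auto simp only: integral_mult_right_zero intro: integrable_mult_right)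
      finally show "(LINT x|lborel. g x t) = indicator {0..} t * (q t * deriv (B n) t + Q t * B n t)"
        by (simp add: mult.commute)
    qed
    also have "(\<lambda>t. indicator {0..} t * (q t * deriv (B n) t + Q t * B n t))
       = (\<lambda>t. indicator {0..} t * (Q t * B n t) - q t * (real (Suc n) * bump (real (Suc n) * (t - \<tau>))))"
    proof
      fix t
      show "indicator {0..} t * (q t * deriv (B n) t + Q t * B n t)
        = indicator {0..} t * (Q t * B n t) - q t * (real (Suc n) * bump (real (Suc n) * (t - \<tau>)))"
      proof (cases "t \<ge> 0")
        case False
        then have "real (Suc n) * (t - \<tau>) \<le> 0" using \<open>0 \<le> \<tau>\<close> by (intro mult_nonneg_nonpos) auto
        then show ?thesis using False by (simp add: bump_eq_0)
      qed (simp add: B_deriv)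
    qed
    also have "(LINT t|lborel. indicator {0..} t * (Q t * B n t) - q t * (real (Suc n) * bump (real (Suc n) * (t - \<tau>))))
      = (LINT t|lborel. indicator {0..} t * (Q t * B n t)) - (LINT t|lborel. q t * (real (Suc n) * bump (real (Suc n) * (t - \<tau>))))"
    proof (rule Bochner_Integration.integral_diff)
      have [measurable]: "B n \<in> borel_measurable borel"
        by (rule borel_measurable_continuous_onI[OF smooth1_continuous[OF B_smooth]])
      show "integrable lborel (\<lambda>t. indicator {0..} t * (Q t * B n t))"
      proof (rule integrable_bounded_support[of _ 0 "\<tau>+1" C])
        fix t assume t: "t \<in> {0..\<tau>+1}"
        then have "\<bar>B n t\<bar> \<le> 1" using B_eq[of t n] step_bounds[of "real (Suc n) * (t - \<tau>)"] by auto
        then have "\<bar>Q t * B n t\<bar> \<le> C * 1" unfolding abs_mult using C t by (intro mult_mono) auto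
        then show "\<bar>indicator {0..} t * (Q t * B n t)\<bar> \<le> C" using t by simp
      next
        fix t assume t: "t \<notin> {0..\<tau>+1}"
        show "indicator {0..} t * (Q t * B n t) = 0"
        proof (cases "t \<ge> 0")
          case True
          then have "1 * 1 \<le> real (Suc n) * (t - \<tau>)" using t by (intro mult_mono) auto
          then show ?thesis using B_eq[OF True, of n] by (simp add: step_eq_1 del: of_nat_Suc)
        qed auto
      qed measurable
      show "integrable lborel (\<lambda>t. q t * (real (Suc n) * bump (real (Suc n) * (t - \<tau>))))"
      proof (rule integrable_continuous_support[of _ \<tau> "\<tau>+1"])
        show "continuous_on UNIV (\<lambda>t. q t * (real (Suc n) * bump (real (Suc n) * (t - \<tau>))))"
          by (intro continuous_intros q_cont continuous_on_compose2[OF bump_continuous[of UNIV]]) auto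
        fix t assume t: "t \<notin> {\<tau>..\<tau>+1}"
        have "real (Suc n) * (t - \<tau>) \<le> 0 \<or> 1 \<le> real (Suc n) * (t - \<tau>)"
        proof (cases "t \<le> \<tau>")
          case True then show ?thesis by (intro disjI1 mult_nonneg_nonpos) auto
        next
          case False
          then have "1 * 1 \<le> real (Suc n) * (t - \<tau>)" using t by (intro mult_mono) auto
          then show ?thesis by simp
        qed
        then show "q t * (real (Suc n) * bump (real (Suc n) * (t - \<tau>))) = 0" by (simp add: bump_eq_0 del: of_nat_Suc)
      qed
    qed
    finally show ?thesis using g0 by linarith
  qed
  have lim1: "(\<lambda>n. LINT t|lborel. q t * (real (Suc n) * bump (real (Suc n) * (t - \<tau>)))) \<longlonglongrightarrow> q \<tau>"
    by (rule bump_average_tendsto(1)) (rule continuous_on_subset[OF q_cont], auto)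
  have lim2: "(\<lambda>n. LINT t|lborel. indicator {0..} t * (Q t * B n t)) \<longlonglongrightarrow> (LINT t|lborel. indicator {0..\<tau>} t * Q t)"
  proof (rule integral_dominated_convergence[where w = "\<lambda>t. C * indicator {0..\<tau>+1} t"])
    have [measurable]: "B n \<in> borel_measurable borel" for n
      by (rule borel_measurable_continuous_onI[OF smooth1_continuous[OF B_smooth]])
    show "(\<lambda>t. indicator {0..} t * (Q t * B n t)) \<in> borel_measurable lborel" for n by measurable
    show "(\<lambda>t. indicator {0..\<tau>} t * Q t) \<in> borel_measurable lborel" by measurable
    show "integrable lborel (\<lambda>t. C * indicator {0..\<tau>+1} t :: real)"
      by (intro integrable_mult_right integrable_real_indicator) (auto simp: emeasure_lborel_Icc_eq)
    have "(\<lambda>n. indicator {0..} t * (Q t * B n t)) \<longlonglongrightarrow> indicator {0..\<tau>} t * Q t" for t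
    proof (cases "t \<ge> 0")
      case True
      have "(\<lambda>n. Q t * (1 - step (real (Suc n) * (t - \<tau>)))) \<longlonglongrightarrow> Q t * (1 - (if t > \<tau> then 1 else 0))"
        by (intro tendsto_intros step_scaled_tendsto)
      then show ?thesis using True by (simp add: B_eq indicator_def split: if_splits)
    qed auto
    then show "AE t in lborel. (\<lambda>n. indicator {0..} t * (Q t * B n t)) \<longlonglongrightarrow> indicator {0..\<tau>} t * Q t" by simp
    have "norm (indicator {0..} t * (Q t * B n t)) \<le> C * indicator {0..\<tau>+1} t" for t n
    proof (cases "0 \<le> t")
      case t: True
      show ?thesis
      proof (cases "t \<le> \<tau> + 1")
        case True
        then have "\<bar>B n t\<bar> \<le> 1" using B_eq[OF t, of n] step_bounds[of "real (Suc n) * (t - \<tau>)"] by auto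
        then have "\<bar>Q t * B n t\<bar> \<le> C * 1" unfolding abs_mult using C t True by (intro mult_mono) auto
        then show ?thesis using t True by simp
      next
        case False
        then have "1 * 1 \<le> real (Suc n) * (t - \<tau>)" by (intro mult_mono) auto
        then show ?thesis using B_eq[OF t, of n] C by (simp add: step_eq_1 del: of_nat_Suc)
      qed
    qed (use C in auto)
    then show "AE t in lborel. norm (indicator {0..} t * (Q t * B n t)) \<le> C * indicator {0..\<tau>+1} t" for n by simp
  qed
  have "q \<tau> = (LINT t|lborel. indicator {0..\<tau>} t * Q t) + q 0"
    using lim1 unfolding key by (rule LIMSEQ_unique) (intro tendsto_intros lim2)
  then show ?thesis
    unfolding q_def[symmetric] Q_def[symmetric] set_lebesgue_integral_def by simp
qed

text \<open>The indicator of [a, b] is approximated by smooth \<open>A n\<close> whose derivative is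
  a bump at a minus a bump at b; in the limit these act as point masses and produce the two flux
  terms.\<close>

lemma mean_evolution:
  assumes W: "weak_eq u w" and "a < b" "0 \<le> \<tau>"
  shows "(LINT x:{a..b}|lborel. u x \<tau>) - (LINT x:{a..b}|lborel. u x 0)
    = (LINT s:{0..\<tau>}|lborel. 1/2 * (u a s)\<^sup>2 - 1/2 * (u b s)\<^sup>2 + (LINT x:{a..b}|lborel. F x s))"
proof -
  define A where "A n x = step (real (Suc n) * x + (- real (Suc n) * a)) - step (real (Suc n) * x + (- real (Suc n) * b))" for n x
  define D where "D n c x = real (Suc n) * bump (real (Suc n) * (x - c))" for n c x
  \<comment> \<open>The extra 1 makes room for the bumps, which extend to the right of a and b by at
    most 1.\<close>
  define R where "R = \<bar>a\<bar> + \<bar>b\<bar> + 1"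
  have A_smooth: "smooth1 (A n)" for n
    unfolding A_def[abs_def] by (intro smooth1_diff smooth1_affine smooth1_step)
  have A_eq: "A n x = step (real (Suc n) * (x - a)) - step (real (Suc n) * (x - b))" for n x
    by (simp add: A_def algebra_simps)
  have A_deriv: "deriv (A n) x = D n a x - D n b x" for n x
  proof -
    define c where "c = real (Suc n)"
    have "((\<lambda>x. step (c * (x - a)) - step (c * (x - b))) has_real_derivative
       bump (c * (x - a)) * c - bump (c * (x - b)) * c) (at x)"
      by (auto intro!: derivative_eq_intros DERIV_chain2[OF step_DERIV])
    then show ?thesis unfolding A_eq[abs_def] D_def c_def[symmetric]
      by (intro DERIV_imp_deriv) (simp add: mult.commute)
  qed
  have bump0: "D n c x = 0" if "x \<notin> {c..c+1}" for n c x
  proof (cases "x \<le> c")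
    case True then show ?thesis unfolding D_def by (subst bump_eq_0) (auto intro!: disjI1 mult_nonneg_nonpos)
  next
    case False
    then have "1 * 1 \<le> real (Suc n) * (x - c)" using that by (intro mult_mono) auto
    then show ?thesis unfolding D_def by (subst bump_eq_0) (auto simp del: of_nat_Suc)
  qed
  have A0: "A n x = 0" if "x \<notin> {a..b+1}" for n x
  proof (cases "x < a")
    case True
    then show ?thesis unfolding A_eq using \<open>a < b\<close>
      by (subst (1 2) step_eq_0) (auto intro!: mult_nonneg_nonpos)
  next
    case False
    then have "1 * 1 \<le> real (Suc n) * (x - a)" "1 * 1 \<le> real (Suc n) * (x - b)"
      using that \<open>a < b\<close> False by (intro mult_mono; auto)+
    then show ?thesis unfolding A_eq by (simp add: step_eq_1 del: of_nat_Suc)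
  qed
  have A_bd: "\<bar>A n x\<bar> \<le> 1" for n x
    unfolding A_eq using step_bounds[of "real (Suc n) * (x - a)"] step_bounds[of "real (Suc n) * (x - b)"] by linarith
  have A_cont: "continuous_on S (A n)" for S n by (rule smooth1_continuous[OF A_smooth])
  have [measurable]: "A n \<in> borel_measurable borel" for n by (rule borel_measurable_continuous_onI[OF A_cont])
  have D_cont: "continuous_on S (D n c)" for S n c
    unfolding D_def[abs_def] by (intro continuous_intros continuous_on_compose2[OF bump_continuous[of UNIV]]) auto
  \<comment> \<open>The limit is the indicator of the left-open interval, which differs from that of
    [a, b] at the one point a.\<close>
  have A_lim: "AE x in lborel. (\<lambda>n. A n x) \<longlonglongrightarrow> indicator {a..b} x"
    using AE_lborel_singleton[of a]
  proof (rule eventually_mono)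
    fix x assume "x \<noteq> a"
    have "(\<lambda>n. A n x) \<longlonglongrightarrow> (if x > a then 1 else 0) - (if x > b then 1 else 0)"
      unfolding A_eq by (intro tendsto_intros step_scaled_tendsto)
    moreover have "(if x > a then 1 else 0) - (if x > b then 1 else 0) = (indicator {a..b} x :: real)"
      using \<open>x \<noteq> a\<close> \<open>a < b\<close> by (auto simp: indicator_def)
    ultimately show "(\<lambda>n. A n x) \<longlonglongrightarrow> indicator {a..b} x" by simp
  qed
  have lim_g: "(\<lambda>n. LINT x|lborel. g x * A n x) \<longlonglongrightarrow> (LINT x:{a..b}|lborel. g x)"
    if [measurable]: "g \<in> borel_measurable borel" and gb: "\<And>x. x \<in> {a..b+1} \<Longrightarrow> \<bar>g x\<bar> \<le> B" for g B
  proof -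
    have B: "0 \<le> B" using gb[of a] \<open>a < b\<close> by auto
    have "(\<lambda>n. LINT x|lborel. g x * A n x) \<longlonglongrightarrow> (LINT x|lborel. g x * indicator {a..b} x)"
    proof (rule integral_dominated_convergence[where w = "\<lambda>x. B * indicator {a..b+1} x"])
      show "integrable lborel (\<lambda>x. B * indicator {a..b+1} x :: real)"
        by (intro integrable_mult_right integrable_real_indicator) (auto simp: emeasure_lborel_Icc_eq)
      show "AE x in lborel. (\<lambda>n. g x * A n x) \<longlonglongrightarrow> g x * indicator {a..b} x"
        using A_lim by (rule eventually_mono) (intro tendsto_intros)
      have "norm (g x * A n x) \<le> B * indicator {a..b+1} x" for x n
      proof (cases "x \<in> {a..b+1}")
        case True
        have "\<bar>g x * A n x\<bar> \<le> B * 1" unfolding abs_mult using gb[OF True] A_bd B by (intro mult_mono) auto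
        then show ?thesis using True by simp
      qed (use A0 in auto)
      then show "AE x in lborel. norm (g x * A n x) \<le> B * indicator {a..b+1} x" for n by simp
    qed measurable
    then show ?thesis unfolding set_lebesgue_integral_def by (simp add: mult.commute)
  qed
  have R: "{a..b+1} \<subseteq> {-R..R}" "{a..a+1} \<subseteq> {-R..R}" "{b..b+1} \<subseteq> {-R..R}"
    using \<open>a < b\<close> unfolding R_def by auto
  obtain U where U: "U \<ge> 0" "\<And>x t. x \<in> {-R..R} \<Longrightarrow> t \<in> {0..\<tau>} \<Longrightarrow> \<bar>u x t\<bar> \<le> U"
    using continuous_bounded_box[OF u_cont] by metis
  define Q where "Q n s = (LINT x|lborel. 1/2 * (u x s)\<^sup>2 * deriv (A n) x + F x s * A n x)" for n s
  have [measurable]: "deriv (A n) \<in> borel_measurable borel" for n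
    by (rule borel_measurable_continuous_onI[OF smooth1_continuous[OF smooth1_deriv[OF A_smooth]]])
  have Q_meas [measurable]: "Q n \<in> borel_measurable borel" for n
    unfolding Q_def by measurable
  have iF: "integrable lborel (\<lambda>x. F x s * A n x)" for n s
  proof (rule integrable_bounded_support[of _ a "b+1" "M/2 * 1"])
    show "\<bar>F x s * A n x\<bar> \<le> M/2 * 1" for x
      unfolding abs_mult using F_abs_le A_bd M_nonneg by (intro mult_mono) auto
  qed (use A0 in auto)
  have iD: "integrable lborel (\<lambda>x. 1/2 * (u x s)\<^sup>2 * D n c x)" for n s c
    by (rule integrable_continuous_support[of _ c "c+1"])
      (use bump0 in \<open>auto intro!: continuous_intros u_continuous D_cont\<close>)
  have Q_split: "Q n s = (LINT x|lborel. 1/2 * (u x s)\<^sup>2 * D n a x) - (LINT x|lborel. 1/2 * (u x s)\<^sup>2 * D n b x)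
     + (LINT x|lborel. F x s * A n x)" for n s
  proof -
    have "Q n s = (LINT x|lborel. 1/2 * (u x s)\<^sup>2 * D n a x - 1/2 * (u x s)\<^sup>2 * D n b x + F x s * A n x)"
      unfolding Q_def A_deriv by (simp only: right_diff_distrib)
    then show ?thesis using iF iD by simp
  qed
  have Q_lim: "(\<lambda>n. Q n s) \<longlonglongrightarrow> 1/2 * (u a s)\<^sup>2 - 1/2 * (u b s)\<^sup>2 + (LINT x:{a..b}|lborel. F x s)" for s
    unfolding Q_split D_def
    by (intro tendsto_add tendsto_diff bump_average_tendsto(1) lim_g[of _ "M/2"])
      (auto intro!: continuous_intros u_continuous simp: F_abs_le[simplified])
  define C where "C = U\<^sup>2 + M/2 * (b + 1 - a)"
  have Q_bd: "\<bar>Q n s\<bar> \<le> C" if s: "s \<in> {0..\<tau>}" for n s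
  proof -
    have sq: "\<bar>1/2 * (u x s)\<^sup>2\<bar> \<le> 1/2 * U\<^sup>2" if "x \<in> {-R..R}" for x
      using power_mono[OF U(2)[OF that s] abs_ge_zero, of 2] by simp
    have "\<bar>LINT x|lborel. 1/2 * (u x s)\<^sup>2 * D n c x\<bar> \<le> 1/2 * U\<^sup>2" if "{c..c+1} \<subseteq> {-R..R}" for c
      unfolding D_def
      by (rule bump_average_tendsto(2)) (use that sq in \<open>auto intro!: continuous_intros u_continuous\<close>)
    then have "\<bar>LINT x|lborel. 1/2 * (u x s)\<^sup>2 * D n a x\<bar> \<le> 1/2 * U\<^sup>2"
      "\<bar>LINT x|lborel. 1/2 * (u x s)\<^sup>2 * D n b x\<bar> \<le> 1/2 * U\<^sup>2" using R by blast+
    moreover have "\<bar>LINT x|lborel. F x s * A n x\<bar> \<le> M/2 * (b + 1 - a)"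
    proof -
      have bd: "\<bar>F x s * A n x\<bar> \<le> M/2 * indicator {a..b+1} x" for x
      proof (cases "x \<in> {a..b+1}")
        case True
        have "\<bar>F x s * A n x\<bar> \<le> M/2 * 1"
          unfolding abs_mult using F_abs_le A_bd M_nonneg by (intro mult_mono) auto
        then show ?thesis using True by simp
      qed (use A0 in auto)
      have "\<bar>LINT x|lborel. F x s * A n x\<bar> \<le> (LINT x|lborel. \<bar>F x s * A n x\<bar>)" by (rule integral_abs_bound)
      also have "\<dots> \<le> (LINT x|lborel. M/2 * indicator {a..b+1} x)"
        by (intro integral_mono integrable_abs iF bd integrable_mult_right integrable_real_indicator)
          (auto simp: emeasure_lborel_Icc_eq)
      finally show ?thesis using \<open>a < b\<close> by simp
    qed
    ultimately show ?thesis unfolding Q_split C_def by linarith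
  qed
  have C: "0 \<le> C" using M_nonneg \<open>a < b\<close> by (simp add: C_def)
  have eq: "(LINT x|lborel. u x \<tau> * A n x) - (LINT x|lborel. u x 0 * A n x) = (LINT s:{0..\<tau>}|lborel. Q n s)" for n
    unfolding Q_def
  proof (rule weak_eq_smooth[OF W A_smooth _ _ \<open>0 \<le> \<tau>\<close>])
    show "x \<notin> {-R..R} \<Longrightarrow> A n x = 0" for x using A0[of x n] R by blast
    show "deriv (A n) x = 0" if "x \<notin> {-R..R}" for x
    proof -
      have "x \<notin> {a..a+1}" "x \<notin> {b..b+1}" using that R(2,3) by (auto simp only: subset_iff)
      then show ?thesis unfolding A_deriv using bump0 by simp
    qed
  qed
  have uB: "\<bar>u x t\<bar> \<le> U" if "x \<in> {a..b+1}" "t \<in> {0..\<tau>}" for x t using U(2) R that by blast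
  have "(\<lambda>n. (LINT x|lborel. u x \<tau> * A n x) - (LINT x|lborel. u x 0 * A n x))
     \<longlonglongrightarrow> (LINT x:{a..b}|lborel. u x \<tau>) - (LINT x:{a..b}|lborel. u x 0)"
    by (intro tendsto_diff lim_g[of _ U] uB) (use \<open>0 \<le> \<tau>\<close> in auto)
  moreover have "(\<lambda>n. LINT s:{0..\<tau>}|lborel. Q n s) \<longlonglongrightarrow>
    (LINT s:{0..\<tau>}|lborel. 1/2 * (u a s)\<^sup>2 - 1/2 * (u b s)\<^sup>2 + (LINT x:{a..b}|lborel. F x s))"
    unfolding set_lebesgue_integral_def
  proof (rule integral_dominated_convergence[where w = "\<lambda>s. C * indicator {0..\<tau>} s"])
    show "integrable lborel (\<lambda>s. C * indicator {0..\<tau>} s :: real)"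
      by (intro integrable_mult_right integrable_real_indicator) (auto simp: emeasure_lborel_Icc_eq)
    show "AE s in lborel. (\<lambda>n. indicator {0..\<tau>} s *\<^sub>R Q n s) \<longlonglongrightarrow>
      indicator {0..\<tau>} s *\<^sub>R (1/2 * (u a s)\<^sup>2 - 1/2 * (u b s)\<^sup>2 + (LINT x|lborel. indicator {a..b} x *\<^sub>R F x s))"
      using Q_lim unfolding set_lebesgue_integral_def by (intro AE_I2 tendsto_scaleR tendsto_const)
    show "AE s in lborel. norm (indicator {0..\<tau>} s *\<^sub>R Q n s) \<le> C * indicator {0..\<tau>} s" for n
      using Q_bd C by (intro AE_I2) (auto simp: indicator_def)
  qed measurable
  ultimately show ?thesis unfolding eq by (rule LIMSEQ_unique)
qed

end

section \<open>Steklov averages\<close>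

text \<open>The balance of interval means takes the place of the distributional equation: it no
  longer mentions test functions, and the evolution results below are derived from it.\<close>

locale hs_flow = hs_base +
  assumes mean_evol: "\<And>a b \<tau>. a < b \<Longrightarrow> 0 \<le> \<tau> \<Longrightarrow>
    (LINT x:{a..b}|lborel. u x \<tau>) - (LINT x:{a..b}|lborel. u x 0)
    = (LINT s:{0..\<tau>}|lborel. 1/2 * (u a s)\<^sup>2 - 1/2 * (u b s)\<^sup>2 + (LINT x:{a..b}|lborel. F x s))"

context hs_base
begin

text \<open>Since u(x+k) - u(x-k) is the integral of \<open>w\<close> over [x-k, x+k], this is the
  average of \<open>w\<close> with the triangular kernel (h - |y - x|) / h^2, and
  \<open>\<kappa>\<close> is the same average of w^2. The triangle makes V a second difference of
  the primitive \<open>P\<close>: its time derivative follows from interval means, and its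
  x-derivative is continuous.\<close>

definition V where "V h x t = (LINT k:{0..h}|lborel. u (x + k) t - u (x - k) t) / h\<^sup>2"
definition \<kappa> where "\<kappa> h x t = (LINT k:{0..h}|lborel. 2 * (F (x + k) t - F (x - k) t)) / h\<^sup>2"
definition P where "P x t = (LBINT y=ereal 0..ereal x. u y t)"

text \<open>This is what remains of the time derivative of V once the transport term is split off.
  The average \<open>\<kappa>\<close> and both squared difference quotients tend to w^2, so the
  whole tends to w^2/2 - w^2 = - w^2/2, the Riccati right-hand side.\<close>

definition G where "G h x t = 1/2 * \<kappa> h x t
  - 1/2 * (((u (x + h) t - u x t) / h)\<^sup>2 + ((u x t - u (x - h) t) / h)\<^sup>2)"

lemma P_DERIV: "((\<lambda>x. P x t) has_real_derivative u x t) (at x)"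
  unfolding P_def by (rule primitive_DERIV) (intro u_continuous continuous_intros)

lemma FTC_continuous:
  fixes f :: "real \<Rightarrow> real"
  assumes "\<And>x. (p has_real_derivative f x) (at x)" "continuous_on UNIV f" "a \<le> b"
  shows "(LINT x:{a..b}|lborel. f x) = p b - p a"
  using integral_FTC_Icc_real[of a b p f] assms
  by (auto simp: set_lebesgue_integral_def mult.commute continuous_on_eq_continuous_at)

lemma u_mean_P: "a \<le> b \<Longrightarrow> (LINT x:{a..b}|lborel. u x t) = P b t - P a t"
  by (rule FTC_continuous) (auto intro: P_DERIV u_continuous continuous_intros)

lemma V_P:
  assumes "h > 0" shows "V h x t = (P (x + h) t - 2 * P x t + P (x - h) t) / h\<^sup>2"
proof -
  have "(LINT k:{0..h}|lborel. u (x + k) t - u (x - k) t) = (P (x + h) t + P (x - h) t) - (P (x + 0) t + P (x - 0) t)"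
    by (rule FTC_continuous[where p = "\<lambda>k. P (x + k) t + P (x - k) t"])
      (use assms in \<open>auto intro!: derivative_eq_intros DERIV_chain2[OF P_DERIV] u_continuous continuous_intros\<close>)
  then show ?thesis by (simp add: V_def)
qed

lemma V_DERIV:
  assumes "h > 0"
  shows "((\<lambda>x. V h x t) has_real_derivative (u (x + h) t - 2 * u x t + u (x - h) t) / h\<^sup>2) (at x)"
  unfolding V_P[OF assms]
  by (rule DERIV_cdivide) (auto intro!: derivative_eq_intros DERIV_chain2[OF P_DERIV])

lemma set_integral_continuous_HK:
  fixes f :: "real \<Rightarrow> real"
  assumes "continuous_on UNIV f"
  shows "(LINT x:{a..b}|lborel. f x) = integral {a..b} f" "set_integrable lborel {a..b} f"
proof -
  show i: "set_integrable lborel {a..b} f"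
    unfolding set_integrable_def
    by (rule borel_integrable_compact) (auto intro: continuous_on_subset[OF assms])
  show "(LINT x:{a..b}|lborel. f x) = integral {a..b} f"
    by (rule set_borel_integral_eq_integral(2)[OF i])
qed

lemma V_cont: "continuous_on UNIV (\<lambda>p. V h (fst p) (snd p))"
proof -
  have eq: "V h (fst p) (snd p) = integral (cbox 0 h) (\<lambda>k. u (fst p + k) (snd p) - u (fst p - k) (snd p)) / h\<^sup>2" for p
    unfolding V_def cbox_interval
    by (subst set_integral_continuous_HK(1)) (auto intro!: continuous_intros u_continuous)
  have "continuous_on UNIV (\<lambda>p. integral (cbox 0 h) (\<lambda>k. u (fst p + k) (snd p) - u (fst p - k) (snd p)))"
    by (rule integral_continuous_on_param)
      (auto simp: case_prod_beta intro!: continuous_intros u_continuous)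
  then show ?thesis unfolding eq by (auto intro!: continuous_intros simp: divide_inverse)
qed

lemma V_continuous: "continuous_on S g \<Longrightarrow> continuous_on S k \<Longrightarrow> continuous_on S (\<lambda>z. V h (g z) (k z))"
  by (rule continuous_on_pair_slice[OF V_cont])

lemma V_meas [measurable]: "case_prod (V h) \<in> borel_measurable (borel \<Otimes>\<^sub>M borel)"
  using borel_measurable_continuous_onI[OF V_cont] by (simp add: borel_prod case_prod_beta')

lemma \<kappa>_meas [measurable]: "case_prod (\<kappa> h) \<in> borel_measurable (borel \<Otimes>\<^sub>M borel)"
  unfolding \<kappa>_def set_lebesgue_integral_def by measurable

lemma G_meas [measurable]: "case_prod (G h) \<in> borel_measurable (borel \<Otimes>\<^sub>M borel)"
  unfolding G_def by measurable

lemma F_continuous': "continuous_on S g \<Longrightarrow> continuous_on S (\<lambda>z. F (g z) t)"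
  by (rule continuous_on_compose2[OF F_continuous]) auto

lemma F_shift_continuous: "continuous_on UNIV (\<lambda>k. 2 * (F (x + k) t - F (x - k) t))"
  by (intro continuous_intros continuous_on_compose2[OF F_continuous]) auto

text \<open>Jensen's inequality for the triangular kernel: \<open>quadratic_nonneg\<close> is
  integrated over k with the same m throughout, namely the average itself.\<close>

lemma V_le_\<kappa>: assumes "h > 0" shows "(V h x t)\<^sup>2 \<le> \<kappa> h x t"
proof -
  define m where "m = V h x t"
  have i: "set_integrable lborel {0..h} (\<lambda>k. 2 * (F (x + k) t - F (x - k) t))"
    "set_integrable lborel {0..h} (\<lambda>k. 2 * m * (u (x + k) t - u (x - k) t))"
    "set_integrable lborel {0..h} (\<lambda>k. m\<^sup>2 * (2 * k))"
    by (auto intro!: set_integral_continuous_HK(2) continuous_intros u_continuous F_continuous')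
  have "0 \<le> (LINT k:{0..h}|lborel. 2 * (F (x + k) t - F (x - k) t) - 2 * m * (u (x + k) t - u (x - k) t) + m\<^sup>2 * (2 * k))"
    unfolding set_lebesgue_integral_def
  proof (rule integral_nonneg_AE, rule AE_I2)
    fix k
    show "0 \<le> indicator {0..h} k *\<^sub>R (2 * (F (x + k) t - F (x - k) t) - 2 * m * (u (x + k) t - u (x - k) t) + m\<^sup>2 * (2 * k))"
      using quadratic_nonneg[of "x - k" "x + k" t m] by (auto simp: indicator_def)
  qed
  also have "\<dots> = (LINT k:{0..h}|lborel. 2 * (F (x + k) t - F (x - k) t))
     - (LINT k:{0..h}|lborel. 2 * m * (u (x + k) t - u (x - k) t)) + (LINT k:{0..h}|lborel. m\<^sup>2 * (2 * k))"
    using i by (simp only: set_integral_add set_integral_diff)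
  also have "(LINT k:{0..h}|lborel. m\<^sup>2 * (2 * k)) = m\<^sup>2 * h\<^sup>2 - m\<^sup>2 * 0\<^sup>2"
    by (rule FTC_continuous) (use assms in \<open>auto intro!: derivative_eq_intros continuous_intros\<close>)
  also have "(LINT k:{0..h}|lborel. 2 * m * (u (x + k) t - u (x - k) t)) = 2 * m * (m * h\<^sup>2)"
    using assms by (simp add: m_def V_def)
  also have "(LINT k:{0..h}|lborel. 2 * (F (x + k) t - F (x - k) t)) = \<kappa> h x t * h\<^sup>2"
    using assms by (simp add: \<kappa>_def)
  finally have "0 \<le> (\<kappa> h x t - m\<^sup>2) * h\<^sup>2" by (simp add: algebra_simps power2_eq_square)
  then show ?thesis using assms unfolding m_def by (simp add: zero_le_mult_iff)
qed

section \<open>L1 convergence of the averages\<close>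

text \<open>By Tonelli: each y is counted for exactly the x in [y - d, y - c), a set of length d -
  c.\<close>

lemma F_shift_nn_integral:
  assumes "c \<le> d"
  shows "(\<integral>\<^sup>+x. ennreal (2 * (F (x + d) t - F (x + c) t)) \<partial>lborel)
    = ennreal (d - c) * (\<integral>\<^sup>+x. ennreal ((w x t)\<^sup>2) \<partial>lborel)"
proof -
  have eq: "ennreal (2 * (F (x + d) t - F (x + c) t))
     = (\<integral>\<^sup>+y. ennreal ((w y t)\<^sup>2) * (if x + c < y \<and> y \<le> x + d then 1 else 0) \<partial>lborel)" for x
  proof -
    have "ennreal (2 * (F (x + d) t - F (x + c) t)) = ennreal (LINT y|lborel. indicator {x+c<..x+d} y *\<^sub>R (w y t)\<^sup>2)"
      using F_diff[of "x + c" "x + d" t] assms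
      by (intro arg_cong[where f = ennreal]) (simp add: set_lebesgue_integral_def)
    also have "\<dots> = (\<integral>\<^sup>+y. ennreal (indicator {x+c<..x+d} y *\<^sub>R (w y t)\<^sup>2) \<partial>lborel)"
      by (rule nn_integral_eq_integral[symmetric])
        (use w_sq_set[of "{x+c<..x+d}" t] in \<open>auto simp: set_integrable_def\<close>)
    also have "\<dots> = (\<integral>\<^sup>+y. ennreal ((w y t)\<^sup>2) * (if x + c < y \<and> y \<le> x + d then 1 else 0) \<partial>lborel)"
      by (intro nn_integral_cong) (auto simp: indicator_def)
    finally show ?thesis .
  qed
  have "(\<integral>\<^sup>+x. ennreal (2 * (F (x + d) t - F (x + c) t)) \<partial>lborel)
     = (\<integral>\<^sup>+y. \<integral>\<^sup>+x. ennreal ((w y t)\<^sup>2) * (if x + c < y \<and> y \<le> x + d then 1 else 0) \<partial>lborel \<partial>lborel)"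
    unfolding eq by (rule lborel_pair.Fubini'[symmetric]) measurable
  also have "\<dots> = (\<integral>\<^sup>+y. ennreal ((w y t)\<^sup>2) * ennreal (d - c) \<partial>lborel)"
  proof (intro nn_integral_cong)
    fix y
    have "(\<integral>\<^sup>+x. ennreal ((w y t)\<^sup>2) * (if x + c < y \<and> y \<le> x + d then 1 else 0) \<partial>lborel)
      = (\<integral>\<^sup>+x. ennreal ((w y t)\<^sup>2) * indicator {y-d..<y-c} x \<partial>lborel)"
      by (intro nn_integral_cong) (auto simp: indicator_def)
    also have "\<dots> = ennreal ((w y t)\<^sup>2) * ennreal (d - c)"
      using assms by (subst nn_integral_cmult_indicator) auto
    finally show "(\<integral>\<^sup>+x. ennreal ((w y t)\<^sup>2) * (if x + c < y \<and> y \<le> x + d then 1 else 0) \<partial>lborel)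
       = ennreal ((w y t)\<^sup>2) * ennreal (d - c)" .
  qed
  also have "\<dots> = ennreal (d - c) * (\<integral>\<^sup>+x. ennreal ((w x t)\<^sup>2) \<partial>lborel)"
    by (subst nn_integral_multc) (auto simp: mult.commute)
  finally show ?thesis .
qed

lemma w_sq_nn: "(\<integral>\<^sup>+x. ennreal ((w x t)\<^sup>2) \<partial>lborel) = ennreal (LINT x|lborel. (w x t)\<^sup>2)"
  by (rule nn_integral_eq_integral) (use w_sq in auto)

lemma \<kappa>_nonneg: assumes "h > 0" shows "0 \<le> \<kappa> h x t"
  using V_le_\<kappa>[OF assms, of x t] zero_le_power2[of "V h x t"] by linarith

lemma \<kappa>_nn_integral:
  assumes "h > 0"
  shows "(\<integral>\<^sup>+x. ennreal (\<kappa> h x t) \<partial>lborel) = ennreal (LINT x|lborel. (w x t)\<^sup>2)"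
proof -
  have eq: "ennreal (\<kappa> h x t) = ennreal (1 / h\<^sup>2) *
      (\<integral>\<^sup>+k. indicator {0..h} k * ennreal (2 * (F (x + k) t - F (x - k) t)) \<partial>lborel)" for x
  proof -
    have "ennreal (LINT k:{0..h}|lborel. 2 * (F (x + k) t - F (x - k) t)) = ennreal (LINT k|lborel. indicator {0..h} k *\<^sub>R (2 * (F (x + k) t - F (x - k) t)))"
      by (simp add: set_lebesgue_integral_def)
    also have "\<dots> = (\<integral>\<^sup>+k. ennreal (indicator {0..h} k *\<^sub>R (2 * (F (x + k) t - F (x - k) t))) \<partial>lborel)"
    proof (rule nn_integral_eq_integral[symmetric])
      show "integrable lborel (\<lambda>k. indicator {0..h} k *\<^sub>R (2 * (F (x + k) t - F (x - k) t)))"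
        using set_integral_continuous_HK(2)[OF F_shift_continuous, of 0 h x t] by (simp only: set_integrable_def)
      show "AE k in lborel. 0 \<le> indicator {0..h} k *\<^sub>R (2 * (F (x + k) t - F (x - k) t))"
      proof (rule AE_I2)
        show "0 \<le> indicator {0..h} k *\<^sub>R (2 * (F (x + k) t - F (x - k) t))" for k
          using F_mono[of "x - k" "x + k" t] by (cases "k \<in> {0..h}") auto
      qed
    qed
    also have "\<dots> = (\<integral>\<^sup>+k. indicator {0..h} k * ennreal (2 * (F (x + k) t - F (x - k) t)) \<partial>lborel)"
      by (intro nn_integral_cong) (auto simp: indicator_def)
    finally have "ennreal (LINT k:{0..h}|lborel. 2 * (F (x + k) t - F (x - k) t)) = \<dots>" .
    moreover have "ennreal (\<kappa> h x t) = ennreal (1 / h\<^sup>2) * ennreal (LINT k:{0..h}|lborel. 2 * (F (x + k) t - F (x - k) t))"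
      unfolding \<kappa>_def by (subst ennreal_mult'[symmetric]) simp_all
    ultimately show ?thesis by (simp only:)
  qed
  have "(\<integral>\<^sup>+x. ennreal (\<kappa> h x t) \<partial>lborel) = ennreal (1 / h\<^sup>2) *
      (\<integral>\<^sup>+x. \<integral>\<^sup>+k. indicator {0..h} k * ennreal (2 * (F (x + k) t - F (x - k) t)) \<partial>lborel \<partial>lborel)"
    unfolding eq by (rule nn_integral_cmult) measurable
  also have "(\<integral>\<^sup>+x. \<integral>\<^sup>+k. indicator {0..h} k * ennreal (2 * (F (x + k) t - F (x - k) t)) \<partial>lborel \<partial>lborel)
     = (\<integral>\<^sup>+k. \<integral>\<^sup>+x. indicator {0..h} k * ennreal (2 * (F (x + k) t - F (x - k) t)) \<partial>lborel \<partial>lborel)"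
    by (rule lborel_pair.Fubini'[symmetric]) measurable
  also have "\<dots> = (\<integral>\<^sup>+k. ennreal (2 * k * indicator {0..h} k) * ennreal (LINT x|lborel. (w x t)\<^sup>2) \<partial>lborel)"
  proof (intro nn_integral_cong)
    fix k :: real
    show "(\<integral>\<^sup>+x. indicator {0..h} k * ennreal (2 * (F (x + k) t - F (x - k) t)) \<partial>lborel)
       = ennreal (2 * k * indicator {0..h} k) * ennreal (LINT x|lborel. (w x t)\<^sup>2)"
    proof (cases "k \<in> {0..h}")
      case True
      then show ?thesis using F_shift_nn_integral[of "-k" k t] by (simp add: w_sq_nn)
    qed auto
  qed
  also have "\<dots> = (\<integral>\<^sup>+k. ennreal (2 * k * indicator {0..h} k) \<partial>lborel) * ennreal (LINT x|lborel. (w x t)\<^sup>2)"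
    by (rule nn_integral_multc) measurable
  also have "(\<integral>\<^sup>+k. ennreal (2 * k * indicator {0..h} k) \<partial>lborel) = (\<integral>\<^sup>+k. ennreal (2 * k) * indicator {0..h} k \<partial>lborel)"
    by (intro nn_integral_cong) (auto simp: indicator_def)
  also have "\<dots> = ennreal (h\<^sup>2 - 0\<^sup>2)"
    by (rule nn_integral_FTC_Icc) (use assms in \<open>auto intro!: derivative_eq_intros\<close>)
  finally have "(\<integral>\<^sup>+x. ennreal (\<kappa> h x t) \<partial>lborel) = ennreal (1 / h\<^sup>2) * ennreal (h\<^sup>2 - 0\<^sup>2) * ennreal (LINT x|lborel. (w x t)\<^sup>2)"
    by (simp only: mult.assoc)
  moreover have "ennreal (1 / h\<^sup>2) * ennreal (h\<^sup>2 - 0\<^sup>2) = 1"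
    using assms by (subst ennreal_mult'[symmetric]) auto
  ultimately show ?thesis by (simp only: mult_1)
qed

lemma \<kappa>_integrable: "h > 0 \<Longrightarrow> integrable lborel (\<lambda>x. \<kappa> h x t)"
  and \<kappa>_integral: "h > 0 \<Longrightarrow> (LINT x|lborel. \<kappa> h x t) = (LINT x|lborel. (w x t)\<^sup>2)"
proof -
  assume h: "h > 0"
  show i: "integrable lborel (\<lambda>x. \<kappa> h x t)"
    by (rule integrableI_nonneg) (use \<kappa>_nonneg[OF h] \<kappa>_nn_integral[OF h] in auto)
  have "ennreal (LINT x|lborel. \<kappa> h x t) = ennreal (LINT x|lborel. (w x t)\<^sup>2)"
    using nn_integral_eq_integral[OF i] \<kappa>_nonneg[OF h] \<kappa>_nn_integral[OF h] by simp
  then show "(LINT x|lborel. \<kappa> h x t) = (LINT x|lborel. (w x t)\<^sup>2)"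
    using \<kappa>_nonneg[OF h] by (subst (asm) ennreal_inj) (auto intro!: integral_nonneg_AE)
qed

lemma difference_quotient_nn:
  assumes "c < d"
  shows "(\<integral>\<^sup>+x. ennreal (((u (x + d) t - u (x + c) t) / (d - c))\<^sup>2) \<partial>lborel) \<le> (\<integral>\<^sup>+x. ennreal ((w x t)\<^sup>2) \<partial>lborel)"
proof -
  have "((u (x + d) t - u (x + c) t) / (d - c))\<^sup>2 \<le> 1 / (d - c) * (2 * (F (x + d) t - F (x + c) t))" for x
  proof -
    have aux: "a\<^sup>2 \<le> D * X \<Longrightarrow> D > 0 \<Longrightarrow> (a / D)\<^sup>2 \<le> 1 / D * X" for a D X :: real
      by (simp add: power_divide field_simps power2_eq_square)
    show ?thesis using aux[OF u_diff_sq[of "x + c" "x + d" t, simplified]] assms by simp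
  qed
  then have "(\<integral>\<^sup>+x. ennreal (((u (x + d) t - u (x + c) t) / (d - c))\<^sup>2) \<partial>lborel)
     \<le> (\<integral>\<^sup>+x. ennreal (1 / (d - c)) * ennreal (2 * (F (x + d) t - F (x + c) t)) \<partial>lborel)"
    using assms by (intro nn_integral_mono) (simp flip: ennreal_mult' add: ennreal_leI)
  also have "\<dots> = ennreal (1 / (d - c)) * (ennreal (d - c) * (\<integral>\<^sup>+x. ennreal ((w x t)\<^sup>2) \<partial>lborel))"
    using assms by (subst nn_integral_cmult) (measurable, subst F_shift_nn_integral, simp_all)
  also have "\<dots> = (\<integral>\<^sup>+x. ennreal ((w x t)\<^sup>2) \<partial>lborel)"
    using assms by (simp flip: ennreal_mult' mult.assoc)
  finally show ?thesis .
qed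

lemma difference_quotient_integrable:
  assumes "c < d"
  shows "integrable lborel (\<lambda>x. ((u (x + d) t - u (x + c) t) / (d - c))\<^sup>2)"
proof (rule integrableI_nonneg)
  show "(\<integral>\<^sup>+x. ennreal (((u (x + d) t - u (x + c) t) / (d - c))\<^sup>2) \<partial>lborel) < \<infinity>"
    using difference_quotient_nn[OF assms, of t] unfolding w_sq_nn by (rule le_less_trans) simp
qed auto

lemma difference_quotient_tendsto:
  assumes D: "((\<lambda>y. f y) has_real_derivative D) (at x)"
    and X: "X \<longlonglongrightarrow> 0" and nz: "\<And>n. X n \<noteq> 0"
  shows "(\<lambda>n. (f (x + X n) - f x) / X n) \<longlonglongrightarrow> D"
proof -
  have "((\<lambda>h. (f (x + h) - f x) / h) \<longlongrightarrow> D) (at 0)" using D by (simp add: DERIV_def)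
  then show ?thesis
    by (rule filterlim_compose) (use X nz in \<open>auto simp: filterlim_at\<close>)
qed

definition hh :: "nat \<Rightarrow> real" where "hh n = 1 / real (Suc n)"

lemma hh: "hh n > 0" "hh n \<noteq> 0" "hh \<longlonglongrightarrow> 0"
proof -
  show "hh n > 0" "hh n \<noteq> 0" by (auto simp: hh_def)
  show "hh \<longlonglongrightarrow> 0" unfolding hh_def[abs_def] by (rule LIMSEQ_Suc[OF lim_1_over_n])
qed

text \<open>The differentiability error of u(x+k) - u(x-k) is at most e * 2k, and its integral over
  k in [0, h] is e h^2, which matches the normalization of V.\<close>

lemma V_tendsto:
  assumes D: "((\<lambda>y. u y t) has_real_derivative D) (at x)"
  shows "(\<lambda>n. V (hh n) x t) \<longlonglongrightarrow> D"
proof (rule LIMSEQ_I)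
  fix r :: real assume "0 < r"
  define e where "e = r / 2"
  have "e > 0" using \<open>0 < r\<close> by (simp add: e_def)
  have "((\<lambda>y. u y t) has_derivative (\<lambda>h. D * h)) (at x)"
    using D by (simp add: has_field_derivative_def)
  then obtain d where "d > 0" and d: "\<And>y. \<bar>y - x\<bar> < d \<Longrightarrow> \<bar>u y t - u x t - D * (y - x)\<bar> \<le> e * \<bar>y - x\<bar>"
    using \<open>e > 0\<close> unfolding has_derivative_at_alt real_norm_def by blast
  obtain N where N: "\<And>n. n \<ge> N \<Longrightarrow> hh n < d"
    using order_tendstoD(2)[OF hh(3) \<open>d > 0\<close>] unfolding eventually_sequentially by blast
  show "\<exists>N. \<forall>n\<ge>N. norm (V (hh n) x t - D) < r"
  proof (intro exI allI impI)
    fix n assume "N \<le> n"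
    define h where "h = hh n"
    have h: "0 < h" "h < d" using N[OF \<open>N \<le> n\<close>] hh(1) by (auto simp: h_def)
    have i: "set_integrable lborel {0..h} (\<lambda>k. u (x + k) t - u (x - k) t - D * (2 * k))"
      "set_integrable lborel {0..h} (\<lambda>k. e * (2 * k))"
      "set_integrable lborel {0..h} (\<lambda>k. D * (2 * k))"
      "set_integrable lborel {0..h} (\<lambda>k. u (x + k) t - u (x - k) t)"
      by (auto intro!: set_integral_continuous_HK(2) continuous_intros u_continuous)
    have sq: "(LINT k:{0..h}|lborel. c * (2 * k)) = c * h\<^sup>2" for c
    proof -
      have "(LINT k:{0..h}|lborel. c * (2 * k)) = c * h\<^sup>2 - c * 0\<^sup>2"
        by (rule FTC_continuous) (use h in \<open>auto intro!: derivative_eq_intros continuous_intros\<close>)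
      then show ?thesis by simp
    qed
    have "V h x t * h\<^sup>2 - D * h\<^sup>2 = (LINT k:{0..h}|lborel. u (x + k) t - u (x - k) t) - (LINT k:{0..h}|lborel. D * (2 * k))"
      using h unfolding V_def sq by simp
    also have "\<dots> = (LINT k:{0..h}|lborel. u (x + k) t - u (x - k) t - D * (2 * k))"
      using i by (simp only: set_integral_diff)
    finally have eq: "V h x t * h\<^sup>2 - D * h\<^sup>2 = \<dots>" .
    have "\<bar>V h x t * h\<^sup>2 - D * h\<^sup>2\<bar> \<le> (LINT k:{0..h}|lborel. \<bar>u (x + k) t - u (x - k) t - D * (2 * k)\<bar>)"
      unfolding eq set_lebesgue_integral_def
      by (rule order_trans[OF integral_abs_bound]) (simp add: abs_mult)
    also have "\<dots> \<le> (LINT k:{0..h}|lborel. e * (2 * k))"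
    proof (rule set_integral_mono)
      fix k assume k: "k \<in> {0..h}"
      then have "\<bar>u (x + k) t - u x t - D * k\<bar> \<le> e * k" "\<bar>u (x - k) t - u x t - D * (- k)\<bar> \<le> e * k"
        using d[of "x + k"] d[of "x - k"] h by auto
      then show "\<bar>u (x + k) t - u (x - k) t - D * (2 * k)\<bar> \<le> e * (2 * k)" by (auto simp: abs_le_iff)
    qed (use i in \<open>auto intro: set_integrable_abs\<close>)
    also have "\<dots> = e * h\<^sup>2" by (rule sq)
    finally have "\<bar>V h x t - D\<bar> * h\<^sup>2 \<le> e * h\<^sup>2" by (simp add: abs_mult flip: left_diff_distrib)
    then have "\<bar>V h x t - D\<bar> \<le> e" using h by simp
    then show "norm (V (hh n) x t - D) < r" using \<open>0 < r\<close> by (simp add: h_def e_def)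
  qed
qed

lemma L1_of_nn:
  fixes f :: "nat \<Rightarrow> real \<Rightarrow> real"
  assumes "\<And>n. integrable lborel (f n)" "(\<lambda>n. \<integral>\<^sup>+x. norm (f n x) \<partial>lborel) \<longlonglongrightarrow> 0"
  shows "(\<lambda>n. LINT x|lborel. \<bar>f n x\<bar>) \<longlonglongrightarrow> 0"
proof -
  have "(\<integral>\<^sup>+x. norm (f n x) \<partial>lborel) = ennreal (LINT x|lborel. \<bar>f n x\<bar>)" for n
    using nn_integral_eq_integral[of lborel "\<lambda>x. \<bar>f n x\<bar>"] assms(1) by auto
  then have "(\<lambda>n. ennreal (LINT x|lborel. \<bar>f n x\<bar>)) \<longlonglongrightarrow> ennreal 0" using assms(2) by simp
  then show ?thesis by (subst (asm) tendsto_ennreal_iff) auto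
qed

text \<open>Scheffe's argument: almost everywhere convergence of the squares, together with
  integrals that do not exceed the integral of the limit, already gives convergence in L1.\<close>

lemma squares_L1_tendsto:
  assumes [measurable]: "\<And>n. f n \<in> borel_measurable borel"
    and "AE x in lborel. (\<lambda>n. f n x) \<longlonglongrightarrow> w x t"
    and "\<And>n. (\<integral>\<^sup>+x. ennreal ((f n x)\<^sup>2) \<partial>lborel) \<le> (\<integral>\<^sup>+x. ennreal ((w x t)\<^sup>2) \<partial>lborel)"
  shows "(\<lambda>n. LINT x|lborel. \<bar>(f n x)\<^sup>2 - (w x t)\<^sup>2\<bar>) \<longlonglongrightarrow> 0"
proof (rule L1_of_nn)
  show "integrable lborel (\<lambda>x. (f n x)\<^sup>2 - (w x t)\<^sup>2)" for n
  proof (intro Bochner_Integration.integrable_diff w_sq integrableI_nonneg)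
    show "(\<integral>\<^sup>+x. ennreal ((f n x)\<^sup>2) \<partial>lborel) < \<infinity>"
      using assms(3)[of n] unfolding w_sq_nn by (rule le_less_trans) simp
  qed auto
  show "(\<lambda>n. \<integral>\<^sup>+x. norm ((f n x)\<^sup>2 - (w x t)\<^sup>2) \<partial>lborel) \<longlonglongrightarrow> 0"
  proof (rule Scheffe_lemma2)
    show "AE x in lborel. (\<lambda>n. (f n x)\<^sup>2) \<longlonglongrightarrow> (w x t)\<^sup>2"
      using assms(2) by (rule eventually_mono) (intro tendsto_intros)
    show "(\<integral>\<^sup>+x. norm ((f n x)\<^sup>2) \<partial>lborel) \<le> (\<integral>\<^sup>+x. norm ((w x t)\<^sup>2) \<partial>lborel)" for n
      using assms(3)[of n] by simp
  qed (use w_sq in auto)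
qed

lemma G_L1_bound:
  assumes "h > 0"
  shows "integrable lborel (\<lambda>x. G h x t)" "(LINT x|lborel. \<bar>G h x t\<bar>) \<le> 2 * M"
proof -
  let ?a = "\<lambda>x. ((u (x + h) t - u x t) / h)\<^sup>2" and ?b = "\<lambda>x. ((u x t - u (x - h) t) / h)\<^sup>2"
  have i: "integrable lborel ?a" "integrable lborel ?b" "integrable lborel (\<lambda>x. \<kappa> h x t)"
    using difference_quotient_integrable[of 0 h t] difference_quotient_integrable[of "-h" 0 t] \<kappa>_integrable assms
    by auto
  show "integrable lborel (\<lambda>x. G h x t)" unfolding G_def using i by simp
  then have iG: "integrable lborel (\<lambda>x. \<bar>G h x t\<bar>)" by (rule integrable_abs)
  have "(LINT x|lborel. ?a x) \<le> M" "(LINT x|lborel. ?b x) \<le> M"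
  proof -
    have "ennreal (LINT x|lborel. ?a x) \<le> ennreal (LINT x|lborel. (w x t)\<^sup>2)"
      using difference_quotient_nn[of 0 h t] assms nn_integral_eq_integral[OF i(1)] by (simp add: w_sq_nn)
    then show "(LINT x|lborel. ?a x) \<le> M" using w_M[of t] by (simp add: ennreal_le_iff)
    have "ennreal (LINT x|lborel. ?b x) \<le> ennreal (LINT x|lborel. (w x t)\<^sup>2)"
      using difference_quotient_nn[of "-h" 0 t] assms nn_integral_eq_integral[OF i(2)] by (simp add: w_sq_nn)
    then show "(LINT x|lborel. ?b x) \<le> M" using w_M[of t] by (simp add: ennreal_le_iff)
  qed
  moreover have "(LINT x|lborel. \<kappa> h x t) \<le> M" using \<kappa>_integral[OF assms] w_M by simp
  moreover have "(LINT x|lborel. \<bar>G h x t\<bar>) \<le> (LINT x|lborel. 1/2 * (?a x + ?b x) + 1/2 * \<kappa> h x t)"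
  proof (rule integral_mono[OF iG])
    show "integrable lborel (\<lambda>x. 1/2 * (?a x + ?b x) + 1/2 * \<kappa> h x t)" using i by simp
    show "\<bar>G h x t\<bar> \<le> 1/2 * (?a x + ?b x) + 1/2 * \<kappa> h x t" for x
    proof -
      have "0 \<le> ?a x" "0 \<le> ?b x" "0 \<le> \<kappa> h x t" using \<kappa>_nonneg[OF assms] by auto
      moreover have "\<bar>1/2 * K - 1/2 * (X + Y)\<bar> \<le> 1/2 * (X + Y) + 1/2 * K"
        if "0 \<le> X" "0 \<le> Y" "0 \<le> K" for X Y K :: real using that by argo
      ultimately show ?thesis unfolding G_def by blast
    qed
  qed
  moreover have "(LINT x|lborel. 1/2 * (?a x + ?b x) + 1/2 * \<kappa> h x t)
     = 1/2 * ((LINT x|lborel. ?a x) + (LINT x|lborel. ?b x)) + 1/2 * (LINT x|lborel. \<kappa> h x t)"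
    using i by simp
  ultimately show "(LINT x|lborel. \<bar>G h x t\<bar>) \<le> 2 * M" using M_nonneg by argo
qed

text \<open>The kernel average of \<^term>\<open>(w x t)\<^sup>2\<close> has the same integral as \<^term>\<open>(w x t)\<^sup>2\<close> and dominates
  \<^term>\<open>(V h x t)\<^sup>2\<close>, so no Lebesgue differentiation theorem is needed for its convergence.\<close>

lemma G_tendsto: "(\<lambda>n. LINT x|lborel. \<bar>G (hh n) x t + 1/2 * (w x t)\<^sup>2\<bar>) \<longlonglongrightarrow> 0"
proof -
  let ?a = "\<lambda>n x. (u (x + hh n) t - u x t) / hh n" and ?b = "\<lambda>n x. (u x t - u (x - hh n) t) / hh n"
  let ?v = "\<lambda>n x. V (hh n) x t"
  have La: "(\<lambda>n. LINT x|lborel. \<bar>(?a n x)\<^sup>2 - (w x t)\<^sup>2\<bar>) \<longlonglongrightarrow> 0"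
  proof (rule squares_L1_tendsto)
    show "AE x in lborel. (\<lambda>n. ?a n x) \<longlonglongrightarrow> w x t"
      using u_deriv[of t] by (rule eventually_mono) (rule difference_quotient_tendsto, auto simp: hh)
  qed (use difference_quotient_nn[of 0 "hh _" t] hh in auto)
  have Lb: "(\<lambda>n. LINT x|lborel. \<bar>(?b n x)\<^sup>2 - (w x t)\<^sup>2\<bar>) \<longlonglongrightarrow> 0"
  proof (rule squares_L1_tendsto)
    have "(\<lambda>n. ?b n x) \<longlonglongrightarrow> D" if "((\<lambda>y. u y t) has_real_derivative D) (at x)" for x D
    proof -
      have "(\<lambda>n. (u (x + (- hh n)) t - u x t) / (- hh n)) \<longlonglongrightarrow> D"
        by (rule difference_quotient_tendsto[OF that]) (use hh tendsto_minus[OF hh(3)] in auto)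
      moreover have "(u (x + (- hh n)) t - u x t) / (- hh n) = ?b n x" for n by (simp add: divide_simps)
      ultimately show ?thesis by simp
    qed
    then show "AE x in lborel. (\<lambda>n. ?b n x) \<longlonglongrightarrow> w x t"
      using u_deriv[of t] by (auto elim!: eventually_mono)
  qed (use difference_quotient_nn[of "- hh _" 0 t] hh in auto)
  have v_le: "(\<integral>\<^sup>+x. ennreal ((?v n x)\<^sup>2) \<partial>lborel) \<le> (\<integral>\<^sup>+x. ennreal ((w x t)\<^sup>2) \<partial>lborel)" for n
  proof -
    have "(\<integral>\<^sup>+x. ennreal ((?v n x)\<^sup>2) \<partial>lborel) \<le> (\<integral>\<^sup>+x. ennreal (\<kappa> (hh n) x t) \<partial>lborel)"
      by (intro nn_integral_mono ennreal_leI V_le_\<kappa> hh)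
    then show ?thesis using \<kappa>_nn_integral[OF hh(1)] by (simp add: w_sq_nn)
  qed
  have Lv: "(\<lambda>n. LINT x|lborel. \<bar>(?v n x)\<^sup>2 - (w x t)\<^sup>2\<bar>) \<longlonglongrightarrow> 0"
  proof (rule squares_L1_tendsto)
    show "AE x in lborel. (\<lambda>n. ?v n x) \<longlonglongrightarrow> w x t"
      using u_deriv[of t] by (rule eventually_mono) (rule V_tendsto)
  qed (use v_le in auto)
  have iv: "integrable lborel (\<lambda>x. (?v n x)\<^sup>2)" for n
  proof (rule integrableI_nonneg)
    show "(\<integral>\<^sup>+x. ennreal ((?v n x)\<^sup>2) \<partial>lborel) < \<infinity>"
      using v_le[of n] unfolding w_sq_nn by (rule le_less_trans) simp
  qed auto
  have ik: "integrable lborel (\<lambda>x. \<kappa> (hh n) x t)" for n by (rule \<kappa>_integrable[OF hh(1)])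
  have ia: "integrable lborel (\<lambda>x. (?a n x)\<^sup>2)" "integrable lborel (\<lambda>x. (?b n x)\<^sup>2)" for n
    using difference_quotient_integrable[of 0 "hh n" t] difference_quotient_integrable[of "- hh n" 0 t] hh(1)[of n] by auto
  have Lk: "(LINT x|lborel. \<bar>\<kappa> (hh n) x t - (w x t)\<^sup>2\<bar>) \<le> 2 * (LINT x|lborel. \<bar>(?v n x)\<^sup>2 - (w x t)\<^sup>2\<bar>)" for n
  proof -
    have "(LINT x|lborel. \<bar>\<kappa> (hh n) x t - (w x t)\<^sup>2\<bar>)
       \<le> (LINT x|lborel. (\<kappa> (hh n) x t - (?v n x)\<^sup>2) + \<bar>(?v n x)\<^sup>2 - (w x t)\<^sup>2\<bar>)"
    proof (rule integral_mono)
      show "\<bar>\<kappa> (hh n) x t - (w x t)\<^sup>2\<bar> \<le> (\<kappa> (hh n) x t - (?v n x)\<^sup>2) + \<bar>(?v n x)\<^sup>2 - (w x t)\<^sup>2\<bar>" for x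
        using V_le_\<kappa>[OF hh(1), of n x t] by linarith
    qed (use iv ik w_sq in auto)
    also have "\<dots> = (LINT x|lborel. \<kappa> (hh n) x t) - (LINT x|lborel. (?v n x)\<^sup>2) + (LINT x|lborel. \<bar>(?v n x)\<^sup>2 - (w x t)\<^sup>2\<bar>)"
      using iv ik w_sq by simp
    also have "(LINT x|lborel. \<kappa> (hh n) x t) - (LINT x|lborel. (?v n x)\<^sup>2) = (LINT x|lborel. (w x t)\<^sup>2 - (?v n x)\<^sup>2)"
      using iv w_sq \<kappa>_integral[OF hh(1)] by simp
    also have "\<dots> \<le> (LINT x|lborel. \<bar>(?v n x)\<^sup>2 - (w x t)\<^sup>2\<bar>)"
      by (rule integral_mono) (use iv w_sq in auto)
    finally show ?thesis by simp
  qed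
  have bound: "(LINT x|lborel. \<bar>G (hh n) x t + 1/2 * (w x t)\<^sup>2\<bar>) \<le> 1/2 * (LINT x|lborel. \<bar>(?a n x)\<^sup>2 - (w x t)\<^sup>2\<bar>)
      + 1/2 * (LINT x|lborel. \<bar>(?b n x)\<^sup>2 - (w x t)\<^sup>2\<bar>) + (LINT x|lborel. \<bar>(?v n x)\<^sup>2 - (w x t)\<^sup>2\<bar>)" for n
  proof -
    have "(LINT x|lborel. \<bar>G (hh n) x t + 1/2 * (w x t)\<^sup>2\<bar>) \<le> (LINT x|lborel. 1/2 * \<bar>(?a n x)\<^sup>2 - (w x t)\<^sup>2\<bar>
       + 1/2 * \<bar>(?b n x)\<^sup>2 - (w x t)\<^sup>2\<bar> + 1/2 * \<bar>\<kappa> (hh n) x t - (w x t)\<^sup>2\<bar>)"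
    proof (rule integral_mono)
      show "integrable lborel (\<lambda>x. \<bar>G (hh n) x t + 1/2 * (w x t)\<^sup>2\<bar>)"
        using G_L1_bound(1)[OF hh(1), of n t] w_sq by simp
      show "\<bar>G (hh n) x t + 1/2 * (w x t)\<^sup>2\<bar> \<le> 1/2 * \<bar>(?a n x)\<^sup>2 - (w x t)\<^sup>2\<bar>
       + 1/2 * \<bar>(?b n x)\<^sup>2 - (w x t)\<^sup>2\<bar> + 1/2 * \<bar>\<kappa> (hh n) x t - (w x t)\<^sup>2\<bar>" for x
      proof -
        have "\<bar>1/2 * K - 1/2 * (X + Y) + 1/2 * W\<bar> \<le> 1/2 * \<bar>X - W\<bar> + 1/2 * \<bar>Y - W\<bar> + 1/2 * \<bar>K - W\<bar>"
          for X Y K W :: real by argo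
        then show ?thesis unfolding G_def by blast
      qed
    qed (use ia ik w_sq in auto)
    also have "\<dots> = 1/2 * (LINT x|lborel. \<bar>(?a n x)\<^sup>2 - (w x t)\<^sup>2\<bar>)
      + 1/2 * (LINT x|lborel. \<bar>(?b n x)\<^sup>2 - (w x t)\<^sup>2\<bar>) + 1/2 * (LINT x|lborel. \<bar>\<kappa> (hh n) x t - (w x t)\<^sup>2\<bar>)"
      using ia ik w_sq by simp
    finally show ?thesis using Lk[of n] by argo
  qed
  have "(\<lambda>n. 1/2 * (LINT x|lborel. \<bar>(?a n x)\<^sup>2 - (w x t)\<^sup>2\<bar>)
      + 1/2 * (LINT x|lborel. \<bar>(?b n x)\<^sup>2 - (w x t)\<^sup>2\<bar>) + (LINT x|lborel. \<bar>(?v n x)\<^sup>2 - (w x t)\<^sup>2\<bar>))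
      \<longlonglongrightarrow> 1/2 * 0 + 1/2 * 0 + 0"
    by (intro tendsto_intros La Lb Lv)
  then have "(\<lambda>n. 1/2 * (LINT x|lborel. \<bar>(?a n x)\<^sup>2 - (w x t)\<^sup>2\<bar>)
      + 1/2 * (LINT x|lborel. \<bar>(?b n x)\<^sup>2 - (w x t)\<^sup>2\<bar>) + (LINT x|lborel. \<bar>(?v n x)\<^sup>2 - (w x t)\<^sup>2\<bar>))
      \<longlonglongrightarrow> 0" by simp
  with tendsto_const show ?thesis
  proof (rule real_tendsto_sandwich[rotated 2])
    show "\<forall>\<^sub>F n in sequentially. 0 \<le> (LINT x|lborel. \<bar>G (hh n) x t + 1/2 * (w x t)\<^sup>2\<bar>)" by simp
  qed (use bound in \<open>simp only: eventually_sequentially, blast\<close>)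
qed

end

section \<open>Integration on intervals and a chain rule for integrals\<close>

lemma set_integral_split:
  fixes f :: "real \<Rightarrow> real"
  assumes "a \<le> b" "b \<le> c" "set_integrable lborel {a..c} f"
  shows "(LINT x:{a..c}|lborel. f x) = (LINT x:{a..b}|lborel. f x) + (LINT x:{b..c}|lborel. f x)"
proof -
  have i: "set_integrable lborel {a..b} f" "set_integrable lborel {b..c} f"
    by (rule set_integrable_subset[OF assms(3)]; use assms in auto)+
  have "integral {a..b} f + integral {b..c} f = integral {a..c} f"
    by (rule Henstock_Kurzweil_Integration.integral_combine)
      (use assms set_borel_integral_eq_integral(1)[OF assms(3)] in auto)
  then show ?thesis
    using set_borel_integral_eq_integral(2)[OF assms(3)] set_borel_integral_eq_integral(2)[OF i(1)]
      set_borel_integral_eq_integral(2)[OF i(2)] by simp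
qed

lemma set_integral_bound_Icc:
  fixes f :: "real \<Rightarrow> real"
  assumes "a \<le> b" "set_integrable lborel {a..b} f" "\<And>x. x \<in> {a..b} \<Longrightarrow> \<bar>f x\<bar> \<le> C"
  shows "\<bar>LINT x:{a..b}|lborel. f x\<bar> \<le> C * (b - a)"
proof -
  have "\<bar>LINT x:{a..b}|lborel. f x\<bar> \<le> (LINT x:{a..b}|lborel. \<bar>f x\<bar>)"
    unfolding set_lebesgue_integral_def
    by (rule order_trans[OF integral_abs_bound]) (simp add: abs_mult)
  also have "\<dots> \<le> (LINT x:{a..b}|lborel. C)"
    by (rule set_integral_mono)
      (use assms set_integrable_abs[OF assms(2)] in \<open>auto simp: set_integrable_def emeasure_lborel_Icc_eq\<close>)
  also have "\<dots> = C * (b - a)" using assms(1) by (simp add: set_lebesgue_integral_def)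
  finally show ?thesis .
qed

lemma set_integrable_bounded_Icc:
  fixes f :: "real \<Rightarrow> real"
  assumes "f \<in> borel_measurable borel" "\<And>x. x \<in> {a..b} \<Longrightarrow> \<bar>f x\<bar> \<le> C"
  shows "set_integrable lborel {a..b} f"
  unfolding set_integrable_def
proof (rule integrable_bounded_support[of _ a b C])
  show "(\<lambda>x. indicator {a..b} x *\<^sub>R f x) \<in> borel_measurable borel" using assms(1) by measurable
qed (use assms(2) in auto)

text \<open>An increment that agrees with an integral to first order, uniformly, is that integral:
  the difference has derivative zero everywhere.\<close>

lemma increment_eq_integral:
  fixes Z \<gamma> :: "real \<Rightarrow> real"
  assumes "a \<le> b" and int: "set_integrable lborel {a..b} \<gamma>"
    and inc: "\<And>e. e > 0 \<Longrightarrow> \<exists>d>0. \<forall>t t'. a \<le> t \<longrightarrow> t \<le> t' \<longrightarrow> t' \<le> b \<longrightarrow> t' - t < d \<longrightarrow>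
        \<bar>Z t' - Z t - (LINT s:{t..t'}|lborel. \<gamma> s)\<bar> \<le> e * (t' - t)"
  shows "Z b - Z a = (LINT s:{a..b}|lborel. \<gamma> s)"
proof -
  define W where "W t = Z t - (LINT s:{a..t}|lborel. \<gamma> s)" for t
  have W_diff: "W t' - W t = Z t' - Z t - (LINT s:{t..t'}|lborel. \<gamma> s)" if "a \<le> t" "t \<le> t'" "t' \<le> b" for t t'
    using set_integral_split[OF that(1,2) set_integrable_subset[OF int]] that by (simp add: W_def)
  have "(W has_field_derivative 0) (at x within {a..b})" if x: "x \<in> {a..b}" for x
    unfolding has_field_derivative_def has_derivative_within_alt
  proof (intro conjI allI impI)
    fix e :: real assume "e > 0"
    obtain d where "d > 0" and d: "\<And>t t'. a \<le> t \<Longrightarrow> t \<le> t' \<Longrightarrow> t' \<le> b \<Longrightarrow> t' - t < d \<Longrightarrow>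
        \<bar>Z t' - Z t - (LINT s:{t..t'}|lborel. \<gamma> s)\<bar> \<le> e * (t' - t)"
      using inc[OF \<open>e > 0\<close>] by blast
    show "\<exists>d>0. \<forall>y\<in>{a..b}. norm (y - x) < d \<longrightarrow> norm (W y - W x - 0 * (y - x)) \<le> e * norm (y - x)"
    proof (intro exI conjI ballI impI)
      fix y assume y: "y \<in> {a..b}" "norm (y - x) < d"
      show "norm (W y - W x - 0 * (y - x)) \<le> e * norm (y - x)"
      proof (cases "x \<le> y")
        case True
        then show ?thesis using d[of x y] W_diff[of x y] x y by simp
      next
        case False
        then show ?thesis using d[of y x] W_diff[of y x] x y
          by (simp add: abs_minus_commute[of "W y" "W x"])
      qed
    qed (rule \<open>d > 0\<close>)
  qed (rule bounded_linear_mult_right)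
  then obtain c where "\<And>x. x \<in> {a..b} \<Longrightarrow> W x = c"
    using has_field_derivative_zero_constant[of "{a..b}" W] by auto
  then have "W b = W a" using \<open>a \<le> b\<close> by simp
  moreover have "(LINT s:{a..a}|lborel. \<gamma> s) = 0"
    using set_integral_split[of a a b \<gamma>] assms by simp
  ultimately show ?thesis unfolding W_def by simp
qed

text \<open>\<open>f\<close> is the integral of a bounded function and may fail to be differentiable
  at a given time. The mean value theorem is applied to \<open>H\<close> separately in y and in s,
  and uniform continuity of \<open>Hy\<close> and \<open>Ht\<close> on a compact box makes the
  resulting increment correct to first order.\<close>

lemma chain_rule_integral:
  fixes f g :: "real \<Rightarrow> real" and H Hy Ht :: "real \<Rightarrow> real \<Rightarrow> real"
  assumes "a \<le> b" and f_cont: "continuous_on UNIV f"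
    and f_inc: "\<And>t t'. a \<le> t \<Longrightarrow> t \<le> t' \<Longrightarrow> t' \<le> b \<Longrightarrow> f t' - f t = (LINT s:{t..t'}|lborel. g s)"
    and g [measurable]: "g \<in> borel_measurable borel" and gC: "\<And>s. s \<in> {a..b} \<Longrightarrow> \<bar>g s\<bar> \<le> C"
    and Hy: "\<And>y s. s \<in> {a..b} \<Longrightarrow> ((\<lambda>y. H y s) has_real_derivative Hy y s) (at y)"
    and Ht: "\<And>y s. s \<in> {a..b} \<Longrightarrow> ((\<lambda>s. H y s) has_real_derivative Ht y s) (at s within {a..b})"
    and Hy_cont: "continuous_on UNIV (\<lambda>p. Hy (fst p) (snd p))"
    and Ht_cont: "continuous_on UNIV (\<lambda>p. Ht (fst p) (snd p))"
  shows "H (f b) b - H (f a) a = (LINT s:{a..b}|lborel. Hy (f s) s * g s + Ht (f s) s)"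
proof (rule increment_eq_integral[OF \<open>a \<le> b\<close>])
  have C: "0 \<le> C" using gC[of a] \<open>a \<le> b\<close> by auto
  have gi: "set_integrable lborel {t..t'} g" if "a \<le> t" "t' \<le> b" for t t'
    by (rule set_integrable_bounded_Icc[of _ _ _ C]) (use gC that in auto)
  have lip: "\<bar>f t' - f t\<bar> \<le> C * (t' - t)" if "a \<le> t" "t \<le> t'" "t' \<le> b" for t t'
    unfolding f_inc[OF that] using that by (intro set_integral_bound_Icc gi gC) auto
  have hyc: "continuous_on UNIV (\<lambda>s. Hy (f s) s)" and htc: "continuous_on UNIV (\<lambda>s. Ht (f s) s)"
    by (intro continuous_on_pair_slice[OF Hy_cont] continuous_on_pair_slice[OF Ht_cont] f_cont continuous_on_id)+
  have [measurable]: "(\<lambda>s. Hy (f s) s) \<in> borel_measurable borel" "(\<lambda>s. Ht (f s) s) \<in> borel_measurable borel"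
    using hyc htc by (auto intro: borel_measurable_continuous_onI)
  obtain D where D: "\<And>s. s \<in> {a..b} \<Longrightarrow> \<bar>Hy (f s) s\<bar> \<le> D" "\<And>s. s \<in> {a..b} \<Longrightarrow> \<bar>Ht (f s) s\<bar> \<le> D"
  proof -
    have "bounded ((\<lambda>s. Hy (f s) s) ` {a..b})" "bounded ((\<lambda>s. Ht (f s) s) ` {a..b})"
      by (intro compact_imp_bounded compact_continuous_image continuous_on_subset[OF hyc] continuous_on_subset[OF htc]; simp)+
    then obtain D1 D2 where "\<forall>s\<in>{a..b}. \<bar>Hy (f s) s\<bar> \<le> D1" "\<forall>s\<in>{a..b}. \<bar>Ht (f s) s\<bar> \<le> D2"
      unfolding bounded_iff by auto
    then show thesis by (intro that[of "max D1 D2"]) (auto simp: le_max_iff_disj)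
  qed
  show int: "set_integrable lborel {a..b} (\<lambda>s. Hy (f s) s * g s + Ht (f s) s)"
  proof (rule set_integrable_bounded_Icc[of _ _ _ "D * C + D"])
    fix s assume s: "s \<in> {a..b}"
    have "\<bar>Hy (f s) s * g s\<bar> \<le> D * C"
      unfolding abs_mult using D(1)[OF s] gC[OF s] C by (intro mult_mono) auto
    then show "\<bar>Hy (f s) s * g s + Ht (f s) s\<bar> \<le> D * C + D" using D(2)[OF s] by linarith
  qed measurable
  fix e :: real assume "e > 0"
  \<comment> \<open>One e' pays for the error in \<open>Ht\<close>, and C times e' for the error in
    \<open>Hy\<close>, which is multiplied by |g| <= C.\<close>
  define e' where "e' = e / (C + 1)"
  have "e' * (C + 1) = e" using C by (simp add: e'_def)
  then have e': "e' > 0" "e' * C + e' = e"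
    using C \<open>e > 0\<close> by (simp_all add: e'_def distrib_left)
  define B where "B = \<bar>f a\<bar> + C * (b - a)"
  have fB: "\<bar>f s\<bar> \<le> B" if "s \<in> {a..b}" for s
  proof -
    have "C * (s - a) \<le> C * (b - a)" using that C by (intro mult_left_mono) auto
    then show ?thesis using lip[of a s] that unfolding B_def by auto
  qed
  define K where "K = {-B..B} \<times> {a..b}"
  have "compact K" unfolding K_def by (intro compact_Times) auto
  then have "uniformly_continuous_on K (\<lambda>p. Hy (fst p) (snd p))" "uniformly_continuous_on K (\<lambda>p. Ht (fst p) (snd p))"
    by (intro compact_uniformly_continuous continuous_on_subset[OF Hy_cont] continuous_on_subset[OF Ht_cont]; simp)+
  then obtain d1 d2 where d1: "d1 > 0" "\<And>p q. p \<in> K \<Longrightarrow> q \<in> K \<Longrightarrow> dist q p < d1 \<Longrightarrow> dist (Hy (fst q) (snd q)) (Hy (fst p) (snd p)) < e'"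
    and d2: "d2 > 0" "\<And>p q. p \<in> K \<Longrightarrow> q \<in> K \<Longrightarrow> dist q p < d2 \<Longrightarrow> dist (Ht (fst q) (snd q)) (Ht (fst p) (snd p)) < e'"
    unfolding uniformly_continuous_on_def using e'(1) by metis
  \<comment> \<open>On a time interval of length l the mean value point between f t and f t' lies
    within 2 C l of every f s, and times differ by at most l; hence the factor 2 C + 2.\<close>
  define d where "d = min d1 d2 / (2 * C + 2)"
  have "d > 0" using d1 d2 C by (simp add: d_def)
  have close: "\<bar>Hy y s - Hy y' s'\<bar> \<le> e'" "\<bar>Ht y s - Ht y' s'\<bar> \<le> e'"
    if "y \<in> {-B..B}" "y' \<in> {-B..B}" "s \<in> {a..b}" "s' \<in> {a..b}" "\<bar>y - y'\<bar> \<le> 2 * C * l" "\<bar>s - s'\<bar> \<le> l" "l < d" for y y' s s' l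
  proof -
    have "dist (y, s) (y', s') \<le> \<bar>y - y'\<bar> + \<bar>s - s'\<bar>"
      unfolding dist_prod_def by (rule order_trans[OF sqrt_sum_squares_le_sum_abs]) (simp add: dist_real_def)
    also have "\<dots> \<le> (2 * C + 1) * l" using that by (simp add: algebra_simps)
    also have "\<dots> \<le> (2 * C + 2) * l" using that C by (intro mult_right_mono) auto
    also have "\<dots> < (2 * C + 2) * d" using that C by (intro mult_strict_left_mono) auto
    also have "\<dots> = min d1 d2" using C by (simp add: d_def)
    finally have "dist (y, s) (y', s') < d1" "dist (y, s) (y', s') < d2" by auto
    then show "\<bar>Hy y s - Hy y' s'\<bar> \<le> e'" "\<bar>Ht y s - Ht y' s'\<bar> \<le> e'"
      using d1(2)[of "(y', s')" "(y, s)"] d2(2)[of "(y', s')" "(y, s)"] that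
      by (auto simp: K_def dist_real_def)
  qed
  show "\<exists>d>0. \<forall>t t'. a \<le> t \<longrightarrow> t \<le> t' \<longrightarrow> t' \<le> b \<longrightarrow> t' - t < d \<longrightarrow>
    \<bar>H (f t') t' - H (f t) t - (LINT s:{t..t'}|lborel. Hy (f s) s * g s + Ht (f s) s)\<bar> \<le> e * (t' - t)"
  proof (intro exI[of _ d] conjI allI impI)
    fix t t' assume t: "a \<le> t" "t \<le> t'" "t' \<le> b" "t' - t < d"
    obtain \<xi> where \<xi>: "\<bar>\<xi> - f t\<bar> \<le> \<bar>f t' - f t\<bar>" "\<xi> \<in> {-B..B}" "H (f t') t' - H (f t) t' = Hy \<xi> t' * (f t' - f t)"
    proof -
      have ft: "f t \<in> {-B..B}" "f t' \<in> {-B..B}" using fB[of t] fB[of t'] t by (auto simp: abs_le_iff)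
      have mv: "\<exists>z. p < z \<and> z < q \<and> H q t' - H p t' = (q - p) * Hy z t'" if "p < q" for p q
        by (rule MVT2[OF that]) (use Hy[of t'] t in auto)
      consider "f t = f t'" | "f t < f t'" | "f t' < f t" by linarith
      then show thesis
      proof cases
        case 1 then show thesis using that[of "f t"] ft by simp
      next
        case 2 then obtain z where "f t < z" "z < f t'" "H (f t') t' - H (f t) t' = (f t' - f t) * Hy z t'" using mv by blast
        then show thesis using that[of z] ft by (simp add: mult.commute)
      next
        case 3 then obtain z where "f t' < z" "z < f t" "H (f t) t' - H (f t') t' = (f t - f t') * Hy z t'" using mv by blast
        then show thesis using that[of z] ft by (simp add: algebra_simps)
      qed
    qed
    obtain \<tau> where \<tau>: "\<tau> \<in> {t..t'}" "H (f t) t' - H (f t) t = Ht (f t) \<tau> * (t' - t)"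
    proof (cases "t = t'")
      case True then show thesis using that[of t] by simp
    next
      case False
      then have "t < t'" using t by simp
      moreover have "((\<lambda>s. H (f t) s) has_derivative (\<lambda>h. Ht (f t) x * h)) (at x within {t..t'})" if "x \<in> {t..t'}" for x
        using DERIV_subset[OF Ht[of x "f t"], of "{t..t'}"] that t by (auto simp: has_field_derivative_def)
      ultimately have "\<exists>x\<in>{t<..<t'}. H (f t) t' - H (f t) t = Ht (f t) x * (t' - t)"
        by (intro mvt_simple[of t t' "\<lambda>s. H (f t) s" "\<lambda>x h. Ht (f t) x * h"]) auto
      then obtain x where "x \<in> {t<..<t'}" "H (f t) t' - H (f t) t = Ht (f t) x * (t' - t)" by blast
      then show thesis using that[of x] by auto
    qed
    have i0: "set_integrable lborel {t..t'} (\<lambda>s. Hy \<xi> t' * g s)"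
      using gi[OF t(1,3)] by (intro set_integrable_mult_right)
    have ic: "set_integrable lborel {t..t'} (\<lambda>s. Ht (f t) \<tau>)"
      by (simp add: set_integrable_def emeasure_lborel_Icc_eq)
    have i1: "set_integrable lborel {t..t'} (\<lambda>s. Hy \<xi> t' * g s + Ht (f t) \<tau>)"
      by (rule set_integral_add(1)[OF i0 ic])
    have i2: "set_integrable lborel {t..t'} (\<lambda>s. Hy (f s) s * g s + Ht (f s) s)"
      by (rule set_integrable_subset[OF int]) (use t in auto)
    have "H (f t') t' - H (f t) t = Hy \<xi> t' * (LINT s:{t..t'}|lborel. g s) + Ht (f t) \<tau> * (t' - t)"
      using \<xi>(3) \<tau>(2) f_inc[OF t(1-3)] by simp
    also have "\<dots> = (LINT s:{t..t'}|lborel. Hy \<xi> t' * g s + Ht (f t) \<tau>)"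
      unfolding set_integral_add(2)[OF i0 ic] using t by (simp add: set_lebesgue_integral_def mult.commute)
    finally have "H (f t') t' - H (f t) t - (LINT s:{t..t'}|lborel. Hy (f s) s * g s + Ht (f s) s)
      = (LINT s:{t..t'}|lborel. (Hy \<xi> t' * g s + Ht (f t) \<tau>) - (Hy (f s) s * g s + Ht (f s) s))"
      using i1 i2 by (simp only: set_integral_diff)
    also have "\<bar>\<dots>\<bar> \<le> (e' * C + e') * (t' - t)"
    proof (rule set_integral_bound_Icc[OF t(2) set_integral_diff(1)[OF i1 i2]])
      fix s assume s: "s \<in> {t..t'}"
      have l1: "\<bar>f t - f s\<bar> \<le> C * (t' - t)"
      proof -
        have "C * (s - t) \<le> C * (t' - t)" using s C by (intro mult_left_mono) auto
        then show ?thesis using lip[of t s] s t by (simp add: abs_minus_commute)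
      qed
      have fs: "f s \<in> {-B..B}" "f t \<in> {-B..B}" using fB[of s] fB[of t] s t by (auto simp: abs_le_iff)
      have "\<bar>\<xi> - f s\<bar> \<le> 2 * C * (t' - t)" using l1 \<xi>(1) lip[OF t(1-3)] by linarith
      then have "\<bar>Hy \<xi> t' - Hy (f s) s\<bar> \<le> e'"
        using s t fs \<xi>(2) by (intro close(1)[of _ _ _ _ "t' - t"]) auto
      moreover have "0 \<le> C * (t' - t)" using C t by simp
      then have "\<bar>f t - f s\<bar> \<le> 2 * C * (t' - t)" using l1 by linarith
      then have "\<bar>Ht (f t) \<tau> - Ht (f s) s\<bar> \<le> e'"
        using s t fs \<tau>(1) by (intro close(2)[of _ _ _ _ "t' - t"]) auto
      moreover have "\<bar>g s\<bar> \<le> C" using gC[of s] s t by simp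
      ultimately have "\<bar>Hy \<xi> t' - Hy (f s) s\<bar> * \<bar>g s\<bar> \<le> e' * C" "\<bar>Ht (f t) \<tau> - Ht (f s) s\<bar> \<le> e'"
        using e'(1) by (auto intro: mult_mono)
      then have "\<bar>(Hy \<xi> t' - Hy (f s) s) * g s\<bar> \<le> e' * C" "\<bar>Ht (f t) \<tau> - Ht (f s) s\<bar> \<le> e'"
        by (simp_all only: abs_mult)
      then show "\<bar>(Hy \<xi> t' * g s + Ht (f t) \<tau>) - (Hy (f s) s * g s + Ht (f s) s)\<bar> \<le> e' * C + e'"
        by (simp add: left_diff_distrib abs_le_iff)
    qed
    finally show "\<bar>H (f t') t' - H (f t) t - (LINT s:{t..t'}|lborel. Hy (f s) s * g s + Ht (f s) s)\<bar> \<le> e * (t' - t)"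
      using e'(2) by simp
  qed (rule \<open>d > 0\<close>)
qed

section \<open>Time derivative of the Steklov averages\<close>

context hs_base
begin

text \<open>The source acts on V through its mean to the right of x minus its mean to the left; this
  identifies that contribution as half of \<open>\<kappa>\<close>.\<close>

lemma F_shift_integral:
  assumes "h > 0"
  shows "(LINT y:{x..x+h}|lborel. F y t) - (LINT y:{x-h..x}|lborel. F y t) = 1/2 * \<kappa> h x t * h\<^sup>2"
proof -
  define PF where "PF x = (LBINT y=ereal 0..ereal x. F y t)" for x
  have D: "(PF has_real_derivative F x t) (at x)" for x
    unfolding PF_def by (rule primitive_DERIV[OF F_continuous])
  have 1: "(LINT y:{a..b}|lborel. F y t) = PF b - PF a" if "a \<le> b" for a b
    by (rule FTC_continuous[OF D F_continuous that])
  have "(LINT k:{0..h}|lborel. 2 * (F (x + k) t - F (x - k) t)) = 2 * (PF (x + h) + PF (x - h)) - 2 * (PF (x + 0) + PF (x - 0))"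
    by (rule FTC_continuous[where p = "\<lambda>k. 2 * (PF (x + k) + PF (x - k))"])
      (use assms in \<open>auto intro!: derivative_eq_intros DERIV_chain2[OF D] F_continuous' continuous_intros\<close>)
  then show ?thesis using assms by (simp add: 1 \<kappa>_def)
qed

lemma \<kappa>_le: assumes "h > 0" shows "\<kappa> h x t \<le> M / h"
proof -
  have "\<bar>LINT k:{0..h}|lborel. 2 * (F (x + k) t - F (x - k) t)\<bar> \<le> M * (h - 0)"
  proof (rule set_integral_bound_Icc)
    show "\<bar>2 * (F (x + k) t - F (x - k) t)\<bar> \<le> M" for k
      using F_nonneg[of "x + k" t] F_nonneg[of "x - k" t] F_le[of "x + k" t] F_le[of "x - k" t] by (simp add: abs_le_iff)
  qed (use assms set_integral_continuous_HK(2)[OF F_shift_continuous] in auto)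
  then have "\<kappa> h x t \<le> M * h / h\<^sup>2" using assms unfolding \<kappa>_def by (intro divide_right_mono) auto
  then show ?thesis using assms by (simp add: power2_eq_square)
qed

text \<open>By \<open>V_DERIV\<close> the first term is - u times the x-derivative of V.\<close>

definition V_rate where
  "V_rate h x s = - u x s * ((u (x + h) s - 2 * u x s + u (x - h) s) / h\<^sup>2) + G h x s"

lemma V_rate_meas [measurable]: "case_prod (V_rate h) \<in> borel_measurable (borel \<Otimes>\<^sub>M borel)"
  unfolding V_rate_def by measurable

lemma V_rate_bounded:
  assumes "h > 0"
  obtains C where "C \<ge> 0" "\<And>x s. x \<in> {a..b} \<Longrightarrow> s \<in> {c..d} \<Longrightarrow> \<bar>V_rate h x s\<bar> \<le> C"
    "\<And>x s. x \<in> {a..b} \<Longrightarrow> s \<in> {c..d} \<Longrightarrow> \<bar>G h x s\<bar> \<le> C"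
proof -
  let ?f = "\<lambda>x s. 1/2 * (((u (x + h) s - u x s) / h)\<^sup>2 + ((u x s - u (x - h) s) / h)\<^sup>2)"
  let ?g = "\<lambda>x s. u x s * ((u (x + h) s - 2 * u x s + u (x - h) s) / h\<^sup>2)"
  obtain C1 where C1: "C1 \<ge> 0" "\<And>x s. x \<in> {a..b} \<Longrightarrow> s \<in> {c..d} \<Longrightarrow> \<bar>?f x s\<bar> \<le> C1"
    by (rule continuous_bounded_box[of ?f a b c d])
      (use assms in \<open>auto intro!: continuous_intros u_continuous\<close>)
  obtain C2 where C2: "C2 \<ge> 0" "\<And>x s. x \<in> {a..b} \<Longrightarrow> s \<in> {c..d} \<Longrightarrow> \<bar>?g x s\<bar> \<le> C2"
    by (rule continuous_bounded_box[of ?g a b c d])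
      (use assms in \<open>auto intro!: continuous_intros u_continuous\<close>)
  have k: "\<bar>1/2 * \<kappa> h x s\<bar> \<le> M / h" for x s
    using \<kappa>_nonneg[OF assms, of x s] \<kappa>_le[OF assms, of x s] by linarith
  show thesis
  proof (rule that[of "C1 + C2 + M / h"])
    show "0 \<le> C1 + C2 + M / h" using C1 C2 M_nonneg assms by simp
    fix x s assume xs: "x \<in> {a..b}" "s \<in> {c..d}"
    show "\<bar>G h x s\<bar> \<le> C1 + C2 + M / h" "\<bar>V_rate h x s\<bar> \<le> C1 + C2 + M / h"
      using C1(2)[OF xs] C2(2)[OF xs] k[of x s] C2(1) unfolding G_def V_rate_def by linarith+
  qed
qed

end

context hs_base
begin

definition mean_rate where
  "mean_rate a b s = 1/2 * (u a s)\<^sup>2 - 1/2 * (u b s)\<^sup>2 + (LINT x:{a..b}|lborel. F x s)"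

lemma mean_rate_meas [measurable]: "mean_rate a b \<in> borel_measurable borel"
  unfolding mean_rate_def set_lebesgue_integral_def by measurable

lemma mean_rate_integrable:
  assumes "a \<le> b" shows "set_integrable lborel {c..d} (mean_rate a b)"
proof -
  obtain B where B: "B \<ge> 0" "\<And>y s. y \<in> {a..b} \<Longrightarrow> s \<in> {c..d} \<Longrightarrow> \<bar>u y s\<bar> \<le> B"
    using continuous_bounded_box[OF u_cont] by metis
  show ?thesis
  proof (rule set_integrable_bounded_Icc[of _ _ _ "B\<^sup>2 + M/2 * (b - a)"])
    fix s assume s: "s \<in> {c..d}"
    have "(u a s)\<^sup>2 \<le> B\<^sup>2" "(u b s)\<^sup>2 \<le> B\<^sup>2"
      using power_mono[OF B(2)[of a s] abs_ge_zero, of 2] power_mono[OF B(2)[of b s] abs_ge_zero, of 2] s assms by auto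
    moreover have "\<bar>LINT y:{a..b}|lborel. F y s\<bar> \<le> M/2 * (b - a)"
      by (rule set_integral_bound_Icc)
        (use assms F_abs_le set_integral_continuous_HK(2)[OF F_continuous] in auto)
    moreover have "0 \<le> (u a s)\<^sup>2" "0 \<le> (u b s)\<^sup>2" by auto
    ultimately show "\<bar>mean_rate a b s\<bar> \<le> B\<^sup>2 + M/2 * (b - a)" unfolding mean_rate_def by linarith
  qed measurable
qed

end

context hs_flow
begin

lemma mean_increment:
  assumes "a < b" "0 \<le> t" "t \<le> t'"
  shows "(P b t' - P a t') - (P b t - P a t) = (LINT s:{t..t'}|lborel. mean_rate a b s)"
proof -
  have "(P b \<tau> - P a \<tau>) - (P b 0 - P a 0) = (LINT s:{0..\<tau>}|lborel. mean_rate a b s)" if "0 \<le> \<tau>" for \<tau>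
    using mean_evol[OF assms(1) that] assms(1) by (simp add: u_mean_P mean_rate_def)
  from this[of t] this[of t'] show ?thesis
    using set_integral_split[OF assms(2,3) mean_rate_integrable[of a b]] assms by simp
qed

text \<open>V h^2 is the integral of \<open>u\<close> over [x, x+h] minus the one over [x-h, x].
  With u, a, b the values at x, x+h, x-h, the fluxes add up to u^2 - a^2/2 - b^2/2 = - u (a - 2u +
  b) - ((a - u)^2 + (u - b)^2) / 2, which is the transport term together with the squares in
  \<open>G\<close>.\<close>

lemma V_increment:
  assumes h: "h > 0" and t: "0 \<le> t" "t \<le> t'"
  shows "V h x t' - V h x t = (LINT s:{t..t'}|lborel. V_rate h x s)"
proof -
  have "(V h x t' - V h x t) * h\<^sup>2 = (LINT s:{t..t'}|lborel. mean_rate x (x+h) s) - (LINT s:{t..t'}|lborel. mean_rate (x-h) x s)"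
  proof -
    have "V h x t * h\<^sup>2 = P (x + h) t - 2 * P x t + P (x - h) t" for t using h by (simp add: V_P)
    then show ?thesis
      using h mean_increment[OF _ t, of x "x+h"] mean_increment[OF _ t, of "x-h" x] by (simp add: left_diff_distrib)
  qed
  also have "\<dots> = (LINT s:{t..t'}|lborel. mean_rate x (x+h) s - mean_rate (x-h) x s)"
    using h by (intro set_integral_diff(2)[symmetric] mean_rate_integrable) auto
  also have "\<dots> = (LINT s:{t..t'}|lborel. V_rate h x s * h\<^sup>2)"
  proof (rule arg_cong[where f = "set_lebesgue_integral lborel {t..t'}"], rule ext)
    fix s
    have "mean_rate x (x+h) s - mean_rate (x-h) x s = (u x s)\<^sup>2 - 1/2 * (u (x+h) s)\<^sup>2 - 1/2 * (u (x-h) s)\<^sup>2 + 1/2 * \<kappa> h x s * h\<^sup>2"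
      using F_shift_integral[OF h, of x s] unfolding mean_rate_def by linarith
    also have "\<dots> = V_rate h x s * h\<^sup>2"
      using h by (simp add: V_rate_def G_def power_divide field_simps) (simp add: power2_eq_square algebra_simps)
    finally show "mean_rate x (x+h) s - mean_rate (x-h) x s = V_rate h x s * h\<^sup>2" .
  qed
  finally show ?thesis using h by simp
qed

end

section \<open>Renormalization\<close>

lemma integrable_pair_bounded_support:
  fixes f :: "real \<times> real \<Rightarrow> real"
  assumes "f \<in> borel_measurable (borel \<Otimes>\<^sub>M borel)"
    and "\<And>x s. x \<in> {a..b} \<Longrightarrow> s \<in> {c..d} \<Longrightarrow> \<bar>f (x, s)\<bar> \<le> C" "\<And>x s. \<not> (x \<in> {a..b} \<and> s \<in> {c..d}) \<Longrightarrow> f (x, s) = 0"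
  shows "integrable (lborel \<Otimes>\<^sub>M lborel) f"
proof (rule Bochner_Integration.integrable_bound[of _ "\<lambda>p. C * indicator ({a..b} \<times> {c..d}) p"])
  show "integrable (lborel \<Otimes>\<^sub>M lborel) (\<lambda>p. C * indicator ({a..b} \<times> {c..d}) p :: real)"
    by (intro integrable_mult_right integrable_real_indicator)
      (auto simp: lborel.emeasure_pair_measure_Times emeasure_lborel_Icc_eq ennreal_mult_less_top)
  have "norm (f p) \<le> norm (C * indicator ({a..b} \<times> {c..d}) p)" for p
    using assms(2)[of "fst p" "snd p"] assms(3)[of "fst p" "snd p"]
    by (cases "fst p \<in> {a..b} \<and> snd p \<in> {c..d}") (auto simp: mem_Times_iff)
  then show "AE p in lborel \<Otimes>\<^sub>M lborel. norm (f p) \<le> norm (C * indicator ({a..b} \<times> {c..d}) p :: real)" by simp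
  have "sets (lborel \<Otimes>\<^sub>M lborel) = sets (borel \<Otimes>\<^sub>M borel :: (real \<times> real) measure)"
    by (rule sets_pair_measure_cong) auto
  then show "f \<in> borel_measurable (lborel \<Otimes>\<^sub>M lborel)" using assms(1) by (simp cong: measurable_cong_sets)
qed

context hs_base
begin

lemma w_abs_set_le:
  assumes "a \<le> b" shows "(LINT x:{a..b}|lborel. \<bar>w x t\<bar>) \<le> (b - a) + M"
proof -
  have i: "set_integrable lborel {a..b} (\<lambda>x. 1 + (w x t)\<^sup>2)"
    using w_sq_set[of "{a..b}" t] by (intro set_integral_add) (auto simp: set_integrable_def emeasure_lborel_Icc_eq)
  have "\<bar>y\<bar> \<le> 1 + y\<^sup>2" for y :: real
    using zero_le_power2[of "\<bar>y\<bar> - 1/2"] by (simp add: power2_eq_square algebra_simps)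
  then have "(LINT x:{a..b}|lborel. \<bar>w x t\<bar>) \<le> (LINT x:{a..b}|lborel. 1 + (w x t)\<^sup>2)"
    by (intro set_integral_mono set_integrable_abs w_set i) auto
  also have "\<dots> = (LINT x:{a..b}|lborel. 1) + (LINT x:{a..b}|lborel. (w x t)\<^sup>2)"
    using w_sq_set[of "{a..b}" t] by (intro set_integral_add) (auto simp: set_integrable_def emeasure_lborel_Icc_eq)
  also have "(LINT x:{a..b}|lborel. (w x t)\<^sup>2) \<le> M"
    using w_sq_set_le[of "{a..b}" t] w_M[of t] by simp
  finally show ?thesis using assms by (simp add: set_lebesgue_integral_def)
qed

lemma w_times_integrable:
  assumes [measurable]: "f \<in> borel_measurable borel" and "\<And>x. x \<in> {a..b} \<Longrightarrow> \<bar>f x\<bar> \<le> C" "\<And>x. x \<notin> {a..b} \<Longrightarrow> f x = 0"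
  shows "integrable lborel (\<lambda>x. w x t * f x)"
proof (rule Bochner_Integration.integrable_bound[of _ "\<lambda>x. C * (indicator {a..b} x *\<^sub>R \<bar>w x t\<bar>)"])
  show "integrable lborel (\<lambda>x. C * (indicator {a..b} x *\<^sub>R \<bar>w x t\<bar>))"
    using set_integrable_abs[OF w_set] unfolding set_integrable_def by (intro integrable_mult_right)
  have "norm (w x t * f x) \<le> norm (C * (indicator {a..b} x *\<^sub>R \<bar>w x t\<bar>))" for x
  proof (cases "x \<in> {a..b}")
    case True
    have "\<bar>w x t\<bar> * \<bar>f x\<bar> \<le> \<bar>w x t\<bar> * C" using assms(2)[OF True] by (intro mult_left_mono) auto
    also have "\<dots> \<le> \<bar>w x t\<bar> * \<bar>C\<bar>" by (intro mult_left_mono) auto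
    finally show ?thesis using True by (simp add: abs_mult mult.commute)
  qed (use assms(3) in auto)
  then show "AE x in lborel. norm (w x t * f x) \<le> norm (C * (indicator {a..b} x *\<^sub>R \<bar>w x t\<bar>))" by simp
qed measurable

text \<open>The product rule is obtained from Fubini on a triangle: u(x) - u(L) is the integral of
  \<open>w\<close> over [L, x], and the order of integration is exchanged.\<close>

lemma integration_by_parts:
  assumes H: "\<And>x. (H has_real_derivative H' x) (at x)" and H'_cont: "continuous_on UNIV H'"
    and supp: "\<And>x. x \<notin> {-R..R} \<Longrightarrow> H x = 0" "\<And>x. x \<notin> {-R..R} \<Longrightarrow> H' x = 0"
  shows "(LINT x|lborel. w x t * H x + u x t * H' x) = 0"
    and "integrable lborel (\<lambda>x. w x t * H x + u x t * H' x)"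
proof -
  \<comment> \<open>One unit beyond the support, so that \<open>H\<close> and its derivative vanish
    at both ends; the absolute value gives L <= U for either sign of R.\<close>
  define L where "L = - \<bar>R\<bar> - 1"
  define U where "U = \<bar>R\<bar> + 1"
  have LU: "L \<le> U" by (simp add: L_def U_def)
  have sup: "H x = 0" "H' x = 0" if "x \<notin> {L<..<U}" for x
  proof -
    have "x \<notin> {-R..R}" using that by (auto simp: L_def U_def)
    then show "H x = 0" "H' x = 0" using supp by auto
  qed
  have HLU: "H L = 0" "H U = 0" using sup(1)[of L] sup(1)[of U] by auto
  have H_cont: "continuous_on UNIV H" using H by (intro continuous_at_imp_continuous_on ballI DERIV_isCont)
  have [measurable]: "H \<in> borel_measurable borel" "H' \<in> borel_measurable borel"
    using H_cont H'_cont by (auto intro: borel_measurable_continuous_onI)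
  obtain C where C: "C \<ge> 0" "\<And>x. x \<in> {L..U} \<Longrightarrow> \<bar>H x\<bar> \<le> C" "\<And>x. x \<in> {L..U} \<Longrightarrow> \<bar>H' x\<bar> \<le> C"
  proof -
    have "bounded (H ` {L..U})" "bounded (H' ` {L..U})"
      by (intro compact_imp_bounded compact_continuous_image continuous_on_subset[OF H_cont] continuous_on_subset[OF H'_cont]; simp)+
    then obtain D1 D2 where "\<forall>x\<in>{L..U}. \<bar>H x\<bar> \<le> D1" "\<forall>x\<in>{L..U}. \<bar>H' x\<bar> \<le> D2"
      unfolding bounded_iff by auto
    then show thesis by (intro that[of "max 0 (max D1 D2)"]) (auto simp: le_max_iff_disj)
  qed
  have i1: "integrable lborel (\<lambda>x. w x t * H x)"
    by (rule w_times_integrable[of _ L U C]) (use C sup in auto)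
  have i2: "integrable lborel (\<lambda>x. u x t * H' x)"
    by (rule integrable_continuous_support[of _ L U])
      (use sup H'_cont in \<open>auto intro!: continuous_intros u_continuous\<close>)
  show "integrable lborel (\<lambda>x. w x t * H x + u x t * H' x)" using i1 i2 by simp
  \<comment> \<open>Integrated in y the kernel gives (u(x) - u(L)) H'(x), integrated in x it gives -
    w(y) H(y).\<close>
  define f where "f x y = (if L \<le> y \<and> y \<le> x \<and> x \<le> U then w y t * H' x else 0)" for x y
  have f_meas [measurable]: "case_prod f \<in> borel_measurable (borel \<Otimes>\<^sub>M borel)" unfolding f_def by measurable
  have f_eq1: "f x y = indicator {L..x} y * w y t * (indicator {..U} x * H' x)" for x y
    unfolding f_def by (auto simp: indicator_def)
  have f_eq2: "f x y = indicator {L..U} y * w y t * (indicator {y..U} x * H' x)" for x y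
    unfolding f_def by (auto simp: indicator_def)
  have fi: "integrable lborel (f x)" for x
    unfolding f_eq1[abs_def]
    using w_set[of L x t] by (intro integrable_mult_left) (simp add: set_integrable_def)
  have fb: "(LINT y|lborel. \<bar>f x y\<bar>) \<le> C * ((U - L) + M)" for x
  proof -
    have "(LINT y|lborel. \<bar>f x y\<bar>) \<le> (LINT y|lborel. C * (indicator {L..U} y *\<^sub>R \<bar>w y t\<bar>))"
    proof (rule integral_mono)
      show "integrable lborel (\<lambda>y. \<bar>f x y\<bar>)" using fi by (rule integrable_abs)
      show "integrable lborel (\<lambda>y. C * (indicator {L..U} y *\<^sub>R \<bar>w y t\<bar>))"
        using set_integrable_abs[OF w_set] unfolding set_integrable_def by (intro integrable_mult_right)
      show "\<bar>f x y\<bar> \<le> C * (indicator {L..U} y *\<^sub>R \<bar>w y t\<bar>)" for y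
      proof (cases "L \<le> y \<and> y \<le> x \<and> x \<le> U")
        case True
        then have "\<bar>w y t\<bar> * \<bar>H' x\<bar> \<le> \<bar>w y t\<bar> * C" using C(3)[of x] by (intro mult_left_mono) auto
        then show ?thesis using True by (simp add: f_def abs_mult mult.commute)
      qed (use C in \<open>auto simp: f_def\<close>)
    qed
    also have "\<dots> = C * (LINT y:{L..U}|lborel. \<bar>w y t\<bar>)" by (simp add: set_lebesgue_integral_def)
    also have "\<dots> \<le> C * ((U - L) + M)" by (intro mult_left_mono w_abs_set_le C LU)
    finally show ?thesis .
  qed
  have "integrable (lborel \<Otimes>\<^sub>M lborel) (case_prod f)"
  proof (rule lborel_pair.Fubini_integrable)
    have "sets (lborel \<Otimes>\<^sub>M lborel) = sets (borel \<Otimes>\<^sub>M borel :: (real \<times> real) measure)"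
      by (rule sets_pair_measure_cong) auto
    then show "case_prod f \<in> borel_measurable (lborel \<Otimes>\<^sub>M lborel)" using f_meas by (simp cong: measurable_cong_sets)
    show "integrable lborel (\<lambda>x. LINT y|lborel. norm (case (x, y) of (x, y) \<Rightarrow> f x y))"
    proof (rule integrable_bounded_support[of _ L U "C * ((U - L) + M)"])
      show "\<bar>LINT y|lborel. norm (case (x, y) of (x, y) \<Rightarrow> f x y)\<bar> \<le> C * ((U - L) + M)" for x
        using fb[of x] by simp
      show "(LINT y|lborel. norm (case (x, y) of (x, y) \<Rightarrow> f x y)) = 0" if "x \<notin> {L..U}" for x
      proof -
        have "f x y = 0" for y using that by (auto simp: f_def)
        then show ?thesis by simp
      qed
    qed measurable
  qed (use fi in auto)
  then have swap: "(LINT y|lborel. LINT x|lborel. f x y) = (LINT x|lborel. LINT y|lborel. f x y)"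
    by (rule lborel_pair.Fubini_integral)
  have left: "(LINT x|lborel. f x y) = - (w y t * H y)" for y
  proof (cases "y \<in> {L..U}")
    case True
    have "(LINT x|lborel. indicator {y..U} x * H' x) = H U - H y"
      using FTC_continuous[OF H H'_cont, of y U] True by (simp add: set_lebesgue_integral_def)
    then show ?thesis using True HLU unfolding f_eq2 by simp
  next
    case False
    then have "f x y = 0" for x by (auto simp: f_def)
    then show ?thesis using sup(1)[of y] False by auto
  qed
  have right: "(LINT y|lborel. f x y) = u x t * H' x - u L t * H' x" for x
  proof (cases "x \<in> {L..U}")
    case True
    have "(LINT y|lborel. indicator {L..x} y * w y t) = u x t - u L t"
      using u_FTC[of L x t] True by (simp add: set_lebesgue_integral_def)
    then show ?thesis using True unfolding f_eq1 by (simp add: left_diff_distrib)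
  next
    case False
    then have "f x y = 0" for y by (auto simp: f_def)
    then show ?thesis using sup(2)[of x] False by auto
  qed
  have iH': "integrable lborel H'"
    by (rule integrable_continuous_support[of _ L U]) (use sup H'_cont in auto)
  have "(LINT x|lborel. H' x) = (LINT x:{L..U}|lborel. H' x)"
    unfolding set_lebesgue_integral_def
  proof (rule Bochner_Integration.integral_cong[OF refl])
    show "H' x = indicator {L..U} x *\<^sub>R H' x" for x using sup(2)[of x] by (cases "x \<in> {L..U}") auto
  qed
  also have "\<dots> = 0" using FTC_continuous[OF H H'_cont LU] HLU by simp
  finally have "(LINT x|lborel. u x t * H' x) = (LINT x|lborel. u x t * H' x - u L t * H' x)"
    using i2 iH' by simp
  also have "\<dots> = - (LINT y|lborel. w y t * H y)"
    using swap unfolding left right by simp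
  finally show "(LINT x|lborel. w x t * H x + u x t * H' x) = 0" using i1 i2 by simp
qed

end

section \<open>Renormalization with compactly supported test pairs\<close>

text \<open>\<beta> renormalizes the values of \<open>w\<close>, \<phi> localizes in space and time.
  The derivatives are parameters of their own, continuous on the plane but tied to \<beta> and
  \<phi> on [t1, t2] only, because the functions inserted later are frozen in time outside that
  interval. Compact supports keep every factor bounded except those that contain \<open>w\<close>
  itself or \<open>G\<close>.\<close>

locale test_pair = hs_flow +
  fixes t1 t2 R B :: real and \<beta> \<beta>w \<beta>s \<phi> \<phi>x \<phi>s :: "real \<Rightarrow> real \<Rightarrow> real"
  assumes t12: "0 \<le> t1" "t1 \<le> t2" and R: "0 \<le> R"
    and \<beta>_cont: "continuous_on UNIV (\<lambda>p. \<beta> (fst p) (snd p))"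
    and \<beta>w_cont: "continuous_on UNIV (\<lambda>p. \<beta>w (fst p) (snd p))"
    and \<beta>s_cont: "continuous_on UNIV (\<lambda>p. \<beta>s (fst p) (snd p))"
    and \<phi>_cont: "continuous_on UNIV (\<lambda>p. \<phi> (fst p) (snd p))"
    and \<phi>x_cont: "continuous_on UNIV (\<lambda>p. \<phi>x (fst p) (snd p))"
    and \<phi>s_cont: "continuous_on UNIV (\<lambda>p. \<phi>s (fst p) (snd p))"
    and \<beta>_Dw: "\<And>y s. s \<in> {t1..t2} \<Longrightarrow> ((\<lambda>y. \<beta> y s) has_real_derivative \<beta>w y s) (at y)"
    and \<beta>_Ds: "\<And>y s. s \<in> {t1..t2} \<Longrightarrow> ((\<lambda>s. \<beta> y s) has_real_derivative \<beta>s y s) (at s within {t1..t2})"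
    and \<phi>_Dx: "\<And>x s. s \<in> {t1..t2} \<Longrightarrow> ((\<lambda>x. \<phi> x s) has_real_derivative \<phi>x x s) (at x)"
    and \<phi>_Ds: "\<And>x s. s \<in> {t1..t2} \<Longrightarrow> ((\<lambda>s. \<phi> x s) has_real_derivative \<phi>s x s) (at s within {t1..t2})"
    and \<beta>_supp: "\<And>y s. y \<notin> {-B..B} \<Longrightarrow> \<beta> y s = 0 \<and> \<beta>w y s = 0 \<and> \<beta>s y s = 0"
    and \<phi>_supp: "\<And>x s. x \<notin> {-R..R} \<Longrightarrow> \<phi> x s = 0 \<and> \<phi>x x s = 0 \<and> \<phi>s x s = 0"
begin

lemma test_continuous:
  assumes "continuous_on S g" "continuous_on S k"
  shows "continuous_on S (\<lambda>z. \<beta> (g z) (k z))" "continuous_on S (\<lambda>z. \<beta>w (g z) (k z))"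
    "continuous_on S (\<lambda>z. \<beta>s (g z) (k z))" "continuous_on S (\<lambda>z. \<phi> (g z) (k z))"
    "continuous_on S (\<lambda>z. \<phi>x (g z) (k z))" "continuous_on S (\<lambda>z. \<phi>s (g z) (k z))"
  using assms continuous_on_pair_slice \<beta>_cont \<beta>w_cont \<beta>s_cont \<phi>_cont \<phi>x_cont \<phi>s_cont by blast+

lemma test_meas [measurable]:
  "case_prod \<beta> \<in> borel_measurable (borel \<Otimes>\<^sub>M borel)" "case_prod \<beta>w \<in> borel_measurable (borel \<Otimes>\<^sub>M borel)"
  "case_prod \<beta>s \<in> borel_measurable (borel \<Otimes>\<^sub>M borel)" "case_prod \<phi> \<in> borel_measurable (borel \<Otimes>\<^sub>M borel)"
  "case_prod \<phi>x \<in> borel_measurable (borel \<Otimes>\<^sub>M borel)" "case_prod \<phi>s \<in> borel_measurable (borel \<Otimes>\<^sub>M borel)"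
  using borel_measurable_continuous_onI[OF \<beta>_cont] borel_measurable_continuous_onI[OF \<beta>w_cont]
    borel_measurable_continuous_onI[OF \<beta>s_cont] borel_measurable_continuous_onI[OF \<phi>_cont]
    borel_measurable_continuous_onI[OF \<phi>x_cont] borel_measurable_continuous_onI[OF \<phi>s_cont]
  by (simp_all add: borel_prod case_prod_beta')

lemma test_bounded:
  obtains C where "C \<ge> 0" "\<And>y s. s \<in> {t1..t2} \<Longrightarrow> \<bar>\<beta> y s\<bar> \<le> C" "\<And>y s. s \<in> {t1..t2} \<Longrightarrow> \<bar>\<beta>w y s\<bar> \<le> C"
    "\<And>y s. s \<in> {t1..t2} \<Longrightarrow> \<bar>\<beta>s y s\<bar> \<le> C" "\<And>x s. s \<in> {t1..t2} \<Longrightarrow> \<bar>\<phi> x s\<bar> \<le> C"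
    "\<And>x s. s \<in> {t1..t2} \<Longrightarrow> \<bar>\<phi>x x s\<bar> \<le> C" "\<And>x s. s \<in> {t1..t2} \<Longrightarrow> \<bar>\<phi>s x s\<bar> \<le> C"
proof -
  have bd: "\<exists>D\<ge>0. \<forall>y s. s \<in> {t1..t2} \<longrightarrow> \<bar>f y s\<bar> \<le> D"
    if f: "continuous_on UNIV (\<lambda>p. f (fst p) (snd p))" and f0: "\<And>y s. y \<notin> {-K..K} \<Longrightarrow> f y s = 0" for f :: "real \<Rightarrow> real \<Rightarrow> real" and K
  proof -
    obtain D where "D \<ge> 0" "\<And>y s. y \<in> {-K..K} \<Longrightarrow> s \<in> {t1..t2} \<Longrightarrow> \<bar>f y s\<bar> \<le> D"
      using continuous_bounded_box[OF f] by metis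
    then show ?thesis using f0 by (metis abs_zero)
  qed
  obtain D1 where D1: "D1 \<ge> 0" "\<And>y s. s \<in> {t1..t2} \<Longrightarrow> \<bar>\<beta> y s\<bar> \<le> D1" using bd[OF \<beta>_cont] \<beta>_supp by metis
  obtain D2 where D2: "D2 \<ge> 0" "\<And>y s. s \<in> {t1..t2} \<Longrightarrow> \<bar>\<beta>w y s\<bar> \<le> D2" using bd[OF \<beta>w_cont] \<beta>_supp by metis
  obtain D3 where D3: "D3 \<ge> 0" "\<And>y s. s \<in> {t1..t2} \<Longrightarrow> \<bar>\<beta>s y s\<bar> \<le> D3" using bd[OF \<beta>s_cont] \<beta>_supp by metis
  obtain D4 where D4: "D4 \<ge> 0" "\<And>y s. s \<in> {t1..t2} \<Longrightarrow> \<bar>\<phi> y s\<bar> \<le> D4" using bd[OF \<phi>_cont] \<phi>_supp by metis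
  obtain D5 where D5: "D5 \<ge> 0" "\<And>y s. s \<in> {t1..t2} \<Longrightarrow> \<bar>\<phi>x y s\<bar> \<le> D5" using bd[OF \<phi>x_cont] \<phi>_supp by metis
  obtain D6 where D6: "D6 \<ge> 0" "\<And>y s. s \<in> {t1..t2} \<Longrightarrow> \<bar>\<phi>s y s\<bar> \<le> D6" using bd[OF \<phi>s_cont] \<phi>_supp by metis
  show thesis
  proof (rule that[of "D1 + D2 + D3 + D4 + D5 + D6"])
    show "0 \<le> D1 + D2 + D3 + D4 + D5 + D6" using D1 D2 D3 D4 D5 D6 by linarith
  qed (use D1 D2 D3 D4 D5 D6 in \<open>fastforce intro: order_trans\<close>)+
qed

text \<open>The chain rule in time for \<beta>(V, s) \<phi> produces the term - u \<beta>w V_x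
  \<phi>. Integration by parts in x takes the derivative off V and turns this term into w \<beta>
  \<phi> + u \<beta> \<phi>x.\<close>

lemma steklov_identity:
  assumes h: "h > 0"
  shows "(LINT x|lborel. \<beta> (V h x t2) t2 * \<phi> x t2) - (LINT x|lborel. \<beta> (V h x t1) t1 * \<phi> x t1)
    = (LINT s:{t1..t2}|lborel. LINT x|lborel. \<beta>s (V h x s) s * \<phi> x s + \<beta>w (V h x s) s * \<phi> x s * G h x s
       + \<beta> (V h x s) s * (w x s * \<phi> x s + u x s * \<phi>x x s + \<phi>s x s))"
proof -
  define E where "E x s = \<beta>w (V h x s) s * \<phi> x s * V_rate h x s
    + (\<beta>s (V h x s) s * \<phi> x s + \<beta> (V h x s) s * \<phi>s x s)" for x s
  have E_meas [measurable]: "case_prod E \<in> borel_measurable (borel \<Otimes>\<^sub>M borel)" unfolding E_def by measurable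
  obtain C where C: "C \<ge> 0" "\<And>y s. s \<in> {t1..t2} \<Longrightarrow> \<bar>\<beta> y s\<bar> \<le> C" "\<And>y s. s \<in> {t1..t2} \<Longrightarrow> \<bar>\<beta>w y s\<bar> \<le> C"
    "\<And>y s. s \<in> {t1..t2} \<Longrightarrow> \<bar>\<beta>s y s\<bar> \<le> C" "\<And>x s. s \<in> {t1..t2} \<Longrightarrow> \<bar>\<phi> x s\<bar> \<le> C"
    "\<And>x s. s \<in> {t1..t2} \<Longrightarrow> \<bar>\<phi>x x s\<bar> \<le> C" "\<And>x s. s \<in> {t1..t2} \<Longrightarrow> \<bar>\<phi>s x s\<bar> \<le> C"
    using test_bounded by blast
  obtain D where D: "D \<ge> 0" "\<And>x s. x \<in> {-R..R} \<Longrightarrow> s \<in> {t1..t2} \<Longrightarrow> \<bar>V_rate h x s\<bar> \<le> D"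
    using V_rate_bounded[OF h] by metis
  have E_bound: "\<bar>E x s\<bar> \<le> C * C * D + (C * C + C * C)" if "x \<in> {-R..R}" "s \<in> {t1..t2}" for x s
  proof -
    have "\<bar>\<beta>w (V h x s) s * \<phi> x s * V_rate h x s\<bar> \<le> C * C * D"
      unfolding abs_mult using C(1) C(3)[OF that(2)] C(5)[OF that(2)] D(1) D(2)[OF that] by (intro mult_mono) auto
    moreover have "\<bar>\<beta>s (V h x s) s * \<phi> x s\<bar> \<le> C * C" "\<bar>\<beta> (V h x s) s * \<phi>s x s\<bar> \<le> C * C"
      unfolding abs_mult using C(1) C(4)[OF that(2)] C(5)[OF that(2)] C(2)[OF that(2)] C(7)[OF that(2)]
      by (auto intro!: mult_mono)
    ultimately show ?thesis unfolding E_def by linarith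
  qed
  have E_supp: "E x s = 0" if "x \<notin> {-R..R}" for x s using \<phi>_supp[OF that, of s] by (simp add: E_def)
  have chain: "\<beta> (V h x t2) t2 * \<phi> x t2 - \<beta> (V h x t1) t1 * \<phi> x t1 = (LINT s:{t1..t2}|lborel. E x s)" for x
    unfolding E_def
  proof (cases "x \<in> {-R..R}")
    case True
    show "\<beta> (V h x t2) t2 * \<phi> x t2 - \<beta> (V h x t1) t1 * \<phi> x t1 = (LINT s:{t1..t2}|lborel.
       \<beta>w (V h x s) s * \<phi> x s * V_rate h x s + (\<beta>s (V h x s) s * \<phi> x s + \<beta> (V h x s) s * \<phi>s x s))"
    proof (rule chain_rule_integral[where f = "V h x" and H = "\<lambda>y s. \<beta> y s * \<phi> x s" and Hy = "\<lambda>y s. \<beta>w y s * \<phi> x s"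
          and Ht = "\<lambda>y s. \<beta>s y s * \<phi> x s + \<beta> y s * \<phi>s x s" and C = D])
      show "V h x t' - V h x t = (LINT s:{t..t'}|lborel. V_rate h x s)" if "t1 \<le> t" "t \<le> t'" for t t'
        using V_increment[OF h] that t12 by auto
      show "((\<lambda>y. \<beta> y s * \<phi> x s) has_real_derivative \<beta>w y s * \<phi> x s) (at y)" if "s \<in> {t1..t2}" for y s
        by (rule DERIV_cmult_right[OF \<beta>_Dw[OF that]])
      show "((\<lambda>s. \<beta> y s * \<phi> x s) has_real_derivative \<beta>s y s * \<phi> x s + \<beta> y s * \<phi>s x s) (at s within {t1..t2})"
        if "s \<in> {t1..t2}" for y s
        using DERIV_mult[OF \<beta>_Ds[OF that] \<phi>_Ds[OF that]] by (simp add: algebra_simps)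
    qed (use t12 D True in \<open>auto intro!: V_continuous continuous_intros test_continuous\<close>)
  qed (use \<phi>_supp in auto)
  have swap: "(LINT s|lborel. LINT x|lborel. indicator {t1..t2} s * E x s) = (LINT x|lborel. LINT s|lborel. indicator {t1..t2} s * E x s)"
  proof (rule lborel_pair.Fubini_integral, rule integrable_pair_bounded_support[of _ "-R" R t1 t2])
    show "(\<lambda>(x, s). indicator {t1..t2} s * E x s) \<in> borel_measurable (borel \<Otimes>\<^sub>M borel)" by measurable
    show "\<bar>case (x, s) of (x, s) \<Rightarrow> indicator {t1..t2} s * E x s\<bar> \<le> C * C * D + (C * C + C * C)"
      if "x \<in> {-R..R}" "s \<in> {t1..t2}" for x s using E_bound[OF that] that by simp
  qed (use E_supp in auto)
  have int_end: "integrable lborel (\<lambda>x. \<beta> (V h x t) t * \<phi> x t)" for t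
    by (rule integrable_continuous_support[of _ "-R" R])
      (use \<phi>_supp in \<open>auto intro!: continuous_intros test_continuous V_continuous\<close>)
  have inner: "(LINT x|lborel. E x s) = (LINT x|lborel. \<beta>s (V h x s) s * \<phi> x s + \<beta>w (V h x s) s * \<phi> x s * G h x s
       + \<beta> (V h x s) s * (w x s * \<phi> x s + u x s * \<phi>x x s + \<phi>s x s))" if s: "s \<in> {t1..t2}" for s
  proof -
    define Vx where "Vx x = (u (x + h) s - 2 * u x s + u (x - h) s) / h\<^sup>2" for x
    have rate: "V_rate h x s = - u x s * Vx x + G h x s" for x by (simp add: V_rate_def Vx_def)
    define H where "H x = \<beta> (V h x s) s * \<phi> x s" for x
    define H' where "H' x = \<beta>w (V h x s) s * Vx x * \<phi> x s + \<beta> (V h x s) s * \<phi>x x s" for x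
    have H: "(H has_real_derivative H' x) (at x)" for x
      unfolding H_def[abs_def] H'_def
      using DERIV_mult[OF DERIV_chain2[OF \<beta>_Dw[OF s] V_DERIV[OF h, of s x]] \<phi>_Dx[OF s]]
      by (simp add: Vx_def algebra_simps)
    have Hc: "continuous_on UNIV H'"
      unfolding H'_def Vx_def using h
      by (auto intro!: continuous_intros test_continuous V_continuous u_continuous)
    have ibp: "(LINT x|lborel. w x s * H x + u x s * H' x) = 0" "integrable lborel (\<lambda>x. w x s * H x + u x s * H' x)"
      by (rule integration_by_parts[OF H Hc, of R]; use \<phi>_supp in \<open>auto simp: H_def H'_def\<close>)+
    have iE: "integrable lborel (\<lambda>x. E x s)"
      by (rule integrable_bounded_support[of _ "-R" R "C * C * D + (C * C + C * C)"]) (use E_bound E_supp s in auto)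
    \<comment> \<open>A vanishing integral is added in order to cancel \<open>Vx\<close>, for which
      no bound uniform in h is available.\<close>
    have "(LINT x|lborel. E x s) = (LINT x|lborel. E x s + (w x s * H x + u x s * H' x))"
      using ibp iE by simp
    also have "\<dots> = (LINT x|lborel. \<beta>s (V h x s) s * \<phi> x s + \<beta>w (V h x s) s * \<phi> x s * G h x s
       + \<beta> (V h x s) s * (w x s * \<phi> x s + u x s * \<phi>x x s + \<phi>s x s))"
      by (rule Bochner_Integration.integral_cong) (auto simp: E_def H_def H'_def rate algebra_simps)
    finally show ?thesis .
  qed
  have "(LINT x|lborel. \<beta> (V h x t2) t2 * \<phi> x t2) - (LINT x|lborel. \<beta> (V h x t1) t1 * \<phi> x t1)
     = (LINT x|lborel. \<beta> (V h x t2) t2 * \<phi> x t2 - \<beta> (V h x t1) t1 * \<phi> x t1)"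
    using int_end by simp
  also have "\<dots> = (LINT x|lborel. LINT s|lborel. indicator {t1..t2} s * E x s)"
    unfolding chain by (simp add: set_lebesgue_integral_def)
  also have "\<dots> = (LINT s:{t1..t2}|lborel. LINT x|lborel. E x s)"
    using swap by (simp add: set_lebesgue_integral_def)
  also have "\<dots> = (LINT s:{t1..t2}|lborel. LINT x|lborel. \<beta>s (V h x s) s * \<phi> x s + \<beta>w (V h x s) s * \<phi> x s * G h x s
       + \<beta> (V h x s) s * (w x s * \<phi> x s + u x s * \<phi>x x s + \<phi>s x s))"
    unfolding set_lebesgue_integral_def
    by (rule Bochner_Integration.integral_cong) (auto simp: inner indicator_def)
  finally show ?thesis .
qed

lemma w_sq_integrable_times:
  assumes [measurable]: "f \<in> borel_measurable borel" and "\<And>x. \<bar>f x\<bar> \<le> C"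
  shows "integrable lborel (\<lambda>x. f x * (w x t)\<^sup>2)"
proof (rule Bochner_Integration.integrable_bound[of _ "\<lambda>x. C * (w x t)\<^sup>2"])
  have C: "0 \<le> C" using assms(2)[of 0] by auto
  show "AE x in lborel. norm (f x * (w x t)\<^sup>2) \<le> norm (C * (w x t)\<^sup>2)"
    using assms(2) C by (intro AE_I2) (simp add: abs_mult mult_right_mono)
qed (use w_sq in auto)

text \<open>As h tends to 0, all terms but one converge by domination, since V tends to w almost
  everywhere. The remaining term contains the factor \<open>G\<close>, which has no uniform bound;
  its convergence in L1 is what carries that term to the limit.\<close>

theorem renormalized:
  "(LINT x|lborel. \<beta> (w x t2) t2 * \<phi> x t2) - (LINT x|lborel. \<beta> (w x t1) t1 * \<phi> x t1)
    = (LINT s:{t1..t2}|lborel. LINT x|lborel.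
        (\<beta>s (w x s) s - 1/2 * (w x s)\<^sup>2 * \<beta>w (w x s) s + w x s * \<beta> (w x s) s) * \<phi> x s
        + \<beta> (w x s) s * (\<phi>s x s + u x s * \<phi>x x s))"
proof -
  obtain C where C: "C \<ge> 0" "\<And>y s. s \<in> {t1..t2} \<Longrightarrow> \<bar>\<beta> y s\<bar> \<le> C" "\<And>y s. s \<in> {t1..t2} \<Longrightarrow> \<bar>\<beta>w y s\<bar> \<le> C"
    "\<And>y s. s \<in> {t1..t2} \<Longrightarrow> \<bar>\<beta>s y s\<bar> \<le> C" "\<And>x s. s \<in> {t1..t2} \<Longrightarrow> \<bar>\<phi> x s\<bar> \<le> C"
    "\<And>x s. s \<in> {t1..t2} \<Longrightarrow> \<bar>\<phi>x x s\<bar> \<le> C" "\<And>x s. s \<in> {t1..t2} \<Longrightarrow> \<bar>\<phi>s x s\<bar> \<le> C"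
    using test_bounded by blast
  obtain U where U: "U \<ge> 0" "\<And>x s. x \<in> {-R..R} \<Longrightarrow> s \<in> {t1..t2} \<Longrightarrow> \<bar>u x s\<bar> \<le> U"
    using continuous_bounded_box[OF u_cont] by metis
  have prod_le: "\<bar>p * q\<bar> \<le> C * C" if "\<bar>p\<bar> \<le> C" "\<bar>q\<bar> \<le> C" for p q
    unfolding abs_mult using that C(1) by (intro mult_mono) auto
  define K1 where "K1 = C * C + C * (U * C + C)"
  define J1 where "J1 v s x = \<beta>s (v x) s * \<phi> x s + \<beta> (v x) s * (u x s * \<phi>x x s + \<phi>s x s)" for v :: "real \<Rightarrow> real" and s x
  define J2 where "J2 v s x = w x s * (\<beta> (v x) s * \<phi> x s)" for v :: "real \<Rightarrow> real" and s x
  have J1_bound: "\<bar>J1 v s x\<bar> \<le> K1 * indicator {-R..R} x" if s: "s \<in> {t1..t2}" for v s x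
  proof (cases "x \<in> {-R..R}")
    case True
    have "\<bar>\<beta>s (v x) s * \<phi> x s\<bar> \<le> C * C" using C s by (intro prod_le) auto
    moreover have "\<bar>\<beta> (v x) s * (u x s * \<phi>x x s + \<phi>s x s)\<bar> \<le> C * (U * C + C)"
    proof -
      have "\<bar>u x s * \<phi>x x s\<bar> \<le> U * C" unfolding abs_mult using U(2)[OF True s] U(1) C(6)[OF s] by (intro mult_mono) auto
      then have "\<bar>u x s * \<phi>x x s + \<phi>s x s\<bar> \<le> U * C + C" using C(7)[OF s, of x] by linarith
      then show ?thesis unfolding abs_mult using C(1) C(2)[OF s] by (intro mult_mono) auto
    qed
    ultimately show ?thesis using True unfolding J1_def K1_def by (simp add: abs_le_iff)
  qed (use \<phi>_supp in \<open>auto simp: J1_def\<close>)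
  have K1: "0 \<le> K1" using C(1) U(1) by (simp add: K1_def)
  have iK1: "integrable lborel (\<lambda>x. K1 * indicator {-R..R} x :: real)"
    by (intro integrable_mult_right integrable_real_indicator) (auto simp: emeasure_lborel_Icc_eq)
  have J1_int: "integrable lborel (J1 v s)" if s: "s \<in> {t1..t2}" and [measurable]: "v \<in> borel_measurable borel" for v s
  proof (rule Bochner_Integration.integrable_bound[OF iK1])
    show "J1 v s \<in> borel_measurable lborel" unfolding J1_def by measurable
    show "AE x in lborel. norm (J1 v s x) \<le> norm (K1 * indicator {-R..R} x :: real)"
      unfolding real_norm_def by (intro AE_I2 order_trans[OF J1_bound[OF s] abs_ge_self])
  qed
  have iw: "integrable lborel (\<lambda>x. C * C * (indicator {-R..R} x *\<^sub>R \<bar>w x s\<bar>))" for s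
    using set_integrable_abs[OF w_set] unfolding set_integrable_def by (intro integrable_mult_right)
  have J2_bound: "\<bar>J2 v s x\<bar> \<le> C * C * (indicator {-R..R} x *\<^sub>R \<bar>w x s\<bar>)" if s: "s \<in> {t1..t2}" for v s x
  proof (cases "x \<in> {-R..R}")
    case True
    have "\<bar>\<beta> (v x) s * \<phi> x s\<bar> \<le> C * C" using C s by (intro prod_le) auto
    then have "\<bar>w x s\<bar> * \<bar>\<beta> (v x) s * \<phi> x s\<bar> \<le> \<bar>w x s\<bar> * (C * C)" by (intro mult_left_mono) auto
    then show ?thesis using True unfolding J2_def by (simp add: abs_mult mult.commute)
  qed (use \<phi>_supp in \<open>auto simp: J2_def\<close>)
  have J2_int: "integrable lborel (J2 v s)" if s: "s \<in> {t1..t2}" and [measurable]: "v \<in> borel_measurable borel" for v s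
  proof (rule Bochner_Integration.integrable_bound[OF iw])
    show "J2 v s \<in> borel_measurable lborel" unfolding J2_def by measurable
    show "AE x in lborel. norm (J2 v s x) \<le> norm (C * C * (indicator {-R..R} x *\<^sub>R \<bar>w x s\<bar>))"
      unfolding real_norm_def by (intro AE_I2 order_trans[OF J2_bound[OF s] abs_ge_self])
  qed
  define I where "I n s = (LINT x|lborel. \<beta>s (V (hh n) x s) s * \<phi> x s + \<beta>w (V (hh n) x s) s * \<phi> x s * G (hh n) x s
       + \<beta> (V (hh n) x s) s * (w x s * \<phi> x s + u x s * \<phi>x x s + \<phi>s x s))" for n s
  define J where "J s = (LINT x|lborel. (\<beta>s (w x s) s - 1/2 * (w x s)\<^sup>2 * \<beta>w (w x s) s + w x s * \<beta> (w x s) s) * \<phi> x s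
        + \<beta> (w x s) s * (\<phi>s x s + u x s * \<phi>x x s))" for s
  have cf_meas [measurable]: "(\<lambda>x. \<beta>w (V (hh n) x s) s * \<phi> x s) \<in> borel_measurable borel" for n s by measurable
  have cf_bound: "\<bar>\<beta>w y s * \<phi> x s\<bar> \<le> C * C" if "s \<in> {t1..t2}" for x y s
    using C that by (intro prod_le) auto
  have iG: "integrable lborel (\<lambda>x. \<beta>w (V (hh n) x s) s * \<phi> x s * G (hh n) x s)" if s: "s \<in> {t1..t2}" for n s
  proof (rule Bochner_Integration.integrable_bound[of _ "\<lambda>x. C * C * \<bar>G (hh n) x s\<bar>"])
    show "integrable lborel (\<lambda>x. C * C * \<bar>G (hh n) x s\<bar>)"
      by (intro integrable_mult_right integrable_abs G_L1_bound(1) hh)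
    show "AE x in lborel. norm (\<beta>w (V (hh n) x s) s * \<phi> x s * G (hh n) x s) \<le> norm (C * C * \<bar>G (hh n) x s\<bar>)"
      using cf_bound[OF s] C(1) unfolding real_norm_def abs_mult[of "\<beta>w _ _ * \<phi> _ _"] abs_mult[of "C * C"]
      by (intro AE_I2 mult_mono) auto
  qed measurable
  have I_split: "I n s = (LINT x|lborel. J1 (\<lambda>x. V (hh n) x s) s x) + (LINT x|lborel. J2 (\<lambda>x. V (hh n) x s) s x)
     + (LINT x|lborel. \<beta>w (V (hh n) x s) s * \<phi> x s * G (hh n) x s)" if s: "s \<in> {t1..t2}" for n s
  proof -
    have "I n s = (LINT x|lborel. J1 (\<lambda>x. V (hh n) x s) s x + J2 (\<lambda>x. V (hh n) x s) s x + \<beta>w (V (hh n) x s) s * \<phi> x s * G (hh n) x s)"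
      unfolding I_def by (rule Bochner_Integration.integral_cong) (auto simp: J1_def J2_def algebra_simps)
    then show ?thesis using J1_int[OF s] J2_int[OF s] iG[OF s] by simp
  qed
  have iwsq: "integrable lborel (\<lambda>x. \<beta>w (v x) s * \<phi> x s * (w x s)\<^sup>2)"
    if s: "s \<in> {t1..t2}" and [measurable]: "v \<in> borel_measurable borel" for v s
    by (rule w_sq_integrable_times[of _ "C * C"]) (use cf_bound[OF s] in auto)
  have J_split: "J s = (LINT x|lborel. J1 (\<lambda>x. w x s) s x) + (LINT x|lborel. J2 (\<lambda>x. w x s) s x)
     - 1/2 * (LINT x|lborel. \<beta>w (w x s) s * \<phi> x s * (w x s)\<^sup>2)" if s: "s \<in> {t1..t2}" for s
  proof -
    have "J s = (LINT x|lborel. J1 (\<lambda>x. w x s) s x + J2 (\<lambda>x. w x s) s x - 1/2 * (\<beta>w (w x s) s * \<phi> x s * (w x s)\<^sup>2))"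
      unfolding J_def by (rule Bochner_Integration.integral_cong) (auto simp: J1_def J2_def algebra_simps)
    then show ?thesis using J1_int[OF s] J2_int[OF s] iwsq[OF s] by simp
  qed
  have V_lim: "AE x in lborel. (\<lambda>n. V (hh n) x s) \<longlonglongrightarrow> w x s" for s
    using u_deriv[of s] by (rule eventually_mono) (rule V_tendsto)
  have slice_lim: "(\<lambda>n. f (X n) s) \<longlonglongrightarrow> f y s" if "continuous_on UNIV (\<lambda>p. f (fst p) (snd p))" "X \<longlonglongrightarrow> y"
    for f :: "real \<Rightarrow> real \<Rightarrow> real" and X y s
  proof -
    have "continuous_on UNIV (\<lambda>z. f z s)"
      by (rule continuous_on_pair_slice[OF that(1)]) (auto intro: continuous_intros)
    then show ?thesis by (rule continuous_on_tendsto_compose[OF _ that(2)]) auto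
  qed
  have I_lim: "(\<lambda>n. I n s) \<longlonglongrightarrow> J s" if s: "s \<in> {t1..t2}" for s
  proof -
    have "(\<lambda>n. LINT x|lborel. J1 (\<lambda>x. V (hh n) x s) s x) \<longlonglongrightarrow> (LINT x|lborel. J1 (\<lambda>x. w x s) s x)"
    proof (rule integral_dominated_convergence[OF _ _ iK1])
      show "J1 (\<lambda>x. w x s) s \<in> borel_measurable lborel" "J1 (\<lambda>x. V (hh n) x s) s \<in> borel_measurable lborel" for n
        unfolding J1_def by measurable
      show "AE x in lborel. (\<lambda>n. J1 (\<lambda>x. V (hh n) x s) s x) \<longlonglongrightarrow> J1 (\<lambda>x. w x s) s x"
        using V_lim[of s] unfolding J1_def
        by (rule eventually_mono) (intro tendsto_add tendsto_mult tendsto_const slice_lim[OF \<beta>s_cont] slice_lim[OF \<beta>_cont])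
      show "AE x in lborel. norm (J1 (\<lambda>x. V (hh n) x s) s x) \<le> K1 * indicator {-R..R} x" for n
        using J1_bound[OF s] by simp
    qed
    moreover have "(\<lambda>n. LINT x|lborel. J2 (\<lambda>x. V (hh n) x s) s x) \<longlonglongrightarrow> (LINT x|lborel. J2 (\<lambda>x. w x s) s x)"
    proof (rule integral_dominated_convergence[OF _ _ iw])
      show "J2 (\<lambda>x. w x s) s \<in> borel_measurable lborel" "J2 (\<lambda>x. V (hh n) x s) s \<in> borel_measurable lborel" for n
        unfolding J2_def by measurable
      show "AE x in lborel. (\<lambda>n. J2 (\<lambda>x. V (hh n) x s) s x) \<longlonglongrightarrow> J2 (\<lambda>x. w x s) s x"
        using V_lim[of s] unfolding J2_def
        by (rule eventually_mono) (intro tendsto_mult tendsto_const slice_lim[OF \<beta>_cont])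
      show "AE x in lborel. norm (J2 (\<lambda>x. V (hh n) x s) s x) \<le> C * C * (indicator {-R..R} x *\<^sub>R \<bar>w x s\<bar>)" for n
        using J2_bound[OF s] by simp
    qed
    moreover have "(\<lambda>n. LINT x|lborel. \<beta>w (V (hh n) x s) s * \<phi> x s * G (hh n) x s)
       \<longlonglongrightarrow> 0 - 1/2 * (LINT x|lborel. \<beta>w (w x s) s * \<phi> x s * (w x s)\<^sup>2)"
    proof -
      let ?c = "\<lambda>n x. \<beta>w (V (hh n) x s) s * \<phi> x s"
      have iGw: "integrable lborel (\<lambda>x. \<bar>G (hh n) x s + 1/2 * (w x s)\<^sup>2\<bar>)" for n
        using G_L1_bound(1)[OF hh(1), of n s] w_sq by simp
      have iCG: "integrable lborel (\<lambda>x. ?c n x * (G (hh n) x s + 1/2 * (w x s)\<^sup>2))" for n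
      proof (rule Bochner_Integration.integrable_bound[OF integrable_mult_right[OF iGw, of "C * C"]])
        show "AE x in lborel. norm (?c n x * (G (hh n) x s + 1/2 * (w x s)\<^sup>2)) \<le> norm (C * C * \<bar>G (hh n) x s + 1/2 * (w x s)\<^sup>2\<bar>)"
          using cf_bound[OF s] C(1) unfolding real_norm_def abs_mult[of "\<beta>w _ _ * \<phi> _ _"] abs_mult[of "C * C"]
          by (intro AE_I2 mult_mono) auto
      qed measurable
      \<comment> \<open>The coefficient converges only almost everywhere and \<open>G\<close> only
        in L1. So \<open>G\<close> is split into G + w^2/2, which is small in L1, and - w^2/2, to
        which dominated convergence applies.\<close>
      have "(LINT x|lborel. ?c n x * G (hh n) x s)
         = (LINT x|lborel. ?c n x * (G (hh n) x s + 1/2 * (w x s)\<^sup>2) - 1/2 * (?c n x * (w x s)\<^sup>2))" for n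
        by (rule Bochner_Integration.integral_cong) (auto simp: algebra_simps)
      then have eq: "(LINT x|lborel. ?c n x * G (hh n) x s)
         = (LINT x|lborel. ?c n x * (G (hh n) x s + 1/2 * (w x s)\<^sup>2)) - 1/2 * (LINT x|lborel. ?c n x * (w x s)\<^sup>2)" for n
        using iCG[of n] iwsq[OF s, of "\<lambda>x. V (hh n) x s"] by simp
      have l1: "(\<lambda>n. LINT x|lborel. ?c n x * (G (hh n) x s + 1/2 * (w x s)\<^sup>2)) \<longlonglongrightarrow> 0"
      proof (rule Lim_null_comparison)
        have "(\<lambda>n. C * C * (LINT x|lborel. \<bar>G (hh n) x s + 1/2 * (w x s)\<^sup>2\<bar>)) \<longlonglongrightarrow> C * C * 0"
          by (intro tendsto_intros G_tendsto)
        then show "(\<lambda>n. C * C * (LINT x|lborel. \<bar>G (hh n) x s + 1/2 * (w x s)\<^sup>2\<bar>)) \<longlonglongrightarrow> 0" by simp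
        have "norm (LINT x|lborel. ?c n x * (G (hh n) x s + 1/2 * (w x s)\<^sup>2))
           \<le> C * C * (LINT x|lborel. \<bar>G (hh n) x s + 1/2 * (w x s)\<^sup>2\<bar>)" for n
        proof -
          have "norm (LINT x|lborel. ?c n x * (G (hh n) x s + 1/2 * (w x s)\<^sup>2))
            \<le> (LINT x|lborel. \<bar>?c n x * (G (hh n) x s + 1/2 * (w x s)\<^sup>2)\<bar>)"
            unfolding real_norm_def by (rule integral_abs_bound)
          also have "\<dots> \<le> (LINT x|lborel. C * C * \<bar>G (hh n) x s + 1/2 * (w x s)\<^sup>2\<bar>)"
          proof (rule integral_mono[OF integrable_abs[OF iCG] integrable_mult_right[OF iGw]])
            show "\<bar>?c n x * (G (hh n) x s + 1/2 * (w x s)\<^sup>2)\<bar> \<le> C * C * \<bar>G (hh n) x s + 1/2 * (w x s)\<^sup>2\<bar>" for x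
              unfolding abs_mult[of "\<beta>w _ _ * \<phi> _ _"] using cf_bound[OF s] by (intro mult_right_mono) auto
          qed
          finally show ?thesis by simp
        qed
        then show "\<forall>\<^sub>F n in sequentially. norm (LINT x|lborel. ?c n x * (G (hh n) x s + 1/2 * (w x s)\<^sup>2))
           \<le> C * C * (LINT x|lborel. \<bar>G (hh n) x s + 1/2 * (w x s)\<^sup>2\<bar>)" by simp
      qed
      have l2: "(\<lambda>n. LINT x|lborel. ?c n x * (w x s)\<^sup>2) \<longlonglongrightarrow> (LINT x|lborel. \<beta>w (w x s) s * \<phi> x s * (w x s)\<^sup>2)"
      proof (rule integral_dominated_convergence[where w = "\<lambda>x. C * C * (w x s)\<^sup>2"])
        show "AE x in lborel. (\<lambda>n. ?c n x * (w x s)\<^sup>2) \<longlonglongrightarrow> \<beta>w (w x s) s * \<phi> x s * (w x s)\<^sup>2"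
          using V_lim[of s] by (rule eventually_mono) (intro tendsto_mult tendsto_const slice_lim[OF \<beta>w_cont])
        show "AE x in lborel. norm (?c n x * (w x s)\<^sup>2) \<le> C * C * (w x s)\<^sup>2" for n
          unfolding real_norm_def abs_mult[of "\<beta>w _ _ * \<phi> _ _"] using cf_bound[OF s] by (intro AE_I2 mult_mono) auto
      qed (use w_sq in auto)
      show ?thesis unfolding eq by (intro tendsto_intros l1 l2)
    qed
    ultimately have "(\<lambda>n. I n s) \<longlonglongrightarrow> (LINT x|lborel. J1 (\<lambda>x. w x s) s x) + (LINT x|lborel. J2 (\<lambda>x. w x s) s x)
       + (0 - 1/2 * (LINT x|lborel. \<beta>w (w x s) s * \<phi> x s * (w x s)\<^sup>2))"
      unfolding I_split[OF s] by (intro tendsto_add)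
    then show ?thesis unfolding J_split[OF s] by simp
  qed
  \<comment> \<open>A bound independent of n and s, for dominated convergence in time.\<close>
  define K where "K = K1 * (2 * R) + C * C * (2 * R + M) + C * C * (2 * M)"
  have I_bound: "\<bar>I n s\<bar> \<le> K" if s: "s \<in> {t1..t2}" for n s
  proof -
    have "\<bar>LINT x|lborel. J1 (\<lambda>x. V (hh n) x s) s x\<bar> \<le> (LINT x|lborel. K1 * indicator {-R..R} x)"
      by (rule order_trans[OF integral_abs_bound], rule integral_mono[OF integrable_abs[OF J1_int[OF s]] iK1])
        (use J1_bound[OF s] in auto)
    moreover have "\<bar>LINT x|lborel. J2 (\<lambda>x. V (hh n) x s) s x\<bar> \<le> (LINT x|lborel. C * C * (indicator {-R..R} x *\<^sub>R \<bar>w x s\<bar>))"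
      by (rule order_trans[OF integral_abs_bound], rule integral_mono[OF integrable_abs[OF J2_int[OF s]] iw])
        (use J2_bound[OF s] in auto)
    moreover have "(LINT x|lborel. C * C * (indicator {-R..R} x *\<^sub>R \<bar>w x s\<bar>)) \<le> C * C * (2 * R + M)"
      using mult_left_mono[OF w_abs_set_le[of "-R" R s], of "C * C"] R C(1) by (simp add: set_lebesgue_integral_def)
    moreover have "\<bar>LINT x|lborel. \<beta>w (V (hh n) x s) s * \<phi> x s * G (hh n) x s\<bar> \<le> C * C * (2 * M)"
    proof -
      have iabs: "integrable lborel (\<lambda>x. \<bar>G (hh n) x s\<bar>)" by (intro integrable_abs G_L1_bound(1) hh)
      have "\<bar>LINT x|lborel. \<beta>w (V (hh n) x s) s * \<phi> x s * G (hh n) x s\<bar>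
         \<le> (LINT x|lborel. \<bar>\<beta>w (V (hh n) x s) s * \<phi> x s * G (hh n) x s\<bar>)" by (rule integral_abs_bound)
      also have "\<dots> \<le> (LINT x|lborel. C * C * \<bar>G (hh n) x s\<bar>)"
      proof (rule integral_mono[OF integrable_abs[OF iG[OF s]] integrable_mult_right[OF iabs]])
        show "\<bar>\<beta>w (V (hh n) x s) s * \<phi> x s * G (hh n) x s\<bar> \<le> C * C * \<bar>G (hh n) x s\<bar>" for x
          unfolding abs_mult[of "\<beta>w _ _ * \<phi> _ _"] using cf_bound[OF s] by (intro mult_right_mono) auto
      qed
      also have "\<dots> \<le> C * C * (2 * M)"
        using G_L1_bound(2)[OF hh(1), of n s] C(1) by (simp add: mult_left_mono)
      finally show ?thesis .
    qed
    moreover have "(LINT x|lborel. K1 * indicator {-R..R} x) = K1 * (2 * R)" using R by simp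
    ultimately show ?thesis unfolding I_split[OF s] K_def by linarith
  qed
  have J_meas [measurable]: "J \<in> borel_measurable borel" unfolding J_def by measurable
  have I_meas [measurable]: "I n \<in> borel_measurable borel" for n unfolding I_def by measurable
  have L1: "(\<lambda>n. LINT s:{t1..t2}|lborel. I n s) \<longlonglongrightarrow> (LINT s:{t1..t2}|lborel. J s)"
    unfolding set_lebesgue_integral_def
  proof (rule integral_dominated_convergence[where w = "\<lambda>s. K * indicator {t1..t2} s"])
    show "integrable lborel (\<lambda>s. K * indicator {t1..t2} s :: real)"
      by (intro integrable_mult_right integrable_real_indicator) (auto simp: emeasure_lborel_Icc_eq)
    show "AE s in lborel. (\<lambda>n. indicator {t1..t2} s *\<^sub>R I n s) \<longlonglongrightarrow> indicator {t1..t2} s *\<^sub>R J s"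
      using I_lim by (intro AE_I2) (auto simp: indicator_def)
    show "AE s in lborel. norm (indicator {t1..t2} s *\<^sub>R I n s) \<le> K * indicator {t1..t2} s" for n
      using I_bound by (intro AE_I2) (auto simp: indicator_def)
  qed measurable
  have ends: "(\<lambda>n. LINT x|lborel. \<beta> (V (hh n) x t) t * \<phi> x t) \<longlonglongrightarrow> (LINT x|lborel. \<beta> (w x t) t * \<phi> x t)"
    if t: "t \<in> {t1..t2}" for t
  proof (rule integral_dominated_convergence[where w = "\<lambda>x. C * C * indicator {-R..R} x"])
    show "integrable lborel (\<lambda>x. C * C * indicator {-R..R} x :: real)"
      by (intro integrable_mult_right integrable_real_indicator) (auto simp: emeasure_lborel_Icc_eq)
    show "AE x in lborel. (\<lambda>n. \<beta> (V (hh n) x t) t * \<phi> x t) \<longlonglongrightarrow> \<beta> (w x t) t * \<phi> x t"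
      using V_lim[of t] by (rule eventually_mono) (intro tendsto_mult tendsto_const slice_lim[OF \<beta>_cont])
    have "norm (\<beta> (V (hh n) x t) t * \<phi> x t) \<le> C * C * indicator {-R..R} x" for n x
    proof (cases "x \<in> {-R..R}")
      case True
      have "\<bar>\<beta> (V (hh n) x t) t * \<phi> x t\<bar> \<le> C * C" using C t by (intro prod_le) auto
      then show ?thesis using True by simp
    qed (use \<phi>_supp in auto)
    then show "AE x in lborel. norm (\<beta> (V (hh n) x t) t * \<phi> x t) \<le> C * C * indicator {-R..R} x" for n by simp
  qed measurable
  have L2: "(\<lambda>n. (LINT x|lborel. \<beta> (V (hh n) x t2) t2 * \<phi> x t2) - (LINT x|lborel. \<beta> (V (hh n) x t1) t1 * \<phi> x t1))
    \<longlonglongrightarrow> (LINT x|lborel. \<beta> (w x t2) t2 * \<phi> x t2) - (LINT x|lborel. \<beta> (w x t1) t1 * \<phi> x t1)"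
    by (intro tendsto_diff ends) (use t12 in auto)
  have "(LINT x|lborel. \<beta> (V (hh n) x t2) t2 * \<phi> x t2) - (LINT x|lborel. \<beta> (V (hh n) x t1) t1 * \<phi> x t1)
     = (LINT s:{t1..t2}|lborel. I n s)" for n
    unfolding I_def by (rule steklov_identity[OF hh(1)])
  then show ?thesis using LIMSEQ_unique[OF L2] L1 unfolding J_def by simp
qed

end

section \<open>Characteristics\<close>

lemma set_integral_bounded_diff:
  fixes f :: "real \<Rightarrow> real"
  assumes [measurable]: "f \<in> borel_measurable borel" and K: "\<And>s. \<bar>f s\<bar> \<le> K" and "0 \<le> t" "0 \<le> t'"
  shows "\<bar>(LINT s:{0..t'}|lborel. f s) - (LINT s:{0..t}|lborel. f s)\<bar> \<le> K * \<bar>t' - t\<bar>"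
proof -
  have i: "set_integrable lborel {a..b} f" for a b by (rule set_integrable_bounded_Icc[of _ _ _ K]) (use K in auto)
  have *: "\<bar>(LINT s:{0..t'}|lborel. f s) - (LINT s:{0..t}|lborel. f s)\<bar> \<le> K * (t' - t)" if "0 \<le> t" "t \<le> t'" for t t'
    using set_integral_split[OF that i] set_integral_bound_Icc[OF that(2) i, of K] K by simp
  show ?thesis using *[of t t'] *[of t' t] assms(3,4) by (cases "t \<le> t'") (auto simp: abs_minus_commute)
qed

text \<open>Euler polygons with step T/(n+1) are written as integrals of piecewise constant
  velocities \<open>vn\<close>. K is a common Lipschitz constant, so Arzela-Ascoli yields a
  uniformly convergent subsequence, and continuity of v takes the integrals to the limit.\<close>

lemma peano_bounded:
  fixes v :: "real \<Rightarrow> real \<Rightarrow> real"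
  assumes v: "continuous_on UNIV (\<lambda>p. v (fst p) (snd p))" and K: "\<And>x s. \<bar>v x s\<bar> \<le> K" and "0 < T"
  obtains x where "continuous_on {0..T} x" "\<And>t. t \<in> {0..T} \<Longrightarrow> x t = y + (LINT s:{0..t}|lborel. v (x s) s)"
proof -
  define d where "d n = T / real (Suc n)" for n
  have d: "d n > 0" for n using \<open>0 < T\<close> by (simp add: d_def)
  define p where "p n = rec_nat y (\<lambda>k z. z + d n * v z (real k * d n))" for n
  have p: "p n 0 = y" "p n (Suc k) = p n k + d n * v (p n k) (real k * d n)" for n k by (simp_all add: p_def)
  define idx where "idx n s = nat \<lfloor>s / d n\<rfloor>" for n s
  define vn where "vn n s = v (p n (idx n s)) (real (idx n s) * d n)" for n s
  have idx_meas: "idx n \<in> borel \<rightarrow>\<^sub>M count_space UNIV" for n unfolding idx_def by measurable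
  have vn_meas [measurable]: "vn n \<in> borel_measurable borel" for n
    unfolding vn_def by (rule measurable_compose[OF idx_meas]) simp
  have vn_K: "\<bar>vn n s\<bar> \<le> K" for n s unfolding vn_def by (rule K)
  define xn where "xn n t = y + (LINT s:{0..t}|lborel. vn n s)" for n t
  have vi: "set_integrable lborel {a..b} (vn n)" for n a b
    by (rule set_integrable_bounded_Icc[of _ _ _ K]) (use vn_K in auto)
  have xn_p: "xn n (real k * d n) = p n k" for n k
  proof (induction k)
    case 0
    have "(LINT s:{0..0}|lborel. vn n s) = 0" using set_integral_split[of 0 0 0 "vn n"] vi by simp
    then show ?case by (simp add: xn_def p)
  next
    case (Suc k)
    let ?a = "real k * d n" and ?b = "real (Suc k) * d n"
    have ab: "0 \<le> ?a" "?a \<le> ?b" "?b - ?a = d n" using d[of n] by (auto simp: algebra_simps)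
    have "(LINT s:{?a..?b}|lborel. vn n s) = (LINT s:{?a..?b}|lborel. v (p n k) ?a)"
      unfolding set_lebesgue_integral_def
    proof (rule integral_cong_AE)
      \<comment> \<open>At the right end of a cell \<open>idx\<close> already names the next
        one.\<close>
      show "AE s in lborel. indicator {?a..?b} s *\<^sub>R vn n s = indicator {?a..?b} s *\<^sub>R v (p n k) ?a"
        using AE_lborel_singleton[of ?b]
      proof (rule eventually_mono)
        fix s assume "s \<noteq> ?b"
        show "indicator {?a..?b} s *\<^sub>R vn n s = indicator {?a..?b} s *\<^sub>R v (p n k) ?a"
        proof (cases "s \<in> {?a..?b}")
          case True
          then have "real k \<le> s / d n" "s / d n < real (Suc k)"
            using \<open>s \<noteq> ?b\<close> d[of n] by (auto simp: pos_le_divide_eq pos_divide_less_eq)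
          then have "\<lfloor>s / d n\<rfloor> = int k" by (intro floor_unique) auto
          then show ?thesis by (simp add: vn_def idx_def)
        qed simp
      qed
    qed measurable
    also have "\<dots> = d n * v (p n k) ?a" using ab by (simp add: set_lebesgue_integral_def del: of_nat_Suc)
    finally have "(LINT s:{0..?b}|lborel. vn n s) = (LINT s:{0..?a}|lborel. vn n s) + d n * v (p n k) ?a"
      using set_integral_split[OF ab(1,2) vi] by simp
    then show ?case using Suc by (simp add: xn_def p del: of_nat_Suc)
  qed
  have K0: "0 \<le> K" using K[of 0 0] by auto
  have lip: "\<bar>xn n t' - xn n t\<bar> \<le> K * \<bar>t' - t\<bar>" if "0 \<le> t" "0 \<le> t'" for n t t'
    unfolding xn_def using set_integral_bounded_diff[OF vn_meas vn_K that] by simp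
  obtain g k where g: "continuous_on {0..T} g" "strict_mono (k :: nat \<Rightarrow> nat)"
    "\<And>e. 0 < e \<Longrightarrow> \<exists>N. \<forall>n t. n \<ge> N \<and> t \<in> {0..T} \<longrightarrow> norm (xn (k n) t - g t) < e"
  proof (rule Arzela_Ascoli[of "{0..T}" xn "\<bar>y\<bar> + K * T"])
    show "norm (xn n t) \<le> \<bar>y\<bar> + K * T" if t: "t \<in> {0..T}" for n t
    proof -
      have "xn n 0 = y" using xn_p[of n 0] by (simp add: p)
      moreover have "K * t \<le> K * T" using t K0 by (intro mult_left_mono) auto
      ultimately show ?thesis using lip[of 0 t n] t by auto
    qed
    show "\<exists>d>0. \<forall>n t'. t' \<in> {0..T} \<and> norm (t - t') < d \<longrightarrow> norm (xn n t - xn n t') < e" if t: "t \<in> {0..T}" and e: "0 < e" for t e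
    proof (intro exI[of _ "e / (K + 1)"] conjI allI impI)
      show "0 < e / (K + 1)" using e K0 by simp
      fix n t' assume t': "t' \<in> {0..T} \<and> norm (t - t') < e / (K + 1)"
      then have "(K + 1) * \<bar>t - t'\<bar> < e" using K0 by (simp add: pos_less_divide_eq mult.commute)
      moreover have "\<bar>xn n t - xn n t'\<bar> \<le> K * \<bar>t - t'\<bar>" using lip[of t' t n] t t' by auto
      moreover have "K * \<bar>t - t'\<bar> \<le> (K + 1) * \<bar>t - t'\<bar>" by (intro mult_right_mono) auto
      ultimately show "norm (xn n t - xn n t') < e" by simp
    qed
  qed auto
  have xlim: "(\<lambda>n. xn (k n) t) \<longlonglongrightarrow> g t" if "t \<in> {0..T}" for t
    by (rule LIMSEQ_I) (use g(3) that in blast)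
  have d_lim: "(\<lambda>n. d (k n)) \<longlonglongrightarrow> 0"
  proof -
    have "(\<lambda>n. T * (1 / real (Suc n))) \<longlonglongrightarrow> T * 0" by (intro tendsto_intros LIMSEQ_Suc lim_1_over_n)
    then have "d \<longlonglongrightarrow> 0" by (simp add: d_def[abs_def])
    then show ?thesis using LIMSEQ_subseq_LIMSEQ[OF _ g(2)] by (simp add: comp_def)
  qed
  have vlim: "(\<lambda>n. vn (k n) s) \<longlonglongrightarrow> v (g s) s" if s: "s \<in> {0..T}" for s
  proof -
    define \<tau> where "\<tau> n = real (idx (k n) s) * d (k n)" for n
    have \<tau>: "0 \<le> \<tau> n" "\<bar>\<tau> n - s\<bar> \<le> d (k n)" for n
    proof -
      have "0 \<le> s / d (k n)" using s d[of "k n"] by auto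
      then have "real (idx (k n) s) \<le> s / d (k n)" "s / d (k n) \<le> real (idx (k n) s) + 1"
        unfolding idx_def by linarith+
      then have "\<tau> n \<le> s" "s \<le> \<tau> n + d (k n)"
        using d[of "k n"] unfolding \<tau>_def by (auto simp: pos_le_divide_eq pos_divide_le_eq algebra_simps)
      then show "\<bar>\<tau> n - s\<bar> \<le> d (k n)" by simp
      show "0 \<le> \<tau> n" using d[of "k n"] unfolding \<tau>_def by simp
    qed
    have t_lim: "(\<lambda>n. \<tau> n - s) \<longlonglongrightarrow> 0"
      by (rule Lim_null_comparison[OF _ d_lim]) (use \<tau> in auto)
    then have \<tau>_lim: "\<tau> \<longlonglongrightarrow> s" using LIM_zero_iff by blast
    have "(\<lambda>n. xn (k n) (\<tau> n) - xn (k n) s) \<longlonglongrightarrow> 0"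
    proof (rule Lim_null_comparison)
      show "\<forall>\<^sub>F n in sequentially. norm (xn (k n) (\<tau> n) - xn (k n) s) \<le> K * \<bar>\<tau> n - s\<bar>"
        using lip \<tau>(1) s by auto
      show "(\<lambda>n. K * \<bar>\<tau> n - s\<bar>) \<longlonglongrightarrow> 0" using tendsto_mult[OF tendsto_const[of K] tendsto_rabs[OF t_lim]] by simp
    qed
    then have "(\<lambda>n. (xn (k n) (\<tau> n) - xn (k n) s) + xn (k n) s) \<longlonglongrightarrow> 0 + g s"
      by (intro tendsto_add xlim s)
    then have "(\<lambda>n. p (k n) (idx (k n) s)) \<longlonglongrightarrow> g s" by (simp add: \<tau>_def xn_p)
    then have "(\<lambda>n. (p (k n) (idx (k n) s), \<tau> n)) \<longlonglongrightarrow> (g s, s)" using \<tau>_lim by (rule tendsto_Pair)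
    then have "(\<lambda>n. (\<lambda>p. v (fst p) (snd p)) (p (k n) (idx (k n) s), \<tau> n)) \<longlonglongrightarrow> (\<lambda>p. v (fst p) (snd p)) (g s, s)"
      by (rule continuous_on_tendsto_compose[OF v]) auto
    then show ?thesis by (simp add: vn_def \<tau>_def)
  qed
  show thesis
  proof (rule that[OF g(1)])
    fix t assume t: "t \<in> {0..T}"
    have "(\<lambda>n. LINT s:{0..t}|lborel. vn (k n) s) \<longlonglongrightarrow> (LINT s:{0..t}|lborel. v (g s) s)"
      unfolding set_lebesgue_integral_def
    proof (rule integral_dominated_convergence[where w = "\<lambda>s. K * indicator {0..t} s"])
      show "integrable lborel (\<lambda>s. K * indicator {0..t} s :: real)"
        by (intro integrable_mult_right integrable_real_indicator) (auto simp: emeasure_lborel_Icc_eq)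
      show "AE s in lborel. (\<lambda>n. indicator {0..t} s *\<^sub>R vn (k n) s) \<longlonglongrightarrow> indicator {0..t} s *\<^sub>R v (g s) s"
        using vlim t by (intro AE_I2) (auto simp: indicator_def)
      show "AE s in lborel. norm (indicator {0..t} s *\<^sub>R vn (k n) s) \<le> K * indicator {0..t} s" for n
        using vn_K by (intro AE_I2) (auto simp: indicator_def)
      have "continuous_on {0..t} (\<lambda>s. v (g s) s)"
        by (intro continuous_on_pair_slice[OF v] continuous_on_id continuous_on_subset[OF g(1)]) (use t in auto)
      from borel_integrable_compact[OF _ this]
      show "(\<lambda>s. indicator {0..t} s *\<^sub>R v (g s) s) \<in> borel_measurable lborel" by auto
    qed measurable
    then have "(\<lambda>n. xn (k n) t) \<longlonglongrightarrow> y + (LINT s:{0..t}|lborel. v (g s) s)"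
      unfolding xn_def by (intro tendsto_intros)
    then show "g t = y + (LINT s:{0..t}|lborel. v (g s) s)"
      using xlim[OF t] LIMSEQ_unique by blast
  qed
qed

text \<open>A local bound suffices: the velocity is evaluated at arguments clamped to the box |x -
  y| <= K T, 0 <= s <= T, so it is bounded by K everywhere, and the resulting curve never leaves the
  box in which clamping changes nothing.\<close>

lemma peano:
  fixes v :: "real \<Rightarrow> real \<Rightarrow> real"
  assumes v: "continuous_on UNIV (\<lambda>p. v (fst p) (snd p))" and "0 < T" "0 \<le> K"
    and K: "\<And>x s. \<bar>x - y\<bar> \<le> K * T \<Longrightarrow> s \<in> {0..T} \<Longrightarrow> \<bar>v x s\<bar> \<le> K"
  obtains x where "x 0 = y" "\<And>t. t \<in> {0..T} \<Longrightarrow> \<bar>x t - y\<bar> \<le> K * T"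
    "\<And>t. t \<in> {0..T} \<Longrightarrow> (x has_real_derivative v (x t) t) (at t within {0..T})"
proof -
  define c where "c x = max (y - K * T) (min (y + K * T) x)" for x
  define e where "e s = max 0 (min T s)" for s
  define v' where "v' x s = v (c x) (e s)" for x s
  have KT: "0 \<le> K * T" using assms by simp
  have v'_cont: "continuous_on UNIV (\<lambda>p. v' (fst p) (snd p))"
    unfolding v'_def c_def e_def by (intro continuous_on_pair_slice[OF v] continuous_intros)
  have v'_K: "\<bar>v' x s\<bar> \<le> K" for x s
    unfolding v'_def by (rule K) (use KT \<open>0 < T\<close> in \<open>auto simp: c_def e_def abs_le_iff\<close>)
  obtain x where x: "continuous_on {0..T} x" "\<And>t. t \<in> {0..T} \<Longrightarrow> x t = y + (LINT s:{0..t}|lborel. v' (x s) s)"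
    by (rule peano_bounded[OF v'_cont v'_K \<open>0 < T\<close>, where y = y]) blast
  have cont: "continuous_on {0..T} (\<lambda>s. v' (x s) s)"
    by (intro continuous_on_pair_slice[OF v'_cont] x(1) continuous_on_id)
  have int: "set_integrable lborel {0..t} (\<lambda>s. v' (x s) s)" if "t \<in> {0..T}" for t
    unfolding set_integrable_def
    by (rule borel_integrable_compact) (use that continuous_on_subset[OF cont] in auto)
  have x0: "x 0 = y"
    using x(2)[of 0] \<open>0 < T\<close> set_borel_integral_eq_integral(2)[OF int[of 0]] by simp
  have near: "\<bar>x t - y\<bar> \<le> K * T" if t: "t \<in> {0..T}" for t
  proof -
    have "\<bar>LINT s:{0..t}|lborel. v' (x s) s\<bar> \<le> K * (t - 0)"
      by (rule set_integral_bound_Icc) (use t int v'_K in auto)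
    also have "\<dots> \<le> K * T" using t \<open>0 \<le> K\<close> by (intro mult_left_mono) auto
    finally show ?thesis using x(2)[OF t] by simp
  qed
  show thesis
  proof (rule that[of x])
    show "x 0 = y" by (rule x0)
    show "\<bar>x t - y\<bar> \<le> K * T" if "t \<in> {0..T}" for t by (rule near[OF that])
    fix t assume t: "t \<in> {0..T}"
    have "((\<lambda>t. integral {0..t} (\<lambda>s. v' (x s) s)) has_real_derivative v' (x t) t) (at t within {0..T})"
      by (rule integral_has_real_derivative[OF cont t])
    then have "((\<lambda>t. y + integral {0..t} (\<lambda>s. v' (x s) s)) has_real_derivative v' (x t) t) (at t within {0..T})"
      by (auto intro!: derivative_eq_intros)
    then have "(x has_real_derivative v' (x t) t) (at t within {0..T})"
      by (rule has_field_derivative_transform_within[OF _ zero_less_one t])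
        (use x(2) set_borel_integral_eq_integral(2)[OF int] in auto)
    moreover have "c (x t) = x t" "e t = t"
      using near[OF t] t by (auto simp: c_def e_def abs_le_iff min_def max_def)
    then have "v' (x t) t = v (x t) t" by (simp add: v'_def)
    ultimately show "(x has_real_derivative v (x t) t) (at t within {0..T})" by simp
  qed
qed

section \<open>Existence and reach of characteristics\<close>

context hs_base
begin

definition is_char where
  "is_char T x \<longleftrightarrow> (\<forall>t\<in>{0..T}. (x has_real_derivative u (x t) t) (at t within {0..T}))"

lemma is_char_continuous: "is_char T x \<Longrightarrow> continuous_on {0..T} x"
  unfolding is_char_def by (auto intro!: DERIV_continuous_on)

lemma u_growth: "\<bar>u x t\<bar> \<le> \<bar>u 0 t\<bar> + sqrt (M * \<bar>x\<bar>)"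
proof -
  have *: "(u b t - u a t)\<^sup>2 \<le> M * (b - a)" if "a \<le> b" for a b
  proof -
    have "2 * (F b t - F a t) \<le> M" using F_nonneg[of a t] F_le[of b t] by simp
    then have "(b - a) * (2 * (F b t - F a t)) \<le> (b - a) * M" using that by (intro mult_left_mono) auto
    then show ?thesis using u_diff_sq[OF that, of t] by (simp add: mult.commute)
  qed
  have "(u x t - u 0 t)\<^sup>2 \<le> M * \<bar>x\<bar>"
    using *[of 0 x] *[of x 0] by (cases "0 \<le> x") (auto simp: power2_commute)
  then have "\<bar>u x t - u 0 t\<bar> \<le> sqrt (M * \<bar>x\<bar>)" using real_le_rsqrt by (metis power2_abs)
  then show ?thesis by linarith
qed

text \<open>\<open>u\<close> grows only like the square root of |x|, so there is a speed K with |u|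
  <= K on the ball of radius K T around y. Writing K = A + q, with A a bound for |u| at x = 0, the
  requirement is M (|y| + (A + q) T) <= q^2; it holds for q = M T + r with r^2 = M |y| + M T
  A.\<close>

lemma speed_bound:
  assumes "0 \<le> T"
  obtains A where "A \<ge> 0" "\<And>y x t. t \<in> {0..T} \<Longrightarrow>
     \<bar>x - y\<bar> \<le> (A + M * T + sqrt (M * \<bar>y\<bar> + M * T * A)) * T \<Longrightarrow>
     \<bar>u x t\<bar> \<le> A + M * T + sqrt (M * \<bar>y\<bar> + M * T * A)"
proof -
  obtain A where A: "A \<ge> 0" "\<And>x t. x \<in> {0..0} \<Longrightarrow> t \<in> {0..T} \<Longrightarrow> \<bar>u x t\<bar> \<le> A"
    using continuous_bounded_box[OF u_cont] by metis
  show thesis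
  proof (rule that[OF A(1)])
    fix y x t assume t: "t \<in> {0..T}" and xy: "\<bar>x - y\<bar> \<le> (A + M * T + sqrt (M * \<bar>y\<bar> + M * T * A)) * T"
    define r where "r = sqrt (M * \<bar>y\<bar> + M * T * A)"
    have r: "0 \<le> r" "r\<^sup>2 = M * \<bar>y\<bar> + M * T * A" using M_nonneg A assms by (auto simp: r_def)
    define q where "q = M * T + r"
    have q: "0 \<le> q" "r \<le> q" using r M_nonneg assms by (auto simp: q_def)
    have "\<bar>x\<bar> \<le> \<bar>y\<bar> + (A + q) * T" using xy unfolding r_def[symmetric] q_def by (simp add: add.assoc)
    then have "M * \<bar>x\<bar> \<le> M * (\<bar>y\<bar> + (A + q) * T)" using M_nonneg by (intro mult_left_mono)
    also have "\<dots> = r * r + M * T * q" using r(2) by (simp add: power2_eq_square algebra_simps)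
    also have "\<dots> \<le> q * r + M * T * q" using q r by (intro add_right_mono mult_right_mono) auto
    also have "\<dots> = q\<^sup>2" by (simp add: q_def power2_eq_square algebra_simps)
    finally have "sqrt (M * \<bar>x\<bar>) \<le> q" using q by (simp add: real_le_lsqrt)
    then show "\<bar>u x t\<bar> \<le> A + M * T + sqrt (M * \<bar>y\<bar> + M * T * A)"
      using u_growth[of x t] A(2)[of 0 t] t unfolding r_def[symmetric] q_def by simp
  qed
qed

lemma char_exists:
  assumes "0 < T"
  obtains x where "is_char T x" "x 0 = y"
proof -
  obtain A where A: "A \<ge> 0" "\<And>y x t. t \<in> {0..T} \<Longrightarrow>
     \<bar>x - y\<bar> \<le> (A + M * T + sqrt (M * \<bar>y\<bar> + M * T * A)) * T \<Longrightarrow>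
     \<bar>u x t\<bar> \<le> A + M * T + sqrt (M * \<bar>y\<bar> + M * T * A)"
    using speed_bound[of T] assms by (metis less_imp_le)
  define K where "K = A + M * T + sqrt (M * \<bar>y\<bar> + M * T * A)"
  have "0 \<le> K" using A(1) M_nonneg assms by (simp add: K_def)
  moreover have b: "\<bar>u x s\<bar> \<le> K" if "\<bar>x - y\<bar> \<le> K * T" "s \<in> {0..T}" for x s
    using A(2)[where y = y and x = x and t = s] that unfolding K_def[symmetric] by auto
  ultimately show thesis
  proof (rule peano[OF u_cont \<open>0 < T\<close>])
    fix x assume "x 0 = y" "\<And>t. t \<in> {0..T} \<Longrightarrow> (x has_real_derivative u (x t) t) (at t within {0..T})"
    then show thesis using that[of x] unfolding is_char_def by auto
  qed
qed

text \<open>Peano's theorem for the reversed field. Every point (y, T) is thereby joined to time 0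
  by some characteristic, so that solutions can be compared at arbitrary points.\<close>

lemma backward_char_exists:
  assumes "0 < T"
  obtains x where "is_char T x" "x T = y"
proof -
  obtain A where A: "A \<ge> 0" "\<And>y x t. t \<in> {0..T} \<Longrightarrow>
     \<bar>x - y\<bar> \<le> (A + M * T + sqrt (M * \<bar>y\<bar> + M * T * A)) * T \<Longrightarrow>
     \<bar>u x t\<bar> \<le> A + M * T + sqrt (M * \<bar>y\<bar> + M * T * A)"
    using speed_bound[of T] assms by (metis less_imp_le)
  define K where "K = A + M * T + sqrt (M * \<bar>y\<bar> + M * T * A)"
  have "0 \<le> K" using A(1) M_nonneg assms by (simp add: K_def)
  have c: "continuous_on UNIV (\<lambda>p. - u (fst p) (T - snd p))" by (intro continuous_intros u_continuous)
  have b: "\<bar>- u x (T - s)\<bar> \<le> K" if "\<bar>x - y\<bar> \<le> K * T" "s \<in> {0..T}" for x s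
    using A(2)[where y = y and x = x and t = "T - s"] that unfolding K_def[symmetric] by auto
  obtain x where x: "x 0 = y" "\<And>t. t \<in> {0..T} \<Longrightarrow> (x has_real_derivative - u (x t) (T - t)) (at t within {0..T})"
    by (rule peano[OF c \<open>0 < T\<close> \<open>0 \<le> K\<close> b]) auto
  have "((\<lambda>t. x (T - t)) has_real_derivative u (x (T - t)) t) (at t within {0..T})" if t: "t \<in> {0..T}" for t
  proof -
    have "(x has_real_derivative - u (x (T - t)) t) (at (T - t) within {0..T})"
      using x(2)[of "T - t"] t by simp
    moreover have "(\<lambda>t. T - t) ` {0..T} = {0..T}" by (auto simp: image_iff intro: bexI[of _ "T - _"])
    ultimately have "(x has_real_derivative - u (x (T - t)) t) (at (T - t) within (\<lambda>t. T - t) ` {0..T})" by simp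
    moreover have "((\<lambda>t. T - t) has_real_derivative -1) (at t within {0..T})" by (auto intro!: derivative_eq_intros)
    ultimately show ?thesis
      using DERIV_image_chain[of x "- u (x (T - t)) t" "\<lambda>t. T - t" t "{0..T}" "-1"] by (simp add: comp_def)
  qed
  then show thesis using that[of "\<lambda>t. x (T - t)"] x(1) unfolding is_char_def by simp
qed

text \<open>The displacement in time T grows like the square root of the starting distance, so a
  characteristic that starts far enough out stays out.\<close>

lemma far_chars:
  assumes "0 < T"
  obtains x1 x2 where "is_char T x1" "is_char T x2" "\<And>t. t \<in> {0..T} \<Longrightarrow> x1 t \<le> - N" "\<And>t. t \<in> {0..T} \<Longrightarrow> N \<le> x2 t"
proof -
  obtain A where A: "A \<ge> 0" "\<And>y x t. t \<in> {0..T} \<Longrightarrow>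
     \<bar>x - y\<bar> \<le> (A + M * T + sqrt (M * \<bar>y\<bar> + M * T * A)) * T \<Longrightarrow>
     \<bar>u x t\<bar> \<le> A + M * T + sqrt (M * \<bar>y\<bar> + M * T * A)"
    using speed_bound[of T] assms by (metis less_imp_le)
  \<comment> \<open>With r the square root in K, the inequality 2 r T (M + 1) <= r^2 + T^2 (M + 1)^2
    bounds r T by half of the starting distance Y plus terms collected in L; the other half of Y
    pays for these, for (A + M T) T and for N. Using M + 1 instead of M allows the division.\<close>
  define L where "L = \<bar>N\<bar> + (A + M * T) * T + M * T * A + T\<^sup>2 * (M + 1)"
  define Y where "Y = 2 * L"
  have L: "0 \<le> L" using A(1) M_nonneg assms by (simp add: L_def)
  define K where "K = A + M * T + sqrt (M * Y + M * T * A)"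
  have "0 \<le> K" using A(1) M_nonneg assms L by (simp add: K_def Y_def)
  have far: "Y - K * T \<ge> N"
  proof -
    define r where "r = sqrt (M * Y + M * T * A)"
    have r: "0 \<le> r" "r\<^sup>2 = M * Y + M * T * A" using M_nonneg A assms L by (auto simp: r_def Y_def)
    have "0 \<le> (r - T * (M + 1))\<^sup>2" by simp
    then have "2 * (r * T) * (M + 1) \<le> r\<^sup>2 + T\<^sup>2 * (M + 1)\<^sup>2" by (simp add: power2_eq_square algebra_simps)
    also have "\<dots> \<le> (Y + M * T * A + T\<^sup>2 * (M + 1)) * (M + 1)"
    proof -
      have "0 \<le> Y" "0 \<le> M * T * A * M" using L M_nonneg A(1) assms by (auto simp: Y_def)
      then show ?thesis unfolding r(2) by (simp add: power2_eq_square algebra_simps)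
    qed
    finally have "2 * (r * T) \<le> Y + M * T * A + T\<^sup>2 * (M + 1)"
      using M_nonneg by (simp add: mult_le_cancel_right)
    moreover have "0 \<le> M * T * A" "0 \<le> T\<^sup>2 * (M + 1)" using M_nonneg A(1) assms by auto
    ultimately have "r * T \<le> L + M * T * A + T\<^sup>2 * (M + 1)" unfolding Y_def by linarith
    moreover have "K * T = (A + M * T) * T + r * T" by (simp add: K_def r_def algebra_simps)
    moreover have "2 * L = L + \<bar>N\<bar> + (A + M * T) * T + M * T * A + T\<^sup>2 * (M + 1)" by (simp add: L_def)
    ultimately show ?thesis unfolding Y_def by linarith
  qed
  have ex: "\<exists>x. is_char T x \<and> (\<forall>t\<in>{0..T}. \<bar>x t - y\<bar> \<le> K * T)" if y: "\<bar>y\<bar> = Y" for y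
  proof -
    have b: "\<bar>u x s\<bar> \<le> K" if "\<bar>x - y\<bar> \<le> K * T" "s \<in> {0..T}" for x s
      using A(2)[where y = y and x = x and t = s] that unfolding y K_def[symmetric] by auto
    show ?thesis
    proof (rule peano[OF u_cont \<open>0 < T\<close> \<open>0 \<le> K\<close> b])
      fix x assume "\<And>t. t \<in> {0..T} \<Longrightarrow> \<bar>x t - y\<bar> \<le> K * T"
        "\<And>t. t \<in> {0..T} \<Longrightarrow> (x has_real_derivative u (x t) t) (at t within {0..T})"
      then show ?thesis unfolding is_char_def by (intro exI[of _ x]) auto
    qed
  qed
  have "0 \<le> Y" using L by (simp add: Y_def)
  then obtain x1 x2 where "is_char T x1" "\<forall>t\<in>{0..T}. \<bar>x1 t - (- Y)\<bar> \<le> K * T" "is_char T x2" "\<forall>t\<in>{0..T}. \<bar>x2 t - Y\<bar> \<le> K * T"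
    using ex[of "- Y"] ex[of Y] by auto
  then show thesis using far by (intro that[of x1 x2]) (auto simp: abs_le_iff, (smt (verit) atLeastAtMost_iff)+)
qed

end

section \<open>Transport between characteristics\<close>

context hs_flow
begin

text \<open>With e the energy in a window of width 1/c, Cauchy-Schwarz gives (c |u - u(X)|)^2 <= c
  e. Young's inequality then bounds |w| c |u - u(X)| by w^2/2 + c e/2, whose integral over the
  window is e.\<close>

lemma window_bound:
  fixes q \<beta> :: "real \<Rightarrow> real"
  assumes c: "c \<ge> 1" and [measurable]: "q \<in> borel_measurable borel"
    and q: "\<And>x. x \<in> {X..X + 1/c} \<Longrightarrow> \<bar>q x\<bar> \<le> K * (\<bar>w x s\<bar> * (c * \<bar>u x s - u X s\<bar>))"
    and q0: "\<And>x. x \<notin> {X..X + 1/c} \<Longrightarrow> q x = 0" and K: "0 \<le> K"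
  shows "integrable lborel q" "(LINT x|lborel. \<bar>q x\<bar>) \<le> K * (2 * (F (X + 1/c) s - F X s))"
proof -
  define e where "e = 2 * (F (X + 1/c) s - F X s)"
  have e: "0 \<le> e" using F_mono[of X "X + 1/c" s] c by (simp add: e_def)
  have ew: "(LINT x:{X..X+1/c}|lborel. (w x s)\<^sup>2) = e"
    using F_diff'[of X "X + 1/c" s] c by (simp add: e_def)
  have iw: "integrable lborel (\<lambda>x. indicator {X..X+1/c} x *\<^sub>R (w x s)\<^sup>2)"
    using w_sq_set[of "{X..X+1/c}" s] by (simp add: set_integrable_def)
  have ic: "integrable lborel (\<lambda>x. c * e * indicator {X..X+1/c} x :: real)"
    by (intro integrable_mult_right integrable_real_indicator) (auto simp: emeasure_lborel_Icc_eq)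
  define Q where "Q x = K * (1/2 * (indicator {X..X+1/c} x *\<^sub>R (w x s)\<^sup>2) + 1/2 * (c * e * indicator {X..X+1/c} x))" for x
  have iQ: "integrable lborel Q" unfolding Q_def
    by (intro integrable_mult_right Bochner_Integration.integrable_add iw ic)
  have bound: "\<bar>q x\<bar> \<le> Q x" for x
  proof (cases "x \<in> {X..X + 1/c}")
    case True
    define D where "D = u x s - u X s"
    have "F x s \<le> F (X + 1/c) s" using True by (intro F_mono) auto
    then have "(x - X) * (2 * (F x s - F X s)) \<le> (x - X) * e"
      using True unfolding e_def by (intro mult_left_mono) auto
    then have "D\<^sup>2 \<le> (x - X) * e"
      using u_diff_sq[of X x s] True unfolding D_def by auto
    also have "\<dots> \<le> 1/c * e" using True e by (intro mult_right_mono) auto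
    finally have "c * (c * D\<^sup>2) \<le> c * (c * (1/c * e))" using c by (intro mult_left_mono) auto
    then have "(c * D)\<^sup>2 \<le> c * e" using c by (simp add: power2_eq_square ac_simps)
    moreover have "\<bar>w x s\<bar> * (c * \<bar>D\<bar>) \<le> 1/2 * (w x s)\<^sup>2 + 1/2 * (c * D)\<^sup>2"
      using zero_le_power2[of "\<bar>w x s\<bar> - c * \<bar>D\<bar>"] by (simp add: power2_diff power_mult_distrib)
    ultimately have "\<bar>w x s\<bar> * (c * \<bar>D\<bar>) \<le> 1/2 * (w x s)\<^sup>2 + 1/2 * (c * e)" by linarith
    then have "K * (\<bar>w x s\<bar> * (c * \<bar>D\<bar>)) \<le> K * (1/2 * (w x s)\<^sup>2 + 1/2 * (c * e))" using K by (intro mult_left_mono)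
    then show ?thesis using q[OF True] True unfolding Q_def D_def by simp
  qed (use q0 in \<open>simp add: Q_def\<close>)
  show iq: "integrable lborel q"
    by (rule Bochner_Integration.integrable_bound[OF iQ])
      (use bound in \<open>auto intro!: AE_I2 order_trans[OF bound abs_ge_self]\<close>)
  have "(LINT x|lborel. \<bar>q x\<bar>) \<le> (LINT x|lborel. Q x)"
    by (rule integral_mono[OF integrable_abs[OF iq] iQ bound])
  also have "\<dots> = K * (1/2 * (LINT x|lborel. indicator {X..X+1/c} x *\<^sub>R (w x s)\<^sup>2) + 1/2 * (LINT x|lborel. c * e * indicator {X..X+1/c} x))"
    using iw ic unfolding Q_def by (simp only: integral_mult_right_zero Bochner_Integration.integral_add integrable_mult_right)
  also have "(LINT x|lborel. indicator {X..X+1/c} x *\<^sub>R (w x s)\<^sup>2) = e"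
    using ew by (simp add: set_lebesgue_integral_def)
  also have "(LINT x|lborel. c * e * indicator {X..X+1/c} x) = e" using c by simp
  finally show "(LINT x|lborel. \<bar>q x\<bar>) \<le> K * (2 * (F (X + 1/c) s - F X s))" unfolding e_def by simp
qed

text \<open>The cutoff moves with both characteristics, so \<phi>s + u \<phi>x contains only
  differences of \<open>u\<close> near them, multiplied by bumps of height of order c. There
  \<open>lin\<close> replaces \<beta> by a multiple of |w|, and \<open>window_bound\<close> applies.
  The transport equation \<open>eq\<close> is asked almost everywhere at the values that
  \<open>w\<close> takes, so that \<beta> may be cut off above an upper bound of
  \<open>w\<close>.\<close>

theorem char_transport:
  fixes \<beta> \<beta>w \<beta>s :: "real \<Rightarrow> real \<Rightarrow> real"
  assumes t: "0 \<le> t1" "t1 \<le> t2" "t2 \<le> T" and c1: "is_char T x1" and c2: "is_char T x2"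
    and \<beta>_cont: "continuous_on UNIV (\<lambda>p. \<beta> (fst p) (snd p))"
    and \<beta>w_cont: "continuous_on UNIV (\<lambda>p. \<beta>w (fst p) (snd p))"
    and \<beta>s_cont: "continuous_on UNIV (\<lambda>p. \<beta>s (fst p) (snd p))"
    and \<beta>_Dw: "\<And>y s. s \<in> {t1..t2} \<Longrightarrow> ((\<lambda>y. \<beta> y s) has_real_derivative \<beta>w y s) (at y)"
    and \<beta>_Ds: "\<And>y s. s \<in> {t1..t2} \<Longrightarrow> ((\<lambda>s. \<beta> y s) has_real_derivative \<beta>s y s) (at s within {t1..t2})"
    and \<beta>_supp: "\<And>y s. y \<notin> {-B..B} \<Longrightarrow> \<beta> y s = 0 \<and> \<beta>w y s = 0 \<and> \<beta>s y s = 0"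
    and lin: "\<And>y s. s \<in> {t1..t2} \<Longrightarrow> \<bar>\<beta> y s\<bar> \<le> C * \<bar>y\<bar>"
    and RR: "\<And>s. s \<in> {t1..t2} \<Longrightarrow> \<bar>x1 s\<bar> \<le> R - 1 \<and> \<bar>x2 s\<bar> \<le> R - 1"
    and eq: "\<And>s. s \<in> {t1..t2} \<Longrightarrow> AE x in lborel. x \<in> {-R..R} \<longrightarrow>
       \<beta>s (w x s) s - 1/2 * (w x s)\<^sup>2 * \<beta>w (w x s) s + w x s * \<beta> (w x s) s = 0"
  shows "(LINT x:{x1 t2<..x2 t2}|lborel. \<beta> (w x t2) t2) = (LINT x:{x1 t1<..x2 t1}|lborel. \<beta> (w x t1) t1)"
proof -
  have C: "0 \<le> C" using lin[of t1 1] t by auto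
  have R: "1 \<le> R" using RR[of t1] t by auto
  \<comment> \<open>Freezing time outside [t1, t2] makes the cutoffs continuous on the whole
    plane.\<close>
  define cl where "cl s = max t1 (min t2 s)" for s
  have cl: "cl s \<in> {t1..t2}" "s \<in> {t1..t2} \<Longrightarrow> cl s = s" for s using t by (auto simp: cl_def)
  have cl_cont: "continuous_on S cl" for S unfolding cl_def by (intro continuous_intros)
  have Xc: "continuous_on UNIV (\<lambda>s. x (cl s))" if "is_char T x" for x
  proof (rule continuous_on_compose2[OF is_char_continuous[OF that] cl_cont])
    have "cl s \<in> {0..T}" for s using cl(1)[of s] t by auto
    then show "range cl \<subseteq> {0..T}" by blast
  qed
  have XD: "((\<lambda>s. x (cl s)) has_real_derivative u (x (cl s)) (cl s)) (at s within {t1..t2})"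
    if "is_char T x" "s \<in> {t1..t2}" for x s
  proof -
    have "(x has_real_derivative u (x s) s) (at s within {0..T})" using that t unfolding is_char_def by auto
    then have "(x has_real_derivative u (x s) s) (at s within {t1..t2})" by (rule DERIV_subset) (use t in auto)
    then have "(x has_real_derivative u (x (cl s)) (cl s)) (at s within {t1..t2})" using cl(2)[OF that(2)] by simp
    then show ?thesis
      by (rule has_field_derivative_transform_within[OF _ zero_less_one that(2)]) (use cl in auto)
  qed
  define X1 where "X1 s = x1 (cl s)" for s
  define X2 where "X2 s = x2 (cl s)" for s
  define U1 where "U1 s = u (X1 s) (cl s)" for s
  define U2 where "U2 s = u (X2 s) (cl s)" for s
  have cont: "continuous_on UNIV X1" "continuous_on UNIV X2" using Xc c1 c2 by (simp_all add: X1_def[abs_def] X2_def[abs_def])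
  then have contU: "continuous_on UNIV U1" "continuous_on UNIV U2"
    unfolding U1_def U2_def by (auto intro!: u_continuous cl_cont)
  have conts: "continuous_on UNIV (\<lambda>p::real \<times> real. f (snd p))" if "continuous_on UNIV f" for f :: "real \<Rightarrow> real"
    by (rule continuous_on_compose2[OF that]) (auto intro: continuous_intros)
  have D1: "(X1 has_real_derivative U1 s) (at s within {t1..t2})" "(X2 has_real_derivative U2 s) (at s within {t1..t2})"
    if "s \<in> {t1..t2}" for s
    using XD[OF c1 that] XD[OF c2 that] unfolding X1_def[abs_def] X2_def[abs_def] U1_def U2_def by auto
  have X_bd: "\<bar>X1 s\<bar> \<le> R - 1" "\<bar>X2 s\<bar> \<le> R - 1" for s using RR[OF cl(1)[of s]] by (auto simp: X1_def X2_def)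
  define c where "c n = real (Suc n)" for n
  have c: "c n \<ge> 1" for n by (simp add: c_def)
  define b1 where "b1 n x s = bump (c n * (x - X1 s)) * c n" for n x s
  define b2 where "b2 n x s = bump (c n * (x - X2 s)) * c n" for n x s
  define s1 where "s1 n x s = step (c n * (x - X1 s))" for n x s
  define s2 where "s2 n x s = 1 - step (c n * (x - X2 s))" for n x s
  define \<phi> where "\<phi> n x s = s1 n x s * s2 n x s" for n x s
  define \<phi>x where "\<phi>x n x s = b1 n x s * s2 n x s - s1 n x s * b2 n x s" for n x s
  define \<phi>s where "\<phi>s n x s = - U1 s * (b1 n x s * s2 n x s) + U2 s * (s1 n x s * b2 n x s)" for n x s
  have parts_cont: "continuous_on UNIV (\<lambda>p. b1 n (fst p) (snd p))" "continuous_on UNIV (\<lambda>p. b2 n (fst p) (snd p))"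
    "continuous_on UNIV (\<lambda>p. s1 n (fst p) (snd p))" "continuous_on UNIV (\<lambda>p. s2 n (fst p) (snd p))" for n
    unfolding b1_def b2_def s1_def s2_def
    by (auto intro!: continuous_intros conts[OF cont(1)] conts[OF cont(2)]
        continuous_on_compose2[OF bump_continuous[of UNIV]] continuous_on_compose2[OF step_continuous[of UNIV]])
  have s_bd: "0 \<le> s1 n x s" "s1 n x s \<le> 1" "0 \<le> s2 n x s" "s2 n x s \<le> 1" for n x s
    using step_bounds by (auto simp: s1_def s2_def)
  have window0: "b1 n x s = 0" if "x \<notin> {X1 s..X1 s + 1 / c n}" for n x s
  proof -
    have "c n * (x - X1 s) \<le> 0 \<or> 1 \<le> c n * (x - X1 s)"
      using that c[of n] by (auto simp: mult_le_0_iff not_le field_simps)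
    then show ?thesis by (simp add: b1_def bump_eq_0)
  qed
  have window0': "b2 n x s = 0" if "x \<notin> {X2 s..X2 s + 1 / c n}" for n x s
  proof -
    have "c n * (x - X2 s) \<le> 0 \<or> 1 \<le> c n * (x - X2 s)"
      using that c[of n] by (auto simp: mult_le_0_iff not_le field_simps)
    then show ?thesis by (simp add: b2_def bump_eq_0)
  qed
  \<comment> \<open>The distance of at least 1 from the characteristics to the ends of [-R, R]
    leaves room for the transition layers, which lie to the right of the characteristics and have
    width 1 / c n <= 1.\<close>
  have outside: "s1 n x s = 0 \<and> b1 n x s = 0 \<or> s2 n x s = 0 \<and> b2 n x s = 0" if x: "x \<notin> {-R..R}" for n x s
  proof (cases "x < -R")
    case True
    then have "c n * (x - X1 s) \<le> 0" using X_bd(1)[of s] c[of n] by (intro mult_nonneg_nonpos) auto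
    then show ?thesis by (simp add: s1_def b1_def step_eq_0 bump_eq_0)
  next
    case False
    then have "1 * 1 \<le> c n * (x - X2 s)" using x X_bd(2)[of s] c[of n] by (intro mult_mono) auto
    then show ?thesis by (simp add: s2_def b2_def step_eq_1 bump_eq_0)
  qed
  have supp: "\<phi> n x s = 0 \<and> \<phi>x n x s = 0 \<and> \<phi>s n x s = 0" if x: "x \<notin> {-R..R}" for n x s
    using outside[OF x, of n s] by (auto simp: \<phi>_def \<phi>x_def \<phi>s_def)
  have tp: "test_pair u w M t1 t2 R B \<beta> \<beta>w \<beta>s (\<phi> n) (\<phi>x n) (\<phi>s n)" for n
  proof
    show "continuous_on UNIV (\<lambda>p. \<phi> n (fst p) (snd p))" "continuous_on UNIV (\<lambda>p. \<phi>x n (fst p) (snd p))"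
      "continuous_on UNIV (\<lambda>p. \<phi>s n (fst p) (snd p))"
      unfolding \<phi>_def \<phi>x_def \<phi>s_def
      by (intro continuous_intros parts_cont conts[OF contU(1)] conts[OF contU(2)])+
    show "((\<lambda>x. \<phi> n x s) has_real_derivative \<phi>x n x s) (at x)" for x s
      unfolding \<phi>_def \<phi>x_def s1_def s2_def b1_def b2_def
      by (auto intro!: derivative_eq_intros DERIV_chain2[OF step_DERIV])
    show "((\<lambda>s. \<phi> n x s) has_real_derivative \<phi>s n x s) (at s within {t1..t2})" if "s \<in> {t1..t2}" for x s
      unfolding \<phi>_def \<phi>s_def s1_def s2_def b1_def b2_def
      by (auto intro!: derivative_eq_intros DERIV_chain2[OF step_DERIV] D1[OF that] simp: algebra_simps)
  qed (use t R \<beta>_cont \<beta>w_cont \<beta>s_cont \<beta>_Dw \<beta>_Ds \<beta>_supp supp in auto)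
  have meas [measurable]: "case_prod \<beta> \<in> borel_measurable (borel \<Otimes>\<^sub>M borel)"
    "case_prod \<beta>w \<in> borel_measurable (borel \<Otimes>\<^sub>M borel)" "case_prod \<beta>s \<in> borel_measurable (borel \<Otimes>\<^sub>M borel)"
    "case_prod (\<phi> n) \<in> borel_measurable (borel \<Otimes>\<^sub>M borel)"
    "case_prod (\<phi>x n) \<in> borel_measurable (borel \<Otimes>\<^sub>M borel)" "case_prod (\<phi>s n) \<in> borel_measurable (borel \<Otimes>\<^sub>M borel)" for n
    using test_pair.test_meas[OF tp[of n]] by auto
  define \<rho> where "\<rho> n s = (LINT x|lborel. \<beta> (w x s) s * (\<phi>s n x s + u x s * \<phi>x n x s))" for n s
  have \<rho>_meas [measurable]: "\<rho> n \<in> borel_measurable borel" for n unfolding \<rho>_def by measurable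
  have renorm: "(LINT x|lborel. \<beta> (w x t2) t2 * \<phi> n x t2) - (LINT x|lborel. \<beta> (w x t1) t1 * \<phi> n x t1)
     = (LINT s:{t1..t2}|lborel. \<rho> n s)" for n
  proof -
    have "(LINT x|lborel. (\<beta>s (w x s) s - 1/2 * (w x s)\<^sup>2 * \<beta>w (w x s) s + w x s * \<beta> (w x s) s) * \<phi> n x s
        + \<beta> (w x s) s * (\<phi>s n x s + u x s * \<phi>x n x s)) = \<rho> n s" if s: "s \<in> {t1..t2}" for s
      unfolding \<rho>_def
    proof (rule integral_cong_AE)
      show "AE x in lborel. (\<beta>s (w x s) s - 1/2 * (w x s)\<^sup>2 * \<beta>w (w x s) s + w x s * \<beta> (w x s) s) * \<phi> n x s
        + \<beta> (w x s) s * (\<phi>s n x s + u x s * \<phi>x n x s) = \<beta> (w x s) s * (\<phi>s n x s + u x s * \<phi>x n x s)"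
        using eq[OF s]
      proof (rule eventually_mono)
        fix x assume "x \<in> {-R..R} \<longrightarrow> \<beta>s (w x s) s - 1/2 * (w x s)\<^sup>2 * \<beta>w (w x s) s + w x s * \<beta> (w x s) s = 0"
        then show "(\<beta>s (w x s) s - 1/2 * (w x s)\<^sup>2 * \<beta>w (w x s) s + w x s * \<beta> (w x s) s) * \<phi> n x s
          + \<beta> (w x s) s * (\<phi>s n x s + u x s * \<phi>x n x s) = \<beta> (w x s) s * (\<phi>s n x s + u x s * \<phi>x n x s)"
          using supp[of x n s] by (cases "x \<in> {-R..R}") simp_all
      qed
    qed measurable
    then show ?thesis
      unfolding test_pair.renormalized[OF tp] set_lebesgue_integral_def
      by (intro Bochner_Integration.integral_cong) (auto simp: indicator_def)
  qed
  obtain Cb where Cb: "Cb > 0" "\<And>x. bump x \<le> Cb" using bump_bounded by blast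
  define K where "K = C * Cb"
  have K: "0 \<le> K" using C Cb by (simp add: K_def)
  have \<rho>_bound: "\<bar>\<rho> n s\<bar> \<le> K * (2 * (F (X1 s + 1 / c n) s - F (X1 s) s)) + K * (2 * (F (X2 s + 1 / c n) s - F (X2 s) s))"
    if s: "s \<in> {t1..t2}" for n s
  proof -
    define q1 where "q1 x = \<beta> (w x s) s * ((u x s - u (X1 s) s) * (b1 n x s * s2 n x s))" for x
    define q2 where "q2 x = \<beta> (w x s) s * ((u x s - u (X2 s) s) * (s1 n x s * b2 n x s))" for x
    have [measurable]: "case_prod (b1 n) \<in> borel_measurable (borel \<Otimes>\<^sub>M borel)" "case_prod (b2 n) \<in> borel_measurable (borel \<Otimes>\<^sub>M borel)"
      "case_prod (s1 n) \<in> borel_measurable (borel \<Otimes>\<^sub>M borel)" "case_prod (s2 n) \<in> borel_measurable (borel \<Otimes>\<^sub>M borel)"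
      using parts_cont[of n, THEN borel_measurable_continuous_onI] by (simp_all add: borel_prod case_prod_beta')
    have qm [measurable]: "q1 \<in> borel_measurable borel" "q2 \<in> borel_measurable borel" unfolding q1_def q2_def by measurable
    have prod: "\<bar>b * (d * (p * r))\<bar> \<le> K * (\<bar>y\<bar> * (c n * \<bar>d\<bar>))"
      if "\<bar>b\<bar> \<le> C * \<bar>y\<bar>" "0 \<le> p" "p \<le> Cb * c n" "0 \<le> r" "r \<le> 1" for b d p r y :: real
    proof -
      have "p * r \<le> Cb * c n * 1" using that Cb c[of n] by (intro mult_mono) auto
      then have "\<bar>d\<bar> * (p * r) \<le> \<bar>d\<bar> * (Cb * c n)" by (intro mult_left_mono) auto
      then have "\<bar>b\<bar> * (\<bar>d\<bar> * (p * r)) \<le> (C * \<bar>y\<bar>) * (\<bar>d\<bar> * (Cb * c n))"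
        using that(1,2,4) C by (intro mult_mono[OF that(1)]) auto
      also have "\<dots> = K * (\<bar>y\<bar> * (c n * \<bar>d\<bar>))" by (simp add: K_def ac_simps)
      finally show ?thesis using that by (simp add: abs_mult)
    qed
    have b_bd: "0 \<le> b1 n x s" "b1 n x s \<le> Cb * c n" "0 \<le> b2 n x s" "b2 n x s \<le> Cb * c n" for x
      using Cb(2) bump_nonneg c[of n] unfolding b1_def b2_def by (auto intro!: mult_right_mono)
    have A1: "\<bar>q1 x\<bar> \<le> K * (\<bar>w x s\<bar> * (c n * \<bar>u x s - u (X1 s) s\<bar>))" for x
      unfolding q1_def by (rule prod[OF lin[OF s] b_bd(1,2) s_bd(3,4)])
    have Z1: "q1 x = 0" if "x \<notin> {X1 s..X1 s + 1 / c n}" for x using window0[OF that] by (simp add: q1_def)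
    have B1: "integrable lborel q1" "(LINT x|lborel. \<bar>q1 x\<bar>) \<le> K * (2 * (F (X1 s + 1 / c n) s - F (X1 s) s))"
      by (rule window_bound[OF c qm(1) A1 Z1 K]; assumption)+
    have A2: "\<bar>q2 x\<bar> \<le> K * (\<bar>w x s\<bar> * (c n * \<bar>u x s - u (X2 s) s\<bar>))" for x
      unfolding q2_def mult.commute[of "s1 n x s"] by (rule prod[OF lin[OF s] b_bd(3,4) s_bd(1,2)])
    have Z2: "q2 x = 0" if "x \<notin> {X2 s..X2 s + 1 / c n}" for x using window0'[OF that] by (simp add: q2_def)
    have B2: "integrable lborel q2" "(LINT x|lborel. \<bar>q2 x\<bar>) \<le> K * (2 * (F (X2 s + 1 / c n) s - F (X2 s) s))"
      by (rule window_bound[OF c qm(2) A2 Z2 K]; assumption)+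
    \<comment> \<open>Each bump moves with the speed of its characteristic, so only the difference
      between u(x) and that speed survives.\<close>
    have "\<beta> (w x s) s * (\<phi>s n x s + u x s * \<phi>x n x s) = q1 x - q2 x" for x
      using cl(2)[OF s] by (simp add: \<phi>s_def \<phi>x_def q1_def q2_def U1_def U2_def algebra_simps)
    then have "\<rho> n s = (LINT x|lborel. q1 x) - (LINT x|lborel. q2 x)" using B1(1) B2(1) by (simp add: \<rho>_def)
    then show ?thesis
      using integral_abs_bound[of lborel q1] integral_abs_bound[of lborel q2] B1(2) B2(2) by linarith
  qed
  have FF: "2 * (F (X + 1 / c n) s - F X s) \<le> M" for X n s
    using F_nonneg[of X s] F_le[of "X + 1 / c n" s] by simp
  have "(\<lambda>n. LINT s:{t1..t2}|lborel. \<rho> n s) \<longlonglongrightarrow> (LINT s:{t1..t2}|lborel. 0)"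
    unfolding set_lebesgue_integral_def
  proof (rule integral_dominated_convergence[where w = "\<lambda>s. (K * M + K * M) * indicator {t1..t2} s"])
    show "integrable lborel (\<lambda>s. (K * M + K * M) * indicator {t1..t2} s :: real)"
      by (intro integrable_mult_right integrable_real_indicator) (auto simp: emeasure_lborel_Icc_eq)
    have lim: "(\<lambda>n. \<rho> n s) \<longlonglongrightarrow> 0" if s: "s \<in> {t1..t2}" for s
    proof (rule Lim_null_comparison)
      show "\<forall>\<^sub>F n in sequentially. norm (\<rho> n s) \<le> K * (2 * (F (X1 s + 1 / c n) s - F (X1 s) s)) + K * (2 * (F (X2 s + 1 / c n) s - F (X2 s) s))"
        using \<rho>_bound[OF s] by simp
      have Fl: "(\<lambda>n. F (X + 1 / c n) s) \<longlonglongrightarrow> F X s" for X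
      proof (rule continuous_on_tendsto_compose[OF F_continuous])
        have "(\<lambda>n. X + 1 / c n) \<longlonglongrightarrow> X + 0" unfolding c_def by (intro tendsto_intros LIMSEQ_Suc lim_1_over_n)
        then show "(\<lambda>n. X + 1 / c n) \<longlonglongrightarrow> X" by simp
      qed auto
      have "(\<lambda>n. K * (2 * (F (X1 s + 1 / c n) s - F (X1 s) s)) + K * (2 * (F (X2 s + 1 / c n) s - F (X2 s) s)))
        \<longlonglongrightarrow> K * (2 * (F (X1 s) s - F (X1 s) s)) + K * (2 * (F (X2 s) s - F (X2 s) s))"
        by (intro tendsto_add tendsto_mult tendsto_diff tendsto_const Fl)
      then show "(\<lambda>n. K * (2 * (F (X1 s + 1 / c n) s - F (X1 s) s)) + K * (2 * (F (X2 s + 1 / c n) s - F (X2 s) s))) \<longlonglongrightarrow> 0"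
        by simp
    qed
    show "AE s in lborel. (\<lambda>n. indicator {t1..t2} s *\<^sub>R \<rho> n s) \<longlonglongrightarrow> indicator {t1..t2} s *\<^sub>R 0"
      using lim by (intro AE_I2) (auto simp: indicator_def)
    have bd: "\<bar>\<rho> n s\<bar> \<le> K * M + K * M" if s: "s \<in> {t1..t2}" for n s
      using \<rho>_bound[OF s, of n] mult_left_mono[OF FF[of "X1 s" n s] K] mult_left_mono[OF FF[of "X2 s" n s] K] by linarith
    show "AE s in lborel. norm (indicator {t1..t2} s *\<^sub>R \<rho> n s) \<le> (K * M + K * M) * indicator {t1..t2} s" for n
      using bd by (intro AE_I2) (auto simp: indicator_def)
  qed measurable
  then have L1: "(\<lambda>n. LINT s:{t1..t2}|lborel. \<rho> n s) \<longlonglongrightarrow> 0" by (simp add: set_lebesgue_integral_def)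
  have ends: "(\<lambda>n. LINT x|lborel. \<beta> (w x s) s * \<phi> n x s) \<longlonglongrightarrow> (LINT x:{x1 s<..x2 s}|lborel. \<beta> (w x s) s)"
    if s: "s \<in> {t1..t2}" for s
    unfolding set_lebesgue_integral_def
  proof (rule integral_dominated_convergence[where w = "\<lambda>x. C * (indicator {-R..R} x *\<^sub>R \<bar>w x s\<bar>)"])
    show "integrable lborel (\<lambda>x. C * (indicator {-R..R} x *\<^sub>R \<bar>w x s\<bar>))"
      using set_integrable_abs[OF w_set] unfolding set_integrable_def by (intro integrable_mult_right)
    have "(\<lambda>n. \<beta> (w x s) s * \<phi> n x s) \<longlonglongrightarrow> indicator {x1 s<..x2 s} x *\<^sub>R \<beta> (w x s) s" for x
    proof -
      have "(\<lambda>n. \<beta> (w x s) s * \<phi> n x s) \<longlonglongrightarrow> \<beta> (w x s) s * ((if x > X1 s then 1 else 0) * (1 - (if x > X2 s then 1 else 0)))"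
        unfolding \<phi>_def s1_def s2_def c_def by (intro tendsto_intros step_scaled_tendsto)
      moreover have "X1 s = x1 s" "X2 s = x2 s" using cl(2)[OF s] by (simp_all add: X1_def X2_def)
      ultimately show ?thesis by (auto simp: indicator_def split: if_splits)
    qed
    then show "AE x in lborel. (\<lambda>n. \<beta> (w x s) s * \<phi> n x s) \<longlonglongrightarrow> indicator {x1 s<..x2 s} x *\<^sub>R \<beta> (w x s) s" by simp
    have "norm (\<beta> (w x s) s * \<phi> n x s) \<le> C * (indicator {-R..R} x *\<^sub>R \<bar>w x s\<bar>)" for n x
    proof (cases "x \<in> {-R..R}")
      case True
      have "0 \<le> \<phi> n x s" "\<phi> n x s \<le> 1" unfolding \<phi>_def using s_bd[of n x s] by (auto intro: mult_le_one)
      then have "\<bar>\<beta> (w x s) s\<bar> * \<bar>\<phi> n x s\<bar> \<le> (C * \<bar>w x s\<bar>) * 1" using lin[OF s] C by (intro mult_mono) auto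
      then show ?thesis using True by (simp add: abs_mult)
    qed (use supp in auto)
    then show "AE x in lborel. norm (\<beta> (w x s) s * \<phi> n x s) \<le> C * (indicator {-R..R} x *\<^sub>R \<bar>w x s\<bar>)" for n by simp
  qed measurable
  have "(\<lambda>n. (LINT x|lborel. \<beta> (w x t2) t2 * \<phi> n x t2) - (LINT x|lborel. \<beta> (w x t1) t1 * \<phi> n x t1))
    \<longlonglongrightarrow> (LINT x:{x1 t2<..x2 t2}|lborel. \<beta> (w x t2) t2) - (LINT x:{x1 t1<..x2 t1}|lborel. \<beta> (w x t1) t1)"
    by (intro tendsto_diff ends) (use t in auto)
  then show ?thesis using LIMSEQ_unique[OF L1] unfolding renorm by fastforce
qed

end

section \<open>Evolution along characteristics\<close>

context hs_base
begin

lemma is_char_restrict: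
  assumes "is_char T x" "t \<le> T" shows "is_char t x"
  unfolding is_char_def
proof
  fix s assume "s \<in> {0..t}"
  then have "(x has_real_derivative u (x s) s) (at s within {0..T})" using assms unfolding is_char_def by auto
  then show "(x has_real_derivative u (x s) s) (at s within {0..t})" by (rule DERIV_subset) (use assms in auto)
qed

text \<open>Shifting a window exchanges two pieces of length at most |a - b|, and on each of them
  the source is at most M/2.\<close>

lemma F_mean_lipschitz:
  assumes "0 \<le> \<delta>"
  shows "\<bar>(LINT y:{a..a+\<delta>}|lborel. F y s) - (LINT y:{b..b+\<delta>}|lborel. F y s)\<bar> \<le> M * \<bar>a - b\<bar>"
proof -
  have i: "set_integrable lborel {p..q} (\<lambda>y. F y s)" for p q
    by (rule set_integral_continuous_HK(2)[OF F_continuous])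
  have *: "\<bar>(LINT y:{a..a+\<delta>}|lborel. F y s) - (LINT y:{b..b+\<delta>}|lborel. F y s)\<bar> \<le> M * (b - a)" if "a \<le> b" for a b
  proof -
    have "(LINT y:{a..b+\<delta>}|lborel. F y s) = (LINT y:{a..a+\<delta>}|lborel. F y s) + (LINT y:{a+\<delta>..b+\<delta>}|lborel. F y s)"
      "(LINT y:{a..b+\<delta>}|lborel. F y s) = (LINT y:{a..b}|lborel. F y s) + (LINT y:{b..b+\<delta>}|lborel. F y s)"
      using that assms by (auto intro!: set_integral_split i)
    moreover have "\<bar>LINT y:{a+\<delta>..b+\<delta>}|lborel. F y s\<bar> \<le> M/2 * ((b + \<delta>) - (a + \<delta>))"
      "\<bar>LINT y:{a..b}|lborel. F y s\<bar> \<le> M/2 * (b - a)"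
      using that F_abs_le by (intro set_integral_bound_Icc i; simp)+
    ultimately show ?thesis by (simp add: algebra_simps)
  qed
  show ?thesis using *[of a b] *[of b a] by (cases "a \<le> b") (auto simp: abs_minus_commute)
qed

end

context hs_flow
begin

text \<open>With a and b the values of \<open>u\<close> at the ends of the window, the motion of the
  window contributes (b - a) a and the fluxes contribute a^2/2 - b^2/2; together this is the perfect
  square - (b - a)^2 / 2.\<close>

lemma mean_along_char:
  assumes "0 < \<delta>" and ch: "is_char T x" and "0 \<le> T"
  shows "(P (x T + \<delta>) T - P (x T) T) - (P (x 0 + \<delta>) 0 - P (x 0) 0)
    = (LINT s:{0..T}|lborel. (LINT y:{x s..x s + \<delta>}|lborel. F y s) - 1/2 * (u (x s + \<delta>) s - u (x s) s)\<^sup>2)"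
proof -
  define X where "X s = x (max 0 (min T s))" for s
  have X_eq: "X s = x s" if "s \<in> {0..T}" for s using that by (simp add: X_def)
  have X_cont: "continuous_on UNIV X" unfolding X_def
    by (rule continuous_on_compose2[OF is_char_continuous[OF ch]]) (use \<open>0 \<le> T\<close> in \<open>auto intro!: continuous_intros\<close>)
  have X_cont2: "continuous_on S g \<Longrightarrow> continuous_on S (\<lambda>z. X (g z))" for S and g :: "'z::topological_space \<Rightarrow> real"
    by (rule continuous_on_compose2[OF X_cont]) auto
  define D where "D z s = P (z + \<delta>) s - P z s" for z s
  \<comment> \<open>The first time argument places the window, the second evaluates the fields. An
    increment then splits into moving the window at a fixed time and letting time pass over a fixed
    window.\<close>
  define A where "A r s = (u (X r + \<delta>) s - u (X r) s) * u (X r) r" for r s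
  define B where "B r s = 1/2 * (u (X r) s)\<^sup>2 - 1/2 * (u (X r + \<delta>) s)\<^sup>2" for r s
  define I where "I r s = (LINT y:{X r..X r + \<delta>}|lborel. F y s)" for r s
  define \<gamma> where "\<gamma> s = A s s + (B s s + I s s)" for s
  have A_cont: "continuous_on UNIV (\<lambda>p. A (fst p) (snd p))" unfolding A_def
    by (intro continuous_intros u_continuous X_cont2)
  have B_cont: "continuous_on UNIV (\<lambda>p. B (fst p) (snd p))" unfolding B_def
    by (intro continuous_intros u_continuous X_cont2)
  have [measurable]: "X \<in> borel_measurable borel" by (rule borel_measurable_continuous_onI[OF X_cont])
  have AB_meas [measurable]: "(\<lambda>s. A s s) \<in> borel_measurable borel" "(\<lambda>s. B s s) \<in> borel_measurable borel"
    by (intro borel_measurable_continuous_onI continuous_on_pair_slice[OF A_cont] continuous_on_pair_slice[OF B_cont] continuous_on_id)+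
  have I_alt: "I r s = (LINT y|lborel. (if X r \<le> y \<and> y \<le> X r + \<delta> then F y s else 0))" for r s
    unfolding I_def set_lebesgue_integral_def
    by (rule Bochner_Integration.integral_cong) (auto simp: indicator_def)
  have I_meas [measurable]: "(\<lambda>s. I r s) \<in> borel_measurable borel" "(\<lambda>s. I s s) \<in> borel_measurable borel" for r
    unfolding I_alt by measurable
  have I_bound: "\<bar>I r s\<bar> \<le> M/2 * \<delta>" for r s
    using set_integral_bound_Icc[OF _ set_integral_continuous_HK(2)[OF F_continuous], of "X r" "X r + \<delta>" s "M/2"] F_abs_le \<open>0 < \<delta>\<close>
    unfolding I_def by simp
  obtain C1 where C1: "C1 \<ge> 0" "\<And>r s. r \<in> {0..T} \<Longrightarrow> s \<in> {0..T} \<Longrightarrow> \<bar>A r s\<bar> \<le> C1"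
    using continuous_bounded_box[OF A_cont] by metis
  obtain C2 where C2: "C2 \<ge> 0" "\<And>r s. r \<in> {0..T} \<Longrightarrow> s \<in> {0..T} \<Longrightarrow> \<bar>B r s\<bar> \<le> C2"
    using continuous_bounded_box[OF B_cont] by metis
  have B_slice: "(\<lambda>s. B r s) \<in> borel_measurable borel" for r
    by (intro borel_measurable_continuous_onI continuous_on_pair_slice[OF B_cont] continuous_intros)
  have BI_int: "set_integrable lborel {a..b} (\<lambda>s. B r s + I r s)" if "0 \<le> a" "b \<le> T" "r \<in> {0..T}" for a b r
  proof (rule set_integrable_bounded_Icc[of _ _ _ "C2 + M/2 * \<delta>"])
    show "\<bar>B r s + I r s\<bar> \<le> C2 + M/2 * \<delta>" if "s \<in> {a..b}" for s
      using C2(2)[of r s] I_bound[of r s] that \<open>0 \<le> a\<close> \<open>b \<le> T\<close> \<open>r \<in> {0..T}\<close> by (simp add: abs_le_iff) linarith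
  qed (use B_slice I_meas(1) in measurable)
  have \<gamma>_int: "set_integrable lborel {0..T} \<gamma>"
  proof (rule set_integrable_bounded_Icc[of _ _ _ "C1 + (C2 + M/2 * \<delta>)"])
    show "\<bar>\<gamma> s\<bar> \<le> C1 + (C2 + M/2 * \<delta>)" if "s \<in> {0..T}" for s
      using C1(2)[OF that that] C2(2)[OF that that] I_bound[of s s] unfolding \<gamma>_def by linarith
    show "\<gamma> \<in> borel_measurable borel" unfolding \<gamma>_def by measurable
  qed
  have "D (x T) T - D (x 0) 0 = (LINT s:{0..T}|lborel. \<gamma> s)"
  proof (rule increment_eq_integral[OF \<open>0 \<le> T\<close> \<gamma>_int])
    fix e :: real assume "e > 0"
    define e' where "e' = e / 3"
    define eM where "eM = e' / (M + 1)"
    have e': "e' > 0" "eM > 0" "M * eM \<le> e'"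
      using \<open>e > 0\<close> M_nonneg by (auto simp: e'_def eM_def field_simps)
    let ?Q = "{0..T} \<times> {0..T}"
    have ucAB: "uniformly_continuous_on ?Q (\<lambda>p. A (fst p) (snd p))" "uniformly_continuous_on ?Q (\<lambda>p. B (fst p) (snd p))"
      by (intro compact_uniformly_continuous continuous_on_subset[OF A_cont] continuous_on_subset[OF B_cont] compact_Times compact_Icc; simp)+
    have ucX: "uniformly_continuous_on {0..T} X"
      by (intro compact_uniformly_continuous continuous_on_subset[OF X_cont]) auto
    obtain d1 where d1: "d1 > 0" "\<And>p q. p \<in> ?Q \<Longrightarrow> q \<in> ?Q \<Longrightarrow> dist q p < d1 \<Longrightarrow> dist (A (fst q) (snd q)) (A (fst p) (snd p)) < e'"
      using uniformly_continuous_onE[OF ucAB(1) e'(1)] by metis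
    obtain d2 where d2: "d2 > 0" "\<And>p q. p \<in> ?Q \<Longrightarrow> q \<in> ?Q \<Longrightarrow> dist q p < d2 \<Longrightarrow> dist (B (fst q) (snd q)) (B (fst p) (snd p)) < e'"
      using uniformly_continuous_onE[OF ucAB(2) e'(1)] by metis
    obtain d3 where d3: "d3 > 0" "\<And>p q. p \<in> {0..T} \<Longrightarrow> q \<in> {0..T} \<Longrightarrow> dist q p < d3 \<Longrightarrow> dist (X q) (X p) < eM"
      using uniformly_continuous_onE[OF ucX e'(2)] by metis
    define d where "d = min (d1 / 2) (min (d2 / 2) d3)"
    have "d > 0" using d1 d2 d3 by (simp add: d_def)
    have close: "\<bar>A r1 s1 - A r2 s2\<bar> \<le> e'" "\<bar>B r1 s1 - B r2 s2\<bar> \<le> e'"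
      if "r1 \<in> {0..T}" "r2 \<in> {0..T}" "s1 \<in> {0..T}" "s2 \<in> {0..T}" "\<bar>r1 - r2\<bar> < d" "\<bar>s1 - s2\<bar> < d" for r1 r2 s1 s2
    proof -
      have "dist (r1, s1) (r2, s2) \<le> \<bar>r1 - r2\<bar> + \<bar>s1 - s2\<bar>"
        unfolding dist_prod_def by (rule order_trans[OF sqrt_sum_squares_le_sum_abs]) (simp add: dist_real_def)
      then have "dist (r1, s1) (r2, s2) < d1" "dist (r1, s1) (r2, s2) < d2" using that by (auto simp: d_def)
      then show "\<bar>A r1 s1 - A r2 s2\<bar> \<le> e'" "\<bar>B r1 s1 - B r2 s2\<bar> \<le> e'"
        using d1(2)[of "(r2, s2)" "(r1, s1)"] d2(2)[of "(r2, s2)" "(r1, s1)"] that by (auto simp: dist_real_def)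
    qed
    show "\<exists>d>0. \<forall>t t'. 0 \<le> t \<longrightarrow> t \<le> t' \<longrightarrow> t' \<le> T \<longrightarrow> t' - t < d \<longrightarrow>
        \<bar>D (x t') t' - D (x t) t - (LINT s:{t..t'}|lborel. \<gamma> s)\<bar> \<le> e * (t' - t)"
    proof (intro exI[of _ d] conjI allI impI)
      fix t t' assume t: "0 \<le> t" "t \<le> t'" "t' \<le> T" "t' - t < d"
      have first: "\<exists>\<eta>\<in>{t..t'}. D (x t') t' - D (x t) t' = A \<eta> t' * (t' - t)"
      proof (cases "t = t'")
        case False
        then have "t < t'" using t by simp
        have der: "((\<lambda>s. D (x s) t') has_derivative (\<lambda>h. A s t' * h)) (at s within {t..t'})" if s: "t \<le> s" "s \<le> t'" for s
        proof -
          have "(x has_real_derivative u (x s) s) (at s within {0..T})" using ch s t unfolding is_char_def by auto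
          then have xd: "(x has_real_derivative u (x s) s) (at s within {t..t'})" by (rule DERIV_subset) (use t in auto)
          have "((\<lambda>s. D (x s) t') has_real_derivative u (x s + \<delta>) t' * u (x s) s - u (x s) t' * u (x s) s) (at s within {t..t'})"
            unfolding D_def by (auto intro!: derivative_eq_intros DERIV_chain2[OF P_DERIV] xd)
          moreover have "A s t' = u (x s + \<delta>) t' * u (x s) s - u (x s) t' * u (x s) s"
            using X_eq[of s] s t by (simp add: A_def left_diff_distrib)
          ultimately show ?thesis by (simp only: has_field_derivative_def)
        qed
        obtain \<eta> where "\<eta> \<in> {t<..<t'}" "D (x t') t' - D (x t) t' = A \<eta> t' * (t' - t)"
          using mvt_simple[OF \<open>t < t'\<close> der] by blast
        then show ?thesis by (intro bexI[of _ \<eta>]) auto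
      qed (auto intro: bexI[of _ t])
      then obtain \<eta> where \<eta>: "\<eta> \<in> {t..t'}" "D (x t') t' - D (x t) t' = A \<eta> t' * (t' - t)" by blast
      have second: "D (x t) t' - D (x t) t = (LINT s:{t..t'}|lborel. B t s + I t s)"
        using mean_increment[OF _ t(1,2), of "x t" "x t + \<delta>"] \<open>0 < \<delta>\<close> X_eq[of t] t
        unfolding D_def mean_rate_def B_def I_def by simp
      have ic: "set_integrable lborel {t..t'} (\<lambda>s. A \<eta> t')" by (simp add: set_integrable_def emeasure_lborel_Icc_eq)
      have ib: "set_integrable lborel {t..t'} (\<lambda>s. B t s + I t s)" by (rule BI_int) (use t in auto)
      have ig: "set_integrable lborel {t..t'} \<gamma>" by (rule set_integrable_subset[OF \<gamma>_int]) (use t in auto)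
      have "D (x t') t' - D (x t) t - (LINT s:{t..t'}|lborel. \<gamma> s)
         = (LINT s:{t..t'}|lborel. A \<eta> t') + (LINT s:{t..t'}|lborel. B t s + I t s) - (LINT s:{t..t'}|lborel. \<gamma> s)"
        using \<eta>(2) second t by (simp add: set_lebesgue_integral_def mult.commute)
      also have "\<dots> = (LINT s:{t..t'}|lborel. (A \<eta> t' + (B t s + I t s)) - \<gamma> s)"
        using ic ib ig by (simp only: set_integral_add set_integral_diff)
      also have "\<bar>\<dots>\<bar> \<le> e * (t' - t)"
      proof (rule set_integral_bound_Icc[OF t(2)])
        show "set_integrable lborel {t..t'} (\<lambda>s. (A \<eta> t' + (B t s + I t s)) - \<gamma> s)"
          by (rule set_integral_diff(1)[OF set_integral_add(1)[OF ic ib] ig])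
        fix s assume s: "s \<in> {t..t'}"
        have "\<bar>A \<eta> t' - A s s\<bar> \<le> e'" by (rule close(1)) (use s \<eta> t in auto)
        moreover have "\<bar>B t s - B s s\<bar> \<le> e'" by (rule close(2)) (use s t \<open>d > 0\<close> in auto)
        moreover have "\<bar>I t s - I s s\<bar> \<le> e'"
        proof -
          have "\<bar>X t - X s\<bar> \<le> eM" using d3(2)[of s t] s t by (auto simp: dist_real_def d_def)
          then have "M * \<bar>X t - X s\<bar> \<le> M * eM" using M_nonneg by (intro mult_left_mono)
          then show ?thesis using F_mean_lipschitz[of \<delta> "X t" s "X s"] e'(3) \<open>0 < \<delta>\<close> unfolding I_def by simp
        qed
        ultimately show "\<bar>(A \<eta> t' + (B t s + I t s)) - \<gamma> s\<bar> \<le> e" unfolding \<gamma>_def e'_def by linarith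
      qed
      finally show "\<bar>D (x t') t' - D (x t) t - (LINT s:{t..t'}|lborel. \<gamma> s)\<bar> \<le> e * (t' - t)" .
    qed (rule \<open>d > 0\<close>)
  qed
  also have "\<dots> = (LINT s:{0..T}|lborel. (LINT y:{x s..x s + \<delta>}|lborel. F y s) - 1/2 * (u (x s + \<delta>) s - u (x s) s)\<^sup>2)"
    unfolding set_lebesgue_integral_def[of lborel "{0..T}"]
  proof (rule Bochner_Integration.integral_cong[OF refl])
    fix s
    show "indicator {0..T} s *\<^sub>R \<gamma> s = indicator {0..T} s *\<^sub>R ((LINT y:{x s..x s + \<delta>}|lborel. F y s) - 1/2 * (u (x s + \<delta>) s - u (x s) s)\<^sup>2)"
      using X_eq[of s] unfolding \<gamma>_def A_def B_def I_def
      by (cases "s \<in> {0..T}") (simp_all add: power2_eq_square algebra_simps)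
  qed
  finally show ?thesis unfolding D_def .
qed

text \<open>After division by the window length \<delta> the squared difference is at most F(x +
  \<delta>) - F(x), which vanishes with \<delta> because \<open>F\<close> is continuous in x. So the
  balance of means becomes an equation along each characteristic, unique or not.\<close>

theorem u_along_char:
  assumes ch: "is_char T x" and "0 \<le> T"
  shows "u (x T) T = u (x 0) 0 + (LINT s:{0..T}|lborel. F (x s) s)"
proof -
  define X where "X s = x (max 0 (min T s))" for s
  have X_eq: "X s = x s" if "s \<in> {0..T}" for s using that by (simp add: X_def)
  have X_cont: "continuous_on UNIV X" unfolding X_def
    by (rule continuous_on_compose2[OF is_char_continuous[OF ch]]) (use \<open>0 \<le> T\<close> in \<open>auto intro!: continuous_intros\<close>)
  have [measurable]: "X \<in> borel_measurable borel" by (rule borel_measurable_continuous_onI[OF X_cont])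
  define g where "g n s = ((LINT y:{X s..X s + hh n}|lborel. F y s) - 1/2 * (u (X s + hh n) s - u (X s) s)\<^sup>2) / hh n" for n s
  have g_alt: "g n s = ((LINT y|lborel. (if X s \<le> y \<and> y \<le> X s + hh n then F y s else 0)) - 1/2 * (u (X s + hh n) s - u (X s) s)\<^sup>2) / hh n" for n s
    unfolding g_def set_lebesgue_integral_def
    by (intro arg_cong2[where f = "(/)"] arg_cong2[where f = "(-)"] Bochner_Integration.integral_cong) (auto simp: indicator_def)
  have [measurable]: "g n \<in> borel_measurable borel" for n unfolding g_alt by measurable
  have quot: "(\<lambda>n. (P (z + hh n) t - P z t) / hh n) \<longlonglongrightarrow> u z t" for z t
    by (rule difference_quotient_tendsto[OF P_DERIV]) (use hh in auto)
  have eq: "(P (x T + hh n) T - P (x T) T) / hh n - (P (x 0 + hh n) 0 - P (x 0) 0) / hh n = (LINT s:{0..T}|lborel. g n s)" for n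
  proof -
    have "(P (x T + hh n) T - P (x T) T) / hh n - (P (x 0 + hh n) 0 - P (x 0) 0) / hh n
      = (LINT s:{0..T}|lborel. (LINT y:{x s..x s + hh n}|lborel. F y s) - 1/2 * (u (x s + hh n) s - u (x s) s)\<^sup>2) / hh n"
      using mean_along_char[OF hh(1) ch \<open>0 \<le> T\<close>, of n] by (simp add: diff_divide_distrib[symmetric])
    also have "\<dots> = (LINT s:{0..T}|lborel. ((LINT y:{x s..x s + hh n}|lborel. F y s) - 1/2 * (u (x s + hh n) s - u (x s) s)\<^sup>2) / hh n)"
      by (simp only: set_integral_divide_zero)
    also have "\<dots> = (LINT s:{0..T}|lborel. g n s)"
      unfolding set_lebesgue_integral_def[of lborel "{0..T}"]
      by (rule Bochner_Integration.integral_cong[OF refl]) (use X_eq in \<open>auto simp: g_def indicator_def\<close>)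
    finally show ?thesis .
  qed
  have sq: "0 \<le> 1/2 * (u (z + h) s - u z s)\<^sup>2 / h" "1/2 * (u (z + h) s - u z s)\<^sup>2 / h \<le> F (z + h) s - F z s" if "h > 0" for z h s
  proof -
    show "0 \<le> 1/2 * (u (z + h) s - u z s)\<^sup>2 / h" using that by simp
    have "(u (z + h) s - u z s)\<^sup>2 \<le> h * (2 * (F (z + h) s - F z s))" using u_diff_sq[of z "z + h" s] that by simp
    then have "1/2 * (u (z + h) s - u z s)\<^sup>2 / h \<le> 1/2 * (h * (2 * (F (z + h) s - F z s))) / h"
      using that by (intro divide_right_mono mult_left_mono) auto
    then show "1/2 * (u (z + h) s - u z s)\<^sup>2 / h \<le> F (z + h) s - F z s" using that by simp
  qed
  have "(\<lambda>n. LINT s:{0..T}|lborel. g n s) \<longlonglongrightarrow> (LINT s:{0..T}|lborel. F (X s) s)"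
    unfolding set_lebesgue_integral_def[of lborel "{0..T}"]
  proof (rule integral_dominated_convergence[where w = "\<lambda>s. M * indicator {0..T} s"])
    show "integrable lborel (\<lambda>s. M * indicator {0..T} s :: real)"
      by (intro integrable_mult_right integrable_real_indicator) (auto simp: emeasure_lborel_Icc_eq)
    have lim: "(\<lambda>n. g n s) \<longlonglongrightarrow> F (X s) s" for s
    proof -
      define PF where "PF x = (LBINT y=ereal 0..ereal x. F y s)" for x
      have D: "(PF has_real_derivative F z s) (at z)" for z unfolding PF_def by (rule primitive_DERIV[OF F_continuous])
      have 1: "(LINT y:{X s..X s + hh n}|lborel. F y s) / hh n = (PF (X s + hh n) - PF (X s)) / hh n" for n
        using FTC_continuous[OF D F_continuous, of "X s" "X s + hh n"] hh(1)[of n] by simp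
      have "(\<lambda>n. (LINT y:{X s..X s + hh n}|lborel. F y s) / hh n) \<longlonglongrightarrow> F (X s) s"
        unfolding 1 by (rule difference_quotient_tendsto[OF D]) (use hh in auto)
      moreover have "(\<lambda>n. 1/2 * (u (X s + hh n) s - u (X s) s)\<^sup>2 / hh n) \<longlonglongrightarrow> 0"
      proof (rule real_tendsto_sandwich[OF _ _ tendsto_const])
        have "(\<lambda>n. X s + hh n) \<longlonglongrightarrow> X s + 0" by (intro tendsto_intros hh)
        then have "(\<lambda>n. F (X s + hh n) s) \<longlonglongrightarrow> F (X s) s"
          using continuous_on_tendsto_compose[OF F_continuous, of "\<lambda>n. X s + hh n" "X s"] by simp
        then show "(\<lambda>n. F (X s + hh n) s - F (X s) s) \<longlonglongrightarrow> 0" using LIM_zero by blast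
      qed (use sq[OF hh(1)] in \<open>simp_all only: eventually_True\<close>)
      ultimately have "(\<lambda>n. (LINT y:{X s..X s + hh n}|lborel. F y s) / hh n - 1/2 * (u (X s + hh n) s - u (X s) s)\<^sup>2 / hh n) \<longlonglongrightarrow> F (X s) s - 0"
        by (rule tendsto_diff)
      then show ?thesis unfolding g_def by (simp add: diff_divide_distrib)
    qed
    then show "AE s in lborel. (\<lambda>n. indicator {0..T} s *\<^sub>R g n s) \<longlonglongrightarrow> indicator {0..T} s *\<^sub>R F (X s) s"
      by (intro AE_I2 tendsto_scaleR tendsto_const)
    have bd: "\<bar>g n s\<bar> \<le> M" for n s
    proof -
      have "\<bar>LINT y:{X s..X s + hh n}|lborel. F y s\<bar> \<le> M/2 * (X s + hh n - X s)"
        by (rule set_integral_bound_Icc)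
          (use hh(1)[of n] F_abs_le set_integral_continuous_HK(2)[OF F_continuous] in auto)
      then have "\<bar>(LINT y:{X s..X s + hh n}|lborel. F y s) / hh n\<bar> \<le> M/2"
        using hh(1)[of n] by (simp add: abs_divide pos_divide_le_eq)
      moreover have "\<bar>1/2 * (u (X s + hh n) s - u (X s) s)\<^sup>2 / hh n\<bar> \<le> M/2"
        using sq[OF hh(1), of "X s" n s] F_nonneg[of "X s" s] F_le[of "X s + hh n" s] by linarith
      ultimately show ?thesis unfolding g_def diff_divide_distrib by linarith
    qed
    then show "AE s in lborel. norm (indicator {0..T} s *\<^sub>R g n s) \<le> M * indicator {0..T} s" for n
      by (intro AE_I2) (auto simp: indicator_def)
  qed measurable
  moreover have "(\<lambda>n. (P (x T + hh n) T - P (x T) T) / hh n - (P (x 0 + hh n) 0 - P (x 0) 0) / hh n) \<longlonglongrightarrow> u (x T) T - u (x 0) 0"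
    by (intro tendsto_diff quot)
  ultimately have "u (x T) T - u (x 0) 0 = (LINT s:{0..T}|lborel. F (X s) s)"
    unfolding eq using LIMSEQ_unique by blast
  also have "\<dots> = (LINT s:{0..T}|lborel. F (x s) s)"
    unfolding set_lebesgue_integral_def[of lborel "{0..T}"]
    by (rule Bochner_Integration.integral_cong[OF refl]) (use X_eq in \<open>auto simp: indicator_def\<close>)
  finally show ?thesis by simp
qed

end

section \<open>Conserved quantities and the one-sided bound\<close>

lemma smooth1_id: "smooth1 (\<lambda>x. x)"
  by (rule smooth1_I[OF DERIV_ident smooth1_const])

lemma deriv_eq_0_outside:
  fixes G :: "real \<Rightarrow> real"
  assumes "\<And>z. z \<notin> {a..b} \<Longrightarrow> G z = 0" "z \<notin> {a..b}"
  shows "deriv G z = 0"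
proof -
  have "((\<lambda>z. 0) has_real_derivative 0) (at z)" by simp
  then have "(G has_real_derivative 0) (at z)"
    by (rule has_field_derivative_transform_within_open[of _ _ _ "- {a..b}"]) (use assms in auto)
  then show ?thesis by (rule DERIV_imp_deriv)
qed

context hs_base
begin

lemma is_char_bounded:
  assumes "is_char T x" obtains R where "\<And>s. s \<in> {0..T} \<Longrightarrow> \<bar>x s\<bar> \<le> R"
proof -
  have "bounded (x ` {0..T})"
    by (intro compact_imp_bounded compact_continuous_image is_char_continuous assms) auto
  then obtain R where "\<forall>y\<in>x ` {0..T}. norm y \<le> R" unfolding bounded_iff by blast
  then show thesis using that[of R] by auto
qed

end

context hs_flow
begin

text \<open>Along smooth solutions \<open>w / (1 - s w / 2)\<close> is constant and \<open>(1 - s w / 2)\<^sup>2\<close> is the density of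
  a transported measure, so the combination below is conserved. The bound \<open>L T < 2\<close> keeps its
  support away from the blow-up of negative values.\<close>

lemma homogeneous_transport:
  assumes H: "\<And>z. (H has_real_derivative H' z) (at z)" and g_cont: "continuous_on UNIV H'"
    and supp: "\<And>z. z \<notin> {-L..K} \<Longrightarrow> H z = 0" "\<And>z. z \<notin> {-L..K} \<Longrightarrow> H' z = 0"
    and L: "0 \<le> L" "L * T < 2" and K: "0 \<le> K" and T: "0 < T"
    and Gz: "\<And>z. \<bar>H z\<bar> \<le> z\<^sup>2"
    and c1: "is_char T x1" and c2: "is_char T x2"
  shows "(LINT x:{x1 T<..x2 T}|lborel. if 0 < 1 - T * w x T / 2
      then (1 - T * w x T / 2)\<^sup>2 * H (w x T / (1 - T * w x T / 2)) else 0)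
    = (LINT x:{x1 0<..x2 0}|lborel. H (w x 0))"
proof -
  define cl where "cl s = max 0 (min T s)" for s
  have cl: "0 \<le> cl s" "cl s \<le> T" "s \<in> {0..T} \<Longrightarrow> cl s = s" for s using T by (auto simp: cl_def)
  have cl_cont: "continuous_on S f \<Longrightarrow> continuous_on S (\<lambda>z. cl (f z))" for S and f :: "'z::topological_space \<Rightarrow> real"
    unfolding cl_def by (intro continuous_intros)
  define a where "a y s = 1 - cl s * y / 2" for y s
  define \<Gamma> where "\<Gamma> h y s = (if 0 < a y s then h (y / a y s) else 0)" for h :: "real \<Rightarrow> real" and y s
  have G_cont: "continuous_on UNIV H" using H by (intro continuous_at_imp_continuous_on ballI DERIV_isCont)
  have a_cont: "continuous_on S (\<lambda>p. a (fst p) (snd p))" for S unfolding a_def by (intro continuous_intros cl_cont) auto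
  have a_nonpos: "y > 0 \<and> K * a y s < y" if "a y s \<le> 0" for y s
  proof -
    have "0 < cl s * y" using that by (simp add: a_def)
    then have "0 < y" using cl(1)[of s] by (simp add: zero_less_mult_iff)
    moreover have "K * a y s \<le> 0" using K that by (rule mult_nonneg_nonpos)
    ultimately show ?thesis by linarith
  qed
  have \<Gamma>0: "\<Gamma> h y s = 0" if "K * a y s < y" "\<And>z. z > K \<Longrightarrow> h z = 0" for h y s
    using that by (auto simp: \<Gamma>_def pos_less_divide_eq)
  have \<Gamma>_cont: "continuous_on UNIV (\<lambda>p. \<Gamma> h (fst p) (snd p))"
    if h: "continuous_on UNIV h" "\<And>z. z > K \<Longrightarrow> h z = 0" for h
  proof -
    \<comment> \<open>The quotient y / a is singular where \<open>a\<close> vanishes. Wherever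
      \<open>a\<close> is nonpositive, K * a < y holds, and on the open set described by this
      inequality \<Gamma> is zero; so continuity can be checked on two open sets that cover the
      plane.\<close>
    define O1 where "O1 = {p. 0 < a (fst p) (snd p)}"
    define O2 where "O2 = {p. K * a (fst p) (snd p) < fst p}"
    have "open O1" unfolding O1_def by (rule open_Collect_less) (intro continuous_intros a_cont)+
    have "open O2" unfolding O2_def by (rule open_Collect_less) (intro continuous_intros a_cont)+
    have 1: "continuous_on O1 (\<lambda>p. \<Gamma> h (fst p) (snd p))"
    proof (rule continuous_on_eq)
      show "continuous_on O1 (\<lambda>p. h (fst p / a (fst p) (snd p)))"
        by (rule continuous_on_compose2[OF h(1)]) (auto intro!: continuous_intros a_cont simp: O1_def)
    qed (simp add: \<Gamma>_def O1_def)
    have 2: "continuous_on O2 (\<lambda>p. \<Gamma> h (fst p) (snd p))"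
      by (rule continuous_on_eq[OF continuous_on_const[of _ 0]]) (use \<Gamma>0[OF _ h(2)] in \<open>simp add: O2_def\<close>)
    have "O1 \<union> O2 = UNIV"
    proof -
      have "p \<in> O1 \<union> O2" for p using a_nonpos[of "fst p" "snd p"] by (cases "0 < a (fst p) (snd p)") (auto simp: O1_def O2_def)
      then show ?thesis by blast
    qed
    then show ?thesis using continuous_on_open_Un[OF \<open>open O1\<close> \<open>open O2\<close> 1 2] by simp
  qed
  have GK: "H z = 0" "H' z = 0" if "z > K" for z using supp that by auto
  define \<beta> where "\<beta> y s = (a y s)\<^sup>2 * \<Gamma> H y s" for y s
  define \<beta>w where "\<beta>w y s = - cl s * a y s * \<Gamma> H y s + \<Gamma> H' y s" for y s
  define \<beta>s where "\<beta>s y s = - y * a y s * \<Gamma> H y s + 1/2 * y\<^sup>2 * \<Gamma> H' y s" for y s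
  \<comment> \<open>If the quotient z lies in [-L, K], then y (1 + s z / 2) = z. For negative z the
    factor is at least m since s <= T, so y >= - L / m; for z >= 0 one has y <= z.\<close>
  define m where "m = 1 - L * T / 2"
  have m: "0 < m" "m \<le> 1" using L T by (auto simp: m_def)
  define B where "B = max L K / m"
  have B: "L / m \<le> B" "K \<le> B" "0 \<le> B"
  proof -
    show "L / m \<le> B" unfolding B_def using m by (intro divide_right_mono) auto
    have "K \<le> K / m" using m K by (simp add: pos_le_divide_eq mult_left_le)
    also have "\<dots> \<le> B" unfolding B_def using m by (intro divide_right_mono) auto
    finally show "K \<le> B" .
    then show "0 \<le> B" using K by simp
  qed
  have outside: "\<Gamma> h y s = 0" if h: "\<And>z. z \<notin> {-L..K} \<Longrightarrow> h z = 0" and y: "y \<notin> {-B..B}" for h y s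
  proof (cases "0 < a y s")
    case True
    have "y / a y s \<notin> {-L..K}"
    proof
      assume z: "y / a y s \<in> {-L..K}"
      define z where "z = y / a y s"
      have yz: "y = z * a y s" using True by (simp add: z_def)
      show False
      proof (cases "0 \<le> z")
        case True
        then have "0 \<le> y" using yz \<open>0 < a y s\<close> by (metis less_imp_le mult_nonneg_nonneg)
        then have "a y s \<le> 1" using cl(1)[of s] by (simp add: a_def)
        then have "y \<le> z * 1" using True by (subst yz) (rule mult_left_mono)
        then show False using z y B \<open>0 \<le> y\<close> by (auto simp: z_def)
      next
        case False
        then have "y < 0" using yz \<open>0 < a y s\<close> by (metis mult_neg_pos not_le)
        have "y * (1 + cl s * z / 2) = z" using yz by (simp add: a_def algebra_simps)
        have "cl s * (- z) \<le> T * L" using cl z False T by (intro mult_mono) (auto simp: z_def)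
        then have "m \<le> 1 + cl s * z / 2" by (simp add: m_def mult.commute)
        then have "y * (1 + cl s * z / 2) \<le> y * m" using \<open>y < 0\<close> by (intro mult_left_mono_neg) auto
        then have "- L \<le> y * m" using \<open>y * (1 + cl s * z / 2) = z\<close> z by (simp add: z_def)
        then have "(- y) * m \<le> L" by simp
        then have "- y \<le> L / m" using m by (simp only: pos_le_divide_eq)
        then show False using y B \<open>y < 0\<close> by auto
      qed
    qed
    then show ?thesis using True h by (simp add: \<Gamma>_def)
  qed (simp add: \<Gamma>_def)
  have zero_case: "\<Gamma> H y s = 0" "\<Gamma> H' y s = 0" if "\<not> 0 < a y s" for y s using that by (auto simp: \<Gamma>_def)
  have Dw: "((\<lambda>y. \<beta> y s) has_real_derivative \<beta>w y s) (at y)" if s: "s \<in> {0..T}" for y s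
  proof (cases "0 < a y s")
    case True
    define a0 where "a0 = 1 - s * y / 2"
    have a0: "0 < a0" "a y s = a0" using True cl(3)[OF s] by (auto simp: a_def a0_def)
    have q: "((\<lambda>y. y / (1 - s * y / 2)) has_real_derivative 1 / a0\<^sup>2) (at y)"
      using a0 by (auto intro!: derivative_eq_intros simp: a0_def power2_eq_square)
    have p: "((\<lambda>y. (1 - s * y / 2)\<^sup>2) has_real_derivative - s * a0) (at y)"
      by (auto intro!: derivative_eq_intros simp: a0_def)
    have "((\<lambda>y. (1 - s * y / 2)\<^sup>2 * H (y / (1 - s * y / 2))) has_real_derivative
        - s * a0 * H (y / a0) + (H' (y / a0) * (1 / a0\<^sup>2)) * a0\<^sup>2) (at y)"
      using DERIV_mult[OF p DERIV_chain2[OF H q]] by (simp add: a0_def)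
    then have "((\<lambda>y. (1 - s * y / 2)\<^sup>2 * H (y / (1 - s * y / 2))) has_real_derivative \<beta>w y s) (at y)"
      using a0 cl(3)[OF s] True by (simp add: \<beta>w_def \<Gamma>_def)
    then show ?thesis
    proof (rule has_field_derivative_transform_within_open)
      show "open {y. 0 < 1 - s * y / 2}" by (auto intro!: open_Collect_less continuous_intros)
      show "y \<in> {y. 0 < 1 - s * y / 2}" using a0 by (simp add: a0_def)
    qed (use cl(3)[OF s] in \<open>simp add: \<beta>_def \<Gamma>_def a_def\<close>)
  next
    case False
    have "((\<lambda>y. 0) has_real_derivative \<beta>w y s) (at y)" using zero_case[OF False] by (simp add: \<beta>w_def)
    then show ?thesis
    proof (rule has_field_derivative_transform_within_open)
      show "open {y. K * (1 - s * y / 2) < y}" by (auto intro!: open_Collect_less continuous_intros)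
      show "y \<in> {y. K * (1 - s * y / 2) < y}" using a_nonpos[of y s] False cl(3)[OF s] by (simp add: a_def)
      show "0 = \<beta> x s" if "x \<in> {y. K * (1 - s * y / 2) < y}" for x
        using \<Gamma>0[of x s H] GK that cl(3)[OF s] by (simp add: \<beta>_def a_def)
    qed
  qed
  have Ds: "((\<lambda>s. \<beta> y s) has_real_derivative \<beta>s y s) (at s within {0..T})" if s: "s \<in> {0..T}" for y s
  proof -
    define \<beta>0 where "\<beta>0 s = (if 0 < 1 - s * y / 2 then (1 - s * y / 2)\<^sup>2 * H (y / (1 - s * y / 2)) else 0)" for s
    have "(\<beta>0 has_real_derivative \<beta>s y s) (at s)"
    proof (cases "0 < a y s")
      case True
      define a0 where "a0 = 1 - s * y / 2"
      have a0: "0 < a0" "a y s = a0" using True cl(3)[OF s] by (auto simp: a_def a0_def)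
      have q: "((\<lambda>s. y / (1 - s * y / 2)) has_real_derivative 1/2 * y\<^sup>2 / a0\<^sup>2) (at s)"
        using a0 by (auto intro!: derivative_eq_intros simp: a0_def power2_eq_square)
      have p: "((\<lambda>s. (1 - s * y / 2)\<^sup>2) has_real_derivative - y * a0) (at s)"
        by (auto intro!: derivative_eq_intros simp: a0_def)
      have "((\<lambda>s. (1 - s * y / 2)\<^sup>2 * H (y / (1 - s * y / 2))) has_real_derivative
          - y * a0 * H (y / a0) + (H' (y / a0) * (1/2 * y\<^sup>2 / a0\<^sup>2)) * a0\<^sup>2) (at s)"
        using DERIV_mult[OF p DERIV_chain2[OF H q]] by (simp add: a0_def)
      then have "((\<lambda>s. (1 - s * y / 2)\<^sup>2 * H (y / (1 - s * y / 2))) has_real_derivative \<beta>s y s) (at s)"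
        using a0 cl(3)[OF s] True by (simp add: \<beta>s_def \<Gamma>_def mult.commute)
      then show ?thesis
      proof (rule has_field_derivative_transform_within_open)
        show "open {s. 0 < 1 - s * y / 2}" by (auto intro!: open_Collect_less continuous_intros)
        show "s \<in> {s. 0 < 1 - s * y / 2}" using a0 by (simp add: a0_def)
      qed (simp add: \<beta>0_def)
    next
      case False
      have "((\<lambda>y. 0) has_real_derivative \<beta>s y s) (at s)" using zero_case[OF False] by (simp add: \<beta>s_def)
      then show ?thesis
      proof (rule has_field_derivative_transform_within_open)
        show "open {s. K * (1 - s * y / 2) < y}" by (auto intro!: open_Collect_less continuous_intros)
        show "s \<in> {s. K * (1 - s * y / 2) < y}" using a_nonpos[of y s] False cl(3)[OF s] by (simp add: a_def)
        show "0 = \<beta>0 x" if x: "x \<in> {s. K * (1 - s * y / 2) < y}" for x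
        proof (cases "0 < 1 - x * y / 2")
          case True
          then have "K < y / (1 - x * y / 2)" using x by (simp add: pos_less_divide_eq)
          then show ?thesis using GK by (simp add: \<beta>0_def)
        qed (simp add: \<beta>0_def)
      qed
    qed
    then have "(\<beta>0 has_real_derivative \<beta>s y s) (at s within {0..T})" by (rule has_field_derivative_at_within)
    then show ?thesis
      by (rule has_field_derivative_transform_within[OF _ zero_less_one s])
        (use cl(3) in \<open>simp add: \<beta>0_def \<beta>_def \<Gamma>_def a_def\<close>)
  qed
  obtain R1 R2 where "\<And>s. s \<in> {0..T} \<Longrightarrow> \<bar>x1 s\<bar> \<le> R1" "\<And>s. s \<in> {0..T} \<Longrightarrow> \<bar>x2 s\<bar> \<le> R2"
    using is_char_bounded c1 c2 by metis
  then have RR: "\<bar>x1 s\<bar> \<le> (max R1 R2 + 1) - 1 \<and> \<bar>x2 s\<bar> \<le> (max R1 R2 + 1) - 1" if "s \<in> {0..T}" for s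
    using that by (auto simp: le_max_iff_disj)
  have "(LINT x:{x1 T<..x2 T}|lborel. \<beta> (w x T) T) = (LINT x:{x1 0<..x2 0}|lborel. \<beta> (w x 0) 0)"
  proof (rule char_transport[OF order_refl _ order_refl c1 c2 _ _ _ Dw Ds _ _ RR])
    show "continuous_on UNIV (\<lambda>p. \<beta> (fst p) (snd p))" "continuous_on UNIV (\<lambda>p. \<beta>w (fst p) (snd p))"
      "continuous_on UNIV (\<lambda>p. \<beta>s (fst p) (snd p))"
      unfolding \<beta>_def \<beta>w_def \<beta>s_def
      using a_cont[of UNIV] cl_cont[OF continuous_on_snd[OF continuous_on_id[of UNIV]]]
        \<Gamma>_cont[OF G_cont GK(1)] \<Gamma>_cont[OF g_cont GK(2)]
      by (auto intro!: continuous_intros)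
    show "\<beta> y s = 0 \<and> \<beta>w y s = 0 \<and> \<beta>s y s = 0" if "y \<notin> {-B..B}" for y s
      using outside[of H y s, OF supp(1) that] outside[of H' y s, OF supp(2) that] by (simp add: \<beta>_def \<beta>w_def \<beta>s_def)
    \<comment> \<open>\<beta> is at most y^2 and vanishes for |y| > B, whence the linear bound that
      transport between characteristics asks for.\<close>
    show "\<bar>\<beta> y s\<bar> \<le> B * \<bar>y\<bar>" for y s
    proof (cases "y \<in> {-B..B} \<and> 0 < a y s")
      case True
      have "\<bar>\<beta> y s\<bar> \<le> (a y s)\<^sup>2 * (y / a y s)\<^sup>2"
        using True Gz[of "y / a y s"] by (simp add: \<beta>_def \<Gamma>_def abs_mult mult_left_mono)
      also have "\<dots> = \<bar>y\<bar> * \<bar>y\<bar>" using True by (simp add: power_divide power2_eq_square)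
      also have "\<dots> \<le> B * \<bar>y\<bar>" using True by (intro mult_right_mono) auto
      finally show ?thesis .
    next
      case False
      then have "\<beta> y s = 0" using outside[of H y s, OF supp(1)] by (auto simp: \<beta>_def \<Gamma>_def)
      then show ?thesis using B by simp
    qed
    \<comment> \<open>The terms with the derivative of \<open>H\<close> cancel. The others share the
      factor \<open>a\<close> - 1 + \<open>cl s\<close> * y / 2, which is zero by the definition of
      \<open>a\<close>.\<close>
    have "\<beta>s y s - 1/2 * y\<^sup>2 * \<beta>w y s + y * \<beta> y s = 0" for y s
      unfolding \<beta>_def \<beta>w_def \<beta>s_def a_def by (simp add: algebra_simps power2_eq_square)
    then show "AE x in lborel. x \<in> {- (max R1 R2 + 1)..max R1 R2 + 1} \<longrightarrow>
       \<beta>s (w x s) s - 1/2 * (w x s)\<^sup>2 * \<beta>w (w x s) s + w x s * \<beta> (w x s) s = 0" for s by simp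
  qed (use T in auto)
  moreover have "\<beta> y T = (if 0 < 1 - T * y / 2 then (1 - T * y / 2)\<^sup>2 * H (y / (1 - T * y / 2)) else 0)" for y
    using cl(3)[of T] T by (simp add: \<beta>_def \<Gamma>_def a_def)
  moreover have "\<beta> y 0 = H y" for y using cl(3)[of 0] T by (simp add: \<beta>_def \<Gamma>_def a_def)
  ultimately show ?thesis by simp
qed

text \<open>For H(z) = z^2 the factor (1 - T w / 2)^2 cancels and the density is w^2 itself. The
  Riccati flow over time T maps initial values above -2/T onto values below 2/T, hence the two
  restrictions; the square is reached as a limit of compactly supported smooth
  \<open>H n\<close>.\<close>

theorem conserved:
  assumes T: "0 < T" and c1: "is_char T x1" and c2: "is_char T x2"
  shows "(LINT x:{x1 T<..x2 T}|lborel. (w x T)\<^sup>2 * (if w x T < 2 / T then 1 else 0))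
    = (LINT x:{x1 0<..x2 0}|lborel. (w x 0)\<^sup>2 * (if - (2 / T) < w x 0 then 1 else 0))"
proof -
  define N where "N n = real (Suc n)" for n
  have N: "0 < N n" for n by (simp add: N_def)
  \<comment> \<open>Zero for z <= -2/T + 1/N, one between -2/T + 2/N and N, and zero beyond N + 1.
    The gap of 1/N at the threshold gives L T < 2.\<close>
  define \<eta> where "\<eta> n z = step (N n * z + (N n * (2 / T) - 1)) * (1 - step (1 * z + (- N n)))" for n z
  define H where "H n z = z * z * \<eta> n z" for n z
  have G_smooth: "smooth1 (H n)" for n
    unfolding H_def[abs_def] \<eta>_def
    by (intro smooth1_mult smooth1_id smooth1_diff smooth1_const smooth1_affine smooth1_step)
  have \<eta>_bd: "0 \<le> \<eta> n z" "\<eta> n z \<le> 1" for n z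
    unfolding \<eta>_def using step_bounds by (auto intro!: mult_nonneg_nonneg mult_le_one)
  define L where "L n = max 0 (2 / T - 1 / N n)" for n
  have supp: "H n z = 0" if "z \<notin> {- L n..N n + 1}" for n z
  proof (cases "z > N n + 1")
    case True then show ?thesis by (simp add: H_def \<eta>_def step_eq_1)
  next
    case False
    then have "z < - (2 / T - 1 / N n)" using that by (auto simp: L_def)
    then have "N n * z \<le> N n * (- (2 / T - 1 / N n))" using N[of n] by (intro mult_left_mono) auto
    also have "\<dots> = - (N n * (2 / T) - 1)" using N[of n] by (simp add: right_diff_distrib)
    finally show ?thesis by (simp add: H_def \<eta>_def step_eq_0)
  qed
  have eq: "(LINT x:{x1 T<..x2 T}|lborel. if 0 < 1 - T * w x T / 2
      then (1 - T * w x T / 2)\<^sup>2 * H n (w x T / (1 - T * w x T / 2)) else 0)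
    = (LINT x:{x1 0<..x2 0}|lborel. H n (w x 0))" for n
  proof (rule homogeneous_transport[OF smooth1_DERIV[OF G_smooth] smooth1_continuous[OF smooth1_deriv[OF G_smooth]] supp])
    show "z \<notin> {- L n..N n + 1} \<Longrightarrow> deriv (H n) z = 0" for z by (rule deriv_eq_0_outside[OF supp])
    show "L n * T < 2" using T N[of n] by (auto simp: L_def max_def left_diff_distrib)
    show "\<bar>H n z\<bar> \<le> z\<^sup>2" for z
    proof -
      have "\<bar>z * z\<bar> * \<bar>\<eta> n z\<bar> \<le> \<bar>z * z\<bar> * 1" using \<eta>_bd[of n z] by (intro mult_left_mono) auto
      then show ?thesis by (simp add: H_def abs_mult power2_eq_square)
    qed
  qed (use T N[of n] c1 c2 in \<open>auto simp: L_def\<close>)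
  have big: "\<exists>n0. \<forall>n\<ge>n0. b \<le> N n * c" if "c > 0" for b c
  proof -
    obtain n0 :: nat where "b / c < real n0" using reals_Archimedean2 by blast
    then have "b \<le> N n * c" if "n \<ge> n0" for n
      using that \<open>c > 0\<close> by (simp add: N_def pos_divide_less_eq) (smt (verit) mult_right_mono of_nat_mono)
    then show ?thesis by blast
  qed
  have \<eta>_lim: "(\<lambda>n. \<eta> n z) \<longlonglongrightarrow> (if - (2 / T) < z then 1 else 0)" for z
  proof (cases "- (2 / T) < z")
    case True
    then obtain n1 where n1: "\<And>n. n \<ge> n1 \<Longrightarrow> 2 \<le> N n * (z + 2 / T)" using big[of "z + 2 / T" 2] by auto
    obtain n2 where n2: "\<And>n. n \<ge> n2 \<Longrightarrow> z \<le> N n * 1" using big[of 1 z] by auto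
    have "\<eta> n z = 1" if "n \<ge> max n1 n2" for n
      using n1[of n] n2[of n] that by (simp add: \<eta>_def step_eq_0 step_eq_1 distrib_left)
    then show ?thesis using True by (intro tendsto_eventually eventually_sequentiallyI[of "max n1 n2"]) simp
  next
    case False
    have "\<eta> n z = 0" for n
    proof -
      have "N n * (z + 2 / T) \<le> 0" using False N[of n] by (intro mult_nonneg_nonpos) auto
      then show ?thesis by (simp add: \<eta>_def step_eq_0 distrib_left)
    qed
    then show ?thesis using False by simp
  qed
  have \<eta>_meas [measurable]: "\<eta> n \<in> borel_measurable borel" for n unfolding \<eta>_def by measurable
  have iw: "integrable lborel (\<lambda>x. indicator A x *\<^sub>R (w x t)\<^sup>2)" if "A \<in> sets borel" for A t
    using w_sq_set[OF that] by (simp add: set_integrable_def)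
  have "(\<lambda>n. LINT x:{x1 0<..x2 0}|lborel. H n (w x 0)) \<longlonglongrightarrow> (LINT x:{x1 0<..x2 0}|lborel. (w x 0)\<^sup>2 * (if - (2 / T) < w x 0 then 1 else 0))"
    unfolding set_lebesgue_integral_def
  proof (rule integral_dominated_convergence[where w = "\<lambda>x. indicator {x1 0<..x2 0} x *\<^sub>R (w x 0)\<^sup>2"])
    show "AE x in lborel. (\<lambda>n. indicator {x1 0<..x2 0} x *\<^sub>R H n (w x 0)) \<longlonglongrightarrow>
      indicator {x1 0<..x2 0} x *\<^sub>R ((w x 0)\<^sup>2 * (if - (2 / T) < w x 0 then 1 else 0))"
      unfolding H_def power2_eq_square by (intro AE_I2 tendsto_scaleR tendsto_const tendsto_mult \<eta>_lim)
    show "AE x in lborel. norm (indicator {x1 0<..x2 0} x *\<^sub>R H n (w x 0)) \<le> indicator {x1 0<..x2 0} x *\<^sub>R (w x 0)\<^sup>2" for n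
      using \<eta>_bd[of n] by (intro AE_I2) (auto simp: indicator_def H_def abs_mult power2_eq_square intro!: mult_left_le)
    show "(\<lambda>x. indicator {x1 0<..x2 0} x *\<^sub>R H n (w x 0)) \<in> borel_measurable lborel" for n unfolding H_def by measurable
  qed (use iw in auto)
  moreover have "(\<lambda>n. LINT x:{x1 T<..x2 T}|lborel. if 0 < 1 - T * w x T / 2
      then (1 - T * w x T / 2)\<^sup>2 * H n (w x T / (1 - T * w x T / 2)) else 0) \<longlonglongrightarrow>
     (LINT x:{x1 T<..x2 T}|lborel. (w x T)\<^sup>2 * (if w x T < 2 / T then 1 else 0))"
    unfolding set_lebesgue_integral_def
  proof (rule integral_dominated_convergence[where w = "\<lambda>x. indicator {x1 T<..x2 T} x *\<^sub>R (w x T)\<^sup>2"])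
    have expr: "(if 0 < 1 - T * y / 2 then (1 - T * y / 2)\<^sup>2 * H n (y / (1 - T * y / 2)) else 0)
       = y\<^sup>2 * (if y < 2 / T then \<eta> n (y / (1 - T * y / 2)) else 0)" for y n
    proof -
      have pos: "0 < 1 - T * y / 2 \<longleftrightarrow> y < 2 / T" using T by (simp add: pos_less_divide_eq mult.commute)
      show ?thesis
      proof (cases "y < 2 / T")
        case True
        then have "1 - T * y / 2 \<noteq> 0" using pos by auto
        then have e: "(1 - T * y / 2)\<^sup>2 * (y / (1 - T * y / 2) * (y / (1 - T * y / 2))) = y\<^sup>2"
          by (simp add: power2_eq_square)
        have "(1 - T * y / 2)\<^sup>2 * H n (y / (1 - T * y / 2))
          = (1 - T * y / 2)\<^sup>2 * (y / (1 - T * y / 2) * (y / (1 - T * y / 2))) * \<eta> n (y / (1 - T * y / 2))"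
          by (simp only: H_def mult.assoc)
        then show ?thesis using True pos unfolding e by simp
      qed (use pos in simp)
    qed
    have lim: "(\<lambda>n. y\<^sup>2 * (if y < 2 / T then \<eta> n (y / (1 - T * y / 2)) else 0)) \<longlonglongrightarrow> y\<^sup>2 * (if y < 2 / T then 1 else 0)" for y
    proof (cases "y < 2 / T")
      case True
      then have "0 < 1 - T * y / 2" using T by (simp add: pos_less_divide_eq mult.commute)
      moreover have "- (2 / T) * (1 - T * y / 2) < y" using T by (simp add: algebra_simps)
      ultimately have "- (2 / T) < y / (1 - T * y / 2)" by (simp only: pos_less_divide_eq)
      then have "(\<lambda>n. \<eta> n (y / (1 - T * y / 2))) \<longlonglongrightarrow> 1" using \<eta>_lim[of "y / (1 - T * y / 2)"] by simp
      then have "(\<lambda>n. y\<^sup>2 * \<eta> n (y / (1 - T * y / 2))) \<longlonglongrightarrow> y\<^sup>2 * 1" by (intro tendsto_mult tendsto_const)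
      then show ?thesis using True by simp
    qed simp
    show "AE x in lborel. (\<lambda>n. indicator {x1 T<..x2 T} x *\<^sub>R (if 0 < 1 - T * w x T / 2
      then (1 - T * w x T / 2)\<^sup>2 * H n (w x T / (1 - T * w x T / 2)) else 0)) \<longlonglongrightarrow>
      indicator {x1 T<..x2 T} x *\<^sub>R ((w x T)\<^sup>2 * (if w x T < 2 / T then 1 else 0))"
      unfolding expr by (intro AE_I2 tendsto_scaleR tendsto_const lim)
    show "AE x in lborel. norm (indicator {x1 T<..x2 T} x *\<^sub>R (if 0 < 1 - T * w x T / 2
      then (1 - T * w x T / 2)\<^sup>2 * H n (w x T / (1 - T * w x T / 2)) else 0)) \<le> indicator {x1 T<..x2 T} x *\<^sub>R (w x T)\<^sup>2" for n
      unfolding expr using \<eta>_bd[of n] by (intro AE_I2) (auto simp: indicator_def abs_mult intro!: mult_left_le)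
    show "(\<lambda>x. indicator {x1 T<..x2 T} x *\<^sub>R (if 0 < 1 - T * w x T / 2
      then (1 - T * w x T / 2)\<^sup>2 * H n (w x T / (1 - T * w x T / 2)) else 0)) \<in> borel_measurable lborel" for n
      unfolding H_def by measurable
  qed (use iw in auto)
  ultimately show ?thesis unfolding eq using LIMSEQ_unique by blast
qed

section \<open>The one-sided bound at every time\<close>

lemma AE_interval_witness:
  fixes a b :: real
  assumes "AE s in lborel. Q s" "a < b"
  obtains s where "a < s" "s < b" "Q s"
proof (rule ccontr)
  assume "\<not> thesis"
  then have "\<And>s. s \<in> {a<..<b} \<Longrightarrow> \<not> Q s" using that by auto
  then have "AE s in lborel. s \<notin> {a<..<b}" using assms(1) by (auto elim!: eventually_mono)
  then have "{a<..<b} \<in> null_sets lborel" by (subst AE_iff_null_sets) auto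
  then show False using assms(2) by (simp add: null_sets_def)
qed

text \<open>The hypothesis holds almost everywhere in space-time, hence a priori at almost every
  time. Integrated in x it reads u(b) - u(a) <= C (b - a), which passes to all times because
  \<open>u\<close> is continuous; difference quotients then give back a bound for
  \<open>w\<close>.\<close>

lemma upper_bound_slices:
  assumes ub: "\<And>K. compact K \<Longrightarrow> K \<subseteq> HPo \<Longrightarrow> \<exists>C. AE p in lborel \<Otimes>\<^sub>M lborel. p \<in> K \<longrightarrow> w (fst p) (snd p) \<le> C"
    and "0 < \<delta>"
  obtains C where "\<And>s. s \<in> {\<delta>..T} \<Longrightarrow> AE x in lborel. x \<in> {-R..R} \<longrightarrow> w x s \<le> C"
proof -
  \<comment> \<open>The margins of 1 admit difference quotients of step at most 1 to the right of R,
    and good times up to 1 later than T.\<close>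
  define K where "K = {-R-1..R+1} \<times> {\<delta>..T+1}"
  have "compact K" unfolding K_def by (intro compact_Times compact_Icc)
  moreover have "K \<subseteq> HPo" using \<open>0 < \<delta>\<close> by (auto simp: K_def HPo_def)
  ultimately obtain C where C: "AE p in lborel \<Otimes>\<^sub>M lborel. p \<in> K \<longrightarrow> w (fst p) (snd p) \<le> C" using ub by blast
  have "AE x in lborel. AE s in lborel. (x, s) \<in> K \<longrightarrow> w x s \<le> C"
    using lborel_pair.AE_pair[OF C] by simp
  then have slices: "AE s in lborel. AE x in lborel. (x, s) \<in> K \<longrightarrow> w x s \<le> C"
  proof (subst lborel_pair.AE_commute[symmetric])
    have "{p \<in> space (borel \<Otimes>\<^sub>M borel). (fst p \<in> {-R-1..R+1} \<and> snd p \<in> {\<delta>..T+1}) \<longrightarrow> w (fst p) (snd p) \<le> C} \<in> sets (borel \<Otimes>\<^sub>M borel)"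
      by measurable
    moreover have "sets (lborel \<Otimes>\<^sub>M lborel) = sets (borel \<Otimes>\<^sub>M borel :: (real \<times> real) measure)"
      by (rule sets_pair_measure_cong) auto
    ultimately show "{x \<in> space (lborel \<Otimes>\<^sub>M lborel). (fst x, snd x) \<in> K \<longrightarrow> w (fst x) (snd x) \<le> C} \<in> sets (lborel \<Otimes>\<^sub>M lborel)"
      by (simp add: K_def space_pair_measure mem_Times_iff)
  qed auto
  have good: "u b s - u a s \<le> C * (b - a)"
    if s: "AE x in lborel. (x, s) \<in> K \<longrightarrow> w x s \<le> C" "s \<in> {\<delta>..T+1}" and ab: "-R-1 \<le> a" "a \<le> b" "b \<le> R+1" for s a b
  proof -
    have "(LINT x:{a..b}|lborel. w x s) \<le> (LINT x:{a..b}|lborel. C)"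
      unfolding set_lebesgue_integral_def
    proof (rule integral_mono_AE)
      show "AE x in lborel. indicator {a..b} x *\<^sub>R w x s \<le> indicator {a..b} x *\<^sub>R C"
        using s(1) by (rule eventually_mono) (use s(2) ab in \<open>auto simp: K_def indicator_def\<close>)
    qed (use w_set[of a b s] in \<open>auto simp: set_integrable_def emeasure_lborel_Icc_eq\<close>)
    then show ?thesis using u_FTC[OF ab(2), of s] ab(2) by (simp add: set_lebesgue_integral_def mult.commute)
  qed
  have all: "u b s - u a s \<le> C * (b - a)" if s: "s \<in> {\<delta>..T}" and ab: "-R-1 \<le> a" "a \<le> b" "b \<le> R+1" for s a b
  proof -
    have "\<exists>r. s < r \<and> r < s + hh n \<and> (AE x in lborel. (x, r) \<in> K \<longrightarrow> w x r \<le> C)" for n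
    proof -
      have "s < s + hh n" using hh(1)[of n] by simp
      then obtain r where "s < r" "r < s + hh n" "AE x in lborel. (x, r) \<in> K \<longrightarrow> w x r \<le> C"
        by (rule AE_interval_witness[OF slices])
      then show ?thesis by (intro exI[of _ r] conjI)
    qed
    then have "\<exists>r. \<forall>n. s < r n \<and> r n < s + hh n \<and> (AE x in lborel. (x, r n) \<in> K \<longrightarrow> w x (r n) \<le> C)"
      by (intro choice allI)
    then obtain r where "\<forall>n. s < r n \<and> r n < s + hh n \<and> (AE x in lborel. (x, r n) \<in> K \<longrightarrow> w x (r n) \<le> C)" ..
    then have r: "\<And>n. s < r n" "\<And>n. r n < s + hh n" "\<And>n. AE x in lborel. (x, r n) \<in> K \<longrightarrow> w x (r n) \<le> C"
      by auto
    have r_lim: "r \<longlonglongrightarrow> s"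
    proof (rule real_tendsto_sandwich[OF _ _ tendsto_const])
      have "(\<lambda>n. s + hh n) \<longlonglongrightarrow> s + 0" by (intro tendsto_intros hh)
      then show "(\<lambda>n. s + hh n) \<longlonglongrightarrow> s" by simp
    qed (use less_imp_le[OF r(1)] less_imp_le[OF r(2)] in auto)
    have hh1: "hh n \<le> 1" for n by (simp add: hh_def)
    have le: "u b (r n) - u a (r n) \<le> C * (b - a)" for n
    proof (rule good[OF r(3) _ ab])
      show "r n \<in> {\<delta>..T+1}" using r(1)[of n] r(2)[of n] hh1[of n] s by auto
    qed
    have uc: "continuous_on UNIV (\<lambda>t. u z t)" for z by (intro u_continuous continuous_intros)
    have "(\<lambda>n. u b (r n) - u a (r n)) \<longlonglongrightarrow> u b s - u a s"
      by (intro tendsto_diff continuous_on_tendsto_compose[OF uc r_lim]) auto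
    then show ?thesis by (rule LIMSEQ_le_const2) (use le in blast)
  qed
  show thesis
  proof (rule that[of C])
    fix s assume s: "s \<in> {\<delta>..T}"
    show "AE x in lborel. x \<in> {-R..R} \<longrightarrow> w x s \<le> C"
      using u_deriv[of s]
    proof (rule eventually_mono, intro impI)
      fix x assume D: "((\<lambda>y. u y s) has_real_derivative w x s) (at x)" and x: "x \<in> {-R..R}"
      have "(\<lambda>n. (u (x + hh n) s - u x s) / hh n) \<longlonglongrightarrow> w x s"
        by (rule difference_quotient_tendsto[OF D]) (use hh in auto)
      moreover have "(u (x + hh n) s - u x s) / hh n \<le> C" for n
      proof -
        have "hh n \<le> 1" by (simp add: hh_def)
        then show ?thesis using all[OF s, of x "x + hh n"] x hh(1)[of n] by (simp add: pos_divide_le_eq)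
      qed
      ultimately show "w x s \<le> C" by (intro LIMSEQ_le_const2) auto
    qed
  qed
qed

lemma pos_part_square_DERIV:
  "((\<lambda>x. (max 0 x)\<^sup>2) has_real_derivative 2 * max 0 x) (at (x::real))"
proof -
  consider "x > 0" | "x < 0" | "x = 0" by linarith
  then show ?thesis
  proof cases
    case 1
    have "((\<lambda>x. x\<^sup>2) has_real_derivative 2 * max 0 x) (at x)" using 1 by (auto intro!: derivative_eq_intros)
    then show ?thesis
      by (rule has_field_derivative_transform_within_open[of _ _ _ "{0<..}"]) (use 1 in auto)
  next
    case 2
    have "((\<lambda>x. 0) has_real_derivative 2 * max 0 x) (at x)" using 2 by simp
    then show ?thesis
      by (rule has_field_derivative_transform_within_open[of _ _ _ "{..<0}"]) (use 2 in auto)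
  next
    case 3
    have "((\<lambda>h. (max 0 h)\<^sup>2 / h) \<longlongrightarrow> 0) (at (0::real))"
    proof (rule Lim_null_comparison)
      show "\<forall>\<^sub>F h in at (0::real). norm ((max 0 h)\<^sup>2 / h) \<le> \<bar>h\<bar>"
        by (rule always_eventually) (auto simp: max_def power2_eq_square)
      show "((\<lambda>h. \<bar>h\<bar>) \<longlongrightarrow> 0) (at (0::real))" using tendsto_rabs[OF tendsto_ident_at, of 0 UNIV] by simp
    qed
    then show ?thesis using 3 by (simp add: DERIV_def)
  qed
qed

text \<open>For every \<open>c\<close> the function \<open>(((1 + c s / 2) w - c)\<^sup>+)\<^sup>2\<close> is conserved as long as \<open>w\<close> is bounded
  from above; the cutoff at \<open>C\<close> is never seen.\<close>

lemma pos_part_transport: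
  assumes c: "0 < c" and t: "0 \<le> t1" "t1 \<le> T" and c1: "is_char T x1" and c2: "is_char T x2"
    and R: "\<And>s. s \<in> {t1..T} \<Longrightarrow> \<bar>x1 s\<bar> \<le> R - 1 \<and> \<bar>x2 s\<bar> \<le> R - 1"
    and C: "\<And>s. s \<in> {t1..T} \<Longrightarrow> AE x in lborel. x \<in> {-R..R} \<longrightarrow> w x s \<le> C"
  shows "(LINT x:{x1 T<..x2 T}|lborel. (max 0 ((1 + c * T / 2) * w x T - c))\<^sup>2)
    = (LINT x:{x1 t1<..x2 t1}|lborel. (max 0 ((1 + c * t1 / 2) * w x t1 - c))\<^sup>2)"
proof -
  define cl where "cl s = max t1 (min T s)" for s
  have cl: "t1 \<le> cl s" "cl s \<le> T" "s \<in> {t1..T} \<Longrightarrow> cl s = s" for s using t by (auto simp: cl_def)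
  have cl_cont: "continuous_on S f \<Longrightarrow> continuous_on S (\<lambda>z. cl (f z))" for S and f :: "'z::topological_space \<Rightarrow> real"
    unfolding cl_def by (intro continuous_intros)
  \<comment> \<open>c / lam solves the Riccati equation with value c at time 0, and lam y - c = lam
    (y - c / lam): the conserved density measures the excess over this solution.\<close>
  define lam where "lam s = 1 + c * cl s / 2" for s
  define q where "q y s = max 0 (lam s * y - c)" for y s
  define \<beta> where "\<beta> y s = (q y s)\<^sup>2 * (1 - step (y - C))" for y s
  define \<beta>w where "\<beta>w y s = 2 * q y s * lam s * (1 - step (y - C)) + (q y s)\<^sup>2 * (- bump (y - C))" for y s
  define \<beta>s where "\<beta>s y s = 2 * q y s * (c * y / 2) * (1 - step (y - C))" for y s
  have lam: "1 \<le> lam s" "lam s \<le> 1 + c * T / 2" for s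
    using cl[of s] c t by (auto simp: lam_def)
  have q_cont: "continuous_on UNIV (\<lambda>p. q (fst p) (snd p))" unfolding q_def lam_def
    by (intro continuous_intros cl_cont) auto
  have sc: "continuous_on UNIV (\<lambda>p::real \<times> real. step (fst p - C))" "continuous_on UNIV (\<lambda>p::real \<times> real. bump (fst p - C))"
    by (auto intro!: continuous_on_compose2[OF step_continuous[of UNIV]] continuous_on_compose2[OF bump_continuous[of UNIV]] continuous_intros)
  define B where "B = \<bar>C\<bar> + 1"
  have q0: "q y s = 0" if "y \<le> 0" for y s
  proof -
    have "lam s * y \<le> 0" using lam(1)[of s] that by (intro mult_nonneg_nonpos) auto
    then show ?thesis using c by (simp add: q_def)
  qed
  have eq: "(LINT x:{x1 T<..x2 T}|lborel. \<beta> (w x T) T) = (LINT x:{x1 t1<..x2 t1}|lborel. \<beta> (w x t1) t1)"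
  proof (rule char_transport[OF t order_refl c1 c2, where \<beta>w = \<beta>w and \<beta>s = \<beta>s])
    show "continuous_on UNIV (\<lambda>p. \<beta> (fst p) (snd p))" "continuous_on UNIV (\<lambda>p. \<beta>s (fst p) (snd p))"
      unfolding \<beta>_def \<beta>s_def by (auto intro!: continuous_intros q_cont sc)
    show "continuous_on UNIV (\<lambda>p. \<beta>w (fst p) (snd p))"
      unfolding \<beta>w_def lam_def by (intro continuous_intros q_cont sc cl_cont) auto
    show "((\<lambda>y. \<beta> y s) has_real_derivative \<beta>w y s) (at y)" for y s
    proof -
      have "((\<lambda>y. (max 0 (lam s * y - c))\<^sup>2) has_real_derivative 2 * max 0 (lam s * y - c) * lam s) (at y)"
        by (rule DERIV_chain2[OF pos_part_square_DERIV]) (auto intro!: derivative_eq_intros)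
      moreover have "((\<lambda>y. 1 - step (y - C)) has_real_derivative - bump (y - C)) (at y)"
        by (auto intro!: derivative_eq_intros DERIV_chain2[OF step_DERIV])
      ultimately show ?thesis
        using DERIV_mult unfolding \<beta>_def \<beta>w_def q_def by (fastforce simp: mult.commute)
    qed
    show "((\<lambda>s. \<beta> y s) has_real_derivative \<beta>s y s) (at s within {t1..T})" if s: "s \<in> {t1..T}" for y s
    proof -
      have "((\<lambda>s. (max 0 ((1 + c * s / 2) * y - c))\<^sup>2 * (1 - step (y - C))) has_real_derivative \<beta>s y s) (at s within {t1..T})"
        unfolding \<beta>s_def q_def lam_def cl(3)[OF s]
        by (rule DERIV_cmult_right, rule DERIV_chain2[OF pos_part_square_DERIV]) (auto intro!: derivative_eq_intros)
      then show ?thesis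
        by (rule has_field_derivative_transform_within[OF _ zero_less_one s])
          (use cl(3) in \<open>simp add: \<beta>_def q_def lam_def\<close>)
    qed
    show "\<beta> y s = 0 \<and> \<beta>w y s = 0 \<and> \<beta>s y s = 0" if "y \<notin> {-B..B}" for y s
    proof (cases "y \<le> 0")
      case True then show ?thesis using q0 by (simp add: \<beta>_def \<beta>w_def \<beta>s_def)
    next
      case False
      then have "1 \<le> y - C" using that by (auto simp: B_def)
      then show ?thesis by (simp add: \<beta>_def \<beta>w_def \<beta>s_def step_eq_1 bump_eq_0)
    qed
    show "\<bar>\<beta> y s\<bar> \<le> ((1 + c * T / 2)\<^sup>2 * B) * \<bar>y\<bar>" for y s
    proof (cases "0 \<le> y \<and> y \<le> B")
      case True
      have "0 \<le> q y s" "q y s \<le> (1 + c * T / 2) * y"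
      proof -
        have "lam s * y \<le> (1 + c * T / 2) * y" using lam(2) True by (intro mult_right_mono) auto
        moreover have "0 \<le> (1 + c * T / 2) * y" using True c t by auto
        ultimately show "0 \<le> q y s" "q y s \<le> (1 + c * T / 2) * y" using c by (auto simp: q_def)
      qed
      then have "(q y s)\<^sup>2 \<le> ((1 + c * T / 2) * y)\<^sup>2" by (intro power_mono)
      also have "\<dots> = (1 + c * T / 2)\<^sup>2 * (y * y)" by (simp add: power_mult_distrib power2_eq_square)
      also have "\<dots> \<le> (1 + c * T / 2)\<^sup>2 * (B * y)" using True by (intro mult_left_mono mult_right_mono) auto
      finally have "(q y s)\<^sup>2 * \<bar>1 - step (y - C)\<bar> \<le> (1 + c * T / 2)\<^sup>2 * (B * y) * 1"
        using step_bounds[of "y - C"] True by (intro mult_mono) (auto simp: B_def)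
      then show ?thesis using True by (simp add: \<beta>_def abs_mult mult.assoc)
    next
      case False
      have "\<beta> y s = 0"
      proof (cases "y \<le> 0")
        case True then show ?thesis using q0 by (simp add: \<beta>_def)
      next
        case f: False
        then have "1 \<le> y - C" using False by (auto simp: B_def)
        then show ?thesis by (simp add: \<beta>_def step_eq_1)
      qed
      then show ?thesis by (simp add: B_def)
    qed
    have zero: "\<beta>s y s - 1/2 * y\<^sup>2 * \<beta>w y s + y * \<beta> y s = 0" if "y \<le> C" for y s
    proof -
      \<comment> \<open>Either q = 0 or q = lam y - c. For y <= C the transport equation for \<beta>
        reduces to y times this product.\<close>
      have "q y s * (c - lam s * y + q y s) = 0" by (auto simp: q_def max_def)
      moreover have "\<beta>s y s - 1/2 * y\<^sup>2 * \<beta>w y s + y * \<beta> y s = y * (q y s * (c - lam s * y + q y s))"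
        using that by (simp add: \<beta>_def \<beta>w_def \<beta>s_def step_eq_0 bump_eq_0 power2_eq_square algebra_simps)
      ultimately show ?thesis by simp
    qed
    show "AE x in lborel. x \<in> {-R..R} \<longrightarrow> \<beta>s (w x s) s - 1/2 * (w x s)\<^sup>2 * \<beta>w (w x s) s + w x s * \<beta> (w x s) s = 0"
      if "s \<in> {t1..T}" for s
      using C[OF that] by (rule eventually_mono) (use zero in blast)
  qed (use R in auto)
  have ends: "(LINT x:{x1 s<..x2 s}|lborel. \<beta> (w x s) s) = (LINT x:{x1 s<..x2 s}|lborel. (max 0 ((1 + c * s / 2) * w x s - c))\<^sup>2)"
    if s: "s \<in> {t1..T}" for s
    unfolding set_lebesgue_integral_def
  proof (rule integral_cong_AE)
    show "AE x in lborel. indicator {x1 s<..x2 s} x *\<^sub>R \<beta> (w x s) s = indicator {x1 s<..x2 s} x *\<^sub>R (max 0 ((1 + c * s / 2) * w x s - c))\<^sup>2"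
      using C[OF s]
    proof (rule eventually_mono)
      fix x assume x: "x \<in> {-R..R} \<longrightarrow> w x s \<le> C"
      show "indicator {x1 s<..x2 s} x *\<^sub>R \<beta> (w x s) s = indicator {x1 s<..x2 s} x *\<^sub>R (max 0 ((1 + c * s / 2) * w x s - c))\<^sup>2"
      proof (cases "x \<in> {x1 s<..x2 s}")
        case True
        then have "w x s \<le> C" using x R[OF s] by auto
        then show ?thesis using cl(3)[OF s] by (simp add: \<beta>_def q_def lam_def step_eq_0)
      qed simp
    qed
    show "(\<lambda>x. indicator {x1 s<..x2 s} x *\<^sub>R \<beta> (w x s) s) \<in> borel_measurable lborel" unfolding \<beta>_def q_def by measurable
  qed measurable
  show ?thesis using eq ends[of T] ends[of t1] t by simp
qed

end

section \<open>Energy and uniqueness\<close>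

text \<open>For y >= 0, \<mu> <= 2 gives \<mu> y - c <= 2 (y - c/2), and y - c/2 exceeds z - c/2 by
  at most |y - z|. The purpose is to compare the conserved quantity at a small positive time with
  the data at time 0.\<close>

lemma pos_part_shift_bound:
  fixes y z c \<mu> :: real
  assumes "1 \<le> \<mu>" "\<mu> \<le> 2" "0 < c"
  shows "(max 0 (\<mu> * y - c))\<^sup>2 \<le> 8 * (y - z)\<^sup>2 + 8 * (max 0 (z - c / 2))\<^sup>2"
proof -
  define m where "m = max 0 (z - c / 2)"
  have m: "0 \<le> m" "z - c / 2 \<le> m" by (auto simp: m_def)
  have "max 0 (\<mu> * y - c) \<le> 2 * (\<bar>y - z\<bar> + m)"
  proof (cases "0 \<le> y")
    case True
    then have "\<mu> * y \<le> 2 * y" using assms by (intro mult_right_mono) auto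
    moreover have "y \<le> \<bar>y - z\<bar> + z" by arith
    ultimately have "\<mu> * y - c \<le> 2 * (\<bar>y - z\<bar> + m)" using m(2) by argo
    then show ?thesis using m(1) by simp
  next
    case False
    then have "\<mu> * y \<le> 0" using assms by (intro mult_nonneg_nonpos) auto
    then show ?thesis using m assms by simp
  qed
  then have "(max 0 (\<mu> * y - c))\<^sup>2 \<le> (2 * (\<bar>y - z\<bar> + m))\<^sup>2" by (intro power_mono) auto
  also have "\<dots> \<le> 8 * \<bar>y - z\<bar>\<^sup>2 + 8 * m\<^sup>2"
    using zero_le_power2[of "\<bar>y - z\<bar> - m"] by (simp add: power2_eq_square algebra_simps)
  finally show ?thesis by (simp add: m_def)
qed

context hs_flow
begin

lemma w_sq_indicator_integrable:
  assumes [measurable]: "Measurable.pred borel Q"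
  shows "integrable lborel (\<lambda>x. (w x t)\<^sup>2 * (if Q (w x t) then 1 else 0))"
  by (rule Bochner_Integration.integrable_bound[OF w_sq[of t]]) auto

lemma w_diff_integrable: "integrable lborel (\<lambda>x. (w x s - w x t)\<^sup>2)"
proof (rule Bochner_Integration.integrable_bound[of _ "\<lambda>x. 2 * (w x s)\<^sup>2 + 2 * (w x t)\<^sup>2"])
  show "integrable lborel (\<lambda>x. 2 * (w x s)\<^sup>2 + 2 * (w x t)\<^sup>2)" using w_sq by simp
  have "(a - b)\<^sup>2 \<le> 2 * a\<^sup>2 + 2 * b\<^sup>2" for a b :: real
    using zero_le_power2[of "a + b"] by (simp add: power2_eq_square algebra_simps)
  then show "AE x in lborel. norm ((w x s - w x t)\<^sup>2) \<le> norm (2 * (w x s)\<^sup>2 + 2 * (w x t)\<^sup>2)" by simp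
qed measurable

lemma pos_part_integrable: "0 \<le> c \<Longrightarrow> integrable lborel (\<lambda>x. (max 0 (w x t - c))\<^sup>2)"
proof (rule Bochner_Integration.integrable_bound[OF w_sq[of t]])
  assume "0 \<le> c"
  then have "(max 0 (y - c))\<^sup>2 \<le> y\<^sup>2" for y :: real
    using power_mono[of "max 0 (y - c)" "\<bar>y\<bar>" 2] by auto
  then show "AE x in lborel. norm ((max 0 (w x t - c))\<^sup>2) \<le> norm ((w x t)\<^sup>2)"
    by simp
qed measurable

text \<open>Where w >= 2/T one has (1 + c T/2) w - c = w + c (T w/2 - 1) >= w, so the conserved
  quantity at T dominates this part of the energy. It is carried back to a time t1 < 2/c, where the
  coefficient 1 + c t1/2 is at most 2, and then t1 tends to 0.\<close>

lemma fast_part_bound: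
  assumes ub: "\<And>K. compact K \<Longrightarrow> K \<subseteq> HPo \<Longrightarrow> \<exists>C. AE p in lborel \<Otimes>\<^sub>M lborel. p \<in> K \<longrightarrow> w (fst p) (snd p) \<le> C"
    and conv: "((\<lambda>t. LINT x|lborel. (w x t - w x 0)\<^sup>2) \<longlongrightarrow> 0) (at_right 0)"
    and T: "0 < T" and c: "0 < c" and c1: "is_char T x1" and c2: "is_char T x2"
  shows "(LINT x:{x1 T<..x2 T}|lborel. (w x T)\<^sup>2 * (if 2 / T \<le> w x T then 1 else 0))
    \<le> 8 * (LINT x|lborel. (max 0 (w x 0 - c / 2))\<^sup>2)"
proof -
  let ?A = "LINT x:{x1 T<..x2 T}|lborel. (w x T)\<^sup>2 * (if 2 / T \<le> w x T then 1 else 0)"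
  let ?b = "LINT x|lborel. (max 0 (w x 0 - c / 2))\<^sup>2"
  let ?I = "\<lambda>t. LINT x|lborel. (w x t - w x 0)\<^sup>2"
  have q_int: "integrable lborel (\<lambda>x. indicator A x *\<^sub>R (max 0 (\<mu> * w x t - c))\<^sup>2)" if "1 \<le> \<mu>" "A \<in> sets borel" for \<mu> t A
  proof (rule Bochner_Integration.integrable_bound[of _ "\<lambda>x. \<mu>\<^sup>2 * (w x t)\<^sup>2"])
    have "max 0 (\<mu> * y - c) \<le> \<bar>\<mu> * y\<bar>" for y using c by simp
    from power_mono[OF this, of _ 2] have "(max 0 (\<mu> * y - c))\<^sup>2 \<le> \<mu>\<^sup>2 * y\<^sup>2" for y
      by (simp add: power_mult_distrib)
    then show "AE x in lborel. norm (indicator A x *\<^sub>R (max 0 (\<mu> * w x t - c))\<^sup>2) \<le> norm (\<mu>\<^sup>2 * (w x t)\<^sup>2)"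
      by (intro AE_I2) (auto simp: indicator_def)
  qed (use w_sq that in auto)
  have step: "?A \<le> 8 * ?I t1 + 8 * ?b" if t1: "0 < t1" "t1 < T" "t1 < 2 / c" for t1
  proof -
    obtain R1 R2 where R12: "\<And>s. s \<in> {0..T} \<Longrightarrow> \<bar>x1 s\<bar> \<le> R1" "\<And>s. s \<in> {0..T} \<Longrightarrow> \<bar>x2 s\<bar> \<le> R2"
      using is_char_bounded c1 c2 by metis
    define R where "R = max R1 R2 + 1"
    have R: "\<bar>x1 s\<bar> \<le> R - 1 \<and> \<bar>x2 s\<bar> \<le> R - 1" if "s \<in> {t1..T}" for s
      using R12[of s] that t1 by (auto simp: R_def le_max_iff_disj)
    obtain C where C: "\<And>s. s \<in> {t1..T} \<Longrightarrow> AE x in lborel. x \<in> {-R..R} \<longrightarrow> w x s \<le> C"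
      by (rule upper_bound_slices[OF ub t1(1), of T R]) blast+
    have "c * t1 \<le> 2" using t1 c by (simp add: pos_less_divide_eq mult.commute)
    then have \<mu>: "1 \<le> 1 + c * t1 / 2" "1 + c * t1 / 2 \<le> 2" using c t1 by auto
    have \<mu>T: "1 \<le> 1 + c * T / 2" using c T by simp
    have "?A \<le> (LINT x:{x1 T<..x2 T}|lborel. (max 0 ((1 + c * T / 2) * w x T - c))\<^sup>2)"
      unfolding set_lebesgue_integral_def
    proof (rule integral_mono)
      show "integrable lborel (\<lambda>x. indicator {x1 T<..x2 T} x *\<^sub>R ((w x T)\<^sup>2 * (if 2 / T \<le> w x T then 1 else 0)))"
        by (rule Bochner_Integration.integrable_bound[OF w_sq[of T]]) (auto simp: indicator_def)
      show "integrable lborel (\<lambda>x. indicator {x1 T<..x2 T} x *\<^sub>R (max 0 ((1 + c * T / 2) * w x T - c))\<^sup>2)"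
        by (rule q_int[OF \<mu>T]) simp
      have "y\<^sup>2 * (if 2 / T \<le> y then 1 else 0) \<le> (max 0 ((1 + c * T / 2) * y - c))\<^sup>2" for y
      proof (cases "2 / T \<le> y")
        case True
        then have "2 \<le> T * y" using T by (simp add: pos_divide_le_eq mult.commute)
        then have "c * 2 \<le> c * (T * y)" using c by (intro mult_left_mono) auto
        moreover have "0 < y" using True T by (smt (verit) divide_pos_pos)
        ultimately have "0 \<le> y" "y \<le> max 0 ((1 + c * T / 2) * y - c)" by (auto simp: algebra_simps)
        then show ?thesis using True by (simp add: power_mono)
      qed simp
      then show "indicator {x1 T<..x2 T} x *\<^sub>R ((w x T)\<^sup>2 * (if 2 / T \<le> w x T then 1 else 0))
         \<le> indicator {x1 T<..x2 T} x *\<^sub>R (max 0 ((1 + c * T / 2) * w x T - c))\<^sup>2" for x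
        by (intro scaleR_left_mono) auto
    qed
    also have "\<dots> = (LINT x:{x1 t1<..x2 t1}|lborel. (max 0 ((1 + c * t1 / 2) * w x t1 - c))\<^sup>2)"
      by (rule pos_part_transport[OF c _ _ c1 c2 R C]) (use t1 in auto)
    also have "\<dots> \<le> (LINT x|lborel. 8 * (w x t1 - w x 0)\<^sup>2 + 8 * (max 0 (w x 0 - c / 2))\<^sup>2)"
      unfolding set_lebesgue_integral_def
    proof (rule integral_mono)
      show "integrable lborel (\<lambda>x. indicator {x1 t1<..x2 t1} x *\<^sub>R (max 0 ((1 + c * t1 / 2) * w x t1 - c))\<^sup>2)"
        by (rule q_int[OF \<mu>(1)]) simp
      show "integrable lborel (\<lambda>x. 8 * (w x t1 - w x 0)\<^sup>2 + 8 * (max 0 (w x 0 - c / 2))\<^sup>2)"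
        using w_diff_integrable[of t1 0] pos_part_integrable[of "c / 2" 0] c by simp
      show "indicator {x1 t1<..x2 t1} x *\<^sub>R (max 0 ((1 + c * t1 / 2) * w x t1 - c))\<^sup>2
         \<le> 8 * (w x t1 - w x 0)\<^sup>2 + 8 * (max 0 (w x 0 - c / 2))\<^sup>2" for x
        using pos_part_shift_bound[OF \<mu> c, of "w x t1" "w x 0"] by (auto simp: indicator_def)
    qed
    also have "\<dots> = 8 * ?I t1 + 8 * ?b"
      using w_diff_integrable[of t1 0] pos_part_integrable[of "c / 2" 0] c by simp
    finally show ?thesis .
  qed
  have lim: "((\<lambda>t. 8 * ?I t + 8 * ?b) \<longlongrightarrow> 8 * 0 + 8 * ?b) (at_right 0)"
    by (intro tendsto_intros conv)
  have "\<forall>\<^sub>F t in at_right 0. ?A \<le> 8 * ?I t + 8 * ?b"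
    using step T c by (intro eventually_at_rightI[of 0 "min T (2 / c)"]) auto
  from tendsto_lowerbound[OF lim this] show ?thesis by simp
qed

text \<open>Here the strong convergence at \<open>t = 0\<close> excludes the fan \<open>w = 2 / t\<close>, which satisfies the
  one-sided bound for positive times.\<close>

theorem oleinik:
  assumes ub: "\<And>K. compact K \<Longrightarrow> K \<subseteq> HPo \<Longrightarrow> \<exists>C. AE p in lborel \<Otimes>\<^sub>M lborel. p \<in> K \<longrightarrow> w (fst p) (snd p) \<le> C"
    and conv: "((\<lambda>t. LINT x|lborel. (w x t - w x 0)\<^sup>2) \<longlongrightarrow> 0) (at_right 0)"
    and T: "0 < T"
  shows "AE x in lborel. w x T < 2 / T"
proof -
  have "(\<lambda>n. LINT x|lborel. (max 0 (w x 0 - real (Suc n) / 2))\<^sup>2) \<longlonglongrightarrow> (LINT x::real|lborel. 0::real)"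
  proof (rule integral_dominated_convergence[where w = "\<lambda>x. (w x 0)\<^sup>2"])
    have "(\<lambda>n. (max 0 (y - real (Suc n) / 2))\<^sup>2) \<longlonglongrightarrow> 0" for y
    proof (rule tendsto_eventually)
      obtain n0 :: nat where "2 * y < real n0" using reals_Archimedean2 by blast
      then show "\<forall>\<^sub>F n in sequentially. (max 0 (y - real (Suc n) / 2))\<^sup>2 = 0"
        by (intro eventually_sequentiallyI[of n0]) auto
    qed
    then show "AE x in lborel. (\<lambda>n. (max 0 (w x 0 - real (Suc n) / 2))\<^sup>2) \<longlonglongrightarrow> 0" by simp
    have "(max 0 (y - real (Suc n) / 2))\<^sup>2 \<le> y\<^sup>2" for y n
    proof -
      have "y \<le> \<bar>y\<bar> + real (Suc n) / 2" by (rule order_trans[OF abs_ge_self]) simp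
      then have "y - real (Suc n) / 2 \<le> \<bar>y\<bar>" unfolding diff_le_eq .
      then show ?thesis using power_mono[of "max 0 (y - real (Suc n) / 2)" "\<bar>y\<bar>" 2] by simp
    qed
    then show "AE x in lborel. norm ((max 0 (w x 0 - real (Suc n) / 2))\<^sup>2) \<le> (w x 0)\<^sup>2" for n
      by simp
  qed (use w_sq in auto)
  then have lim: "(\<lambda>n. 8 * (LINT x|lborel. (max 0 (w x 0 - real (Suc n) / 2))\<^sup>2)) \<longlonglongrightarrow> 8 * 0"
    by (intro tendsto_intros) simp
  have local: "AE x in lborel. x \<in> {- real N<..real N} \<longrightarrow> w x T < 2 / T" for N :: nat
  proof -
    obtain x1 x2 where x: "is_char T x1" "is_char T x2" "\<And>t. t \<in> {0..T} \<Longrightarrow> x1 t \<le> - real N" "\<And>t. t \<in> {0..T} \<Longrightarrow> real N \<le> x2 t"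
      using far_chars[OF T] by metis
    let ?f = "\<lambda>x. indicator {x1 T<..x2 T} x *\<^sub>R ((w x T)\<^sup>2 * (if 2 / T \<le> w x T then 1 else 0))"
    have fi: "integrable lborel ?f"
      by (rule Bochner_Integration.integrable_bound[OF w_sq[of T]]) (auto simp: indicator_def)
    have "(LINT x|lborel. ?f x) \<le> 8 * (LINT x|lborel. (max 0 (w x 0 - real (Suc n) / 2))\<^sup>2)" for n
      using fast_part_bound[OF ub conv T _ x(1,2), of "real (Suc n)"] by (simp add: set_lebesgue_integral_def)
    then have "(LINT x|lborel. ?f x) \<le> 8 * 0" by (intro LIMSEQ_le_const[OF lim]) auto
    moreover have "0 \<le> (LINT x|lborel. ?f x)" by (rule integral_nonneg_AE) (auto simp: indicator_def)
    ultimately have "(LINT x|lborel. ?f x) = 0" by linarith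
    then have "AE x in lborel. ?f x = 0"
      by (subst (asm) integral_nonneg_eq_0_iff_AE[OF fi]) (auto simp: indicator_def)
    then show ?thesis
    proof (rule eventually_mono, intro impI)
      fix y assume f0: "?f y = 0" and y: "y \<in> {- real N<..real N}"
      have "y \<in> {x1 T<..x2 T}" using y x(3)[of T] x(4)[of T] T by auto
      then have "(w y T)\<^sup>2 * (if 2 / T \<le> w y T then 1 else 0) = 0" using f0 by simp
      moreover have "0 < 2 / T" using T by simp
      ultimately show "w y T < 2 / T" by (cases "2 / T \<le> w y T") auto
    qed
  qed
  have "AE x in lborel. \<forall>N::nat. x \<in> {- real N<..real N} \<longrightarrow> w x T < 2 / T"
    by (simp only: AE_all_countable) (use local in blast)
  then show ?thesis
  proof (rule eventually_mono)
    fix x assume *: "\<forall>N::nat. x \<in> {- real N<..real N} \<longrightarrow> w x T < 2 / T"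
    obtain N :: nat where "\<bar>x\<bar> < real N" using reals_Archimedean2 by blast
    then have "x \<in> {- real N<..real N}" by auto
    then show "w x T < 2 / T" using * by blast
  qed
qed

text \<open>The left characteristic is sent to minus infinity. Since \<open>far_chars\<close> keeps
  it to the left of -n during all of [0, T], one sequence serves at both times.\<close>

lemma left_limit_conserved:
  assumes T: "0 < T" and x: "is_char T x"
  shows "(LINT y:{..x T}|lborel. (w y T)\<^sup>2 * (if w y T < 2 / T then 1 else 0))
    = (LINT y:{..x 0}|lborel. (w y 0)\<^sup>2 * (if - (2 / T) < w y 0 then 1 else 0))"
proof -
  have "\<forall>n. \<exists>z. is_char T z \<and> (\<forall>t\<in>{0..T}. z t \<le> - real n)"
    using far_chars[OF T] by metis
  then obtain z where z: "\<And>n. is_char T (z n)" "\<And>n t. t \<in> {0..T} \<Longrightarrow> z n t \<le> - real n" by metis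
  have lim: "(\<lambda>n. LINT y:{z n t<..x t}|lborel. (w y t)\<^sup>2 * (if Q (w y t) then 1 else 0))
    \<longlonglongrightarrow> (LINT y:{..x t}|lborel. (w y t)\<^sup>2 * (if Q (w y t) then 1 else 0))"
    if t: "t \<in> {0..T}" and [measurable]: "Measurable.pred borel Q" for t Q
    unfolding set_lebesgue_integral_def
  proof (rule integral_dominated_convergence[OF _ _ w_sq[of t]])
    have "(\<lambda>n. indicator {z n t<..x t} y) \<longlonglongrightarrow> (indicator {..x t} y :: real)" for y
    proof (rule tendsto_eventually)
      obtain N :: nat where "\<bar>y\<bar> < real N" using reals_Archimedean2 by blast
      then have "z n t < y" if "n \<ge> N" for n using z(2)[OF t, of n] that by (auto simp: abs_less_iff)
      then show "\<forall>\<^sub>F n in sequentially. indicator {z n t<..x t} y = (indicator {..x t} y :: real)"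
        by (intro eventually_sequentiallyI[of N]) (auto simp: indicator_def)
    qed
    then show "AE y in lborel. (\<lambda>n. indicator {z n t<..x t} y *\<^sub>R ((w y t)\<^sup>2 * (if Q (w y t) then 1 else 0)))
      \<longlonglongrightarrow> indicator {..x t} y *\<^sub>R ((w y t)\<^sup>2 * (if Q (w y t) then 1 else 0))"
      by (intro AE_I2 tendsto_scaleR tendsto_const)
    show "AE y in lborel. norm (indicator {z n t<..x t} y *\<^sub>R ((w y t)\<^sup>2 * (if Q (w y t) then 1 else 0))) \<le> (w y t)\<^sup>2" for n
      by (intro AE_I2) (auto simp: indicator_def)
  qed measurable
  have 1: "(\<lambda>n. LINT y:{z n T<..x T}|lborel. (w y T)\<^sup>2 * (if w y T < 2 / T then 1 else 0))
    \<longlonglongrightarrow> (LINT y:{..x T}|lborel. (w y T)\<^sup>2 * (if w y T < 2 / T then 1 else 0))"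
    by (rule lim) (use T in auto)
  have 2: "(\<lambda>n. LINT y:{z n 0<..x 0}|lborel. (w y 0)\<^sup>2 * (if - (2 / T) < w y 0 then 1 else 0))
    \<longlonglongrightarrow> (LINT y:{..x 0}|lborel. (w y 0)\<^sup>2 * (if - (2 / T) < w y 0 then 1 else 0))"
    by (rule lim) (use T in auto)
  show ?thesis using 1 2 unfolding conserved[OF T z(1) x] by (rule LIMSEQ_unique)
qed

lemma conserved_line:
  assumes T: "0 < T"
  shows "(LINT y|lborel. (w y T)\<^sup>2 * (if w y T < 2 / T then 1 else 0))
    = (LINT y|lborel. (w y 0)\<^sup>2 * (if - (2 / T) < w y 0 then 1 else 0))"
proof -
  have "\<forall>n. \<exists>z. is_char T z \<and> (\<forall>t\<in>{0..T}. real n \<le> z t)"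
    using far_chars[OF T] by metis
  then obtain z where z: "\<And>n. is_char T (z n)" "\<And>n t. t \<in> {0..T} \<Longrightarrow> real n \<le> z n t" by metis
  have lim: "(\<lambda>n. LINT y:{..z n t}|lborel. (w y t)\<^sup>2 * (if Q (w y t) then 1 else 0))
    \<longlonglongrightarrow> (LINT y|lborel. (w y t)\<^sup>2 * (if Q (w y t) then 1 else 0))"
    if t: "t \<in> {0..T}" and [measurable]: "Measurable.pred borel Q" for t Q
    unfolding set_lebesgue_integral_def
  proof (rule integral_dominated_convergence[OF _ _ w_sq[of t]])
    have "(\<lambda>n. indicator {..z n t} y *\<^sub>R c) \<longlonglongrightarrow> c" for y c :: real
    proof (rule tendsto_eventually)
      obtain N :: nat where "\<bar>y\<bar> < real N" using reals_Archimedean2 by blast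
      then have "y < z n t" if "n \<ge> N" for n using z(2)[OF t, of n] that by (auto simp: abs_less_iff)
      then show "\<forall>\<^sub>F n in sequentially. indicator {..z n t} y *\<^sub>R c = c"
        by (intro eventually_sequentiallyI[of N]) (auto simp: indicator_def less_imp_le)
    qed
    then show "AE y in lborel. (\<lambda>n. indicator {..z n t} y *\<^sub>R ((w y t)\<^sup>2 * (if Q (w y t) then 1 else 0)))
      \<longlonglongrightarrow> (w y t)\<^sup>2 * (if Q (w y t) then 1 else 0)"
      by (intro AE_I2)
    show "AE y in lborel. norm (indicator {..z n t} y *\<^sub>R ((w y t)\<^sup>2 * (if Q (w y t) then 1 else 0))) \<le> (w y t)\<^sup>2" for n
      by (intro AE_I2) (auto simp: indicator_def)
  qed measurable
  have 1: "(\<lambda>n. LINT y:{..z n T}|lborel. (w y T)\<^sup>2 * (if w y T < 2 / T then 1 else 0))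
    \<longlonglongrightarrow> (LINT y|lborel. (w y T)\<^sup>2 * (if w y T < 2 / T then 1 else 0))"
    by (rule lim) (use T in auto)
  have 2: "(\<lambda>n. LINT y:{..z n 0}|lborel. (w y 0)\<^sup>2 * (if - (2 / T) < w y 0 then 1 else 0))
    \<longlonglongrightarrow> (LINT y|lborel. (w y 0)\<^sup>2 * (if - (2 / T) < w y 0 then 1 else 0))"
    by (rule lim) (use T in auto)
  show ?thesis using 1 2 unfolding left_limit_conserved[OF T z(1)] by (rule LIMSEQ_unique)
qed

text \<open>The first term depends on the initial data alone and is common to all weak solutions
  with these data; the second is nonnegative. The comparison of energies can be read off.\<close>

lemma energy_decomposition:
  assumes T: "0 < T"
  shows "(LINT y|lborel. (w y T)\<^sup>2) = (LINT y|lborel. (w y 0)\<^sup>2 * (if - (2 / T) < w y 0 then 1 else 0))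
    + (LINT y|lborel. (w y T)\<^sup>2 * (if 2 / T \<le> w y T then 1 else 0))"
proof -
  have "(LINT y|lborel. (w y T)\<^sup>2) = (LINT y|lborel. (w y T)\<^sup>2 * (if w y T < 2 / T then 1 else 0)
     + (w y T)\<^sup>2 * (if 2 / T \<le> w y T then 1 else 0))"
    by (rule Bochner_Integration.integral_cong) auto
  also have "\<dots> = (LINT y|lborel. (w y T)\<^sup>2 * (if w y T < 2 / T then 1 else 0))
     + (LINT y|lborel. (w y T)\<^sup>2 * (if 2 / T \<le> w y T then 1 else 0))"
    by (intro Bochner_Integration.integral_add w_sq_indicator_integrable) measurable
  finally show ?thesis using conserved_line[OF T] by simp
qed

text \<open>The characteristic enters the right-hand side through its foot \<open>x 0\<close> only,
  which makes the sources of two different solutions comparable.\<close>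

lemma source_along_char:
  assumes T: "0 < T" and x: "is_char T x" and ol: "AE y in lborel. w y T < 2 / T"
  shows "F (x T) T = 1/2 * (LINT y:{..x 0}|lborel. (w y 0)\<^sup>2 * (if - (2 / T) < w y 0 then 1 else 0))"
proof -
  have "(LINT y:{..x T}|lborel. (w y T)\<^sup>2) = (LINT y:{..x T}|lborel. (w y T)\<^sup>2 * (if w y T < 2 / T then 1 else 0))"
    unfolding set_lebesgue_integral_def
  proof (rule integral_cong_AE)
    show "AE y in lborel. indicator {..x T} y *\<^sub>R (w y T)\<^sup>2 = indicator {..x T} y *\<^sub>R ((w y T)\<^sup>2 * (if w y T < 2 / T then 1 else 0))"
      using ol by (rule eventually_mono) simp
  qed measurable
  then show ?thesis unfolding hs_source_def using left_limit_conserved[OF T x] by simp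
qed

end

section \<open>Comparison of two solutions along characteristics\<close>

text \<open>A characteristic of the first solution is traced back from (x, t), and any
  characteristic of the second is started at its foot. The sources along both agree at equal times,
  hence so do the velocities, and curves with the same start and the same velocity at each time
  coincide, whether or not characteristics are unique.\<close>

lemma hs_flow_unique:
  assumes 1: "hs_flow u w M" and 2: "hs_flow u' w' M'"
    and u0: "\<And>x. u x 0 = u' x 0" and w0: "AE x in lborel. w x 0 = w' x 0"
    and ol1: "\<And>T. 0 < T \<Longrightarrow> AE x in lborel. w x T < 2 / T"
    and ol2: "\<And>T. 0 < T \<Longrightarrow> AE x in lborel. w' x T < 2 / T"
    and t: "0 \<le> t"
  shows "u x t = u' x t"
proof (cases "t = 0")
  case False
  then have t: "0 < t" using t by simp
  interpret A: hs_flow u w M by (rule 1)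
  interpret B: hs_flow u' w' M' by (rule 2)
  obtain z where z: "A.is_char t z" "z t = x" using A.backward_char_exists[OF t] by metis
  obtain z' where z': "B.is_char t z'" "z' 0 = z 0" using B.char_exists[OF t] by metis
  have F_eq: "hs_source w (z s) s = hs_source w' (z' s) s" if s: "0 < s" "s \<le> t" for s
  proof -
    have "(LINT y:{..z 0}|lborel. (w y 0)\<^sup>2 * (if - (2 / s) < w y 0 then 1 else 0))
       = (LINT y:{..z 0}|lborel. (w' y 0)\<^sup>2 * (if - (2 / s) < w' y 0 then 1 else 0))"
      unfolding set_lebesgue_integral_def
    proof (rule integral_cong_AE)
      show "AE y in lborel. indicator {..z 0} y *\<^sub>R ((w y 0)\<^sup>2 * (if - (2 / s) < w y 0 then 1 else 0))
         = indicator {..z 0} y *\<^sub>R ((w' y 0)\<^sup>2 * (if - (2 / s) < w' y 0 then 1 else 0))"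
        using w0 by (rule eventually_mono) simp
    qed measurable
    then show ?thesis
      using A.source_along_char[OF s(1) A.is_char_restrict[OF z(1) s(2)] ol1[OF s(1)]]
        B.source_along_char[OF s(1) B.is_char_restrict[OF z'(1) s(2)] ol2[OF s(1)]] z'(2) by simp
  qed
  have uz: "u (z s) s = u' (z' s) s" if s: "s \<in> {0..t}" for s
  proof -
    have "(LINT r:{0..s}|lborel. hs_source w (z r) r) = (LINT r:{0..s}|lborel. hs_source w' (z' r) r)"
      unfolding set_lebesgue_integral_def[of lborel "{0..s}"]
    proof (rule integral_cong_AE)
      \<comment> \<open>The characteristics are controlled on [0, t] only; clamping the argument
        gives Borel functions that agree with them there.\<close>
      have zc: "continuous_on UNIV (\<lambda>r. z (max 0 (min t r)))" "continuous_on UNIV (\<lambda>r. z' (max 0 (min t r)))"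
        by (rule continuous_on_compose2[OF A.is_char_continuous[OF z(1)]] continuous_on_compose2[OF B.is_char_continuous[OF z'(1)]];
            use t in \<open>auto intro!: continuous_intros\<close>)+
      have [measurable]: "(\<lambda>r. z (max 0 (min t r))) \<in> borel_measurable borel" "(\<lambda>r. z' (max 0 (min t r))) \<in> borel_measurable borel"
        using zc by (auto intro: borel_measurable_continuous_onI)
      have cl: "max 0 (min t r) = r" if "r \<in> {0..s}" for r using that s by auto
      have m: "(\<lambda>r. indicator {0..s} r *\<^sub>R hs_source w (z (max 0 (min t r))) r) \<in> borel_measurable lborel"
        "(\<lambda>r. indicator {0..s} r *\<^sub>R hs_source w' (z' (max 0 (min t r))) r) \<in> borel_measurable lborel" by measurable
      have eqs: "(\<lambda>r. indicator {0..s} r *\<^sub>R hs_source w (z (max 0 (min t r))) r) = (\<lambda>r. indicator {0..s} r *\<^sub>R hs_source w (z r) r)"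
        "(\<lambda>r. indicator {0..s} r *\<^sub>R hs_source w' (z' (max 0 (min t r))) r) = (\<lambda>r. indicator {0..s} r *\<^sub>R hs_source w' (z' r) r)"
        using cl by (auto simp: fun_eq_iff indicator_def)
      show "(\<lambda>r. indicator {0..s} r *\<^sub>R hs_source w (z r) r) \<in> borel_measurable lborel"
        using m(1) unfolding eqs(1) .
      show "(\<lambda>r. indicator {0..s} r *\<^sub>R hs_source w' (z' r) r) \<in> borel_measurable lborel"
        using m(2) unfolding eqs(2) .
      \<comment> \<open>The sources are known to agree at positive times, where the threshold 2 / s
        makes sense; time 0 is a null set.\<close>
      have "AE r in lborel. r \<noteq> (0::real)" by (rule AE_lborel_singleton)
      then show "AE r in lborel. indicator {0..s} r *\<^sub>R hs_source w (z r) r = indicator {0..s} r *\<^sub>R hs_source w' (z' r) r"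
        by (rule eventually_mono) (use F_eq s in \<open>auto simp: indicator_def\<close>)
    qed
    then show ?thesis
      using A.u_along_char[OF A.is_char_restrict[OF z(1), of s]] B.u_along_char[OF B.is_char_restrict[OF z'(1), of s]] s u0 z'(2)
      by simp
  qed
  have "((\<lambda>s. z s - z' s) has_field_derivative 0) (at s within {0..t})" if s: "s \<in> {0..t}" for s
  proof -
    have "(z has_real_derivative u (z s) s) (at s within {0..t})" "(z' has_real_derivative u' (z' s) s) (at s within {0..t})"
      using z(1) z'(1) s unfolding A.is_char_def B.is_char_def by auto
    from DERIV_diff[OF this] show ?thesis using uz[OF s] by simp
  qed
  then obtain c where "\<And>s. s \<in> {0..t} \<Longrightarrow> z s - z' s = c"
    using has_field_derivative_zero_constant[of "{0..t}" "\<lambda>s. z s - z' s"] by auto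
  from this[of 0] this[of t] have "z t = z' t" using z'(2) t by simp
  then show ?thesis using uz[of t] z(2) t by simp
qed (use u0 in simp)

section \<open>Weak solutions\<close>

text \<open>Replacing t by max 0 t extends the solution to negative times by its initial values. The
  weak formulation integrates over the half plane, where nothing has changed.\<close>

lemma weak_solution_flow:
  assumes W: "hs_weak_solution u0 w0 u w"
  obtains M where "hs_flow (\<lambda>x t. u x (max 0 t)) (\<lambda>x t. w x (max 0 t)) M"
proof -
  let ?u = "\<lambda>x t. u x (max 0 t)" and ?w = "\<lambda>x t. w x (max 0 t)"
  have cont: "continuous_on HP (\<lambda>p. u (fst p) (snd p))"
    and ac: "\<And>t. 0 \<le> t \<Longrightarrow> abs_cont_real (\<lambda>x. u x t)"
    and der: "\<And>t. 0 \<le> t \<Longrightarrow> AE x in lborel. ((\<lambda>y. u y t) has_real_derivative w x t) (at x)"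
    and meas: "(\<lambda>p. w (fst p) (snd p)) \<in> borel_measurable (lborel \<Otimes>\<^sub>M lborel)"
    and eq: "\<And>\<phi>. test_fun \<phi> \<Longrightarrow> set_integrable (lborel \<Otimes>\<^sub>M lborel) HP
          (\<lambda>p. u (fst p) (snd p) * pdt \<phi> (fst p) (snd p)
               + (1/2) * (u (fst p) (snd p))^2 * pdx \<phi> (fst p) (snd p)
               + hs_source w (fst p) (snd p) * \<phi> (fst p) (snd p)) \<and>
        (LINT p:HP|(lborel \<Otimes>\<^sub>M lborel).
             u (fst p) (snd p) * pdt \<phi> (fst p) (snd p)
           + (1/2) * (u (fst p) (snd p))^2 * pdx \<phi> (fst p) (snd p)
           + hs_source w (fst p) (snd p) * \<phi> (fst p) (snd p))
        + (LINT x|lborel. u0 x * \<phi> x 0) = 0"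
    and init: "\<And>x. u x 0 = u0 x"
    using W unfolding hs_weak_solution_def by auto
  obtain M where M: "\<And>t. 0 \<le> t \<Longrightarrow> square_integrable (\<lambda>x. w x t)" "\<And>t. 0 \<le> t \<Longrightarrow> (LINT x|lborel. (w x t)^2) \<le> M"
    using W unfolding hs_weak_solution_def by blast
  have "hs_base ?u ?w M"
  proof
    show "continuous_on UNIV (\<lambda>p. ?u (fst p) (snd p))"
    proof -
      have "continuous_on UNIV (\<lambda>p. (\<lambda>q. u (fst q) (snd q)) (fst p, max 0 (snd p)))"
        by (rule continuous_on_compose2[OF cont]) (auto simp: HP_def intro!: continuous_intros)
      then show ?thesis by simp
    qed
    have "sets (lborel \<Otimes>\<^sub>M lborel) = sets (borel \<Otimes>\<^sub>M borel :: (real \<times> real) measure)"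
      by (rule sets_pair_measure_cong) auto
    then have [measurable]: "case_prod w \<in> borel_measurable (borel \<Otimes>\<^sub>M borel)"
      using meas by (simp add: case_prod_beta' cong: measurable_cong_sets)
    show "case_prod ?w \<in> borel_measurable (borel \<Otimes>\<^sub>M borel)" by measurable
    show "integrable lborel (\<lambda>x. (?w x t)\<^sup>2)" for t using M(1)[of "max 0 t"] by (simp add: square_integrable_def)
    show "(LINT x|lborel. (?w x t)\<^sup>2) \<le> M" for t using M(2)[of "max 0 t"] by simp
    show "?u b t - ?u a t = (LINT x:{a..b}|lborel. ?w x t)" if "a \<le> b" for t a b
      by (rule abs_cont_real_FTC[OF ac der M(1) that]) auto
    show "AE x in lborel. ((\<lambda>y. ?u y t) has_real_derivative ?w x t) (at x)" for t by (rule der) simp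
  qed
  then interpret hs_base ?u ?w M .
  have src: "hs_source ?w x t = hs_source w x (max 0 t)" for x t by (simp add: hs_source_def)
  have weq: "weak_eq ?u ?w"
    unfolding weak_eq_def
  proof (intro allI impI)
    fix \<phi> assume "test_fun \<phi>"
    have *: "indicator HP p *\<^sub>R (?u (fst p) (snd p) * pdt \<phi> (fst p) (snd p)
           + (1/2) * (?u (fst p) (snd p))^2 * pdx \<phi> (fst p) (snd p)
           + hs_source ?w (fst p) (snd p) * \<phi> (fst p) (snd p))
      = indicator HP p *\<^sub>R (u (fst p) (snd p) * pdt \<phi> (fst p) (snd p)
           + (1/2) * (u (fst p) (snd p))^2 * pdx \<phi> (fst p) (snd p)
           + hs_source w (fst p) (snd p) * \<phi> (fst p) (snd p))" for p
      unfolding src by (cases "p \<in> HP") (auto simp: HP_def max_def)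
    show "set_integrable (lborel \<Otimes>\<^sub>M lborel) HP
          (\<lambda>p. ?u (fst p) (snd p) * pdt \<phi> (fst p) (snd p)
               + (1/2) * (?u (fst p) (snd p))^2 * pdx \<phi> (fst p) (snd p)
               + hs_source ?w (fst p) (snd p) * \<phi> (fst p) (snd p)) \<and>
        (LINT p:HP|(lborel \<Otimes>\<^sub>M lborel).
             ?u (fst p) (snd p) * pdt \<phi> (fst p) (snd p)
           + (1/2) * (?u (fst p) (snd p))^2 * pdx \<phi> (fst p) (snd p)
           + hs_source ?w (fst p) (snd p) * \<phi> (fst p) (snd p))
        + (LINT x|lborel. ?u x 0 * \<phi> x 0) = 0"
      using eq[OF \<open>test_fun \<phi>\<close>] unfolding set_integrable_def set_lebesgue_integral_def[of _ HP] * by (simp add: init)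
  qed
  have "hs_flow ?u ?w M"
    by unfold_locales (rule mean_evolution[OF weq])
  then show thesis by (rule that)
qed

theorem theorem1p1:
  fixes u0 w0 :: "real \<Rightarrow> real"
    and u w ut wt :: "real \<Rightarrow> real \<Rightarrow> real"
  assumes u0_ac: "abs_cont_real u0"
    and u0_deriv: "AE x in lborel. (u0 has_real_derivative w0 x) (at x)"
    and w0_L2: "square_integrable w0"
    and diss: "hs_dissipative u0 w0 ut wt"
    and weak: "hs_weak_solution u0 w0 u w"
  shows "(\<forall>t\<ge>0. hs_energy wt t \<le> hs_energy w t) \<and>
         ((\<forall>t\<ge>0. hs_energy w t = hs_energy wt t) \<longrightarrow> (\<forall>x. \<forall>t\<ge>0. u x t = ut x t))"
proof -
  have weakt: "hs_weak_solution u0 w0 ut wt"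
    and ub: "\<And>K. compact K \<Longrightarrow> K \<subseteq> HPo \<Longrightarrow> \<exists>C. AE p in lborel \<Otimes>\<^sub>M lborel. p \<in> K \<longrightarrow> wt (fst p) (snd p) \<le> C"
    and conv: "((\<lambda>t. LINT x|lborel. (wt x t - w0 x)^2) \<longlongrightarrow> 0) (at_right 0)"
    using diss unfolding hs_dissipative_def by auto
  \<comment> \<open>At time 0 both \<open>w'\<close> and \<open>w0\<close> are derivatives of
    \<open>u0\<close> almost everywhere; they may differ on a null set, so initial slopes are
    compared almost everywhere only.\<close>
  have w_init: "AE x in lborel. w' x 0 = w0 x" "\<And>x. u' x 0 = u0 x" if "hs_weak_solution u0 w0 u' w'" for u' w'
  proof -
    have d: "AE x in lborel. ((\<lambda>y. u' y 0) has_real_derivative w' x 0) (at x)" and i: "\<And>x. u' x 0 = u0 x"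
      using that unfolding hs_weak_solution_def by auto
    show "\<And>x. u' x 0 = u0 x" by (rule i)
    show "AE x in lborel. w' x 0 = w0 x"
      using d u0_deriv by eventually_elim (auto simp: i intro: DERIV_unique)
  qed
  obtain M where "hs_flow (\<lambda>x t. u x (max 0 t)) (\<lambda>x t. w x (max 0 t)) M" by (rule weak_solution_flow[OF weak])
  then interpret A: hs_flow "\<lambda>x t. u x (max 0 t)" "\<lambda>x t. w x (max 0 t)" M .
  obtain M' where "hs_flow (\<lambda>x t. ut x (max 0 t)) (\<lambda>x t. wt x (max 0 t)) M'" by (rule weak_solution_flow[OF weakt])
  then interpret B: hs_flow "\<lambda>x t. ut x (max 0 t)" "\<lambda>x t. wt x (max 0 t)" M' .
  have w_eq0: "AE x in lborel. w x 0 = wt x 0"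
    using w_init(1)[OF weak] w_init(1)[OF weakt] by eventually_elim simp
  have [measurable]: "w0 \<in> borel_measurable borel" using w0_L2 by (simp add: square_integrable_def)
  have slice_meas [measurable]: "(\<lambda>x. w x t) \<in> borel_measurable borel" "(\<lambda>x. wt x t) \<in> borel_measurable borel" if "0 \<le> t" for t
    using A.w_meas1[of t] B.w_meas1[of t] that by (simp_all add: max_absorb2)
  have olB: "AE x in lborel. wt x (max 0 T) < 2 / T" if "0 < T" for T
  proof (rule B.oleinik[OF _ _ that])
    fix K :: "(real \<times> real) set" assume K: "compact K" "K \<subseteq> HPo"
    obtain C where "AE p in lborel \<Otimes>\<^sub>M lborel. p \<in> K \<longrightarrow> wt (fst p) (snd p) \<le> C" using ub[OF K] by blast
    then have "AE p in lborel \<Otimes>\<^sub>M lborel. p \<in> K \<longrightarrow> wt (fst p) (max 0 (snd p)) \<le> C"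
      by (rule eventually_mono) (use K(2) in \<open>auto simp: HPo_def max_def\<close>)
    then show "\<exists>C. AE p in lborel \<Otimes>\<^sub>M lborel. p \<in> K \<longrightarrow> wt (fst p) (max 0 (snd p)) \<le> C" ..
  next
    \<comment> \<open>Strong convergence is assumed towards \<open>w0\<close>, whereas the one-sided
      bound is formulated with the slice of the flow at time 0.\<close>
    have "(LINT x|lborel. (wt x t - w0 x)\<^sup>2) = (LINT x|lborel. (wt x (max 0 t) - wt x (max 0 0))\<^sup>2)" if "0 < t" for t
    proof (rule integral_cong_AE)
      show "AE x in lborel. (wt x t - w0 x)\<^sup>2 = (wt x (max 0 t) - wt x (max 0 0))\<^sup>2"
        using w_init(1)[OF weakt] by (rule eventually_mono) (use that in simp)
    next
      have [measurable]: "(\<lambda>x. wt x t) \<in> borel_measurable borel" "(\<lambda>x. wt x (max 0 t)) \<in> borel_measurable borel"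
        "(\<lambda>x. wt x (max 0 0)) \<in> borel_measurable borel"
        using slice_meas(2)[of t] B.w_meas1[of t] B.w_meas1[of 0] that by auto
      show "(\<lambda>x. (wt x t - w0 x)\<^sup>2) \<in> borel_measurable lborel"
        "(\<lambda>x. (wt x (max 0 t) - wt x (max 0 0))\<^sup>2) \<in> borel_measurable lborel" by measurable
    qed
    then have "\<forall>\<^sub>F t in at_right 0. (LINT x|lborel. (wt x t - w0 x)\<^sup>2) = (LINT x|lborel. (wt x (max 0 t) - wt x (max 0 0))\<^sup>2)"
      by (intro eventually_at_rightI[of 0 1]) auto
    then show "((\<lambda>t. LINT x|lborel. (wt x (max 0 t) - wt x (max 0 0))\<^sup>2) \<longlongrightarrow> 0) (at_right 0)"
      using conv by (rule Lim_transform_eventually[rotated])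
  qed
  \<comment> \<open>The initial energy carried by values that do not blow up before or at time T; it
    is the same for both solutions.\<close>
  define D where "D T = (LINT y|lborel. (wt y 0)\<^sup>2 * (if - (2 / T) < wt y 0 then 1 else 0))" for T
  have EB: "(LINT y|lborel. (wt y T)\<^sup>2) = D T" if T: "0 < T" for T
  proof -
    have "(LINT y|lborel. (wt y (max 0 T))\<^sup>2 * (if 2 / T \<le> wt y (max 0 T) then 1 else 0)) = 0"
      by (rule integral_eq_zero_AE) (use olB[OF T] in \<open>auto elim!: eventually_mono\<close>)
    then show ?thesis using B.energy_decomposition[OF T] T by (simp add: D_def max_absorb2)
  qed
  have EA: "(LINT y|lborel. (w y T)\<^sup>2) = D T + (LINT y|lborel. (w y (max 0 T))\<^sup>2 * (if 2 / T \<le> w y (max 0 T) then 1 else 0))" if T: "0 < T" for T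
  proof -
    have "(LINT y|lborel. (w y 0)\<^sup>2 * (if - (2 / T) < w y 0 then 1 else 0)) = D T"
      unfolding D_def
      by (rule integral_cong_AE) (use w_eq0 slice_meas[of 0] in \<open>auto elim!: eventually_mono\<close>)
    then show ?thesis using A.energy_decomposition[OF T] T by (simp add: max_absorb2)
  qed
  have E0: "(LINT y|lborel. (w y 0)\<^sup>2) = (LINT y|lborel. (wt y 0)\<^sup>2)"
    by (rule integral_cong_AE) (use w_eq0 slice_meas[of 0] in \<open>auto elim!: eventually_mono\<close>)
  have "hs_energy wt t \<le> hs_energy w t" if "0 \<le> t" for t
  proof (cases "t = 0")
    case True then show ?thesis using E0 by (simp add: hs_energy_def)
  next
    case False
    then have t: "0 < t" using that by simp
    have "0 \<le> (LINT y|lborel. (w y (max 0 t))\<^sup>2 * (if 2 / t \<le> w y (max 0 t) then 1 else 0))"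
      by (rule integral_nonneg_AE) auto
    then show ?thesis using EA[OF t] EB[OF t] by (simp add: hs_energy_def)
  qed
  moreover have "u x t = ut x t" if E: "\<forall>t\<ge>0. hs_energy w t = hs_energy wt t" and t: "0 \<le> t" for x t
  proof -
    \<comment> \<open>Equality of energies leaves no room for the nonnegative excess, so w^2
      vanishes almost everywhere on the set where w >= 2/T; as 2/T > 0, this set is null.\<close>
    have olA: "AE x in lborel. w x (max 0 T) < 2 / T" if T: "0 < T" for T
    proof -
      have "(LINT y|lborel. (w y T)\<^sup>2) = (LINT y|lborel. (wt y T)\<^sup>2)" using E T by (simp add: hs_energy_def)
      then have "(LINT y|lborel. (w y (max 0 T))\<^sup>2 * (if 2 / T \<le> w y (max 0 T) then 1 else 0)) = 0"
        using EA[OF T] EB[OF T] by linarith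
      then have "AE y in lborel. (w y (max 0 T))\<^sup>2 * (if 2 / T \<le> w y (max 0 T) then 1 else 0) = 0"
        by (subst (asm) integral_nonneg_eq_0_iff_AE[OF A.w_sq_indicator_integrable]) auto
      then show ?thesis
      proof (rule eventually_mono)
        fix y assume *: "(w y (max 0 T))\<^sup>2 * (if 2 / T \<le> w y (max 0 T) then 1 else 0) = 0"
        have "0 < 2 / T" using T by simp
        then show "w y (max 0 T) < 2 / T" using * by (cases "2 / T \<le> w y (max 0 T)") auto
      qed
    qed
    have "u x (max 0 t) = ut x (max 0 t)"
      by (rule hs_flow_unique[OF A.hs_flow_axioms B.hs_flow_axioms _ _ olA olB t])
        (use w_init(2)[OF weak] w_init(2)[OF weakt] w_eq0 in auto)
    then show ?thesis using t by (simp add: max_absorb2)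
  qed
  ultimately show ?thesis by blast
qed

end
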